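(* Let $k\ge0$ be an integer, and let $\mathcal{X}_n$ be the multi-parameter random complex process with $n$ vertices and multi-parameter function $(p_0(\cdot),\dots,p_{n-1}(\cdot))$, where the distribution functions $p_i$ do not depend on $n$. (1) Suppose there exist $A\in(0,1]$ and $u_0\in(0,1)$ such that \[ \Phi_k(u_0)>0\quad\text{and}\quad \Phi_k(u/2)\ge A\,\Phi_k(u)\ \text{ for } 0\le u\le u_0 . \] Then, for any $m\in\mathbb{N}$, there exists a constant $C\ge0$ such that for all sufficiently large $n$, \[ \mathbb{E}[(L_k(\mathcal{X}_n))_T]\le C n^{k+1}\Phi_k(1/n)(1+Tn^{-m})\quad\text{for all } T>0 . \] Moreover, if $\int_0^\infty t^{1+\delta}\,dq_{k+1}(t)<\infty$ for some $\delta>0$, then $\mathbb{E}[L_k(\mathcal{X}_n)]=O(n^{k+1}\Phi_k(1/n))$ as $n\to\infty$. (2) Suppose $\Phi_k(u)=O(u^m)$ as $u\to0$ for all $m\ge0$. Then, for all $m\in\mathbb{N}$, there exists a constant $C\ge0$ such that for all sufficiently large $n$, \[ \mathbb{E}[(L_k(\mathcal{X}_n))_T]\le C(1+T)n^{-m}\quad\text{for all } T>0 . \] Moreover, if $\int_0^\infty t^{1+\delta}\,dq_{k+1}(t)<\infty$ for some $\delta>0$, then $\mathbb{E}[L_k(\mathcal{X}_n)]=O(n^{-m})$ as $n\to\infty$ for all $m\ge0$.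
   Context: Process: let $p_0(\cdot),p_1(\cdot),\dots$ be distribution functions of non-negative random variables, independent of $n$. Let $V$ be an $n$-point set and $K(n)$ the family of all nonempty subsets of $V$. To each $\sigma\in K(n)$ of dimension $i=\#\sigma-1$ assign an independent non-negative random variable $u_\sigma$ with distribution function $p_i(\cdot)$. Put $X_n(t)=\{\sigma\in K(n): u_\tau\le t\text{ for every }\emptyset\ne\tau\subset\sigma\}$ for $t\ge0$ and $\mathcal{X}_n=\{X_n(t)\}_{t\ge0}$, a right-continuous filtration. Functions: for $t\ge 0$, $q_{-1}(t)=1$, $q_k(t)=\prod_{i=0}^k p_i(t)^{\binom{k+1}{i+1}}$ for $k\ge0$, and $r_k(t)=\prod_{i=0}^{k+1}p_i(t)^{\binom{k+1}{i}}$ for $k\ge-1$. For $u<1$, $\check r_k(u)=\inf\{t\ge0: r_k(t)>u\}$. For $k\ge 0$, $Q_k(t)=\int_0^t q_k(s)\,ds$ and $\Phi_k(u)=Q_k(\check r_k(u))$ for $u\in[0,1)$. $\beta_k$ denotes the $k$-th reduced Betti number over $\mathbb{R}$ (homology of the augmented chain complex with $C_{-1}=\mathbb{R}$; zero for the empty complex when $k\ge0$). Lifetime sums: for a right-continuous filtration $\mathcal{X}=\{X(t)\}_{t\ge0}$ of a finite simplicial complex, the $k$-th persistent homology $\bigoplus_{t\ge 0}H_k(X(t))$ (reduced homology over $\mathbb{R}$, maps induced by inclusions), as a graded module over the ring $\mathbb{R}[\mathbb{R}_{\ge0}]$ of finite real linear combinations of monomials $z^t$, is isomorphic to $\bigoplus_{i=1}^p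 (z^{b_i})/(z^{d_i})\oplus\bigoplus_{i=p+1}^{p+q}(z^{b_i})$ for unique $p,q$, birth times $b_i$ and death times $d_i>b_i$ ($d_i=\infty$ for $i>p$). Then $L_k(\mathcal{X})=\sum_{i=1}^{p+q}(d_i-b_i)=\int_0^\infty\beta_k(X(t))\,dt$, and for $T\ge0$, $(L_k(\mathcal{X}))_T=\sum_{i=1}^{p+q}(\min\{d_i,T\}-\min\{b_i,T\})=\int_0^T\beta_k(X(t))\,dt$. *)

theory Defs
  imports "HOL-Probability.Probability" "HOL-Library.Landau_Symbols"
begin

section \<open>Simplicial homology over the reals\<close>

text \<open>
  An abstract simplicial complex is a set of nonempty finite vertex sets. A \<open>k\<close>-chain is a
  real function on vertex sets supported on the \<open>k\<close>-simplices; a simplex stands for itself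
  oriented by the increasing order of its vertices.
\<close>

definition chains :: "nat \<Rightarrow> 'v set set \<Rightarrow> ('v set \<Rightarrow> real) set" where
  "chains k X = {c. \<forall>\<sigma>. c \<sigma> \<noteq> 0 \<longrightarrow> \<sigma> \<in> X \<and> card \<sigma> = k + 1}"

text \<open>
  The coefficient at \<open>\<tau>\<close> of the boundary
  \<open>\<partial>[v\<^sub>0, \<dots>, v\<^sub>k] = (\<Sum>i\<le>k. (-1)^i [v\<^sub>0, \<dots>, v\<^sub>i omitted, \<dots>, v\<^sub>k])\<close>, where \<open>v\<^sub>0 < \<dots> < v\<^sub>k\<close>. On a
  0-chain the coefficient at \<open>\<tau> = {}\<close> is the sum of all coefficients, so this boundary
  contains the augmentation and the homology below is reduced.
\<close>

definition boundary :: "'v::linorder set set \<Rightarrow> ('v set \<Rightarrow> real) \<Rightarrow> 'v set \<Rightarrow> real" where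
  "boundary X c = (\<lambda>\<tau>. \<Sum>\<sigma>\<in>X. \<Sum>v\<in>\<sigma>.
     if \<sigma> - {v} = \<tau> then (- 1) ^ card {w \<in> \<sigma>. w < v} * c \<sigma> else 0)"

definition cycles :: "nat \<Rightarrow> 'v::linorder set set \<Rightarrow> ('v set \<Rightarrow> real) set" where
  "cycles k X = {c \<in> chains k X. boundary X c = (\<lambda>\<tau>. 0)}"

definition boundaries :: "nat \<Rightarrow> 'v::linorder set set \<Rightarrow> ('v set \<Rightarrow> real) set" where
  "boundaries k X = boundary X ` chains (k + 1) X"

definition homology_class ::
    "nat \<Rightarrow> 'v::linorder set set \<Rightarrow> ('v set \<Rightarrow> real) \<Rightarrow> ('v set \<Rightarrow> real) set" where
  "homology_class k X z = {z'. (\<lambda>\<sigma>. z' \<sigma> - z \<sigma>) \<in> boundaries k X}"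

definition homology :: "nat \<Rightarrow> 'v::linorder set set \<Rightarrow> ('v set \<Rightarrow> real) set set" where
  "homology k X = homology_class k X ` cycles k X"


section \<open>Barcodes and lifetime sums\<close>

text \<open>
  A list of pairs \<open>(b, d)\<close> encodes the graded module that is the direct sum of the
  \<open>(z\<^sup>b) / (z\<^sup>d)\<close> (of \<open>(z\<^sup>b)\<close> if \<open>d = \<infinity>\<close>) over \<open>\<real>[\<real>\<^sub>\<ge>\<^sub>0]\<close>. The degree \<open>t\<close> part of a summand is
  spanned by \<open>z\<^sup>t\<close> if \<open>b \<le> t < d\<close> and zero otherwise, so an element of degree \<open>t\<close> is the
  function giving its coordinates in the summands. If \<open>s \<le> t\<close>, multiplication by
  \<open>z\<^sup>t\<^sup>-\<^sup>s\<close> maps degree \<open>s\<close> to degree \<open>t\<close> by killing the coordinates of the summands that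
  have died by time \<open>t\<close>.
\<close>

definition alive :: "(real \<times> ereal) list \<Rightarrow> real \<Rightarrow> nat set" where
  "alive bs t = {i. i < length bs \<and> fst (bs ! i) \<le> t \<and> ereal t < snd (bs ! i)}"

definition interval_module :: "(real \<times> ereal) list \<Rightarrow> real \<Rightarrow> (nat \<Rightarrow> real) set" where
  "interval_module bs t = {f. \<forall>i. f i \<noteq> 0 \<longrightarrow> i \<in> alive bs t}"

definition interval_map :: "(real \<times> ereal) list \<Rightarrow> real \<Rightarrow> (nat \<Rightarrow> real) \<Rightarrow> nat \<Rightarrow> real" where
  "interval_map bs t f = (\<lambda>i. if i \<in> alive bs t then f i else 0)"

text \<open>
  An isomorphism of graded modules from the \<open>k\<close>-th persistent homology of the filtration \<open>X\<close>:
  linear isomorphisms \<open>\<phi> t\<close> in each degree \<open>t\<close> that commute with the action of all monomials,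
  which on homology is induced by the inclusions of \<open>X s\<close> into \<open>X t\<close>.
\<close>

definition is_barcode :: "nat \<Rightarrow> (real \<Rightarrow> 'v::linorder set set) \<Rightarrow> (real \<times> ereal) list \<Rightarrow> bool" where
  "is_barcode k X bs \<longleftrightarrow>
     (\<forall>(b, d) \<in> set bs. 0 \<le> b \<and> ereal b < d) \<and>
     (\<exists>\<phi> :: real \<Rightarrow> ('v set \<Rightarrow> real) set \<Rightarrow> nat \<Rightarrow> real.
        (\<forall>t\<ge>0. bij_betw (\<phi> t) (homology k (X t)) (interval_module bs t)) \<and>
        (\<forall>t\<ge>0. \<forall>z \<in> cycles k (X t). \<forall>w \<in> cycles k (X t). \<forall>a b.
           \<phi> t (homology_class k (X t) (\<lambda>\<sigma>. a * z \<sigma> + b * w \<sigma>)) =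
           (\<lambda>i. a * \<phi> t (homology_class k (X t) z) i + b * \<phi> t (homology_class k (X t) w) i)) \<and>
        (\<forall>s\<ge>0. \<forall>t\<ge>s. \<forall>z \<in> cycles k (X s).
           \<phi> t (homology_class k (X t) z) = interval_map bs t (\<phi> s (homology_class k (X s) z))))"

text \<open>
  By the structure theorem, a right-continuous filtration of a finite complex has a
  barcode, unique up to the order of the list, on which the sums below do not depend.
\<close>

definition barcode :: "nat \<Rightarrow> (real \<Rightarrow> 'v::linorder set set) \<Rightarrow> (real \<times> ereal) list" where
  "barcode k X = (SOME bs. is_barcode k X bs)"

definition lifetime_sum :: "nat \<Rightarrow> (real \<Rightarrow> 'v::linorder set set) \<Rightarrow> ennreal" where
  "lifetime_sum k X = (\<Sum>(b, d) \<leftarrow> barcode k X. e2ennreal (d - ereal b))"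

definition lifetime_sum_upto :: "nat \<Rightarrow> (real \<Rightarrow> 'v::linorder set set) \<Rightarrow> real \<Rightarrow> real" where
  "lifetime_sum_upto k X T =
     (\<Sum>(b, d) \<leftarrow> barcode k X. real_of_ereal (min d (ereal T)) - min b T)"


section \<open>The multi-parameter random complex process\<close>

definition nonneg_distribution_function :: "(real \<Rightarrow> real) \<Rightarrow> bool" where
  "nonneg_distribution_function F \<longleftrightarrow>
     (\<exists>\<mu>. real_distribution \<mu> \<and> measure \<mu> {..<0} = 0 \<and> F = cdf \<mu>)"

definition simplex_weights ::
    "'w measure \<Rightarrow> (nat \<Rightarrow> real \<Rightarrow> real) \<Rightarrow> 'v set \<Rightarrow> ('v set \<Rightarrow> 'w \<Rightarrow> real) \<Rightarrow> bool" where
  "simplex_weights M p V u \<longleftrightarrow>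
     prob_space M \<and>
     prob_space.indep_vars M (\<lambda>\<sigma>. borel) u (Pow V - {{}}) \<and>
     (\<forall>\<sigma> \<in> Pow V - {{}}.
        (\<forall>\<omega> \<in> space M. 0 \<le> u \<sigma> \<omega>) \<and> cdf (distr M borel (u \<sigma>)) = p (card \<sigma> - 1))"

definition complex_process ::
    "'v set \<Rightarrow> ('v set \<Rightarrow> 'w \<Rightarrow> real) \<Rightarrow> 'w \<Rightarrow> real \<Rightarrow> 'v set set" where
  "complex_process V u \<omega> t =
     {\<sigma> \<in> Pow V - {{}}. \<forall>\<tau>. \<tau> \<noteq> {} \<and> \<tau> \<subseteq> \<sigma> \<longrightarrow> u \<tau> \<omega> \<le> t}"

definition qfun :: "(nat \<Rightarrow> real \<Rightarrow> real) \<Rightarrow> nat \<Rightarrow> real \<Rightarrow> real" where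
  "qfun p k t = (\<Prod>i=0..k. p i t ^ ((k + 1) choose (i + 1)))"

definition rfun :: "(nat \<Rightarrow> real \<Rightarrow> real) \<Rightarrow> nat \<Rightarrow> real \<Rightarrow> real" where
  "rfun p k t = (\<Prod>i=0..k+1. p i t ^ ((k + 1) choose i))"

definition rcheck :: "(nat \<Rightarrow> real \<Rightarrow> real) \<Rightarrow> nat \<Rightarrow> real \<Rightarrow> real" where
  "rcheck p k u = Inf {t. 0 \<le> t \<and> rfun p k t > u}"

definition Qfun :: "(nat \<Rightarrow> real \<Rightarrow> real) \<Rightarrow> nat \<Rightarrow> real \<Rightarrow> real" where
  "Qfun p k t = (LBINT s:{0..t}. qfun p k s)"

definition Phi :: "(nat \<Rightarrow> real \<Rightarrow> real) \<Rightarrow> nat \<Rightarrow> real \<Rightarrow> real" where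
  "Phi p k u = Qfun p k (rcheck p k u)"

end

theory Submission imports Defs "HOL-Library.Function_Algebras" "HOL-Real_Asymp.Real_Asymp"
begin

text \<open>
  The key estimate is \<open>E \<beta>\<^sub>k(X\<^sub>n(t)) \<le> C n\<^bsup>k+1\<^esup> q\<^sub>k(t) (n r\<^sub>k(t))\<^bsup>-m\<^esup>\<close> for every \<open>m\<close>. Choose \<open>m\<close>
  disjoint batches of about \<open>n/m\<close> vertices. Coning off a cycle \<open>z\<close> over all vertices of a batch, each
  coface weighted by the inverse of the expected number of cofaces in the batch, shows that \<open>z\<close> is
  homologous to \<open>- E z\<close>, where the coefficients of the error operator \<open>E\<close> are essentially centred and
  have variance of order \<open>1 / (n r\<^sub>k(t))\<close>. Using the batches one after the other, \<open>z\<close> is homologous to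
  \<open>\<plusminus> E\<^sub>m \<dots> E\<^sub>1 z\<close>, so the Betti number is at most the squared Hilbert-Schmidt norm of \<open>E\<^sub>m \<dots> E\<^sub>1\<close>,
  whose expectation is at most the expected number of \<open>k\<close>-simplices times \<open>(C / (n r\<^sub>k(t)))\<^bsup>m\<^esup>\<close>.

  Since the lifetime sum is the time integral of the Betti number, a dyadic decomposition according to
  the size of \<open>n r\<^sub>k(t)\<close> bounds its expectation by \<open>n\<^bsup>k+1\<^esup> \<Sum>\<^sub>j 2\<^bsup>-jm\<^esup> \<Phi>\<^sub>k(2\<^bsup>j\<^esup>/n)\<close>, which the doubling
  condition on \<open>\<Phi>\<^sub>k\<close> controls by the first term. Large times are handled by the moment condition,
  because the Betti number vanishes unless some \<open>(k+1)\<close>-simplex is missing.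
\<close>

section \<open>Random subsets of a finite set\<close>

text \<open>The batches are disjoint because every step needs fresh randomness: after
  \<open>j\<close> steps started at a simplex \<open>\<sigma>\<close>, the chain depends only on the
  faces within \<open>\<sigma>\<close> and the batches used so far, and the faces through a vertex
  of the next batch outside \<open>\<sigma>\<close> are independent of it. The second moments
  therefore multiply. The only dependence left comes from batch vertices in \<open>\<sigma>\<close>,
  of which there are at most \<open>k + 1\<close>.

  The number \<open>m\<close> of steps stays fixed as \<open>n\<close> grows, so decay of arbitrary
  polynomial order is all that results. This is enough, because on scales below \<open>u0\<close>
  the doubling condition lets \<open>Phi\<close> grow by at most a fixed factor \<open>2 ^ a\<close>
  from one dyadic scale to the next.

  All probabilistic estimates take place at one fixed time, where the faces present form a random
  set with independent members and expectations are finite sums. Measure theory enters only when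
  these are integrated over time. Lifetime sums refer to a barcode obtained by choice, so its
  existence has to be proved; what is used of it is that at most \<open>betti k (X t)\<close> bars
  are alive at time \<open>t\<close>.\<close>

definition subset_expectation :: "'a set \<Rightarrow> ('a \<Rightarrow> real) \<Rightarrow> ('a set \<Rightarrow> real) \<Rightarrow> real" where
  "subset_expectation N P G = (\<Sum>Y\<in>Pow N. (\<Prod>a\<in>Y. P a) * (\<Prod>a\<in>N - Y. 1 - P a) * G Y)"

lemma subset_expectation_empty [simp]: "subset_expectation {} P G = G {}"
  by (simp add: subset_expectation_def)

lemma subset_expectation_insert:
  assumes "finite N" "x \<notin> N"
  shows "subset_expectation (insert x N) P G =
    P x * subset_expectation N P (\<lambda>Y. G (insert x Y)) + (1 - P x) * subset_expectation N P G"
proof -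
  have "subset_expectation (insert x N) P G =
      (\<Sum>Y\<in>Pow N. (\<Prod>a\<in>Y. P a) * (\<Prod>a\<in>insert x N - Y. 1 - P a) * G Y) +
      (\<Sum>Y\<in>insert x ` Pow N. (\<Prod>a\<in>Y. P a) * (\<Prod>a\<in>insert x N - Y. 1 - P a) * G Y)"
    unfolding subset_expectation_def Pow_insert using assms
    by (intro sum.union_disjoint) auto
  also have "(\<Sum>Y\<in>insert x ` Pow N. (\<Prod>a\<in>Y. P a) * (\<Prod>a\<in>insert x N - Y. 1 - P a) * G Y)
     = (\<Sum>Y\<in>Pow N. (\<Prod>a\<in>insert x Y. P a) * (\<Prod>a\<in>insert x N - insert x Y. 1 - P a) * G (insert x Y))"
    using assms by (subst sum.reindex) (auto simp: inj_on_def)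
  also have "\<dots> = P x * subset_expectation N P (\<lambda>Y. G (insert x Y))"
    unfolding subset_expectation_def sum_distrib_left
  proof (intro sum.cong refl, goal_cases)
    case (1 Y)
    have "insert x N - insert x Y = N - Y" using 1 assms by auto
    moreover have "x \<notin> Y" "finite Y" using 1 assms finite_subset by auto
    ultimately show ?case by simp
  qed
  also have "(\<Sum>Y\<in>Pow N. (\<Prod>a\<in>Y. P a) * (\<Prod>a\<in>insert x N - Y. 1 - P a) * G Y) = (1 - P x) * subset_expectation N P G"
    unfolding subset_expectation_def sum_distrib_left
  proof (intro sum.cong refl, goal_cases)
    case (1 Y)
    have "insert x N - Y = insert x (N - Y)" using 1 assms by auto
    then show ?case using assms by simp
  qed
  finally show ?thesis by simp
qed

lemma subset_expectation_cong:
  "(\<And>Y. Y \<subseteq> N \<Longrightarrow> G Y = H Y) \<Longrightarrow> subset_expectation N P G = subset_expectation N P H"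
  unfolding subset_expectation_def by (intro sum.cong) auto

lemma subset_expectation_mono:
  assumes "\<And>a. a \<in> N \<Longrightarrow> 0 \<le> P a" "\<And>a. a \<in> N \<Longrightarrow> P a \<le> 1" "\<And>Y. Y \<subseteq> N \<Longrightarrow> G Y \<le> H Y"
  shows "subset_expectation N P G \<le> subset_expectation N P H"
  unfolding subset_expectation_def
  by (intro sum_mono mult_left_mono mult_nonneg_nonneg prod_nonneg) (use assms in auto)

lemma subset_expectation_add:
  "subset_expectation N P (\<lambda>Y. G Y + H Y) = subset_expectation N P G + subset_expectation N P H"
  by (simp add: subset_expectation_def algebra_simps sum.distrib)

lemma subset_expectation_cmult:
  "subset_expectation N P (\<lambda>Y. c * G Y) = c * subset_expectation N P G"
  by (simp add: subset_expectation_def sum_distrib_left algebra_simps)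

lemma subset_expectation_sum:
  "subset_expectation N P (\<lambda>Y. \<Sum>i\<in>I. G i Y) = (\<Sum>i\<in>I. subset_expectation N P (G i))"
  unfolding subset_expectation_def by (subst sum.swap) (simp add: sum_distrib_left)

text \<open>The tower property. With \<open>A\<close> the faces inside a vertex set and
  \<open>B\<close> the remaining ones, the inner expectation is the conditional expectation given
  the faces inside.\<close>

lemma subset_expectation_Un:
  assumes "finite A" "finite B" "A \<inter> B = {}"
  shows "subset_expectation (A \<union> B) P G =
    subset_expectation A P (\<lambda>Y. subset_expectation B P (\<lambda>Y'. G (Y \<union> Y')))"
  using assms
proof (induction A arbitrary: G rule: finite_induct)
  case (insert x A)
  then show ?case by (simp add: subset_expectation_insert)
qed simp

lemma subset_expectation_prod:
  assumes "finite N"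
  shows "subset_expectation N P (\<lambda>Y. \<Prod>a\<in>N. h a (a \<in> Y)) = (\<Prod>a\<in>N. P a * h a True + (1 - P a) * h a False)"
  using assms
proof (induction N rule: finite_induct)
  case (insert x N)
  have 1: "subset_expectation N P (\<lambda>Y. \<Prod>a\<in>insert x N. h a (a \<in> insert x Y))
      = h x True * subset_expectation N P (\<lambda>Y. \<Prod>a\<in>N. h a (a \<in> Y))"
    unfolding subset_expectation_cmult[symmetric]
    using insert.hyps by (intro subset_expectation_cong) (auto intro!: prod.cong; metis)
  have 2: "subset_expectation N P (\<lambda>Y. \<Prod>a\<in>insert x N. h a (a \<in> Y))
      = h x False * subset_expectation N P (\<lambda>Y. \<Prod>a\<in>N. h a (a \<in> Y))"
    unfolding subset_expectation_cmult[symmetric]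
  proof (intro subset_expectation_cong)
    fix Y assume "Y \<subseteq> N"
    then have "x \<notin> Y" using insert.hyps by auto
    then show "(\<Prod>a\<in>insert x N. h a (a \<in> Y)) = h x False * (\<Prod>a\<in>N. h a (a \<in> Y))"
      using insert.hyps by simp
  qed
  show ?case unfolding subset_expectation_insert[OF insert.hyps] 1 2 insert.IH
    using insert.hyps by (simp add: algebra_simps)
qed simp

lemma subset_expectation_superset:
  assumes "finite N" "F \<subseteq> N"
  shows "subset_expectation N P (\<lambda>Y. of_bool (F \<subseteq> Y)) = (\<Prod>a\<in>F. P a)"
proof -
  have fF: "finite F" using assms finite_subset by auto
  have "subset_expectation N P (\<lambda>Y. of_bool (F \<subseteq> Y)) =
    subset_expectation N P (\<lambda>Y. \<Prod>a\<in>N. (\<lambda>a b. if a \<in> F then of_bool b else 1) a (a \<in> Y))"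
  proof (intro subset_expectation_cong)
    fix Y
    have "(\<Prod>a\<in>N. (if a \<in> F then of_bool (a \<in> Y) else (1::real))) = (\<Prod>a\<in>F. of_bool (a \<in> Y))"
      using assms by (intro prod.mono_neutral_cong_right) auto
    also have "\<dots> = of_bool (F \<subseteq> Y)"
      using fF by (cases "F \<subseteq> Y") (auto intro!: prod.neutral)
    finally show "of_bool (F \<subseteq> Y) = (\<Prod>a\<in>N. (\<lambda>a b. if a \<in> F then of_bool b else (1::real)) a (a \<in> Y))" by simp
  qed
  also have "\<dots> = (\<Prod>a\<in>N. if a \<in> F then P a else 1)"
    by (subst subset_expectation_prod[OF assms(1)]) (auto intro!: prod.cong)
  also have "\<dots> = (\<Prod>a\<in>F. P a)"
    using assms by (intro prod.mono_neutral_cong_right) auto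
  finally show ?thesis .
qed

lemma subset_expectation_const: "finite N \<Longrightarrow> subset_expectation N P (\<lambda>Y. c) = c"
  using subset_expectation_superset[of N "{}" P] subset_expectation_cmult[of N P c "\<lambda>_. 1"] by simp

text \<open>Given \<open>H \<subseteq> Y\<close>, the events \<open>F i \<subseteq> Y\<close> are
  independent with probability \<open>\<beta>\<close>, so the variables in the sum are centred and
  uncorrelated. The mixed terms vanish and only the variances remain, each at most
  \<open>1 / (\<alpha> * \<beta>)\<close>.\<close>

lemma subset_expectation_second_moment:
  assumes fin: "finite N" "finite I" and HN: "H \<subseteq> N" and FN: "\<And>i. i \<in> I \<Longrightarrow> F i \<subseteq> N"
    and HF: "\<And>i. i \<in> I \<Longrightarrow> H \<inter> F i = {}" and FF: "\<And>i j. i \<in> I \<Longrightarrow> j \<in> I \<Longrightarrow> i \<noteq> j \<Longrightarrow> F i \<inter> F j = {}"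
    and PH: "(\<Prod>a\<in>H. P a) = \<alpha>" "\<alpha> > 0" and PF: "\<And>i. i \<in> I \<Longrightarrow> (\<Prod>a\<in>F i. P a) = \<beta>" "\<beta> > 0"
  shows "subset_expectation N P (\<lambda>Y. (\<Sum>i\<in>I. c i * (of_bool (H \<subseteq> Y) / \<alpha> - of_bool (H \<union> F i \<subseteq> Y) / (\<alpha> * \<beta>)))\<^sup>2)
    \<le> (\<Sum>i\<in>I. (c i)\<^sup>2) / (\<alpha> * \<beta>)"
proof -
  define \<eta> where "\<eta> = (\<lambda>i Y. of_bool (H \<subseteq> Y) / \<alpha> - of_bool (H \<union> F i \<subseteq> Y) / (\<alpha> * \<beta>))"
  have fH: "finite H" and fF: "\<And>i. i \<in> I \<Longrightarrow> finite (F i)" using fin HN FN finite_subset by metis+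
  have cov: "subset_expectation N P (\<lambda>Y. \<eta> i Y * \<eta> j Y) = (if i = j then 1 / (\<alpha> * \<beta>) - 1 / \<alpha> else 0)"
    if ij: "i \<in> I" "j \<in> I" for i j
  proof -
    \<comment> \<open>A product of indicators of inclusions indicates that \<open>Y\<close> contains
      the union, so the expectation of each of the four terms is a product of probabilities.\<close>
    have "\<eta> i Y * \<eta> j Y = 1 / \<alpha>\<^sup>2 * of_bool (H \<subseteq> Y) + (- 1 / (\<alpha>\<^sup>2 * \<beta>)) * of_bool (H \<union> F i \<subseteq> Y)
       + ((- 1 / (\<alpha>\<^sup>2 * \<beta>)) * of_bool (H \<union> F j \<subseteq> Y) + 1 / (\<alpha>\<^sup>2 * \<beta>\<^sup>2) * of_bool (H \<union> (F i \<union> F j) \<subseteq> Y))" for Y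
      by (auto simp: \<eta>_def power2_eq_square algebra_simps)
    then have "subset_expectation N P (\<lambda>Y. \<eta> i Y * \<eta> j Y) = 1 / \<alpha>\<^sup>2 * (\<Prod>a\<in>H. P a) + (- 1 / (\<alpha>\<^sup>2 * \<beta>)) * (\<Prod>a\<in>H \<union> F i. P a)
       + ((- 1 / (\<alpha>\<^sup>2 * \<beta>)) * (\<Prod>a\<in>H \<union> F j. P a) + 1 / (\<alpha>\<^sup>2 * \<beta>\<^sup>2) * (\<Prod>a\<in>H \<union> (F i \<union> F j). P a))"
      using ij HN FN
      by (simp only: subset_expectation_add subset_expectation_cmult, subst (1 2 3 4) subset_expectation_superset[OF fin(1)]) auto
    also have "\<dots> = (if i = j then 1 / (\<alpha> * \<beta>) - 1 / \<alpha> else 0)"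
    proof (cases "i = j")
      case True
      then show ?thesis using ij fH fF HF PH PF by (simp add: prod.union_disjoint power2_eq_square field_simps)
    next
      case False
      have "H \<inter> (F i \<union> F j) = {}" using HF ij by auto
      then show ?thesis using False ij fH fF HF FF PH PF by (simp add: prod.union_disjoint power2_eq_square field_simps)
    qed
    finally show ?thesis .
  qed
  have "subset_expectation N P (\<lambda>Y. (\<Sum>i\<in>I. c i * \<eta> i Y)\<^sup>2)
     = subset_expectation N P (\<lambda>Y. \<Sum>i\<in>I. \<Sum>j\<in>I. (c i * c j) * (\<eta> i Y * \<eta> j Y))"
    by (simp add: power2_eq_square sum_product algebra_simps)
  also have "\<dots> = (\<Sum>i\<in>I. \<Sum>j\<in>I. (c i * c j) * subset_expectation N P (\<lambda>Y. \<eta> i Y * \<eta> j Y))"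
    by (simp add: subset_expectation_sum subset_expectation_cmult)
  also have "\<dots> = (\<Sum>i\<in>I. \<Sum>j\<in>I. if i = j then (c i)\<^sup>2 * (1 / (\<alpha> * \<beta>) - 1 / \<alpha>) else 0)"
    by (intro sum.cong refl) (auto simp: cov power2_eq_square)
  also have "\<dots> = (\<Sum>i\<in>I. (c i)\<^sup>2 * (1 / (\<alpha> * \<beta>) - 1 / \<alpha>))"
    using fin by simp
  also have "\<dots> \<le> (\<Sum>i\<in>I. (c i)\<^sup>2 * (1 / (\<alpha> * \<beta>)))"
    using PH by (intro sum_mono mult_left_mono) auto
  finally show ?thesis by (simp add: \<eta>_def sum_divide_distrib)
qed

text \<open>An exponential moment, for a Chernoff bound on the number of cofaces. The power
  \<open>2 ^ card\<close> counts the subfamilies of \<open>W\<close> whose sets all lie in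
  \<open>Y\<close>; disjointness factorises the probability of each, and the binomial expansion of
  \<open>(1 + \<beta>) ^ card W\<close> adds them up.\<close>

lemma subset_expectation_exponential_count:
  assumes fin: "finite N" "finite W" and HN: "H \<subseteq> N" and FN: "\<And>i. i \<in> W \<Longrightarrow> F i \<subseteq> N"
    and HF: "\<And>i. i \<in> W \<Longrightarrow> H \<inter> F i = {}" and FF: "\<And>i j. i \<in> W \<Longrightarrow> j \<in> W \<Longrightarrow> i \<noteq> j \<Longrightarrow> F i \<inter> F j = {}"
    and PF: "\<And>i. i \<in> W \<Longrightarrow> (\<Prod>a\<in>F i. P a) = \<beta>"
  shows "subset_expectation N P (\<lambda>Y. of_bool (H \<subseteq> Y) * 2 ^ card {i\<in>W. F i \<subseteq> Y}) = (\<Prod>a\<in>H. P a) * (1 + \<beta>) ^ card W"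
proof -
  have fH: "finite H" and fF: "\<And>i. i \<in> W \<Longrightarrow> finite (F i)" using fin HN FN finite_subset by metis+
  have "of_bool (H \<subseteq> Y) * (2::real) ^ card {i\<in>W. F i \<subseteq> Y} = (\<Sum>S\<in>Pow W. of_bool (H \<union> \<Union>(F ` S) \<subseteq> Y))" for Y
  proof -
    have "(2::real) ^ card {i\<in>W. F i \<subseteq> Y} = (\<Prod>i\<in>W. if F i \<subseteq> Y then 2 else 1)"
      using fin by (subst prod.If_cases) (auto simp: Int_def)
    also have "\<dots> = (\<Prod>i\<in>W. of_bool (F i \<subseteq> Y) + 1)" by (intro prod.cong) auto
    also have "\<dots> = (\<Sum>S\<in>Pow W. (\<Prod>i\<in>S. of_bool (F i \<subseteq> Y)) * (\<Prod>i\<in>W - S. 1))"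
      by (rule prod_add[OF fin(2)])
    also have "\<dots> = (\<Sum>S\<in>Pow W. of_bool (\<Union>(F ` S) \<subseteq> Y))"
    proof (intro sum.cong refl, goal_cases)
      case (1 S)
      then have "finite S" using fin finite_subset by auto
      then show ?case by (cases "\<Union>(F ` S) \<subseteq> Y") (auto intro!: prod.neutral simp: UN_subset_iff)
    qed
    finally show ?thesis by (simp add: sum_distrib_left of_bool_conj[symmetric])
  qed
  then have "subset_expectation N P (\<lambda>Y. of_bool (H \<subseteq> Y) * 2 ^ card {i\<in>W. F i \<subseteq> Y})
     = (\<Sum>S\<in>Pow W. subset_expectation N P (\<lambda>Y. of_bool (H \<union> \<Union>(F ` S) \<subseteq> Y)))"
    by (simp only: subset_expectation_sum)
  also have "\<dots> = (\<Sum>S\<in>Pow W. (\<Prod>a\<in>H \<union> \<Union>(F ` S). P a))"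
    by (intro sum.cong refl subset_expectation_superset fin) (use HN FN in auto)
  also have "\<dots> = (\<Sum>S\<in>Pow W. (\<Prod>a\<in>H. P a) * \<beta> ^ card S)"
  proof (intro sum.cong refl, goal_cases)
    case (1 S)
    then have fS: "finite S" and SW: "S \<subseteq> W" using fin finite_subset by auto
    have "(\<Prod>a\<in>H \<union> \<Union>(F ` S). P a) = (\<Prod>a\<in>H. P a) * (\<Prod>a\<in>\<Union>(F ` S). P a)"
      using HF SW fH fF fS by (intro prod.union_disjoint) auto
    also have "(\<Prod>a\<in>\<Union>(F ` S). P a) = (\<Prod>i\<in>S. \<Prod>a\<in>F i. P a)"
      using FF SW fF fS by (intro prod.UNION_disjoint) auto
    also have "\<dots> = \<beta> ^ card S" using PF SW by (simp add: subset_iff)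
    finally show ?case .
  qed
  also have "\<dots> = (\<Prod>a\<in>H. P a) * (\<Sum>S\<in>Pow W. (\<Prod>i\<in>S. \<beta>) * (\<Prod>i\<in>W - S. 1))"
    by (simp add: sum_distrib_left)
  also have "(\<Sum>S\<in>Pow W. (\<Prod>i\<in>S. \<beta>) * (\<Prod>i\<in>W - S. 1)) = (\<Prod>i\<in>W. \<beta> + 1)"
    by (rule prod_add[OF fin(2), symmetric])
  finally show ?thesis by (simp add: add.commute)
qed

section \<open>Linear algebra of real functions\<close>

interpretation fs: vector_space "\<lambda>(a::real) (f::'b \<Rightarrow> real) x. a * f x"
  by unfold_locales (simp_all add: fun_eq_iff algebra_simps)

lemma fs_subspaceI:
  fixes S :: "('b \<Rightarrow> real) set"
  assumes "(\<lambda>_. 0) \<in> S"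
    and "\<And>f g a b. f \<in> S \<Longrightarrow> g \<in> S \<Longrightarrow> (\<lambda>x. a * f x + b * g x) \<in> S"
  shows "fs.subspace S"
proof (rule fs.subspaceI)
  show "0 \<in> S" using assms(1) by (simp add: zero_fun_def)
  show "f + g \<in> S" if "f \<in> S" "g \<in> S" for f g
    using assms(2)[OF that, of 1 1] by (simp add: plus_fun_def)
  show "(\<lambda>x. c * f x) \<in> S" if "f \<in> S" for c f
    using assms(2)[OF that that, of c 0] by simp
qed

lemma fs_subspace_lincomb:
  fixes S :: "('b \<Rightarrow> real) set"
  assumes "fs.subspace S" "f \<in> S" "g \<in> S"
  shows "(\<lambda>x. a * f x + b * g x) \<in> S"
  using fs.subspace_add[OF assms(1) fs.subspace_scale[OF assms(1,2), of a] fs.subspace_scale[OF assms(1,3), of b]]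
  by (simp add: plus_fun_def)

lemma sum_fun_apply: "(sum f A) x = (\<Sum>i\<in>A. (f i x :: real))"
  by (induction A rule: infinite_finite_induct) auto

lemma fs_subspace_sum:
  fixes S :: "('b \<Rightarrow> real) set"
  assumes "fs.subspace S" "\<And>i. i \<in> I \<Longrightarrow> f i \<in> S"
  shows "(\<lambda>x. \<Sum>i\<in>I. c i * f i x) \<in> S"
proof -
  have "(\<Sum>i\<in>I. (\<lambda>x. c i * f i x)) \<in> S"
    by (intro fs.subspace_sum assms fs.subspace_scale)
  then show ?thesis by (simp add: sum_fun_apply[abs_def] fun_eq_iff cong: if_cong)
qed

text \<open>Gaussian elimination with the unknown \<open>i0\<close> as pivot for the equation
  \<open>j\<close>: \<open>a'\<close> is the system left after \<open>i0\<close> has been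
  eliminated, and \<open>y\<close> restores the value of the pivot.\<close>

lemma homogeneous_system:
  fixes a :: "'i \<Rightarrow> 'j \<Rightarrow> real"
  assumes "finite J" "finite I" "card J < card I"
  shows "\<exists>x. (\<exists>i\<in>I. x i \<noteq> 0) \<and> (\<forall>j\<in>J. (\<Sum>i\<in>I. x i * a i j) = 0)"
  using assms
proof (induction J arbitrary: I a rule: finite_induct)
  case empty
  then have "I \<noteq> {}" by auto
  then show ?case by (intro exI[of _ "\<lambda>_. 1"]) auto
next
  case (insert j J)
  show ?case
  proof (cases "\<forall>i\<in>I. a i j = 0")
    case True
    obtain x where "\<exists>i\<in>I. x i \<noteq> 0" "\<forall>j\<in>J. (\<Sum>i\<in>I. x i * a i j) = 0"
      using insert.IH[of I a] insert.prems insert.hyps by auto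
    with True show ?thesis by (intro exI[of _ x]) auto
  next
    case False
    then obtain i0 where i0: "i0 \<in> I" "a i0 j \<noteq> 0" by auto
    define a' where "a' = (\<lambda>i j'. a i j' - a i j / a i0 j * a i0 j')"
    have "card J < card (I - {i0})"
      using insert.prems insert.hyps i0 by simp
    then obtain x where x: "\<exists>i\<in>I - {i0}. x i \<noteq> 0" "\<forall>j'\<in>J. (\<Sum>i\<in>I - {i0}. x i * a' i j') = 0"
      using insert.IH[of "I - {i0}" a'] insert.prems by auto
    define s where "s = (\<Sum>i\<in>I - {i0}. x i * a i j)"
    define y where "y = x(i0 := - s / a i0 j)"
    have split: "(\<Sum>i\<in>I. y i * a i j') = - s / a i0 j * a i0 j' + (\<Sum>i\<in>I - {i0}. x i * a i j')" for j'
    proof -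
      have "(\<Sum>i\<in>I. y i * a i j') = y i0 * a i0 j' + (\<Sum>i\<in>I - {i0}. y i * a i j')"
        using i0 insert.prems by (simp add: sum.remove)
      also have "(\<Sum>i\<in>I - {i0}. y i * a i j') = (\<Sum>i\<in>I - {i0}. x i * a i j')"
        by (intro sum.cong) (auto simp: y_def)
      finally show ?thesis by (simp add: y_def)
    qed
    have "(\<Sum>i\<in>I. y i * a i j) = 0"
      unfolding split using i0 by (simp add: s_def)
    moreover have "(\<Sum>i\<in>I. y i * a i j') = 0" if "j' \<in> J" for j'
    proof -
      have "0 = (\<Sum>i\<in>I - {i0}. x i * a' i j')" using x that by auto
      also have "\<dots> = (\<Sum>i\<in>I - {i0}. x i * a i j') - s / a i0 j * a i0 j'"
        by (simp add: a'_def s_def algebra_simps sum_subtractf sum_distrib_left sum_distrib_right sum_divide_distrib)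
      finally show ?thesis unfolding split by simp
    qed
    moreover have "\<exists>i\<in>I. y i \<noteq> 0"
      using x(1) by (auto simp: y_def)
    ultimately show ?thesis by (intro exI[of _ y]) auto
  qed
qed

section \<open>Orthonormal families and projections for functions on a finite set\<close>

definition inner_on :: "'a set \<Rightarrow> ('a \<Rightarrow> real) \<Rightarrow> ('a \<Rightarrow> real) \<Rightarrow> real" where
  "inner_on S f g = (\<Sum>x\<in>S. f x * g x)"

definition orthonormal_on :: "'a set \<Rightarrow> ('a \<Rightarrow> real) set \<Rightarrow> bool" where
  "orthonormal_on S E \<longleftrightarrow> (\<forall>e\<in>E. \<forall>f\<in>E. inner_on S e f = (if e = f then 1 else 0))"

definition supported_on :: "'a set \<Rightarrow> ('a \<Rightarrow> real) \<Rightarrow> bool" where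
  "supported_on S f \<longleftrightarrow> (\<forall>x. f x \<noteq> 0 \<longrightarrow> x \<in> S)"

lemma inner_on_commute: "inner_on S f g = inner_on S g f"
  by (simp add: inner_on_def mult.commute)

lemma inner_on_sum_left:
  "inner_on S (\<lambda>x. \<Sum>i\<in>I. c i * f i x) g = (\<Sum>i\<in>I. c i * inner_on S (f i) g)"
  unfolding inner_on_def
  by (subst sum_distrib_right, subst sum.swap) (simp add: sum_distrib_left mult.assoc)

lemma inner_on_diff_left:
  "inner_on S (\<lambda>x. f x - h x) g = inner_on S f g - inner_on S h g"
  unfolding inner_on_def by (simp add: sum_subtractf algebra_simps)

lemma inner_on_self_pos:
  assumes "finite S" "supported_on S f" "f \<noteq> (\<lambda>_. 0)"
  shows "inner_on S f f > 0"
proof -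
  obtain x where x: "f x \<noteq> 0" using assms(3) by auto
  then have "x \<in> S" using assms(2) by (auto simp: supported_on_def)
  then show ?thesis unfolding inner_on_def
    using assms(1) x by (intro sum_pos2[of _ x]) (auto simp: zero_less_mult_iff)
qed

lemma Cauchy_Schwarz_inner_on: "(inner_on S f g)\<^sup>2 \<le> inner_on S f f * inner_on S g g"
  using Cauchy_Schwarz_ineq_sum[of f g S] by (simp add: inner_on_def power2_eq_square)

lemma bessel_inner_on:
  assumes "finite E" "orthonormal_on S E"
  shows "(\<Sum>e\<in>E. (inner_on S e g)\<^sup>2) \<le> inner_on S g g"
proof -
  define c where "c = (\<lambda>e. inner_on S e g)"
  define h where "h = (\<lambda>x. \<Sum>e\<in>E. c e * e x)"
  have he: "inner_on S h e = c e" if "e \<in> E" for e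
  proof -
    have "inner_on S h e = (\<Sum>e'\<in>E. c e' * inner_on S e' e)"
      unfolding h_def by (rule inner_on_sum_left)
    also have "\<dots> = (\<Sum>e'\<in>E. if e' = e then c e' else 0)"
      using assms(2) that by (intro sum.cong) (auto simp: orthonormal_on_def)
    finally show ?thesis using assms(1) that by simp
  qed
  have hg: "inner_on S h g = (\<Sum>e\<in>E. (c e)\<^sup>2)"
    unfolding h_def inner_on_sum_left by (simp add: c_def power2_eq_square)
  have "inner_on S h h = (\<Sum>e\<in>E. c e * inner_on S e h)"
    by (subst h_def) (rule inner_on_sum_left)
  also have "\<dots> = (\<Sum>e\<in>E. (c e)\<^sup>2)"
    by (intro sum.cong) (auto simp: inner_on_commute[of S _ h] he power2_eq_square)
  finally have hh: "inner_on S h h = (\<Sum>e\<in>E. (c e)\<^sup>2)" .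
  have "0 \<le> inner_on S (\<lambda>x. g x - h x) (\<lambda>x. g x - h x)"
    unfolding inner_on_def by (intro sum_nonneg) simp
  also have "\<dots> = inner_on S g g - 2 * inner_on S h g + inner_on S h h"
    unfolding inner_on_diff_left inner_on_commute[of S _ "\<lambda>x. g x - h x"]
    by (simp add: inner_on_commute)
  finally show ?thesis using hh hg by (simp add: c_def)
qed

text \<open>Sum the squared values of all members of \<open>E\<close> at all points of
  \<open>S\<close>: each member contributes 1, and by Bessel's inequality each point mass
  \<open>d s\<close> receives at most 1. The bound guarantees that orthonormal families of maximal
  cardinality exist.\<close>

lemma card_orthonormal_on_le:
  assumes "finite S" "finite E" "orthonormal_on S E"
  shows "card E \<le> card S"
proof -
  define d :: "'a \<Rightarrow> 'a \<Rightarrow> real" where "d = (\<lambda>s x. if x = s then 1 else 0)"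
  have dd: "inner_on S e (d s) = e s" if "s \<in> S" for e s
    using assms(1) that by (simp add: inner_on_def d_def sum.delta if_distrib cong: if_cong)
  have "real (card E) = (\<Sum>e\<in>E. inner_on S e e)"
    using assms(3) by (simp add: orthonormal_on_def)
  also have "\<dots> = (\<Sum>e\<in>E. \<Sum>s\<in>S. (inner_on S e (d s))\<^sup>2)"
    by (intro sum.cong refl) (simp add: dd inner_on_def[of S e e for e] power2_eq_square)
  also have "\<dots> = (\<Sum>s\<in>S. \<Sum>e\<in>E. (inner_on S e (d s))\<^sup>2)"
    by (rule sum.swap)
  also have "\<dots> \<le> (\<Sum>s\<in>S. inner_on S (d s) (d s))"
    by (intro sum_mono bessel_inner_on assms)
  also have "\<dots> = (\<Sum>s\<in>S. 1)"
    by (intro sum.cong refl) (simp add: dd, simp add: d_def)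
  finally show ?thesis by simp
qed

lemma orthonormal_on_insert:
  assumes "orthonormal_on S E" "\<forall>e\<in>E. inner_on S e f = 0" "inner_on S f f = 1"
  shows "orthonormal_on S (insert f E)"
  using assms unfolding orthonormal_on_def
  by (auto simp: inner_on_commute)

lemma normalize_inner_on:
  assumes "finite S" "supported_on S f" "f \<noteq> (\<lambda>_. 0)"
  shows "\<exists>c. inner_on S (\<lambda>x. c * f x) (\<lambda>x. c * f x) = 1"
proof -
  have p: "inner_on S f f > 0" by (rule inner_on_self_pos[OF assms])
  define c where "c = 1 / sqrt (inner_on S f f)"
  have "inner_on S (\<lambda>x. c * f x) (\<lambda>x. c * f x) = c\<^sup>2 * inner_on S f f"
    by (simp add: inner_on_def sum_distrib_left power2_eq_square algebra_simps)
  also have "\<dots> = 1" using p by (simp add: c_def power_divide)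
  finally show ?thesis by blast
qed

text \<open>A largest orthonormal family \<open>E\<close> in \<open>B\<close> spans
  \<open>B\<close>, as otherwise the normalised remainder of some member of \<open>B\<close> could
  be added. The projection is the Fourier sum over \<open>E\<close>.\<close>

lemma orthogonal_projection_exists:
  assumes "finite S" "fs.subspace B" "\<And>f. f \<in> B \<Longrightarrow> supported_on S f"
  shows "\<exists>b\<in>B. \<forall>b'\<in>B. inner_on S (\<lambda>x. z x - b x) b' = 0"
proof -
  define Q where "Q = (\<lambda>E. finite E \<and> E \<subseteq> B \<and> orthonormal_on S E)"
  have "\<exists>E. Q E \<and> (\<forall>E'. Q E' \<longrightarrow> card E' \<le> card E)"
    using ex_has_greatest_nat[of Q "{}" card "card S + 1"] card_orthonormal_on_le[OF assms(1)]
    by (auto simp: Q_def orthonormal_on_def less_Suc_eq_le)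
  then obtain E where E: "Q E" and max: "\<And>E'. Q E' \<Longrightarrow> card E' \<le> card E" by auto
  have fE: "finite E" and EB: "E \<subseteq> B" and oE: "orthonormal_on S E" using E by (auto simp: Q_def)
  define pr where "pr = (\<lambda>g x. \<Sum>e\<in>E. inner_on S e g * e x)"
  have prB: "pr g \<in> B" for g unfolding pr_def by (intro fs_subspace_sum assms) (use EB in auto)
  have orth: "inner_on S (\<lambda>x. g x - pr g x) e = 0" if "e \<in> E" for g e
  proof -
    have "inner_on S (pr g) e = (\<Sum>e'\<in>E. inner_on S e' g * inner_on S e' e)"
      unfolding pr_def by (rule inner_on_sum_left)
    also have "\<dots> = (\<Sum>e'\<in>E. if e' = e then inner_on S e' g else 0)"
      using oE that by (intro sum.cong) (auto simp: orthonormal_on_def)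
    finally show ?thesis unfolding inner_on_diff_left using fE that by (simp add: inner_on_commute)
  qed
  have span: "g = pr g" if "g \<in> B" for g
  proof (rule ccontr)
    assume ne: "g \<noteq> pr g"
    define f where "f = (\<lambda>x. g x - pr g x)"
    have fB: "f \<in> B" using fs_subspace_lincomb[OF assms(2) that prB[of g], of 1 "-1"] by (simp add: f_def)
    have f0: "f \<noteq> (\<lambda>_. 0)" using ne by (auto simp: f_def fun_eq_iff)
    obtain c where c: "inner_on S (\<lambda>x. c * f x) (\<lambda>x. c * f x) = 1"
      using normalize_inner_on[OF assms(1) assms(3)[OF fB] f0] by auto
    define h where "h = (\<lambda>x. c * f x)"
    have hB: "h \<in> B" unfolding h_def using fs.subspace_scale[OF assms(2) fB] by simp
    have he: "inner_on S e h = 0" if "e \<in> E" for e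
      using orth[OF that, of g]
      by (subst inner_on_commute) (simp add: h_def f_def inner_on_def sum_distrib_left[symmetric] mult.assoc)
    have "Q (insert h E)"
      using fE EB hB he c oE unfolding Q_def
      by (auto intro!: orthonormal_on_insert simp: h_def)
    then have "card (insert h E) \<le> card E" by (rule max)
    moreover have "h \<notin> E" using he[of h] c by (auto simp: h_def)
    ultimately show False using fE by simp
  qed
  have "inner_on S (\<lambda>x. z x - pr z x) b' = 0" if "b' \<in> B" for b'
  proof -
    have "inner_on S b' (\<lambda>x. z x - pr z x) = inner_on S (pr b') (\<lambda>x. z x - pr z x)"
      using span[OF that] by simp
    also have "\<dots> = (\<Sum>e\<in>E. inner_on S e b' * inner_on S e (\<lambda>x. z x - pr z x))"
      by (subst pr_def) (rule inner_on_sum_left)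
    also have "\<dots> = 0" using orth by (simp add: inner_on_commute[of S _ "\<lambda>x. z x - pr z x"])
    finally show ?thesis by (simp add: inner_on_commute)
  qed
  with prB show ?thesis by blast
qed

text \<open>
  Here \<open>B\<close> are the boundaries and \<open>Z\<close> the cycles. Classes have representatives orthogonal to \<open>B\<close>; on
  those that satisfy the constraints \<open>T\<close> acts as \<open>\<plusminus>1\<close> modulo \<open>B\<close>, so each unit vector among them
  contributes at least \<open>1\<close> to the squared Hilbert-Schmidt norm of \<open>T\<close>.
\<close>

lemma card_independent_le_constraints_plus_hilbert_schmidt:
  fixes T :: "('a \<Rightarrow> real) \<Rightarrow> 'a \<Rightarrow> real" and L :: "'j \<Rightarrow> ('a \<Rightarrow> real) \<Rightarrow> real"
  assumes fin: "finite S" "finite I" "finite J"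
    and B: "fs.subspace B" and Z: "fs.subspace Z" and BZ: "B \<subseteq> Z"
    and supp: "\<And>f. f \<in> Z \<Longrightarrow> supported_on S f"
    and zZ: "\<And>i. i \<in> I \<Longrightarrow> z i \<in> Z"
    and ind: "\<And>a. (\<lambda>x. \<Sum>i\<in>I. a i * z i x) \<in> B \<Longrightarrow> \<forall>i\<in>I. a i = 0"
    and L: "\<And>j f. j \<in> J \<Longrightarrow> f \<in> Z \<Longrightarrow> L j f = (\<Sum>s\<in>S. f s * l j s)"
    and T: "\<And>f x. f \<in> Z \<Longrightarrow> T f x = (\<Sum>s\<in>S. f s * t s x)"
    and eps: "\<epsilon>\<^sup>2 = (1::real)"
    and id: "\<And>f. f \<in> Z \<Longrightarrow> \<forall>j\<in>J. L j f = 0 \<Longrightarrow> (\<lambda>x. f x - \<epsilon> * T f x) \<in> B"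
  shows "real (card I) \<le> real (card J) + (\<Sum>s\<in>S. \<Sum>x\<in>S. (t s x)\<^sup>2)"
proof -
  have suppB: "\<And>f. f \<in> B \<Longrightarrow> supported_on S f" using supp BZ by auto
  have "\<exists>b. b \<in> B \<and> (\<forall>b'\<in>B. inner_on S (\<lambda>x. z i x - b x) b' = 0)" for i
    using orthogonal_projection_exists[OF fin(1) B suppB, of "z i"] by blast
  then obtain b where bB: "\<And>i. b i \<in> B" and borth: "\<And>i b'. b' \<in> B \<Longrightarrow> inner_on S (\<lambda>x. z i x - b i x) b' = 0"
    by metis
  define y where "y = (\<lambda>i x. z i x - b i x)"
  have yZ: "y i \<in> Z" if "i \<in> I" for i
    using fs_subspace_lincomb[OF Z zZ[OF that], of "b i" 1 "-1"] bB BZ by (auto simp: y_def)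
  define Q where "Q = (\<lambda>E. finite E \<and> E \<subseteq> Z \<and> orthonormal_on S E \<and>
     (\<forall>e\<in>E. (\<forall>j\<in>J. L j e = 0) \<and> (\<forall>b'\<in>B. inner_on S e b' = 0)))"
  have "\<exists>E. Q E \<and> (\<forall>E'. Q E' \<longrightarrow> card E' \<le> card E)"
    using ex_has_greatest_nat[of Q "{}" card "card S + 1"] card_orthonormal_on_le[OF fin(1)]
    by (auto simp: Q_def orthonormal_on_def less_Suc_eq_le)
  then obtain E where E: "Q E" and max: "\<And>E'. Q E' \<Longrightarrow> card E' \<le> card E" by auto
  have fE: "finite E" and EZ: "E \<subseteq> Z" and oE: "orthonormal_on S E"
    and EL: "\<And>e j. e \<in> E \<Longrightarrow> j \<in> J \<Longrightarrow> L j e = 0"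
    and EB: "\<And>e b'. e \<in> E \<Longrightarrow> b' \<in> B \<Longrightarrow> inner_on S e b' = 0" using E by (auto simp: Q_def)
  \<comment> \<open>If \<open>card I\<close> were larger, \<open>card J + card E\<close> linear
    conditions could not exclude every nontrivial combination \<open>f\<close> of the
    \<open>y i\<close>. Such an \<open>f\<close> meets the constraints, is orthogonal to
    \<open>B\<close> and \<open>E\<close>, and is nonzero by the independence of the classes, so
    \<open>E\<close> would not be maximal.\<close>
  have "card I \<le> card J + card E"
  proof (rule ccontr)
    assume "\<not> ?thesis"
    then have "card (Inl ` J \<union> Inr ` E) < card I"
      using fin(3) fE by (subst card_Un_disjoint) (auto simp: card_image inj_on_def)
    then obtain a where a: "\<exists>i\<in>I. a i \<noteq> 0"
      and a0: "\<forall>j\<in>Inl ` J \<union> Inr ` E.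
        (\<Sum>i\<in>I. a i * (case j of Inl j \<Rightarrow> L j (y i) | Inr e \<Rightarrow> inner_on S (y i) e)) = 0"
      using homogeneous_system[of "Inl ` J \<union> Inr ` E" I
          "\<lambda>i j. case j of Inl j \<Rightarrow> L j (y i) | Inr e \<Rightarrow> inner_on S (y i) e"] fin fE by auto
    define f where "f = (\<lambda>x. \<Sum>i\<in>I. a i * y i x)"
    have fZ: "f \<in> Z" unfolding f_def by (intro fs_subspace_sum Z yZ)
    have fL: "L j f = 0" if "j \<in> J" for j
    proof -
      have "L j f = (\<Sum>s\<in>S. f s * l j s)" by (rule L[OF that fZ])
      also have "\<dots> = (\<Sum>i\<in>I. a i * L j (y i))"
        unfolding f_def
        by (simp add: sum_distrib_right sum.swap[of _ I S] L[OF that yZ] sum_distrib_left mult.assoc)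
      also have "\<dots> = 0" using bspec[OF a0, of "Inl j"] that by simp
      finally show ?thesis .
    qed
    have fe: "inner_on S e f = 0" if "e \<in> E" for e
      using bspec[OF a0, of "Inr e"] that unfolding inner_on_commute[of S e] f_def inner_on_sum_left by simp
    have fB: "inner_on S f b' = 0" if "b' \<in> B" for b'
      using borth[OF that] unfolding f_def inner_on_sum_left by (simp add: y_def)
    have f0: "f \<noteq> (\<lambda>_. 0)"
    proof
      assume "f = (\<lambda>_. 0)"
      then have "(\<Sum>i\<in>I. a i * y i x) = 0" for x by (metis f_def)
      then have "(\<lambda>x. \<Sum>i\<in>I. a i * z i x) = (\<lambda>x. \<Sum>i\<in>I. a i * b i x)"
        by (simp add: y_def algebra_simps sum_subtractf)
      also have "\<dots> \<in> B" by (intro fs_subspace_sum B bB)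
      finally show False using ind a by blast
    qed
    obtain c where c: "inner_on S (\<lambda>x. c * f x) (\<lambda>x. c * f x) = 1"
      using normalize_inner_on[OF fin(1) supp[OF fZ] f0] by auto
    define h where "h = (\<lambda>x. c * f x)"
    have hZ: "h \<in> Z" unfolding h_def using fs.subspace_scale[OF Z fZ] by simp
    have hi: "inner_on S h g = c * inner_on S f g" for g
      by (simp add: h_def inner_on_def sum_distrib_left mult.assoc)
    have hL: "L j h = 0" if "j \<in> J" for j
      using fL[OF that] unfolding L[OF that hZ] L[OF that fZ]
      by (simp add: h_def mult.assoc sum_distrib_left[symmetric])
    have he: "inner_on S e h = 0" if "e \<in> E" for e
      using fe[OF that] by (simp add: inner_on_commute[of S e] hi)
    have "Q (insert h E)"
      using fE EZ hZ he c oE EL EB hL fB unfolding Q_def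
      by (auto intro!: orthonormal_on_insert simp: h_def[symmetric] hi)
    then have "card (insert h E) \<le> card E" by (rule max)
    moreover have "h \<notin> E" using he[of h] c by (auto simp: h_def)
    ultimately show False using fE by simp
  qed
  moreover have "real (card E) \<le> (\<Sum>s\<in>S. \<Sum>x\<in>S. (t s x)\<^sup>2)"
  proof -
    \<comment> \<open>Pairing the boundary \<open>e - \<epsilon> * T e\<close> with
      \<open>e\<close>, which is orthogonal to \<open>B\<close>, gives
      \<open>\<epsilon> * inner_on S e (T e) = 1\<close>; Cauchy-Schwarz turns this into a lower
      bound for the norm of \<open>T e\<close>.\<close>
    have one: "1 \<le> inner_on S (T e) (T e)" if "e \<in> E" for e
    proof -
      have eZ: "e \<in> Z" using that EZ by auto
      have "inner_on S e (\<lambda>x. e x - \<epsilon> * T e x) = 0"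
        by (intro EB that id eZ) (simp add: EL that)
      moreover have "inner_on S e (\<lambda>x. e x - \<epsilon> * T e x) = inner_on S e e - \<epsilon> * inner_on S e (T e)"
        by (simp add: inner_on_def algebra_simps sum_subtractf sum_distrib_left)
      moreover have ee: "inner_on S e e = 1" using oE that by (simp add: orthonormal_on_def)
      ultimately have "\<epsilon> * inner_on S e (T e) = 1" by simp
      then have "(\<epsilon> * inner_on S e (T e))\<^sup>2 = 1" by simp
      then have "(inner_on S e (T e))\<^sup>2 = 1" using eps by (simp add: power_mult_distrib)
      then show ?thesis using Cauchy_Schwarz_inner_on[of S e "T e"] ee by simp
    qed
    have "real (card E) = (\<Sum>e\<in>E. 1)" by simp
    also have "\<dots> \<le> (\<Sum>e\<in>E. inner_on S (T e) (T e))" by (intro sum_mono one)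
    \<comment> \<open>\<open>T e x\<close> is the inner product of \<open>e\<close> with the column
      of \<open>t\<close> at \<open>x\<close>, so Bessel's inequality bounds the sum over
      \<open>E\<close> by the squared norm of that column.\<close>
    also have "\<dots> = (\<Sum>e\<in>E. \<Sum>x\<in>S. (inner_on S e (\<lambda>s. t s x))\<^sup>2)"
      using EZ by (intro sum.cong refl) (auto simp: inner_on_def T power2_eq_square intro!: sum.cong)
    also have "\<dots> = (\<Sum>x\<in>S. \<Sum>e\<in>E. (inner_on S e (\<lambda>s. t s x))\<^sup>2)" by (rule sum.swap)
    also have "\<dots> \<le> (\<Sum>x\<in>S. inner_on S (\<lambda>s. t s x) (\<lambda>s. t s x))"
      by (intro sum_mono bessel_inner_on fE oE)
    also have "\<dots> = (\<Sum>s\<in>S. \<Sum>x\<in>S. (t s x)\<^sup>2)"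
      by (simp add: inner_on_def power2_eq_square) (rule sum.swap)
    finally show ?thesis .
  qed
  ultimately show ?thesis by linarith
qed

section \<open>Bases adapted to two flags\<close>

text \<open>Upward closed subsets of a finite chain are nested, so cardinality decides which
  contains which. The number of members of a flag that contain a vector thus determines these
  members.\<close>

lemma card_less_upclosed:
  fixes F :: "real set"
  assumes "finite F" "\<And>s t. s \<in> F \<Longrightarrow> t \<in> F \<Longrightarrow> s \<le> t \<Longrightarrow> P s \<Longrightarrow> P t"
    "\<And>s t. s \<in> F \<Longrightarrow> t \<in> F \<Longrightarrow> s \<le> t \<Longrightarrow> Q s \<Longrightarrow> Q t"
    "card {s\<in>F. P s} \<le> card {s\<in>F. Q s}" "s \<in> F" "P s"
  shows "Q s"
proof (rule ccontr)
  assume "\<not> Q s"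
  have "t > s" if "t \<in> F" "Q t" for t
    using assms(3)[OF that(1) assms(5)] that \<open>\<not> Q s\<close> by force
  then have "{t\<in>F. Q t} \<subset> {t\<in>F. P t}"
    using assms(2)[OF assms(5)] assms(5,6) \<open>\<not> Q s\<close> by (auto intro: less_imp_le)
  then have "card {t\<in>F. Q t} < card {t\<in>F. P t}" by (intro psubset_card_mono) (simp_all add: assms(1))
  with assms(4) show False by simp
qed

text \<open>
  If \<open>A s\<close> is not spanned by basis vectors, some basis vector can be exchanged for one that lies
  in strictly more members of the two flags. A basis maximising this count is therefore adapted
  to both flags.
\<close>

lemma flag_exchange:
  fixes A B :: "real \<Rightarrow> ('b \<Rightarrow> real) set"
  assumes F: "finite F"
    and subA: "\<And>s. s \<in> F \<Longrightarrow> fs.subspace (A s)" and subB: "\<And>s. s \<in> F \<Longrightarrow> fs.subspace (B s)"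
    and monoA: "\<And>s t. s \<in> F \<Longrightarrow> t \<in> F \<Longrightarrow> s \<le> t \<Longrightarrow> A s \<subseteq> A t"
    and monoB: "\<And>s t. s \<in> F \<Longrightarrow> t \<in> F \<Longrightarrow> s \<le> t \<Longrightarrow> B s \<subseteq> B t"
    and ind: "fs.independent E" and fE: "finite E"
    and s: "s \<in> F" and v: "v \<in> A s" "v \<in> fs.span E" "v \<notin> fs.span (E \<inter> A s)"
  shows "\<exists>E'. fs.independent E' \<and> fs.span E' = fs.span E \<and> finite E' \<and>
    (\<Sum>e\<in>E. card {s\<in>F. e \<in> A s} + card {s\<in>F. e \<in> B s}) <
    (\<Sum>e\<in>E'. card {s\<in>F. e \<in> A s} + card {s\<in>F. e \<in> B s})"
proof -
  define r where "r = fs.representation E v"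
  have vs: "v = (\<Sum>e\<in>E. (\<lambda>x. r e * e x))"
    using fs.sum_representation_eq[OF ind v(2) fE subset_refl] by (simp add: r_def)
  \<comment> \<open>\<open>w\<close> is the part of \<open>v\<close> carried by basis vectors
    outside \<open>A s\<close>. It still lies in \<open>A s\<close>, because \<open>v\<close> and
    the other part \<open>u\<close> do, and it involves at least one basis vector, since
    \<open>v\<close> is not spanned by \<open>E \<inter> A s\<close>.\<close>
  define D where "D = {e\<in>E. e \<notin> A s \<and> r e \<noteq> 0}"
  define w where "w = (\<Sum>e\<in>D. (\<lambda>x. r e * e x))"
  have fD: "finite D" using fE by (simp add: D_def)
  define u where "u = (\<Sum>e\<in>E \<inter> A s. (\<lambda>x. r e * e x))"
  have us: "u \<in> fs.span (E \<inter> A s)" unfolding u_def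
    by (intro fs.span_sum fs.span_scale fs.span_base) auto
  have "(\<Sum>e\<in>E - A s. (\<lambda>x. r e * e x)) = w"
    unfolding w_def by (rule sum.mono_neutral_right) (use fE in \<open>auto simp: D_def fun_eq_iff\<close>)
  moreover have "v = u + (\<Sum>e\<in>E - A s. (\<lambda>x. r e * e x))"
    unfolding vs u_def using fE
    by (subst sum.union_disjoint[symmetric]) (auto intro!: sum.cong)
  ultimately have vuw: "v = u + w" by simp
  have uA: "u \<in> A s" unfolding u_def
    by (intro fs.subspace_sum fs.subspace_scale subA s) auto
  have wA: "w \<in> A s" using fs.subspace_diff[OF subA[OF s] v(1) uA] by (simp add: vuw)
  have D0: "D \<noteq> {}"
  proof
    assume "D = {}"
    then have "w = 0" by (simp add: w_def)
    with vuw us v(3) show False by simp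
  qed
  \<comment> \<open>The vector to be replaced by \<open>w\<close> is one that lies in the fewest
    members of \<open>B\<close>: by nestedness every \<open>B t\<close> that contains it contains
    all of \<open>D\<close> and hence \<open>w\<close>, so no membership in the second flag is
    lost.\<close>
  obtain e where e: "e \<in> D" "\<And>e'. e' \<in> D \<Longrightarrow> card {s\<in>F. e \<in> B s} \<le> card {s\<in>F. e' \<in> B s}"
    using ex_has_least_nat[of "\<lambda>e. e \<in> D" _ "\<lambda>e. card {s\<in>F. e \<in> B s}"] D0 by blast
  have eE: "e \<in> E" and eA: "e \<notin> A s" and re: "r e \<noteq> 0" using e by (auto simp: D_def)
  have wB: "w \<in> B t" if "t \<in> F" "e \<in> B t" for t
  proof -
    have "e' \<in> B t" if "e' \<in> D" for e'
      by (rule card_less_upclosed[OF F, of "\<lambda>s. e \<in> B s" "\<lambda>s. e' \<in> B s"])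
         (use monoB e(2)[OF that] \<open>t \<in> F\<close> \<open>e \<in> B t\<close> in auto)
    then show ?thesis unfolding w_def
      by (intro fs.subspace_sum fs.subspace_scale subB that) auto
  qed
  have cB: "card {s\<in>F. e \<in> B s} \<le> card {s\<in>F. w \<in> B s}"
    by (intro card_mono) (use F wB in auto)
  \<comment> \<open>An \<open>A t\<close> that contains \<open>e\<close> cannot lie below
    \<open>A s\<close>, so it contains \<open>w\<close>; in addition \<open>w\<close> gains
    \<open>A s\<close> itself.\<close>
  have "{t\<in>F. e \<in> A t} \<subset> {t\<in>F. w \<in> A t}"
  proof -
    have "w \<in> A t" if "t \<in> F" "e \<in> A t" for t
    proof -
      have "s \<le> t" using monoA[OF that(1) s] that(2) eA by force
      with monoA[OF s that(1)] wA show ?thesis by auto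
    qed
    with s wA eA show ?thesis by auto
  qed
  then have cA: "card {s\<in>F. e \<in> A s} < card {s\<in>F. w \<in> A s}"
    by (intro psubset_card_mono) (use F in auto)
  have wr: "w - (\<lambda>x. r e * e x) = (\<Sum>e\<in>D - {e}. (\<lambda>x. r e * e x))"
    unfolding w_def using e(1) fD by (subst sum.remove[of D e]) auto
  have wspan: "w - (\<lambda>x. r e * e x) \<in> fs.span (E - {e})"
    unfolding wr by (intro fs.span_sum fs.span_scale fs.span_base) (auto simp: D_def)
  have wnot: "w \<notin> fs.span (E - {e})"
  proof
    assume "w \<in> fs.span (E - {e})"
    from fs.span_diff[OF this wspan] have "(\<lambda>x. r e * e x) \<in> fs.span (E - {e})" by simp
    from fs.span_scale[OF this, of "1 / r e"] re have "e \<in> fs.span (E - {e})" by simp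
    with ind eE show False by (auto simp: fs.dependent_def)
  qed
  define E' where "E' = insert w (E - {e})"
  have wE: "w \<notin> E - {e}" using wnot fs.span_base[of w "E - {e}"] by metis
  have ind': "fs.independent E'" unfolding E'_def
    by (intro fs.independent_insertI wnot fs.independent_mono[OF ind]) simp
  have "w \<in> fs.span E" unfolding w_def
    by (intro fs.span_sum fs.span_scale fs.span_base) (auto simp: D_def)
  moreover have "e \<in> fs.span E'"
  proof -
    have a: "w \<in> fs.span E'" by (intro fs.span_base) (simp add: E'_def)
    have b: "w - (\<lambda>x. r e * e x) \<in> fs.span E'"
      using wspan fs.span_mono[of "E - {e}" E'] by (auto simp: E'_def)
    from fs.span_diff[OF a b] have "(\<lambda>x. r e * e x) \<in> fs.span E'" by simp
    from fs.span_scale[OF this, of "1 / r e"] re show ?thesis by simp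
  qed
  ultimately have sp: "fs.span E' = fs.span E"
    unfolding fs.span_eq by (auto simp: E'_def intro: fs.span_base)
  have "(\<Sum>e\<in>E. card {s\<in>F. e \<in> A s} + card {s\<in>F. e \<in> B s}) <
    (\<Sum>e\<in>E'. card {s\<in>F. e \<in> A s} + card {s\<in>F. e \<in> B s})"
    using fE eE wE cA cB unfolding E'_def by (subst sum.insert) (auto simp: sum.remove[of E e])
  moreover have "finite E'" using fE by (simp add: E'_def)
  ultimately show ?thesis using ind' sp by blast
qed

text \<open>Two flags always have a common adapted basis, which would fail for three. Applied to
  cycles and boundaries it takes the place of the structure theorem for graded modules: each basis
  vector has a first time as a cycle and a first time as a boundary, the ends of its bar.\<close>

lemma flag_adapted_basis:
  fixes A B :: "real \<Rightarrow> ('b \<Rightarrow> real) set"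
  assumes F: "finite F"
    and subA: "\<And>s. s \<in> F \<Longrightarrow> fs.subspace (A s)" and subB: "\<And>s. s \<in> F \<Longrightarrow> fs.subspace (B s)"
    and monoA: "\<And>s t. s \<in> F \<Longrightarrow> t \<in> F \<Longrightarrow> s \<le> t \<Longrightarrow> A s \<subseteq> A t"
    and monoB: "\<And>s t. s \<in> F \<Longrightarrow> t \<in> F \<Longrightarrow> s \<le> t \<Longrightarrow> B s \<subseteq> B t"
    and C: "fs.subspace C" "finite S" "C \<subseteq> fs.span S"
    and AC: "\<And>s. s \<in> F \<Longrightarrow> A s \<subseteq> C" and BC: "\<And>s. s \<in> F \<Longrightarrow> B s \<subseteq> C"
  shows "\<exists>E. finite E \<and> fs.independent E \<and> fs.span E = C \<and>
    (\<forall>s\<in>F. A s = fs.span (E \<inter> A s) \<and> B s = fs.span (E \<inter> B s))"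
proof -
  define Q where "Q = (\<lambda>E. finite E \<and> fs.independent E \<and> fs.span E = C)"
  define pot where "pot = (\<lambda>E. \<Sum>e\<in>E. card {s\<in>F. e \<in> A s} + card {s\<in>F. e \<in> B s})"
  have cardS: "finite E \<and> card E \<le> card S" if "fs.independent E" "E \<subseteq> C" for E
    using fs.independent_span_bound[OF C(2) that(1)] that C(3) by auto
  obtain E0 where E0: "E0 \<subseteq> C" "fs.independent E0" "C \<subseteq> fs.span E0"
    using fs.maximal_independent_subset[of C] by metis
  have "Q E0" using E0 cardS[OF E0(2,1)] C(1) by (auto simp: Q_def fs.span_subspace)
  \<comment> \<open>Each of the at most \<open>card S\<close> basis vectors is counted at most
    \<open>card F\<close> times per flag, so \<open>pot\<close> has a maximiser.\<close>
  have bound: "pot E < 2 * card F * card S + 1" if "Q E" for E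
  proof -
    have "E \<subseteq> C" using that fs.span_superset by (auto simp: Q_def)
    then have cE: "card E \<le> card S" using cardS that by (auto simp: Q_def)
    have le: "card {s\<in>F. P s} \<le> card F" for P by (rule card_mono[OF F]) auto
    have "pot E \<le> (\<Sum>e\<in>E. card F + card F)" unfolding pot_def
      by (intro sum_mono add_mono le)
    also have "\<dots> \<le> 2 * card F * card S" using cE by (simp add: mult_2[symmetric] mult.assoc[symmetric])
    finally show ?thesis by simp
  qed
  obtain E where E: "Q E" and max: "\<And>E'. Q E' \<Longrightarrow> pot E' \<le> pot E"
    using ex_has_greatest_nat[of Q E0 pot "2 * card F * card S + 1"] \<open>Q E0\<close> bound by blast
  have fE: "finite E" and ind: "fs.independent E" and sp: "fs.span E = C" using E by (auto simp: Q_def)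
  have 1: "A s \<subseteq> fs.span (E \<inter> A s)" if s: "s \<in> F" for s
  proof (rule ccontr)
    assume "\<not> ?thesis"
    then obtain v where "v \<in> A s" "v \<notin> fs.span (E \<inter> A s)" by auto
    with flag_exchange[where A = A and B = B and v = v and s = s, OF F subA subB monoA monoB ind fE s] AC[OF s] sp
    obtain E' where "fs.independent E' \<and> fs.span E' = fs.span E \<and> finite E' \<and> pot E < pot E'"
      unfolding pot_def by auto
    with max[of E'] sp show False by (auto simp: Q_def)
  qed
  have 2: "B s \<subseteq> fs.span (E \<inter> B s)" if s: "s \<in> F" for s
  proof (rule ccontr)
    assume "\<not> ?thesis"
    then obtain v where "v \<in> B s" "v \<notin> fs.span (E \<inter> B s)" by auto
    with flag_exchange[where A = B and B = A and v = v and s = s, OF F subB subA monoB monoA ind fE s] BC[OF s] sp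
    obtain E' where "fs.independent E' \<and> fs.span E' = fs.span E \<and> finite E' \<and> pot E < pot E'"
      unfolding pot_def by (auto simp: add.commute)
    with max[of E'] sp show False by (auto simp: Q_def)
  qed
  have 3: "fs.span (E \<inter> A s) \<subseteq> A s" if "s \<in> F" for s
    by (rule fs.span_minimal[OF Int_lower2 subA[OF that]])
  have 4: "fs.span (E \<inter> B s) \<subseteq> B s" if "s \<in> F" for s
    by (rule fs.span_minimal[OF Int_lower2 subB[OF that]])
  have "\<forall>s\<in>F. A s = fs.span (E \<inter> A s) \<and> B s = fs.span (E \<inter> B s)"
    by (intro ballI conjI equalityI 1 2 3 4)
  with fE ind sp show ?thesis by (intro exI[of _ E] conjI)
qed

section \<open>Chains and the cone homotopy\<close>

text \<open>The incidence sign between \<open>\<tau>\<close> and \<open>insert x \<tau>\<close>.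
  Membership of \<open>x\<close> in \<open>\<tau>\<close> does not affect it, so one expression
  serves for the facet and for the simplex.\<close>

definition csgn :: "'v::linorder \<Rightarrow> 'v set \<Rightarrow> real" where
  "csgn x \<tau> = (- 1) ^ card {w \<in> \<tau>. w < x}"

lemma csgn_square [simp]: "csgn x \<tau> * csgn x \<tau> = 1"
  by (simp add: csgn_def power_mult_distrib[symmetric])

lemma csgn_square_left [simp]: "csgn x \<tau> * (csgn x \<tau> * c) = c"
  by (simp flip: mult.assoc)

lemma csgn_power2 [simp]: "(csgn x \<tau>)\<^sup>2 = 1"
  by (simp add: power2_eq_square)

lemma csgn_insert:
  assumes "finite \<tau>" "y \<notin> \<tau>"
  shows "csgn x (insert y \<tau>) = (if y < x then - csgn x \<tau> else csgn x \<tau>)"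
proof (cases "y < x")
  case True
  have "{w \<in> insert y \<tau>. w < x} = insert y {w \<in> \<tau>. w < x}" using True by auto
  with True assms show ?thesis by (simp add: csgn_def)
next
  case False
  then have "{w \<in> insert y \<tau>. w < x} = {w \<in> \<tau>. w < x}" by auto
  with False show ?thesis by (simp add: csgn_def)
qed

text \<open>Exactly one of \<open>x < y\<close> and \<open>y < x\<close> holds, so exactly one of
  the two signs flips when the other vertex is added. This is the cancellation behind both
  \<open>\<partial>\<partial> = 0\<close> and the cone formula.\<close>

lemma csgn_swap:
  assumes "finite \<rho>" "x \<notin> \<rho>" "y \<notin> \<rho>" "x \<noteq> y"
  shows "csgn x (insert y \<rho>) * csgn y (insert x \<rho>) = - (csgn x \<rho> * csgn y \<rho>)"
    and "csgn x \<rho> * csgn y (insert x \<rho>) = - (csgn y \<rho> * csgn x (insert y \<rho>))"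
  using assms by (auto simp: csgn_insert)

definition face_closed :: "'v set set \<Rightarrow> bool" where
  "face_closed X \<longleftrightarrow> (\<forall>\<sigma>\<in>X. \<forall>\<tau>. \<tau> \<noteq> {} \<and> \<tau> \<subseteq> \<sigma> \<longrightarrow> \<tau> \<in> X)"

lemma face_closedD: "face_closed X \<Longrightarrow> \<sigma> \<in> X \<Longrightarrow> \<tau> \<subseteq> \<sigma> \<Longrightarrow> \<tau> \<noteq> {} \<Longrightarrow> \<tau> \<in> X"
  by (auto simp: face_closed_def)

text \<open>The pairs \<open>(\<sigma>, v)\<close> with \<open>\<sigma> - {v} = \<tau>\<close>
  correspond to the vertices that complete \<open>\<tau>\<close> to a simplex of \<open>X\<close>.
  This is the form in which single coefficients are computed.\<close>

lemma boundary_eq: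
  fixes V :: "'v::linorder set"
  assumes V: "finite V" "X \<subseteq> Pow V"
  shows "boundary X c \<tau> = (\<Sum>x\<in>V - \<tau>. csgn x \<tau> * (if insert x \<tau> \<in> X then c (insert x \<tau>) else 0))"
proof -
  have fX: "finite X" using V by (auto intro: finite_subset)
  have fs: "finite \<sigma>" if "\<sigma> \<in> X" for \<sigma> using that V by (auto intro: finite_subset)
  have VX: "v \<in> V" if "\<sigma> \<in> X" "v \<in> \<sigma>" for \<sigma> v using that V(2) by auto
  have "boundary X c \<tau> = (\<Sum>(\<sigma>, v)\<in>Sigma X (\<lambda>\<sigma>. \<sigma>). if \<sigma> - {v} = \<tau> then (- 1) ^ card {w \<in> \<sigma>. w < v} * c \<sigma> else 0)"
    unfolding boundary_def using fX fs by (subst sum.Sigma) auto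
  also have "\<dots> = (\<Sum>(\<sigma>, v)\<in>{(\<sigma>, v). \<sigma> \<in> X \<and> v \<in> \<sigma> \<and> \<sigma> - {v} = \<tau>}. (- 1) ^ card {w \<in> \<sigma>. w < v} * c \<sigma>)"
    using fX fs by (intro sum.mono_neutral_cong_right finite_SigmaI) (auto split: if_splits)
  also have "\<dots> = (\<Sum>x\<in>{x\<in>V - \<tau>. insert x \<tau> \<in> X}. csgn x \<tau> * c (insert x \<tau>))"
  proof (rule sum.reindex_bij_witness[of _ "\<lambda>x. (insert x \<tau>, x)" snd], goal_cases)
    case (5 a)
    obtain \<sigma> v where a: "a = (\<sigma>, v)" "\<sigma> \<in> X" "v \<in> \<sigma>" "\<sigma> - {v} = \<tau>" using 5 by auto
    have "{w \<in> \<sigma>. w < v} = {w \<in> \<tau>. w < v}" "insert v \<tau> = \<sigma>" using a by auto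
    then show ?case using a by (simp add: csgn_def)
  qed (use VX in \<open>auto simp: insert_absorb\<close>)
  also have "\<dots> = (\<Sum>x\<in>V - \<tau>. csgn x \<tau> * (if insert x \<tau> \<in> X then c (insert x \<tau>) else 0))"
    using V by (intro sum.mono_neutral_cong_left) auto
  finally show ?thesis .
qed

lemma boundary_chain_eq:
  fixes V :: "'v::linorder set"
  assumes V: "finite V" "X \<subseteq> Pow V" and c: "c \<in> chains k X"
  shows "boundary X c \<tau> = (\<Sum>x\<in>V - \<tau>. csgn x \<tau> * c (insert x \<tau>))"
  unfolding boundary_eq[OF V] using c by (intro sum.cong) (auto simp: chains_def)

lemma boundary_in_chains:
  fixes V :: "'v::linorder set"
  assumes V: "finite V" "X \<subseteq> Pow V" and X: "face_closed X" and c: "c \<in> chains (k + 1) X"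
  shows "boundary X c \<in> chains k X"
proof -
  have "\<tau> \<in> X \<and> card \<tau> = k + 1" if nz: "boundary X c \<tau> \<noteq> 0" for \<tau>
  proof -
    have "\<exists>x\<in>V - \<tau>. csgn x \<tau> * c (insert x \<tau>) \<noteq> 0"
      using nz unfolding boundary_chain_eq[OF V c] by (meson sum.not_neutral_contains_not_neutral)
    then obtain x where x: "x \<in> V" "x \<notin> \<tau>" "c (insert x \<tau>) \<noteq> 0" by auto
    then have i: "insert x \<tau> \<in> X" "card (insert x \<tau>) = k + 2" using c by (auto simp: chains_def)
    then have f: "finite \<tau>" by (metis card.infinite finite_insert add_is_0 zero_neq_numeral)
    then have "card \<tau> = k + 1" using i x by simp
    moreover have "\<tau> \<in> X" by (rule face_closedD[OF X i(1)]) (use calculation in auto)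
    ultimately show ?thesis by simp
  qed
  then show ?thesis by (auto simp: chains_def)
qed

lemma boundary_boundary:
  fixes V :: "'v::linorder set"
  assumes V: "finite V" "X \<subseteq> Pow V" and X: "face_closed X" and c: "c \<in> chains (k + 1) X"
  shows "boundary X (boundary X c) = (\<lambda>\<tau>. 0)"
proof
  fix \<tau>
  \<comment> \<open>\<open>g\<close> is antisymmetric in the two vertices added to
    \<open>\<tau>\<close>, so the double sum equals its own negative.\<close>
  define g where "g = (\<lambda>x y. if x = y then 0 else csgn x \<tau> * csgn y (insert x \<tau>) * c (insert y (insert x \<tau>)))"
  have e: "boundary X (boundary X c) \<tau> = (\<Sum>x\<in>V - \<tau>. \<Sum>y\<in>V - \<tau>. g x y)"
    unfolding boundary_chain_eq[OF V boundary_in_chains[OF V X c]] boundary_chain_eq[OF V c] sum_distrib_left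
    using V(1) by (intro sum.cong refl sum.mono_neutral_cong_left) (auto simp: g_def)
  show "boundary X (boundary X c) \<tau> = 0"
  proof (cases "\<tau> \<subseteq> V")
    case True
    then have f: "finite \<tau>" using V(1) finite_subset by auto
    have anti: "g x y = - g y x" if "x \<in> V - \<tau>" "y \<in> V - \<tau>" for x y
      using csgn_swap(2)[OF f, of x y] that by (auto simp: g_def insert_commute)
    have "(\<Sum>x\<in>V - \<tau>. \<Sum>y\<in>V - \<tau>. g x y) = (\<Sum>y\<in>V - \<tau>. \<Sum>x\<in>V - \<tau>. g x y)" by (rule sum.swap)
    also have "\<dots> = (\<Sum>y\<in>V - \<tau>. \<Sum>x\<in>V - \<tau>. - g y x)" by (intro sum.cong refl anti) auto
    also have "\<dots> = - (\<Sum>y\<in>V - \<tau>. \<Sum>x\<in>V - \<tau>. g y x)" by (simp add: sum_negf)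
    finally show ?thesis using e by simp
  next
    case False
    then have "g x y = 0" for x y using c V(2) by (auto simp: g_def chains_def)
    then show ?thesis using e by simp
  qed
qed

lemma boundary_lincomb:
  "boundary X (\<lambda>\<sigma>. a * c \<sigma> + b * d \<sigma>) = (\<lambda>\<tau>. a * boundary X c \<tau> + b * boundary X d \<tau>)"
  by (auto simp: boundary_def sum_distrib_left sum.distrib[symmetric] algebra_simps intro!: sum.cong ext)

lemma boundary_zero: "boundary X (\<lambda>_. 0) = (\<lambda>_. 0)"
  by (auto simp: boundary_def intro!: ext sum.neutral)

lemma subspace_chains: "fs.subspace (chains k X)"
proof (rule fs_subspaceI)
  fix f g a b assume "f \<in> chains k X" "g \<in> chains k X"
  then show "(\<lambda>x. a * f x + b * g x) \<in> chains k X"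
    unfolding chains_def by (auto; metis add.right_neutral mult_zero_right)
qed (simp add: chains_def)

lemma subspace_cycles: "fs.subspace (cycles k X)"
proof (rule fs_subspaceI)
  show "(\<lambda>_. 0) \<in> cycles k X" by (simp add: cycles_def boundary_zero chains_def)
  fix f g a b assume "f \<in> cycles k X" "g \<in> cycles k X"
  then show "(\<lambda>x. a * f x + b * g x) \<in> cycles k X"
    using fs_subspace_lincomb[OF subspace_chains, of f k X g a b] by (simp add: cycles_def boundary_lincomb)
qed

lemma subspace_boundaries: "fs.subspace (boundaries k X)"
proof (rule fs_subspaceI)
  show "(\<lambda>_. 0) \<in> boundaries k X"
    unfolding boundaries_def by (rule image_eqI[of _ _ "\<lambda>_. 0"]) (simp_all add: boundary_zero chains_def)
  fix f g a b assume "f \<in> boundaries k X" "g \<in> boundaries k X"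
  then obtain c d where cd: "c \<in> chains (k + 1) X" "d \<in> chains (k + 1) X" "f = boundary X c" "g = boundary X d"
    by (auto simp: boundaries_def)
  show "(\<lambda>x. a * f x + b * g x) \<in> boundaries k X"
    unfolding boundaries_def cd(3,4)
    by (rule image_eqI[of _ _ "\<lambda>x. a * c x + b * d x"])
       (use fs_subspace_lincomb[OF subspace_chains cd(1,2)] in \<open>simp_all add: boundary_lincomb\<close>)
qed

lemma boundaries_subset_cycles:
  fixes V :: "'v::linorder set"
  assumes "finite V" "X \<subseteq> Pow V" "face_closed X"
  shows "boundaries k X \<subseteq> cycles k X"
  unfolding boundaries_def cycles_def
  using boundary_in_chains[OF assms] boundary_boundary[OF assms] by auto

lemma chains_mono: "X \<subseteq> Y \<Longrightarrow> chains k X \<subseteq> chains k Y"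
  by (auto simp: chains_def)

lemma boundary_mono:
  fixes V :: "'v::linorder set"
  assumes "finite V" "Y \<subseteq> Pow V" "X \<subseteq> Y" "c \<in> chains k X"
  shows "boundary Y c = boundary X c"
  using assms chains_mono[OF assms(3), of k]
  by (intro ext) (subst (1 2) boundary_chain_eq[of V _ _ k], auto)

lemma cycles_mono:
  fixes V :: "'v::linorder set"
  assumes "finite V" "Y \<subseteq> Pow V" "X \<subseteq> Y"
  shows "cycles k X \<subseteq> cycles k Y"
  using boundary_mono[OF assms] chains_mono[OF assms(3), of k] by (auto simp: cycles_def)

lemma boundaries_mono:
  fixes V :: "'v::linorder set"
  assumes "finite V" "Y \<subseteq> Pow V" "X \<subseteq> Y"
  shows "boundaries k X \<subseteq> boundaries k Y"
  using boundary_mono[OF assms] chains_mono[OF assms(3), of "k + 1"]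
  by (force simp: boundaries_def)

text \<open>
  The cone operator over a set \<open>W\<close> of vertices, with weights \<open>\<alpha>\<close> in degree \<open>k\<close> and \<open>\<alpha>'\<close> in degree
  \<open>k - 1\<close>. If \<open>h\<close> joins a simplex with the vertices of \<open>W\<close>, this is \<open>\<partial>h + h\<partial> - 1\<close>.
\<close>

definition cone_error ::
    "nat \<Rightarrow> 'v::linorder set \<Rightarrow> real \<Rightarrow> real \<Rightarrow> 'v set \<Rightarrow> 'v set set \<Rightarrow> ('v set \<Rightarrow> real) \<Rightarrow> 'v set \<Rightarrow> real" where
  "cone_error k V \<alpha> \<alpha>' W X c \<pi> = (if \<pi> \<in> X \<and> card \<pi> = k + 1 then
     (\<alpha> * (\<Sum>x\<in>W - \<pi>. of_bool (insert x \<pi> \<in> X)) + \<alpha>' * card (\<pi> \<inter> W) - 1) * c \<pi>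
     + (\<Sum>v\<in>\<pi> \<inter> W. csgn v (\<pi> - {v}) * (\<Sum>x\<in>V - \<pi>. csgn x (\<pi> - {v}) *
          (\<alpha>' - \<alpha> * of_bool (insert x \<pi> \<in> X)) * c (insert x (\<pi> - {v})))) else 0)"

text \<open>With \<open>h\<close> the weighted cone over \<open>z\<close>, the boundary of
  \<open>h\<close> involves \<open>\<alpha>\<close> only. The terms with \<open>\<alpha>'\<close>
  belong to the cone over the boundary of \<open>z\<close>, which is zero; they are inserted because
  a suitable \<open>\<alpha>'\<close> centres the off-diagonal coefficients.\<close>

lemma cone_homotopy:
  fixes V :: "'v::linorder set"
  assumes V: "finite V" "X \<subseteq> Pow V" and X: "face_closed X" and W: "W \<subseteq> V"
    and z: "z \<in> cycles k X"
  shows "(\<lambda>\<pi>. z \<pi> + cone_error k V \<alpha> \<alpha>' W X z \<pi>) \<in> boundaries k X"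
proof -
  have zc: "z \<in> chains k X" and bz: "\<And>\<tau>. boundary X z \<tau> = 0" using z by (auto simp: cycles_def)
  define h where "h = (\<lambda>\<mu>. if \<mu> \<in> X \<and> card \<mu> = k + 2 then \<alpha> * (\<Sum>x\<in>\<mu> \<inter> W. csgn x (\<mu> - {x}) * z (\<mu> - {x})) else 0)"
  have hc: "h \<in> chains (k + 1) X" by (auto simp: chains_def h_def)
  have "boundary X h \<pi> = z \<pi> + cone_error k V \<alpha> \<alpha>' W X z \<pi>" for \<pi>
  proof (cases "\<pi> \<in> X \<and> card \<pi> = k + 1")
    case False
    have "boundary X h \<pi> = 0"
      using boundary_in_chains[OF V X hc] False by (auto simp: chains_def)
    with False zc show ?thesis by (auto simp: cone_error_def chains_def)
  next
    case True
    have fp: "finite \<pi>" and pV: "\<pi> \<subseteq> V" using True V by (auto intro: finite_subset)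
    have fW: "finite W" using W V(1) finite_subset by auto
    define b where "b = (\<lambda>x. of_bool (insert x \<pi> \<in> X) :: real)"
    \<comment> \<open>The coefficient of \<open>h\<close> at \<open>insert x \<pi>\<close> is a sum
      over the possible apices: the apex \<open>x\<close>, if it lies in \<open>W\<close>, sits over
      \<open>\<pi>\<close> itself, while an apex \<open>v\<close> in \<open>\<pi>\<close> sits over
      \<open>\<pi>\<close> with \<open>v\<close> exchanged for \<open>x\<close>.\<close>
    have h1: "csgn x \<pi> * h (insert x \<pi>) = \<alpha> * b x * (of_bool (x \<in> W) * z \<pi>
        - (\<Sum>v\<in>\<pi> \<inter> W. csgn v (\<pi> - {v}) * csgn x (\<pi> - {v}) * z (insert x (\<pi> - {v}))))"
      if x: "x \<in> V - \<pi>" for x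
    proof -
      have "card (insert x \<pi>) = k + 2" using True fp x by simp
      then have "h (insert x \<pi>) = \<alpha> * b x * (\<Sum>y\<in>insert x \<pi> \<inter> W. csgn y (insert x \<pi> - {y}) * z (insert x \<pi> - {y}))"
        by (simp add: h_def b_def)
      also have "(\<Sum>y\<in>insert x \<pi> \<inter> W. csgn y (insert x \<pi> - {y}) * z (insert x \<pi> - {y}))
         = of_bool (x \<in> W) * (csgn x \<pi> * z \<pi>) + (\<Sum>v\<in>\<pi> \<inter> W. csgn v (insert x \<pi> - {v}) * z (insert x \<pi> - {v}))"
      proof (cases "x \<in> W")
        case True
        then have e: "insert x \<pi> \<inter> W = insert x (\<pi> \<inter> W)" by auto
        show ?thesis unfolding e using x fp True by (subst sum.insert) auto
      qed auto
      also have "(\<Sum>v\<in>\<pi> \<inter> W. csgn v (insert x \<pi> - {v}) * z (insert x \<pi> - {v}))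
         = - csgn x \<pi> * (\<Sum>v\<in>\<pi> \<inter> W. csgn v (\<pi> - {v}) * csgn x (\<pi> - {v}) * z (insert x (\<pi> - {v})))"
        unfolding sum_distrib_left
      proof (intro sum.cong refl, goal_cases)
        case (1 v)
        then have v: "v \<in> \<pi>" "x \<noteq> v" using x by auto
        have e: "insert x \<pi> - {v} = insert x (\<pi> - {v})" using v by auto
        have "csgn x (insert v (\<pi> - {v})) * csgn v (insert x (\<pi> - {v})) = - (csgn x (\<pi> - {v}) * csgn v (\<pi> - {v}))"
          by (rule csgn_swap(1)) (use x v fp in auto)
        moreover have "insert v (\<pi> - {v}) = \<pi>" using v by auto
        ultimately have s: "csgn x \<pi> * csgn v (insert x (\<pi> - {v})) = - (csgn x (\<pi> - {v}) * csgn v (\<pi> - {v}))" by simp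
        have "csgn v (insert x (\<pi> - {v})) = csgn x \<pi> * (csgn x \<pi> * csgn v (insert x (\<pi> - {v})))" by simp
        also have "\<dots> = - csgn x \<pi> * (csgn v (\<pi> - {v}) * csgn x (\<pi> - {v}))" unfolding s by simp
        finally show ?case unfolding e by simp
      qed
      finally have "h (insert x \<pi>) = csgn x \<pi> * (\<alpha> * b x * (of_bool (x \<in> W) * z \<pi>
        - (\<Sum>v\<in>\<pi> \<inter> W. csgn v (\<pi> - {v}) * csgn x (\<pi> - {v}) * z (insert x (\<pi> - {v})))))"
        by (simp add: algebra_simps)
      then show ?thesis by simp
    qed
    \<comment> \<open>The cycle condition at the facet \<open>\<pi> - {v}\<close>. By it the
      off-diagonal \<open>\<alpha>'\<close> terms contribute \<open>- \<alpha>' * z \<pi>\<close>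
      for each \<open>v \<in> \<pi> \<inter> W\<close>, which the diagonal term
      \<open>\<alpha>' * card (\<pi> \<inter> W)\<close> compensates.\<close>
    have cyc: "(\<Sum>x\<in>V - \<pi>. csgn x (\<pi> - {v}) * z (insert x (\<pi> - {v}))) = - csgn v (\<pi> - {v}) * z \<pi>"
      if v: "v \<in> \<pi>" for v
    proof -
      have e: "V - (\<pi> - {v}) = insert v (V - \<pi>)" using v pV by auto
      have "0 = boundary X z (\<pi> - {v})" using bz by simp
      also have "\<dots> = csgn v (\<pi> - {v}) * z \<pi> + (\<Sum>x\<in>V - \<pi>. csgn x (\<pi> - {v}) * z (insert x (\<pi> - {v})))"
        unfolding boundary_chain_eq[OF V zc] e using v V(1) by (subst sum.insert) (auto simp: insert_absorb)
      finally show ?thesis by simp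
    qed
    have "boundary X h \<pi> = (\<Sum>x\<in>V - \<pi>. \<alpha> * b x * (of_bool (x \<in> W) * z \<pi>
        - (\<Sum>v\<in>\<pi> \<inter> W. csgn v (\<pi> - {v}) * csgn x (\<pi> - {v}) * z (insert x (\<pi> - {v})))))"
      unfolding boundary_chain_eq[OF V hc] by (intro sum.cong refl h1)
    also have "\<dots> = \<alpha> * (\<Sum>x\<in>V - \<pi>. of_bool (x \<in> W) * b x) * z \<pi>
        - (\<Sum>v\<in>\<pi> \<inter> W. csgn v (\<pi> - {v}) * (\<Sum>x\<in>V - \<pi>. csgn x (\<pi> - {v}) * (\<alpha> * b x) * z (insert x (\<pi> - {v}))))"
      unfolding right_diff_distrib sum_subtractf sum_distrib_left
      by (subst (2) sum.swap) (simp add: sum_distrib_left sum_distrib_right algebra_simps)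
    also have "(\<Sum>x\<in>V - \<pi>. of_bool (x \<in> W) * b x) = (\<Sum>x\<in>W - \<pi>. b x)"
      using V(1) W by (intro sum.mono_neutral_cong_right) auto
    also have "\<alpha> * (\<Sum>x\<in>W - \<pi>. b x) * z \<pi>
        - (\<Sum>v\<in>\<pi> \<inter> W. csgn v (\<pi> - {v}) * (\<Sum>x\<in>V - \<pi>. csgn x (\<pi> - {v}) * (\<alpha> * b x) * z (insert x (\<pi> - {v}))))
       = z \<pi> + cone_error k V \<alpha> \<alpha>' W X z \<pi>"
    proof -
      have "(\<Sum>v\<in>\<pi> \<inter> W. csgn v (\<pi> - {v}) * (\<Sum>x\<in>V - \<pi>. csgn x (\<pi> - {v}) * (\<alpha>' - \<alpha> * b x) * z (insert x (\<pi> - {v}))))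
        = (\<Sum>v\<in>\<pi> \<inter> W. csgn v (\<pi> - {v}) * (\<alpha>' * (\<Sum>x\<in>V - \<pi>. csgn x (\<pi> - {v}) * z (insert x (\<pi> - {v})))
             - (\<Sum>x\<in>V - \<pi>. csgn x (\<pi> - {v}) * (\<alpha> * b x) * z (insert x (\<pi> - {v})))))"
        by (simp add: sum_distrib_left sum_subtractf algebra_simps)
      also have "\<dots> = (\<Sum>v\<in>\<pi> \<inter> W. - \<alpha>' * z \<pi> - csgn v (\<pi> - {v}) *
             (\<Sum>x\<in>V - \<pi>. csgn x (\<pi> - {v}) * (\<alpha> * b x) * z (insert x (\<pi> - {v}))))"
        by (intro sum.cong refl) (simp add: cyc right_diff_distrib mult.left_commute[of "csgn _ _" \<alpha>'])
      moreover have "of_bool (insert x \<pi> \<in> X) = b x" for x by (simp add: b_def)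
      ultimately show ?thesis using True unfolding cone_error_def
        by (simp add: sum_subtractf algebra_simps)
    qed
    finally show ?thesis .
  qed
  then have "(\<lambda>\<pi>. z \<pi> + cone_error k V \<alpha> \<alpha>' W X z \<pi>) = boundary X h" by auto
  then show ?thesis unfolding boundaries_def by (rule image_eqI[OF _ hc])
qed

section \<open>Second moments of the cone error\<close>

text \<open>The largest complex contained in \<open>Y\<close>. For \<open>Y\<close> the set of faces
  of weight at most \<open>t\<close> it is the complex at time \<open>t\<close>.\<close>

definition down_complex :: "'v set set \<Rightarrow> 'v set set" where
  "down_complex Y = {\<sigma>. \<sigma> \<noteq> {} \<and> (\<forall>\<tau>. \<tau> \<noteq> {} \<and> \<tau> \<subseteq> \<sigma> \<longrightarrow> \<tau> \<in> Y)}"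

lemma face_closed_down_complex: "face_closed (down_complex Y)"
  by (auto simp: face_closed_def down_complex_def)

lemma down_complex_subset: "down_complex Y \<subseteq> Y"
  by (auto simp: down_complex_def)

lemma down_complex_restrict:
  assumes "Y' \<inter> Pow U = {}" "\<sigma> \<subseteq> U"
  shows "\<sigma> \<in> down_complex (Y \<union> Y') \<longleftrightarrow> \<sigma> \<in> down_complex Y"
proof -
  have "\<tau> \<notin> Y'" if "\<tau> \<subseteq> \<sigma>" for \<tau> using assms that by auto
  then show ?thesis unfolding down_complex_def by blast
qed

lemma insert_in_down_complex_iff:
  assumes "v \<notin> U" "Y \<subseteq> Pow U" "Y' \<inter> Pow U = {}" "\<sigma> \<noteq> {} \<Longrightarrow> \<sigma> \<in> down_complex Y"
  shows "insert v \<sigma> \<in> down_complex (Y \<union> Y') \<longleftrightarrow> insert v ` Pow \<sigma> \<subseteq> Y'"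
proof
  assume a: "insert v \<sigma> \<in> down_complex (Y \<union> Y')"
  show "insert v ` Pow \<sigma> \<subseteq> Y'"
  proof
    fix \<tau> assume "\<tau> \<in> insert v ` Pow \<sigma>"
    then have t: "\<tau> \<subseteq> insert v \<sigma>" "v \<in> \<tau>" by auto
    then have "\<tau> \<in> Y \<union> Y'" using a by (auto simp: down_complex_def)
    moreover have "\<tau> \<notin> Y" using t assms by auto
    ultimately show "\<tau> \<in> Y'" by auto
  qed
next
  assume a: "insert v ` Pow \<sigma> \<subseteq> Y'"
  have "\<tau> \<in> Y \<union> Y'" if t: "\<tau> \<noteq> {}" "\<tau> \<subseteq> insert v \<sigma>" for \<tau>
  proof (cases "v \<in> \<tau>")
    case True
    have "insert v (\<tau> - {v}) \<in> insert v ` Pow \<sigma>" using t by (intro imageI) blast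
    moreover have "insert v (\<tau> - {v}) = \<tau>" using True by blast
    ultimately show ?thesis using a by auto
  next
    case False
    then have "\<tau> \<subseteq> \<sigma>" using t by auto
    then show ?thesis using assms(4) t(1) by (auto simp: down_complex_def)
  qed
  then show "insert v \<sigma> \<in> down_complex (Y \<union> Y')" by (auto simp: down_complex_def)
qed

lemma prod_Pow_card:
  fixes f :: "nat \<Rightarrow> real"
  assumes "finite \<rho>"
  shows "(\<Prod>\<tau>\<in>Pow \<rho>. f (card \<tau>)) = (\<Prod>i\<le>card \<rho>. f i ^ (card \<rho> choose i))"
proof -
  have "(\<Prod>\<tau>\<in>Pow \<rho>. f (card \<tau>)) = (\<Prod>i\<le>card \<rho>. \<Prod>\<tau>\<in>{\<tau>\<in>Pow \<rho>. card \<tau> = i}. f (card \<tau>))"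
    by (rule prod.group[symmetric]) (use assms in \<open>auto intro: card_mono\<close>)
  also have "\<dots> = (\<Prod>i\<le>card \<rho>. f i ^ card {\<tau>. \<tau> \<subseteq> \<rho> \<and> card \<tau> = i})"
    by (intro prod.cong refl) (simp add: Pow_def)
  finally show ?thesis using n_subsets[OF assms] by simp
qed

lemma sum_squared_le_card_support:
  fixes f :: "'a \<Rightarrow> real"
  assumes "finite A" "finite B" "\<And>x. x \<in> A \<Longrightarrow> f x \<noteq> 0 \<Longrightarrow> x \<in> B"
  shows "(\<Sum>x\<in>A. f x)\<^sup>2 \<le> card B * (\<Sum>x\<in>A. (f x)\<^sup>2)"
proof -
  have 1: "(\<Sum>x\<in>A. f x) = (\<Sum>x\<in>A \<inter> B. f x)" "(\<Sum>x\<in>A. (f x)\<^sup>2) = (\<Sum>x\<in>A \<inter> B. (f x)\<^sup>2)"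
    using assms by (auto intro!: sum.mono_neutral_right)
  have "(\<Sum>x\<in>A \<inter> B. f x)\<^sup>2 \<le> card (A \<inter> B) * (\<Sum>x\<in>A \<inter> B. (f x)\<^sup>2)"
    using sum_squared_le_sum_of_squares[of f "A \<inter> B"] assms by (simp add: mult.commute)
  also have "\<dots> \<le> card B * (\<Sum>x\<in>A \<inter> B. (f x)\<^sup>2)"
    using assms by (intro mult_right_mono sum_nonneg) (auto intro!: card_mono)
  finally show ?thesis unfolding 1 .
qed

text \<open>Double counting: given \<open>v\<close>, the pair \<open>(\<pi>, x)\<close> is recovered
  from the exchanged simplex \<open>insert x (\<pi> - {v})\<close> and its vertex \<open>x\<close>,
  so each simplex occurs at most \<open>card A * (k + 1)\<close> times.\<close>

lemma sum_exchange_vertex_le: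
  fixes g :: "'v set \<Rightarrow> real"
  assumes V: "finite V" and A: "finite A" and g: "\<And>\<sigma>. 0 \<le> g \<sigma>"
  shows "(\<Sum>\<pi>\<in>{\<pi>\<in>Pow V. card \<pi> = k + 1}. \<Sum>v\<in>\<pi> \<inter> A. \<Sum>x\<in>V - \<pi>. g (insert x (\<pi> - {v})))
    \<le> card A * (real k + 1) * (\<Sum>\<sigma>\<in>{\<pi>\<in>Pow V. card \<pi> = k + 1}. g \<sigma>)"
proof -
  define S where "S = {\<pi>\<in>Pow V. card \<pi> = k + 1}"
  have fS: "finite S" using V by (simp add: S_def)
  have fe: "finite \<pi>" if "\<pi> \<in> S" for \<pi> using that V finite_subset by (auto simp: S_def)
  have one: "(\<Sum>\<pi>\<in>{\<pi>\<in>S. v \<in> \<pi>}. \<Sum>x\<in>V - \<pi>. g (insert x (\<pi> - {v}))) \<le> (k + 1) * (\<Sum>\<sigma>\<in>S. g \<sigma>)" for v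
  proof -
    have "(\<Sum>\<pi>\<in>{\<pi>\<in>S. v \<in> \<pi>}. \<Sum>x\<in>V - \<pi>. g (insert x (\<pi> - {v})))
       = (\<Sum>(\<pi>, x)\<in>Sigma {\<pi>\<in>S. v \<in> \<pi>} (\<lambda>\<pi>. V - \<pi>). g (insert x (\<pi> - {v})))"
      using fS V by (subst sum.Sigma) auto
    also have "\<dots> \<le> (\<Sum>(\<sigma>, x)\<in>Sigma S (\<lambda>\<sigma>. \<sigma>). g \<sigma>)"
    proof (rule sum_le_included[where i = "\<lambda>(\<sigma>, x). (insert v (\<sigma> - {x}), x)"])
      show "\<forall>px\<in>Sigma {\<pi>\<in>S. v \<in> \<pi>} (\<lambda>\<pi>. V - \<pi>). \<exists>y\<in>Sigma S (\<lambda>\<sigma>. \<sigma>).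
          (case y of (\<sigma>, x) \<Rightarrow> (insert v (\<sigma> - {x}), x)) = px \<and>
          (case px of (\<pi>, x) \<Rightarrow> g (insert x (\<pi> - {v}))) \<le> (case y of (\<sigma>, x) \<Rightarrow> g \<sigma>)"
      proof (clarify, goal_cases)
        case (1 \<pi> x)
        have "finite \<pi>" "\<pi> \<noteq> {}" using fe 1 by auto
        then have "card (insert x (\<pi> - {v})) = k + 1" using 1 by (simp add: S_def)
        then show ?case using 1
          by (intro bexI[of _ "(insert x (\<pi> - {v}), x)"]) (auto simp: S_def)
      qed
    qed (use fS fe V g in auto)
    also have "\<dots> = (\<Sum>\<sigma>\<in>S. \<Sum>x\<in>\<sigma>. g \<sigma>)"
      using fS fe by (subst sum.Sigma) auto
    also have "\<dots> = (k + 1) * (\<Sum>\<sigma>\<in>S. g \<sigma>)" by (simp add: S_def sum_distrib_left)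
    finally show ?thesis .
  qed
  have "(\<Sum>\<pi>\<in>S. \<Sum>v\<in>\<pi> \<inter> A. \<Sum>x\<in>V - \<pi>. g (insert x (\<pi> - {v})))
     = (\<Sum>\<pi>\<in>S. \<Sum>v\<in>A. if v \<in> \<pi> then \<Sum>x\<in>V - \<pi>. g (insert x (\<pi> - {v})) else 0)"
    using A by (intro sum.cong refl sum.mono_neutral_cong_left) auto
  also have "\<dots> = (\<Sum>v\<in>A. \<Sum>\<pi>\<in>S. if v \<in> \<pi> then \<Sum>x\<in>V - \<pi>. g (insert x (\<pi> - {v})) else 0)"
    by (rule sum.swap)
  also have "\<dots> = (\<Sum>v\<in>A. \<Sum>\<pi>\<in>{\<pi>\<in>S. v \<in> \<pi>}. \<Sum>x\<in>V - \<pi>. g (insert x (\<pi> - {v})))"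
    using fS by (intro sum.cong refl sum.mono_neutral_cong_right) auto
  also have "\<dots> \<le> (\<Sum>v\<in>A. (k + 1) * (\<Sum>\<sigma>\<in>S. g \<sigma>))" by (intro sum_mono one)
  finally show ?thesis by (simp add: S_def algebra_simps)
qed

section \<open>The random complex at one fixed time, with face probabilities
  \<open>pr i\<close>\<close>

locale random_complex_model =
  fixes V :: "'v::linorder set" and pr :: "nat \<Rightarrow> real"
  assumes finite_V: "finite V" and pr_nonneg: "\<And>i. 0 \<le> pr i" and pr_le_1: "\<And>i. pr i \<le> 1"
begin

definition weight :: "'v set \<Rightarrow> real" where
  "weight \<sigma> = pr (card \<sigma> - 1)"

text \<open>The probability that a new vertex forms a coface with a given present simplex on
  \<open>j\<close> vertices: the factor for \<open>i\<close> belongs to the faces made of that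
  vertex and \<open>i\<close> old ones. For \<open>j = k + 1\<close> this is the value of
  \<open>rfun p k\<close>.\<close>

definition coface_prob :: "nat \<Rightarrow> real" where
  "coface_prob j = (\<Prod>i\<le>j. pr i ^ (j choose i))"

text \<open>The conditional probability that \<open>insert v (insert x \<rho>)\<close> is present
  when \<open>insert v \<rho>\<close> and \<open>insert x \<rho>\<close> are and
  \<open>\<rho>\<close> has \<open>j\<close> vertices: the faces still undecided contain both
  \<open>v\<close> and \<open>x\<close>.\<close>

definition coface_ratio :: "nat \<Rightarrow> real" where
  "coface_ratio j = (\<Prod>i\<le>j. pr (i + 1) ^ (j choose i))"

text \<open>Split the subsets of \<open>{..<Suc j}\<close> according to whether they contain
  \<open>j\<close>.\<close>

lemma coface_prob_Suc: "coface_prob (Suc j) = coface_prob j * coface_ratio j"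
proof -
  have "coface_prob (Suc j) = (\<Prod>\<tau>\<in>Pow {..<Suc j}. pr (card \<tau>))"
    using prod_Pow_card[of "{..<Suc j}" pr] by (simp add: coface_prob_def)
  also have "Pow {..<Suc j} = Pow {..<j} \<union> insert j ` Pow {..<j}"
    by (simp add: lessThan_Suc Pow_insert)
  also have "(\<Prod>\<tau>\<in>\<dots>. pr (card \<tau>)) = (\<Prod>\<tau>\<in>Pow {..<j}. pr (card \<tau>)) * (\<Prod>\<tau>\<in>insert j ` Pow {..<j}. pr (card \<tau>))"
    by (intro prod.union_disjoint) auto
  also have "(\<Prod>\<tau>\<in>insert j ` Pow {..<j}. pr (card \<tau>)) = (\<Prod>\<tau>\<in>Pow {..<j}. pr (card (insert j \<tau>)))"
    by (subst prod.reindex) (auto simp: inj_on_def)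
  also have "\<dots> = (\<Prod>\<tau>\<in>Pow {..<j}. pr (card \<tau> + 1))"
  proof (intro prod.cong refl)
    fix \<tau> assume t: "\<tau> \<in> Pow {..<j}"
    then have "finite \<tau>" "j \<notin> \<tau>" using finite_subset by auto
    then show "pr (card (insert j \<tau>)) = pr (card \<tau> + 1)" by simp
  qed
  finally show ?thesis
    using prod_Pow_card[of "{..<j}" pr] prod_Pow_card[of "{..<j}" "\<lambda>i. pr (i + 1)"]
    by (simp add: coface_prob_def coface_ratio_def)
qed

lemma coface_prob_nonneg: "0 \<le> coface_prob j" and coface_ratio_nonneg: "0 \<le> coface_ratio j"
  by (auto simp: coface_prob_def coface_ratio_def intro!: prod_nonneg zero_le_power pr_nonneg)

lemma coface_prob_le_1: "coface_prob j \<le> 1" and coface_ratio_le_1: "coface_ratio j \<le> 1"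
  by (auto simp: coface_prob_def coface_ratio_def intro!: prod_le_1 zero_le_power pr_nonneg power_le_one pr_le_1)

lemma coface_prob_Suc_le: "coface_prob (Suc j) \<le> coface_prob j"
  unfolding coface_prob_Suc using coface_ratio_le_1 coface_prob_nonneg by (simp add: mult_left_le)

lemma weight_bounds: "0 \<le> weight \<sigma>" "weight \<sigma> \<le> 1"
  by (simp_all add: weight_def pr_nonneg pr_le_1)

lemma prod_weight_insert_Pow:
  assumes "finite \<rho>" "v \<notin> \<rho>"
  shows "(\<Prod>\<tau>\<in>insert v ` Pow \<rho>. weight \<tau>) = coface_prob (card \<rho>)"
proof -
  have "(\<Prod>\<tau>\<in>insert v ` Pow \<rho>. weight \<tau>) = (\<Prod>\<tau>\<in>Pow \<rho>. weight (insert v \<tau>))"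
    using assms by (subst prod.reindex) (auto simp: inj_on_def)
  also have "\<dots> = (\<Prod>\<tau>\<in>Pow \<rho>. pr (card \<tau>))"
  proof (intro prod.cong refl)
    fix \<tau> assume "\<tau> \<in> Pow \<rho>"
    then have "finite \<tau>" "v \<notin> \<tau>" using assms finite_subset by auto
    then show "weight (insert v \<tau>) = pr (card \<tau>)" by (simp add: weight_def)
  qed
  finally show ?thesis using prod_Pow_card[OF assms(1), of pr] by (simp add: coface_prob_def)
qed

lemma prod_weight_insert_insert_Pow:
  assumes "finite \<rho>" "v \<notin> \<rho>" "x \<notin> \<rho>" "v \<noteq> x"
  shows "(\<Prod>\<tau>\<in>insert v ` insert x ` Pow \<rho>. weight \<tau>) = coface_ratio (card \<rho>)"
proof -
  have "(\<Prod>\<tau>\<in>insert v ` insert x ` Pow \<rho>. weight \<tau>) = (\<Prod>\<tau>\<in>Pow \<rho>. weight (insert v (insert x \<tau>)))"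
    unfolding image_image using assms by (subst prod.reindex) (auto simp: inj_on_def)
  also have "\<dots> = (\<Prod>\<tau>\<in>Pow \<rho>. pr (card \<tau> + 1))"
  proof (intro prod.cong refl)
    fix \<tau> assume "\<tau> \<in> Pow \<rho>"
    then have "finite \<tau>" "v \<notin> \<tau>" "x \<notin> \<tau>" using assms finite_subset by auto
    then show "weight (insert v (insert x \<tau>)) = pr (card \<tau> + 1)" using assms by (simp add: weight_def)
  qed
  finally show ?thesis using prod_Pow_card[OF assms(1), of "\<lambda>i. pr (i + 1)"] by (simp add: coface_ratio_def)
qed

text \<open>\<open>H\<close> consists of the faces of \<open>insert v \<rho>\<close> through the new
  vertex \<open>v\<close>, and \<open>F x\<close> of the further faces of
  \<open>insert x (insert v \<rho>)\<close>, through both \<open>v\<close> and \<open>x\<close>. The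
  ratio of the two weights is \<open>coface_ratio k\<close>, the probability of \<open>F x\<close>,
  and so the coefficient of \<open>c (insert x \<rho>)\<close> is centred.\<close>

lemma second_moment_off_diagonal:
  assumes U: "U \<subseteq> V" and Y1: "Y1 \<subseteq> Pow U" and v: "v \<in> V - U" and \<rho>: "\<rho> \<subseteq> U" "card \<rho> = k"
    and c: "\<And>\<pi>. c \<pi> \<noteq> 0 \<Longrightarrow> \<pi> \<in> down_complex Y1"
    and N: "N > 0" and R: "coface_prob (k + 1) > 0"
  shows "subset_expectation (Pow V - Pow U) weight (\<lambda>Y. (of_bool (insert v \<rho> \<in> down_complex (Y1 \<union> Y)) *
      (\<Sum>x\<in>V - insert v \<rho>. csgn x \<rho> * (1 / (N * coface_prob k) - 1 / (N * coface_prob (k + 1)) *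
          of_bool (insert x (insert v \<rho>) \<in> down_complex (Y1 \<union> Y))) * c (insert x \<rho>)))\<^sup>2)
    \<le> (\<Sum>x\<in>V - insert v \<rho>. (c (insert x \<rho>))\<^sup>2) / (N\<^sup>2 * coface_prob (k + 1))"
proof -
  define I where "I = {x \<in> V - insert v \<rho>. c (insert x \<rho>) \<noteq> 0}"
  define H where "H = insert v ` Pow \<rho>"
  define F where "F = (\<lambda>x. insert v ` insert x ` Pow \<rho>)"
  have fr: "finite \<rho>" using \<rho> U finite_V finite_subset by metis
  have vr: "v \<notin> \<rho>" using v \<rho> by auto
  have fI: "finite I" using finite_V by (simp add: I_def)
  have IU: "x \<in> U \<and> x \<notin> \<rho> \<and> x \<noteq> v \<and> insert x \<rho> \<in> down_complex Y1" if "x \<in> I" for x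
  proof -
    have "insert x \<rho> \<in> down_complex Y1" using that c by (auto simp: I_def)
    moreover then have "insert x \<rho> \<in> Y1" using down_complex_subset by auto
    ultimately show ?thesis using that Y1 by (auto simp: I_def)
  qed
  have Rk: "coface_prob k > 0" "coface_ratio k > 0"
    using R coface_prob_nonneg[of k] coface_ratio_nonneg[of k] coface_prob_Suc[of k]
    by (auto simp: zero_less_mult_iff order_less_le)
  define a where "a = (\<lambda>x. csgn x \<rho> * c (insert x \<rho>) / N)"
  have "subset_expectation (Pow V - Pow U) weight (\<lambda>Y. (of_bool (insert v \<rho> \<in> down_complex (Y1 \<union> Y)) *
      (\<Sum>x\<in>V - insert v \<rho>. csgn x \<rho> * (1 / (N * coface_prob k) - 1 / (N * coface_prob (k + 1)) *
          of_bool (insert x (insert v \<rho>) \<in> down_complex (Y1 \<union> Y))) * c (insert x \<rho>)))\<^sup>2)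
    = subset_expectation (Pow V - Pow U) weight (\<lambda>Y. (\<Sum>x\<in>I. a x * (of_bool (H \<subseteq> Y) / coface_prob k
         - of_bool (H \<union> F x \<subseteq> Y) / (coface_prob k * coface_ratio k)))\<^sup>2)"
  proof (intro subset_expectation_cong arg_cong[where f = "\<lambda>x. x\<^sup>2"])
    fix Y assume Y: "Y \<subseteq> Pow V - Pow U"
    then have YU: "Y \<inter> Pow U = {}" by auto
    have "of_bool (insert v \<rho> \<in> down_complex (Y1 \<union> Y)) *
      (\<Sum>x\<in>V - insert v \<rho>. csgn x \<rho> * (1 / (N * coface_prob k) - 1 / (N * coface_prob (k + 1)) *
          of_bool (insert x (insert v \<rho>) \<in> down_complex (Y1 \<union> Y))) * c (insert x \<rho>))
      = of_bool (insert v \<rho> \<in> down_complex (Y1 \<union> Y)) *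
      (\<Sum>x\<in>I. csgn x \<rho> * (1 / (N * coface_prob k) - 1 / (N * coface_prob (k + 1)) *
          of_bool (insert x (insert v \<rho>) \<in> down_complex (Y1 \<union> Y))) * c (insert x \<rho>))"
      using finite_V by (intro arg_cong2[where f = "(*)"] refl sum.mono_neutral_right) (auto simp: I_def)
    also have "\<dots> = (\<Sum>x\<in>I. a x * (of_bool (H \<subseteq> Y) / coface_prob k
         - of_bool (H \<union> F x \<subseteq> Y) / (coface_prob k * coface_ratio k)))"
      unfolding sum_distrib_left
    proof (intro sum.cong refl)
      fix x assume x: "x \<in> I"
      note xI = IU[OF x]
      have "\<rho> \<in> down_complex Y1" if "\<rho> \<noteq> {}"
        using xI that by (auto intro: face_closedD[OF face_closed_down_complex])
      then have 1: "insert v \<rho> \<in> down_complex (Y1 \<union> Y) \<longleftrightarrow> H \<subseteq> Y"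
        unfolding H_def by (intro insert_in_down_complex_iff[of v U]) (use v Y1 YU in auto)
      have "insert x (insert v \<rho>) \<in> down_complex (Y1 \<union> Y) \<longleftrightarrow> insert v ` Pow (insert x \<rho>) \<subseteq> Y"
        unfolding insert_commute[of x v] by (intro insert_in_down_complex_iff[of v U]) (use v Y1 YU xI in auto)
      also have "insert v ` Pow (insert x \<rho>) = H \<union> F x"
        by (simp add: H_def F_def Pow_insert image_Un)
      finally have 2: "insert x (insert v \<rho>) \<in> down_complex (Y1 \<union> Y) \<longleftrightarrow> H \<union> F x \<subseteq> Y" .
      show "of_bool (insert v \<rho> \<in> down_complex (Y1 \<union> Y)) *
         (csgn x \<rho> * (1 / (N * coface_prob k) - 1 / (N * coface_prob (k + 1)) *
          of_bool (insert x (insert v \<rho>) \<in> down_complex (Y1 \<union> Y))) * c (insert x \<rho>))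
         = a x * (of_bool (H \<subseteq> Y) / coface_prob k - of_bool (H \<union> F x \<subseteq> Y) / (coface_prob k * coface_ratio k))"
        unfolding 1 2 using N Rk by (auto simp: a_def coface_prob_Suc field_simps)
    qed
    finally show "of_bool (insert v \<rho> \<in> down_complex (Y1 \<union> Y)) *
      (\<Sum>x\<in>V - insert v \<rho>. csgn x \<rho> * (1 / (N * coface_prob k) - 1 / (N * coface_prob (k + 1)) *
          of_bool (insert x (insert v \<rho>) \<in> down_complex (Y1 \<union> Y))) * c (insert x \<rho>))
      = (\<Sum>x\<in>I. a x * (of_bool (H \<subseteq> Y) / coface_prob k
         - of_bool (H \<union> F x \<subseteq> Y) / (coface_prob k * coface_ratio k)))" .
  qed
  also have "\<dots> \<le> (\<Sum>x\<in>I. (a x)\<^sup>2) / (coface_prob k * coface_ratio k)"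
  proof (rule subset_expectation_second_moment)
    show "finite (Pow V - Pow U)" using finite_V by simp
    show "finite I" by fact
    show "H \<subseteq> Pow V - Pow U" using v \<rho> U by (auto simp: H_def)
    show "F x \<subseteq> Pow V - Pow U" if "x \<in> I" for x using v \<rho> U IU[OF that] by (auto simp: F_def)
    show "H \<inter> F x = {}" if "x \<in> I" for x using v \<rho> IU[OF that] by (auto simp: H_def F_def)
    show "F x \<inter> F y = {}" if "x \<in> I" "y \<in> I" "x \<noteq> y" for x y
      using v \<rho> IU[OF that(1)] IU[OF that(2)] that(3) by (auto simp: F_def)
    show "prod weight H = coface_prob k" unfolding H_def using prod_weight_insert_Pow[OF fr vr] \<rho> by simp
    show "prod weight (F x) = coface_ratio k" if "x \<in> I" for x
      unfolding F_def using prod_weight_insert_insert_Pow[OF fr vr, of x] \<rho> IU[OF that] by auto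
  qed (use Rk in auto)
  also have "(\<Sum>x\<in>I. (a x)\<^sup>2) = (\<Sum>x\<in>I. (c (insert x \<rho>))\<^sup>2) / N\<^sup>2"
    by (simp add: a_def power_divide power_mult_distrib sum_divide_distrib)
  also have "(\<Sum>x\<in>I. (c (insert x \<rho>))\<^sup>2) = (\<Sum>x\<in>V - insert v \<rho>. (c (insert x \<rho>))\<^sup>2)"
    using finite_V by (intro sum.mono_neutral_left) (auto simp: I_def)
  finally show ?thesis by (simp add: coface_prob_Suc)
qed

text \<open>Each vertex of \<open>W\<close> is new and forms a coface of \<open>\<pi>\<close>
  independently with probability \<open>coface_prob (k + 1)\<close>; the expression is the number of
  cofaces over \<open>N * coface_prob (k + 1)\<close>, minus its mean
  \<open>card W / N\<close>.\<close>

lemma second_moment_diagonal: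
  assumes U: "U \<subseteq> V" and Y1: "Y1 \<subseteq> Pow U" and W: "W \<subseteq> V - U" and \<pi>: "\<pi> \<in> down_complex Y1" "card \<pi> = k + 1"
    and N: "N > 0" and R: "coface_prob (k + 1) > 0"
  shows "subset_expectation (Pow V - Pow U) weight (\<lambda>Y. (1 / (N * coface_prob (k + 1)) *
       (\<Sum>x\<in>W. of_bool (insert x \<pi> \<in> down_complex (Y1 \<union> Y))) - card W / N)\<^sup>2)
    \<le> card W / (N\<^sup>2 * coface_prob (k + 1))"
proof -
  have pU: "\<pi> \<subseteq> U" using \<pi> down_complex_subset Y1 by blast
  have fp: "finite \<pi>" using pU U finite_V finite_subset by metis
  have fW: "finite W" using W finite_V by (meson Diff_subset finite_subset)
  define F where "F = (\<lambda>x. insert x ` Pow \<pi>)"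
  have xW: "x \<in> V \<and> x \<notin> U \<and> x \<notin> \<pi>" if "x \<in> W" for x using that W pU by auto
  have "subset_expectation (Pow V - Pow U) weight (\<lambda>Y. (1 / (N * coface_prob (k + 1)) *
       (\<Sum>x\<in>W. of_bool (insert x \<pi> \<in> down_complex (Y1 \<union> Y))) - card W / N)\<^sup>2)
     = subset_expectation (Pow V - Pow U) weight (\<lambda>Y. (\<Sum>x\<in>W. - 1 / N * (of_bool ({} \<subseteq> Y) / 1
         - of_bool ({} \<union> F x \<subseteq> Y) / (1 * coface_prob (k + 1))))\<^sup>2)"
  proof (intro subset_expectation_cong arg_cong[where f = "\<lambda>x. x\<^sup>2"])
    fix Y assume Y: "Y \<subseteq> Pow V - Pow U"
    have "(\<Sum>x\<in>W. - 1 / N * (of_bool ({} \<subseteq> Y) / 1 - of_bool ({} \<union> F x \<subseteq> Y) / (1 * coface_prob (k + 1))))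
      = (\<Sum>x\<in>W. 1 / (N * coface_prob (k + 1)) * of_bool (insert x \<pi> \<in> down_complex (Y1 \<union> Y)) - 1 / N)"
    proof (intro sum.cong refl)
      fix x assume x: "x \<in> W"
      have "insert x \<pi> \<in> down_complex (Y1 \<union> Y) \<longleftrightarrow> F x \<subseteq> Y"
        unfolding F_def by (intro insert_in_down_complex_iff[of x U]) (use Y Y1 xW[OF x] \<pi> in auto)
      then show "- 1 / N * (of_bool ({} \<subseteq> Y) / 1 - of_bool ({} \<union> F x \<subseteq> Y) / (1 * coface_prob (k + 1)))
        = 1 / (N * coface_prob (k + 1)) * of_bool (insert x \<pi> \<in> down_complex (Y1 \<union> Y)) - 1 / N"
        using N R by (simp add: field_simps)
    qed
    then show "1 / (N * coface_prob (k + 1)) * (\<Sum>x\<in>W. of_bool (insert x \<pi> \<in> down_complex (Y1 \<union> Y))) - card W / N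
      = (\<Sum>x\<in>W. - 1 / N * (of_bool ({} \<subseteq> Y) / 1 - of_bool ({} \<union> F x \<subseteq> Y) / (1 * coface_prob (k + 1))))"
      by (simp add: sum_subtractf sum_distrib_left)
  qed
  also have "\<dots> \<le> (\<Sum>x\<in>W. (- 1 / N)\<^sup>2) / (1 * coface_prob (k + 1))"
  proof (rule subset_expectation_second_moment)
    show "finite (Pow V - Pow U)" using finite_V by simp
    show "finite W" by fact
    show "F x \<subseteq> Pow V - Pow U" if "x \<in> W" for x using xW[OF that] pU U by (auto simp: F_def)
    show "F x \<inter> F y = {}" if "x \<in> W" "y \<in> W" "x \<noteq> y" for x y
      using xW[OF that(1)] xW[OF that(2)] that(3) by (auto simp: F_def)
    show "prod weight (F x) = coface_prob (k + 1)" if "x \<in> W" for x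
      unfolding F_def using prod_weight_insert_Pow[OF fp, of x] \<pi> xW[OF that] by auto
  qed (use R in auto)
  finally show ?thesis by (simp add: power_divide)
qed

end

text \<open>The summands belong to the centred diagonal part, the diagonal correction by batch
  vertices inside \<open>U\<close>, the exchanges at such vertices, and the exchanges at new
  vertices. The factor 3 comes from squaring a sum of three terms; in \<open>12 = 3 * 4\<close> the
  4 comes from squaring a difference of two.\<close>

definition cone_step_constant :: "nat \<Rightarrow> real \<Rightarrow> real" where
  "cone_step_constant k K = 3 + 3 * (real k + 1)\<^sup>2 + 12 * K * (real k + 1) ^ 3 + (real k + 1)"

lemma square_sum3_le: "((a::real) + b + c)\<^sup>2 \<le> 3 * (a\<^sup>2 + b\<^sup>2 + c\<^sup>2)"
proof -
  have "0 \<le> (a - b)\<^sup>2 + (b - c)\<^sup>2 + (a - c)\<^sup>2" by simp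
  then show ?thesis by (simp add: power2_eq_square algebra_simps)
qed

lemma square_diff_le: "((a::real) - b)\<^sup>2 \<le> 2 * (a\<^sup>2 + b\<^sup>2)"
proof -
  have "0 \<le> (a + b)\<^sup>2" by simp
  then show ?thesis by (simp add: power2_eq_square algebra_simps)
qed

context random_complex_model
begin

text \<open>The deterministic part of the step. At a simplex inside \<open>U\<close> the error is
  \<open>S * c \<pi> + \<delta> * c \<pi> + B\<close>, where only \<open>S\<close>, from the batch
  vertices outside \<open>U\<close>, will be centred. The others come from the at most
  \<open>k + 1\<close> batch vertices inside \<open>U\<close>: \<open>\<delta>\<close> is at most
  \<open>(k + 1) * \<alpha>\<close> in absolute value, and \<open>B\<close> is controlled by the
  numbers of cofaces.\<close>

lemma cone_error_bound_inside:
  assumes U: "U \<subseteq> V" and W: "W \<subseteq> V" "card W = N" "card (W \<inter> U) \<le> k + 1"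
    and N: "N * coface_prob (k + 1) \<ge> 1" and K: "K \<ge> 0"
    and Y1: "Y1 \<subseteq> Pow U" and Y: "Y \<inter> Pow U = {}"
    and c: "\<And>\<pi>. c \<pi> \<noteq> 0 \<Longrightarrow> \<pi> \<in> down_complex Y1"
    and facet: "\<And>\<pi> \<rho>. c \<pi> \<noteq> 0 \<Longrightarrow> \<rho> \<subseteq> \<pi> \<Longrightarrow> card \<rho> = k \<Longrightarrow>
      card {x \<in> U - \<rho>. insert x \<rho> \<in> down_complex Y1} \<le> K * N * coface_prob k"
    and \<pi>: "\<pi> \<in> down_complex Y1" "card \<pi> = k + 1"
    and cofaces: "card {x \<in> U - \<pi>. insert x \<pi> \<in> down_complex Y1} \<le> K * N * coface_prob (k + 1)"
    and \<alpha>: "\<alpha> = 1 / (N * coface_prob (k + 1))"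
  shows "(cone_error k V \<alpha> (1 / (N * coface_prob k)) W (down_complex (Y1 \<union> Y)) c \<pi>)\<^sup>2
    \<le> 3 * (c \<pi>)\<^sup>2 * (\<alpha> * (\<Sum>x\<in>W - U. of_bool (insert x \<pi> \<in> down_complex (Y1 \<union> Y))) - card (W - U) / N)\<^sup>2
      + 3 * (real k + 1)\<^sup>2 * \<alpha> * (c \<pi>)\<^sup>2
      + 12 * (real k + 1) * K * \<alpha> * (\<Sum>v\<in>\<pi> \<inter> (W \<inter> U). \<Sum>x\<in>V - \<pi>. (c (insert x (\<pi> - {v})))\<^sup>2)"
proof -
  define \<alpha>' where "\<alpha>' = 1 / (N * coface_prob k)"
  define X where "X = down_complex (Y1 \<union> Y)"
  define b :: "'v \<Rightarrow> real" where "b = (\<lambda>x. of_bool (insert x \<pi> \<in> X))"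
  have R: "coface_prob (k + 1) > 0" "real N > 0"
    using N coface_prob_nonneg[of "k + 1"] by (cases "N = 0"; cases "coface_prob (k + 1) = 0"; simp)+
  have Rk: "coface_prob (k + 1) \<le> coface_prob k" "coface_prob k > 0" using coface_prob_Suc_le[of k] R by auto
  have \<alpha>pos: "0 < \<alpha>" "\<alpha> \<le> 1" using N R by (auto simp: \<alpha>)
  have \<alpha>'pos: "0 < \<alpha>'" using Rk R by (simp add: \<alpha>'_def)
  have \<alpha>'\<alpha>: "\<alpha>' \<le> \<alpha>" unfolding \<alpha> \<alpha>'_def using R Rk by (intro divide_left_mono mult_left_mono) auto
  have N\<alpha>: "1 / N \<le> \<alpha>" unfolding \<alpha> using R coface_prob_le_1[of "k + 1"]
    by (intro divide_left_mono) (auto simp: mult_left_le)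
  have pU: "\<pi> \<subseteq> U" using \<pi> down_complex_subset Y1 by blast
  have fU: "finite U" "finite W" "finite \<pi>" using U W pU finite_V by (meson finite_subset)+
  have XU: "\<sigma> \<in> X \<longleftrightarrow> \<sigma> \<in> down_complex Y1" if "\<sigma> \<subseteq> U" for \<sigma>
    unfolding X_def by (rule down_complex_restrict[OF Y that])
  have cU: "\<sigma> \<subseteq> U" if "c \<sigma> \<noteq> 0" for \<sigma> using c[OF that] down_complex_subset Y1 by blast
  define S where "S = \<alpha> * (\<Sum>x\<in>W - U. b x) - card (W - U) / N"
  define \<delta> where "\<delta> = \<alpha> * (\<Sum>x\<in>W \<inter> U - \<pi>. b x) + \<alpha>' * card (\<pi> \<inter> W) - card (W \<inter> U) / N"
  define t where "t = (\<lambda>v. \<Sum>x\<in>V - \<pi>. csgn x (\<pi> - {v}) * (\<alpha>' - \<alpha> * b x) * c (insert x (\<pi> - {v})))"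
  define B where "B = (\<Sum>v\<in>\<pi> \<inter> W. csgn v (\<pi> - {v}) * t v)"
  define q where "q = (\<lambda>v. \<Sum>x\<in>V - \<pi>. (c (insert x (\<pi> - {v})))\<^sup>2)"
  have q0: "0 \<le> q v" for v by (simp add: q_def sum_nonneg)
  \<comment> \<open>The \<open>- 1\<close> of the cone error is shared out as \<open>1 / N\<close>
    per batch vertex: the share of the vertices outside \<open>U\<close> centres \<open>S\<close>,
    the rest goes into \<open>\<delta>\<close>.\<close>
  have cN: "card (W - U) / N - 1 = - (card (W \<inter> U) / N)"
  proof -
    have "N = card (W - U) + card (W \<inter> U)"
      unfolding W(2)[symmetric] using fU by (subst card_Un_disjoint[symmetric]) (auto simp: Un_commute Int_Diff_Un Un_Diff_Int)
    then have "real N = card (W - U) + card (W \<inter> U)" by linarith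
    then show ?thesis using R by (simp add: field_simps)
  qed
  have "W - \<pi> = (W - U) \<union> (W \<inter> U - \<pi>)" using pU by auto
  then have "(\<Sum>x\<in>W - \<pi>. b x) = (\<Sum>x\<in>W - U. b x) + (\<Sum>x\<in>W \<inter> U - \<pi>. b x)"
    using fU by (auto intro!: sum.union_disjoint)
  then have diag: "\<alpha> * (\<Sum>x\<in>W - \<pi>. b x) + \<alpha>' * card (\<pi> \<inter> W) - 1 = S + \<delta>"
    using cN by (simp add: S_def \<delta>_def algebra_simps)
  have \<pi>X: "\<pi> \<in> X" using XU[OF pU] \<pi> by simp
  have eq: "cone_error k V \<alpha> \<alpha>' W X c \<pi> = S * c \<pi> + \<delta> * c \<pi> + B"
  proof -
    have "cone_error k V \<alpha> \<alpha>' W X c \<pi> = (\<alpha> * (\<Sum>x\<in>W - \<pi>. b x) + \<alpha>' * card (\<pi> \<inter> W) - 1) * c \<pi> + B"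
      using \<pi>X \<pi> by (simp add: cone_error_def B_def t_def b_def)
    then show ?thesis unfolding diag by (simp add: distrib_right)
  qed
  have W3: "real (card (W \<inter> U)) \<le> real k + 1" using W(3) by linarith
  have b01: "0 \<le> b x" "b x \<le> 1" for x by (simp_all add: b_def)
  have "\<bar>\<delta>\<bar> \<le> (real k + 1) * \<alpha>"
  proof -
    have 1: "0 \<le> \<alpha> * (\<Sum>x\<in>W \<inter> U - \<pi>. b x) + \<alpha>' * card (\<pi> \<inter> W)"
      using \<alpha>pos \<alpha>'pos b01 by (intro add_nonneg_nonneg mult_nonneg_nonneg sum_nonneg) auto
    have "\<alpha> * (\<Sum>x\<in>W \<inter> U - \<pi>. b x) + \<alpha>' * card (\<pi> \<inter> W) \<le> \<alpha> * card (W \<inter> U - \<pi>) + \<alpha> * card (\<pi> \<inter> W)"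
      using \<alpha>pos \<alpha>'\<alpha> b01 sum_bounded_above[of "W \<inter> U - \<pi>" b 1]
      by (intro add_mono mult_left_mono mult_right_mono) auto
    also have "\<dots> = \<alpha> * card (W \<inter> U)"
    proof -
      have "card (W \<inter> U) = card (W \<inter> U - \<pi>) + card (\<pi> \<inter> W)"
        using fU pU by (subst card_Un_disjoint[symmetric]) (auto intro!: arg_cong[where f = card])
      then show ?thesis by (simp add: distrib_left)
    qed
    also have "\<dots> \<le> (real k + 1) * \<alpha>" using W3 \<alpha>pos by (simp add: mult.commute)
    finally have 2: "\<alpha> * (\<Sum>x\<in>W \<inter> U - \<pi>. b x) + \<alpha>' * card (\<pi> \<inter> W) \<le> (real k + 1) * \<alpha>" .
    have "card (W \<inter> U) / N \<le> (real k + 1) * (1 / N)" using W3 R by (simp add: divide_right_mono)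
    also have "\<dots> \<le> (real k + 1) * \<alpha>" using N\<alpha> by (intro mult_left_mono) auto
    finally have 3: "card (W \<inter> U) / N \<le> (real k + 1) * \<alpha>" .
    have 4: "0 \<le> card (W \<inter> U) / N" by simp
    show ?thesis using 1 2 3 4 unfolding \<delta>_def by linarith
  qed
  then have "\<delta>\<^sup>2 \<le> ((real k + 1) * \<alpha>)\<^sup>2" using abs_le_square_iff[of \<delta> "(real k + 1) * \<alpha>"] \<alpha>pos by simp
  also have "\<dots> = (real k + 1)\<^sup>2 * (\<alpha> * \<alpha>)" by (simp add: power2_eq_square)
  also have "\<dots> \<le> (real k + 1)\<^sup>2 * \<alpha>" using \<alpha>pos by (intro mult_left_mono) (auto simp: mult_left_le)
  finally have \<delta>2: "\<delta>\<^sup>2 \<le> (real k + 1)\<^sup>2 * \<alpha>" .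
  \<comment> \<open>The two parts of \<open>t v\<close> have different supports: without the
    indicator at most the \<open>K / \<alpha>'\<close> cofaces of the facet \<open>\<rho>\<close>,
    with it at most the \<open>K / \<alpha>\<close> cofaces of \<open>\<pi>\<close>. The factor lost
    in Cauchy-Schwarz is thus cancelled by one of the two weights in the square.\<close>
  have t2: "(t v)\<^sup>2 \<le> 4 * K * \<alpha> * q v" if v: "v \<in> \<pi>" for v
  proof -
    define \<rho> where "\<rho> = \<pi> - {v}"
    define s1 where "s1 = (\<Sum>x\<in>V - \<pi>. csgn x \<rho> * c (insert x \<rho>))"
    define s2 where "s2 = (\<Sum>x\<in>V - \<pi>. csgn x \<rho> * b x * c (insert x \<rho>))"
    have r: "card \<rho> = k" "\<rho> \<subseteq> U" using v \<pi> fU pU by (auto simp: \<rho>_def)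
    have t: "t v = \<alpha>' * s1 - \<alpha> * s2"
      unfolding t_def s1_def s2_def \<rho>_def by (simp add: sum_distrib_left sum_subtractf algebra_simps)
    have s1: "\<alpha>'\<^sup>2 * s1\<^sup>2 \<le> K * \<alpha> * q v"
    proof (cases "\<exists>x\<in>V - \<pi>. c (insert x \<rho>) \<noteq> 0")
      case False
      then show ?thesis using K \<alpha>pos q0[of v] by (simp add: s1_def)
    next
      case True
      then obtain x0 where x0: "c (insert x0 \<rho>) \<noteq> 0" by auto
      define n where "n = card {x \<in> U - \<rho>. insert x \<rho> \<in> down_complex Y1}"
      have n: "n \<le> K / \<alpha>'" using facet[OF x0 subset_insertI r(1)] by (simp add: n_def \<alpha>'_def mult.assoc)
      have "s1\<^sup>2 \<le> n * (\<Sum>x\<in>V - \<pi>. (csgn x \<rho> * c (insert x \<rho>))\<^sup>2)"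
        unfolding s1_def n_def
      proof (rule sum_squared_le_card_support)
        fix x assume "x \<in> V - \<pi>" "csgn x \<rho> * c (insert x \<rho>) \<noteq> 0"
        then show "x \<in> {x \<in> U - \<rho>. insert x \<rho> \<in> down_complex Y1}"
          using c[of "insert x \<rho>"] cU[of "insert x \<rho>"] by (auto simp: \<rho>_def)
      qed (use finite_V fU in auto)
      also have "\<dots> = n * q v" by (simp add: q_def \<rho>_def power_mult_distrib)
      also have "\<dots> \<le> K / \<alpha>' * q v" using n q0 by (intro mult_right_mono) auto
      finally have "\<alpha>'\<^sup>2 * s1\<^sup>2 \<le> \<alpha>'\<^sup>2 * (K / \<alpha>' * q v)" by (intro mult_left_mono) auto
      also have "\<dots> = \<alpha>' * (K * q v)" using \<alpha>'pos by (simp add: power2_eq_square field_simps)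
      also have "\<dots> \<le> \<alpha> * (K * q v)" using \<alpha>'\<alpha> K q0 by (intro mult_right_mono) auto
      finally show ?thesis by (simp add: mult.assoc mult.left_commute)
    qed
    have s2: "\<alpha>\<^sup>2 * s2\<^sup>2 \<le> K * \<alpha> * q v"
    proof -
      define n where "n = card {x \<in> U - \<pi>. insert x \<pi> \<in> down_complex Y1}"
      have n: "n \<le> K / \<alpha>" using cofaces by (simp add: n_def \<alpha> mult.assoc)
      have "s2\<^sup>2 \<le> n * (\<Sum>x\<in>V - \<pi>. (csgn x \<rho> * b x * c (insert x \<rho>))\<^sup>2)"
        unfolding s2_def n_def
      proof (rule sum_squared_le_card_support)
        fix x assume x: "x \<in> V - \<pi>" "csgn x \<rho> * b x * c (insert x \<rho>) \<noteq> 0"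
        then have "x \<in> U" using cU[of "insert x \<rho>"] by auto
        moreover have "insert x \<pi> \<in> X" using x by (auto simp: b_def)
        ultimately show "x \<in> {x \<in> U - \<pi>. insert x \<pi> \<in> down_complex Y1}"
          using x pU XU[of "insert x \<pi>"] by auto
      qed (use finite_V fU in auto)
      also have "\<dots> \<le> n * q v" unfolding q_def \<rho>_def
        by (intro mult_left_mono sum_mono) (auto simp: power_mult_distrib b_def)
      also have "\<dots> \<le> K / \<alpha> * q v" using n q0 by (intro mult_right_mono) auto
      finally have "\<alpha>\<^sup>2 * s2\<^sup>2 \<le> \<alpha>\<^sup>2 * (K / \<alpha> * q v)" by (intro mult_left_mono) auto
      also have "\<dots> = K * \<alpha> * q v" using \<alpha>pos by (simp add: power2_eq_square field_simps)
      finally show ?thesis .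
    qed
    have "(t v)\<^sup>2 \<le> 2 * ((\<alpha>' * s1)\<^sup>2 + (\<alpha> * s2)\<^sup>2)" unfolding t by (rule square_diff_le)
    then show ?thesis using s1 s2 by (simp add: power_mult_distrib)
  qed
  have "B\<^sup>2 \<le> card (W \<inter> U) * (\<Sum>v\<in>\<pi> \<inter> W. (csgn v (\<pi> - {v}) * t v)\<^sup>2)"
    unfolding B_def by (rule sum_squared_le_card_support) (use fU pU in auto)
  also have "\<dots> = card (W \<inter> U) * (\<Sum>v\<in>\<pi> \<inter> W. (t v)\<^sup>2)" by (simp add: power_mult_distrib)
  also have "\<dots> \<le> (real k + 1) * (\<Sum>v\<in>\<pi> \<inter> W. 4 * K * \<alpha> * q v)"
    using W3 t2 K \<alpha>pos q0 by (intro mult_mono sum_mono sum_nonneg) auto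
  also have "\<dots> = 4 * (real k + 1) * K * \<alpha> * (\<Sum>v\<in>\<pi> \<inter> W. q v)" unfolding sum_distrib_left[symmetric] by (simp add: algebra_simps)
  also have "\<pi> \<inter> W = \<pi> \<inter> (W \<inter> U)" using pU by auto
  finally have B2: "B\<^sup>2 \<le> 4 * (real k + 1) * K * \<alpha> * (\<Sum>v\<in>\<pi> \<inter> (W \<inter> U). q v)" .
  have "(cone_error k V \<alpha> \<alpha>' W X c \<pi>)\<^sup>2 \<le> 3 * ((S * c \<pi>)\<^sup>2 + (\<delta> * c \<pi>)\<^sup>2 + B\<^sup>2)"
    unfolding eq by (rule square_sum3_le)
  also have "\<dots> \<le> 3 * ((S * c \<pi>)\<^sup>2 + (real k + 1)\<^sup>2 * \<alpha> * (c \<pi>)\<^sup>2 + 4 * (real k + 1) * K * \<alpha> * (\<Sum>v\<in>\<pi> \<inter> (W \<inter> U). q v))"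
    using B2 mult_right_mono[OF \<delta>2, of "(c \<pi>)\<^sup>2"] by (simp add: power_mult_distrib)
  also have "\<dots> = 3 * (c \<pi>)\<^sup>2 * S\<^sup>2 + 3 * (real k + 1)\<^sup>2 * \<alpha> * (c \<pi>)\<^sup>2
      + 12 * (real k + 1) * K * \<alpha> * (\<Sum>v\<in>\<pi> \<inter> (W \<inter> U). q v)"
    by (simp add: power_mult_distrib algebra_simps)
  finally show ?thesis by (simp add: X_def \<alpha>'_def S_def b_def q_def)
qed

text \<open>
  Conditionally on the faces inside \<open>U\<close>, which determine \<open>c\<close>, the coefficients of the cone error
  over the vertices of \<open>W\<close> outside \<open>U\<close> are centred and uncorrelated.
\<close>

lemma expectation_cone_step:
  assumes U: "U \<subseteq> V" and W: "W \<subseteq> V" "card W = N" "card (W \<inter> U) \<le> k + 1"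
    and N: "N * coface_prob (k + 1) \<ge> 1" and K: "K \<ge> 0" and Y1: "Y1 \<subseteq> Pow U"
    and c: "\<And>\<pi>. c \<pi> \<noteq> 0 \<Longrightarrow> \<pi> \<in> down_complex Y1"
    and facet: "\<And>\<pi> \<rho>. c \<pi> \<noteq> 0 \<Longrightarrow> \<rho> \<subseteq> \<pi> \<Longrightarrow> card \<rho> = k \<Longrightarrow>
      card {x \<in> U - \<rho>. insert x \<rho> \<in> down_complex Y1} \<le> K * N * coface_prob k"
    and G: "\<And>Y \<pi>. Y \<subseteq> Pow V - Pow U \<Longrightarrow> G (Y1 \<union> Y) \<pi> \<Longrightarrow> \<pi> \<subseteq> U \<Longrightarrow> card \<pi> = k + 1 \<Longrightarrow>
      card {x \<in> U - \<pi>. insert x \<pi> \<in> down_complex Y1} \<le> K * N * coface_prob (k + 1)"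
  shows "subset_expectation (Pow V - Pow U) weight (\<lambda>Y. \<Sum>\<pi>\<in>{\<pi>\<in>Pow V. card \<pi> = k + 1}.
      (if G (Y1 \<union> Y) \<pi> then cone_error k V (1 / (N * coface_prob (k + 1))) (1 / (N * coface_prob k)) W
         (down_complex (Y1 \<union> Y)) c \<pi> else 0)\<^sup>2)
    \<le> cone_step_constant k K / (N * coface_prob (k + 1)) * (\<Sum>\<pi>\<in>{\<pi>\<in>Pow V. card \<pi> = k + 1}. (c \<pi>)\<^sup>2)"
proof -
  define \<alpha> where "\<alpha> = 1 / (N * coface_prob (k + 1))"
  define E where "E = (\<lambda>Y. cone_error k V \<alpha> (1 / (N * coface_prob k)) W (down_complex (Y1 \<union> Y)) c)"
  define S where "S = {\<pi>\<in>Pow V. card \<pi> = k + 1}"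
  define q where "q = (\<lambda>A \<pi>. \<Sum>v\<in>\<pi> \<inter> A. \<Sum>x\<in>V - \<pi>. (c (insert x (\<pi> - {v})))\<^sup>2)"
  define M where "M = (\<Sum>\<pi>\<in>S. (c \<pi>)\<^sup>2)"
  let ?EX = "subset_expectation (Pow V - Pow U) weight"
  have W3: "real (card (W \<inter> U)) \<le> real k + 1" using W(3) by linarith
  have M0: "M \<ge> 0" by (simp add: M_def sum_nonneg)
  have R: "coface_prob (k + 1) > 0" "real N > 0"
    using N coface_prob_nonneg[of "k + 1"] by (cases "N = 0"; cases "coface_prob (k + 1) = 0"; simp)+
  have \<alpha>0: "\<alpha> > 0" using R by (simp add: \<alpha>_def)
  have fV: "finite (Pow V - Pow U)" "finite U" "finite W" using finite_V U W by (auto intro: finite_subset)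
  have fS: "finite S" using finite_V by (simp add: S_def)
  note mono = subset_expectation_mono[OF weight_bounds]
  have inside: "?EX (\<lambda>Y. (if G (Y1 \<union> Y) \<pi> then E Y \<pi> else 0)\<^sup>2)
      \<le> (3 + 3 * (real k + 1)\<^sup>2) * \<alpha> * (c \<pi>)\<^sup>2 + 12 * (real k + 1) * K * \<alpha> * q (W \<inter> U) \<pi>"
    if pU: "\<pi> \<subseteq> U" and ck: "card \<pi> = k + 1" for \<pi>
  proof (cases "\<pi> \<in> down_complex Y1")
    case False
    have "?EX (\<lambda>Y. (if G (Y1 \<union> Y) \<pi> then E Y \<pi> else 0)\<^sup>2) = ?EX (\<lambda>Y. 0)"
    proof (rule subset_expectation_cong)
      fix Y assume "Y \<subseteq> Pow V - Pow U"
      then have "Y \<inter> Pow U = {}" by auto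
      from down_complex_restrict[OF this pU, of Y1] False
      show "(if G (Y1 \<union> Y) \<pi> then E Y \<pi> else 0)\<^sup>2 = 0" by (simp add: E_def cone_error_def)
    qed
    also have "\<dots> \<le> (3 + 3 * (real k + 1)\<^sup>2) * \<alpha> * (c \<pi>)\<^sup>2 + 12 * (real k + 1) * K * \<alpha> * q (W \<inter> U) \<pi>"
      unfolding subset_expectation_const[OF fV(1)] q_def using K \<alpha>0
      by (intro add_nonneg_nonneg mult_nonneg_nonneg sum_nonneg) auto
    finally show ?thesis .
  next
    case True
    define D where "D = (\<lambda>Y. (\<alpha> * (\<Sum>x\<in>W - U. of_bool (insert x \<pi> \<in> down_complex (Y1 \<union> Y))) - card (W - U) / N)\<^sup>2)"
    have D: "?EX D \<le> \<alpha>"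
    proof -
      have "?EX D \<le> card (W - U) / ((real N)\<^sup>2 * coface_prob (k + 1))"
        unfolding D_def \<alpha>_def by (rule second_moment_diagonal) (use U Y1 W True ck R in auto)
      also have "\<dots> \<le> N / ((real N)\<^sup>2 * coface_prob (k + 1))"
        using R W(2) card_mono[of W "W - U"] fV by (intro divide_right_mono) auto
      also have "\<dots> = \<alpha>" using R by (simp add: \<alpha>_def power2_eq_square)
      finally show ?thesis .
    qed
    have "?EX (\<lambda>Y. (if G (Y1 \<union> Y) \<pi> then E Y \<pi> else 0)\<^sup>2)
      \<le> ?EX (\<lambda>Y. 3 * (c \<pi>)\<^sup>2 * D Y + (3 * (real k + 1)\<^sup>2 * \<alpha> * (c \<pi>)\<^sup>2 + 12 * (real k + 1) * K * \<alpha> * q (W \<inter> U) \<pi>))"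
    proof (rule mono)
      fix Y assume Y: "Y \<subseteq> Pow V - Pow U"
      then have YU: "Y \<inter> Pow U = {}" by auto
      show "(if G (Y1 \<union> Y) \<pi> then E Y \<pi> else 0)\<^sup>2
        \<le> 3 * (c \<pi>)\<^sup>2 * D Y + (3 * (real k + 1)\<^sup>2 * \<alpha> * (c \<pi>)\<^sup>2 + 12 * (real k + 1) * K * \<alpha> * q (W \<inter> U) \<pi>)"
      proof (cases "G (Y1 \<union> Y) \<pi>")
        case g: True
        have cf: "card {x \<in> U - \<pi>. insert x \<pi> \<in> down_complex Y1} \<le> K * N * coface_prob (k + 1)"
          by (rule G[OF Y g pU ck])
        have "(E Y \<pi>)\<^sup>2 \<le> 3 * (c \<pi>)\<^sup>2 * D Y + 3 * (real k + 1)\<^sup>2 * \<alpha> * (c \<pi>)\<^sup>2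
            + 12 * (real k + 1) * K * \<alpha> * q (W \<inter> U) \<pi>"
          unfolding E_def D_def q_def
        proof (rule cone_error_bound_inside[OF U W N K Y1 YU _ _ True ck cf \<alpha>_def])
          show "\<sigma> \<in> down_complex Y1" if "c \<sigma> \<noteq> 0" for \<sigma> by (rule c[OF that])
          show "card {x \<in> U - \<rho>. insert x \<rho> \<in> down_complex Y1} \<le> K * N * coface_prob k"
            if "c \<sigma> \<noteq> 0" "\<rho> \<subseteq> \<sigma>" "card \<rho> = k" for \<sigma> \<rho> by (rule facet[OF that])
        qed
        then show ?thesis using g by (simp only: if_True add.assoc)
      next
        case False
        then show ?thesis using K \<alpha>0 unfolding D_def q_def
          by (auto intro!: add_nonneg_nonneg mult_nonneg_nonneg sum_nonneg)
      qed
    qed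
    also have "\<dots> = 3 * (c \<pi>)\<^sup>2 * ?EX D + (3 * (real k + 1)\<^sup>2 * \<alpha> * (c \<pi>)\<^sup>2 + 12 * (real k + 1) * K * \<alpha> * q (W \<inter> U) \<pi>)"
      by (simp only: subset_expectation_add subset_expectation_cmult subset_expectation_const[OF fV(1)])
    also have "\<dots> \<le> 3 * (c \<pi>)\<^sup>2 * \<alpha> + (3 * (real k + 1)\<^sup>2 * \<alpha> * (c \<pi>)\<^sup>2 + 12 * (real k + 1) * K * \<alpha> * q (W \<inter> U) \<pi>)"
      using D by (intro add_mono mult_left_mono order_refl) auto
    finally show ?thesis by (simp add: algebra_simps)
  qed
  \<comment> \<open>As \<open>c\<close> lives inside \<open>U\<close>, the error at such a
    \<open>\<pi>\<close> can only come from exchanging a vertex \<open>v\<close> of \<open>W\<close>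
    that is its only vertex outside \<open>U\<close>. Then \<open>\<pi> - {v}\<close> plays the role
    of \<open>\<rho>\<close> in the off-diagonal estimate; in all other cases the error is
    zero.\<close>
  have outside: "?EX (\<lambda>Y. (if G (Y1 \<union> Y) \<pi> then E Y \<pi> else 0)\<^sup>2) \<le> \<alpha> / N * q (W - U) \<pi>"
    if pV: "\<pi> \<subseteq> V" and pU: "\<not> \<pi> \<subseteq> U" and ck: "card \<pi> = k + 1" for \<pi>
  proof -
    have q0: "0 \<le> \<alpha> / N * q (W - U) \<pi>" unfolding q_def using \<alpha>0
      by (intro mult_nonneg_nonneg sum_nonneg) auto
    have cU: "\<sigma> \<subseteq> U" if "c \<sigma> \<noteq> 0" for \<sigma> using c[OF that] down_complex_subset Y1 by blast
    show ?thesis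
    proof (cases "\<exists>v\<in>\<pi> \<inter> W. v \<notin> U \<and> \<pi> - {v} \<subseteq> U")
      case False
      have "E Y \<pi> = 0" for Y
      proof -
        have "c \<pi> = 0" using cU pU by auto
        moreover have "c (insert x (\<pi> - {v})) = 0" if "v \<in> \<pi> \<inter> W" for v x
          using False cU[of "insert x (\<pi> - {v})"] that pU by (cases "v \<in> U") auto
        ultimately show ?thesis by (simp add: E_def cone_error_def)
      qed
      then have "(\<lambda>Y. (if G (Y1 \<union> Y) \<pi> then E Y \<pi> else 0)\<^sup>2) = (\<lambda>Y. 0)" by auto
      then show ?thesis using q0 by (simp only: subset_expectation_const[OF fV(1)])
    next
      case True
      then obtain v where v: "v \<in> \<pi>" "v \<in> W" "v \<notin> U" "\<pi> - {v} \<subseteq> U" by auto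
      define \<rho> where "\<rho> = \<pi> - {v}"
      have fp: "finite \<pi>" using pV finite_V finite_subset by auto
      have \<rho>: "\<rho> \<subseteq> U" "card \<rho> = k" "insert v \<rho> = \<pi>" using v ck fp by (auto simp: \<rho>_def)
      have uniq: "c (insert x (\<pi> - {w})) = 0" if "w \<in> \<pi> \<inter> W" "w \<noteq> v" for w x
        using cU[of "insert x (\<pi> - {w})"] that v by auto
      define T where "T = (\<lambda>Y. of_bool (insert v \<rho> \<in> down_complex (Y1 \<union> Y)) *
        (\<Sum>x\<in>V - insert v \<rho>. csgn x \<rho> * (1 / (N * coface_prob k) - 1 / (N * coface_prob (k + 1)) *
          of_bool (insert x (insert v \<rho>) \<in> down_complex (Y1 \<union> Y))) * c (insert x \<rho>)))"
      have EY: "E Y \<pi> = csgn v \<rho> * T Y" for Y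
      proof -
        have "c \<pi> = 0" using cU pU by auto
        moreover have "(\<Sum>w\<in>\<pi> \<inter> W. csgn w (\<pi> - {w}) * (\<Sum>x\<in>V - \<pi>. csgn x (\<pi> - {w}) *
          (1 / (N * coface_prob k) - \<alpha> * of_bool (insert x \<pi> \<in> down_complex (Y1 \<union> Y))) * c (insert x (\<pi> - {w}))))
          = (\<Sum>w\<in>{v}. csgn w (\<pi> - {w}) * (\<Sum>x\<in>V - \<pi>. csgn x (\<pi> - {w}) *
          (1 / (N * coface_prob k) - \<alpha> * of_bool (insert x \<pi> \<in> down_complex (Y1 \<union> Y))) * c (insert x (\<pi> - {w}))))"
          using uniq fV v by (intro sum.mono_neutral_right) auto
        ultimately show ?thesis
          unfolding E_def cone_error_def T_def \<rho>(3) using ck by (simp add: \<rho>_def \<alpha>_def)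
      qed
      have "?EX (\<lambda>Y. (if G (Y1 \<union> Y) \<pi> then E Y \<pi> else 0)\<^sup>2) \<le> ?EX (\<lambda>Y. (T Y)\<^sup>2)"
        by (rule mono) (auto simp: EY power_mult_distrib)
      also have "\<dots> \<le> (\<Sum>x\<in>V - insert v \<rho>. (c (insert x \<rho>))\<^sup>2) / ((real N)\<^sup>2 * coface_prob (k + 1))"
        unfolding T_def by (rule second_moment_off_diagonal) (use U Y1 v W \<rho> c R in auto)
      also have "\<dots> = \<alpha> / N * (\<Sum>x\<in>V - \<pi>. (c (insert x (\<pi> - {v})))\<^sup>2)"
        unfolding \<rho>(3) by (simp add: \<alpha>_def power2_eq_square \<rho>_def)
      also have "\<dots> \<le> \<alpha> / N * q (W - U) \<pi>"
        unfolding q_def using \<alpha>0 v fV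
        by (intro mult_left_mono member_le_sum[of v "\<pi> \<inter> (W - U)" "\<lambda>v. \<Sum>x\<in>V - \<pi>. (c (insert x (\<pi> - {v})))\<^sup>2"])
           (auto intro!: sum_nonneg)
      finally show ?thesis .
    qed
  qed
  have qsum: "(\<Sum>\<pi>\<in>S. q A \<pi>) \<le> card A * (real k + 1) * M" if "A \<subseteq> W" for A
    unfolding q_def S_def M_def
    by (rule sum_exchange_vertex_le) (use finite_V fV that finite_subset in auto)
  have q0: "0 \<le> q A \<pi>" for A \<pi> by (simp add: q_def sum_nonneg)
  have "?EX (\<lambda>Y. \<Sum>\<pi>\<in>S. (if G (Y1 \<union> Y) \<pi> then E Y \<pi> else 0)\<^sup>2)
    = (\<Sum>\<pi>\<in>S. ?EX (\<lambda>Y. (if G (Y1 \<union> Y) \<pi> then E Y \<pi> else 0)\<^sup>2))"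
    by (rule subset_expectation_sum)
  also have "\<dots> \<le> (\<Sum>\<pi>\<in>S. (3 + 3 * (real k + 1)\<^sup>2) * \<alpha> * (c \<pi>)\<^sup>2 + 12 * (real k + 1) * K * \<alpha> * q (W \<inter> U) \<pi>
       + \<alpha> / N * q (W - U) \<pi>)"
  proof (rule sum_mono)
    fix \<pi> assume p: "\<pi> \<in> S"
    show "?EX (\<lambda>Y. (if G (Y1 \<union> Y) \<pi> then E Y \<pi> else 0)\<^sup>2) \<le> (3 + 3 * (real k + 1)\<^sup>2) * \<alpha> * (c \<pi>)\<^sup>2
       + 12 * (real k + 1) * K * \<alpha> * q (W \<inter> U) \<pi> + \<alpha> / N * q (W - U) \<pi>"
    proof (cases "\<pi> \<subseteq> U")
      case True
      have "0 \<le> \<alpha> / N * q (W - U) \<pi>" using q0 \<alpha>0 by simp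
      then show ?thesis using inside[OF True] p by (simp add: S_def)
    next
      case False
      have "0 \<le> (3 + 3 * (real k + 1)\<^sup>2) * \<alpha> * (c \<pi>)\<^sup>2 + 12 * (real k + 1) * K * \<alpha> * q (W \<inter> U) \<pi>"
        using q0 \<alpha>0 K by (intro add_nonneg_nonneg mult_nonneg_nonneg) auto
      then show ?thesis using outside[OF _ False] p by (simp add: S_def)
    qed
  qed
  also have "\<dots> = (3 + 3 * (real k + 1)\<^sup>2) * \<alpha> * M + 12 * (real k + 1) * K * \<alpha> * (\<Sum>\<pi>\<in>S. q (W \<inter> U) \<pi>)
       + \<alpha> / N * (\<Sum>\<pi>\<in>S. q (W - U) \<pi>)"
    by (simp only: sum.distrib sum_distrib_left[symmetric] M_def)
  \<comment> \<open>Summed over all simplices, exchanges at the vertices of \<open>A\<close> cost a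
    factor \<open>card A * (k + 1)\<close>. For \<open>W \<inter> U\<close> this is bounded; for
    \<open>W - U\<close> it can be of order \<open>N\<close>, which the additional
    \<open>1 / N\<close> in the variance offsets.\<close>
  also have "\<dots> \<le> (3 + 3 * (real k + 1)\<^sup>2) * \<alpha> * M + 12 * (real k + 1) * K * \<alpha> * ((real k + 1) * (real k + 1) * M)
       + \<alpha> / N * (N * (real k + 1) * M)"
  proof (intro add_mono mult_left_mono order_refl)
    have "(\<Sum>\<pi>\<in>S. q (W \<inter> U) \<pi>) \<le> card (W \<inter> U) * (real k + 1) * M" by (rule qsum) auto
    also have "\<dots> \<le> (real k + 1) * (real k + 1) * M" using W3 M0 by (intro mult_right_mono) auto
    finally show "(\<Sum>\<pi>\<in>S. q (W \<inter> U) \<pi>) \<le> (real k + 1) * (real k + 1) * M" by simp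
    have "(\<Sum>\<pi>\<in>S. q (W - U) \<pi>) \<le> card (W - U) * (real k + 1) * M" by (rule qsum) auto
    also have "\<dots> \<le> N * (real k + 1) * M" using W(2) M0 card_mono[of W "W - U"] fV by (intro mult_right_mono) auto
    finally show "(\<Sum>\<pi>\<in>S. q (W - U) \<pi>) \<le> N * (real k + 1) * M" by simp
  qed (use \<alpha>0 K in auto)
  also have "\<dots> = cone_step_constant k K * \<alpha> * M"
    using R by (simp add: cone_step_constant_def power3_eq_cube algebra_simps)
  finally show ?thesis unfolding E_def \<alpha>_def S_def M_def by (simp only: times_divide_eq_right mult_1_right)
qed

end

section \<open>Betti numbers of random complexes\<close>

text \<open>Inside \<open>U\<close>, only simplices inside \<open>U\<close> enter the formula. A
  simplex that leaves \<open>U\<close> keeps an outside vertex when a vertex of \<open>W\<close> is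
  exchanged, so both errors vanish there.\<close>

lemma cone_error_cong:
  assumes X: "X \<inter> Pow U = X' \<inter> Pow U" and W: "W \<subseteq> U" and c: "\<And>\<pi>. c \<pi> \<noteq> 0 \<Longrightarrow> \<pi> \<subseteq> U"
  shows "cone_error k V \<alpha> \<alpha>' W X c = cone_error k V \<alpha> \<alpha>' W X' c"
proof
  fix \<pi>
  have XU: "\<sigma> \<in> X \<longleftrightarrow> \<sigma> \<in> X'" if "\<sigma> \<subseteq> U" for \<sigma> using X that by auto
  show "cone_error k V \<alpha> \<alpha>' W X c \<pi> = cone_error k V \<alpha> \<alpha>' W X' c \<pi>"
  proof (cases "\<pi> \<subseteq> U")
    case True
    have 1: "(\<Sum>x\<in>W - \<pi>. of_bool (insert x \<pi> \<in> X)) = (\<Sum>x\<in>W - \<pi>. of_bool (insert x \<pi> \<in> X') :: real)"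
      by (intro sum.cong refl arg_cong[where f = of_bool] XU) (use True W in auto)
    have 2: "(\<alpha>' - \<alpha> * of_bool (insert x \<pi> \<in> X)) * c (insert x (\<pi> - {v}))
       = (\<alpha>' - \<alpha> * of_bool (insert x \<pi> \<in> X')) * c (insert x (\<pi> - {v}))" for x v
    proof (cases "c (insert x (\<pi> - {v})) = 0")
      case False
      then have "insert x \<pi> \<subseteq> U" using c[OF False] True by auto
      then show ?thesis using XU by simp
    qed simp
    show ?thesis unfolding cone_error_def XU[OF True] 1 mult.assoc 2 ..
  next
    case False
    have "c \<pi> = 0" using c False by auto
    moreover have "c (insert x (\<pi> - {v})) = 0" if "v \<in> \<pi> \<inter> W" for x v
      using c[of "insert x (\<pi> - {v})"] False that W by auto
    ultimately show ?thesis by (simp add: cone_error_def)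
  qed
qed

lemma cone_error_support:
  assumes "cone_error k V \<alpha> \<alpha>' W X c \<pi> \<noteq> 0"
  shows "\<pi> \<in> X" "card \<pi> = k + 1" "c \<pi> \<noteq> 0 \<or> (\<exists>v\<in>\<pi> \<inter> W. \<exists>x. c (insert x (\<pi> - {v})) \<noteq> 0)"
proof -
  show "\<pi> \<in> X" "card \<pi> = k + 1" using assms by (auto simp: cone_error_def split: if_splits)
  show "c \<pi> \<noteq> 0 \<or> (\<exists>v\<in>\<pi> \<inter> W. \<exists>x. c (insert x (\<pi> - {v})) \<noteq> 0)"
  proof (rule ccontr)
    assume "\<not> ?thesis"
    then have c0: "c \<pi> = 0" and c1: "\<And>v x. v \<in> \<pi> \<inter> W \<Longrightarrow> c (insert x (\<pi> - {v})) = 0" by auto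
    have "(\<Sum>v\<in>\<pi> \<inter> W. csgn v (\<pi> - {v}) * (\<Sum>x\<in>V - \<pi>. csgn x (\<pi> - {v}) *
          (\<alpha>' - \<alpha> * of_bool (insert x \<pi> \<in> X)) * c (insert x (\<pi> - {v})))) = 0"
      by (intro sum.neutral ballI) (simp add: c1)
    then show False using assms c0 unfolding cone_error_def by (simp split: if_splits)
  qed
qed

lemma cone_error_sum:
  "cone_error k V \<alpha> \<alpha>' W X (\<lambda>\<pi>. \<Sum>s\<in>S. f s * g s \<pi>) \<pi> = (\<Sum>s\<in>S. f s * cone_error k V \<alpha> \<alpha>' W X (g s) \<pi>)"
proof (cases "\<pi> \<in> X \<and> card \<pi> = k + 1")
  case True
  have sw: "(\<Sum>v\<in>A. d v * (\<Sum>x\<in>B. e v x * (\<Sum>s\<in>S. f s * h s v x))) = (\<Sum>s\<in>S. f s * (\<Sum>v\<in>A. d v * (\<Sum>x\<in>B. e v x * h s v x)))"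
    for A :: "'v set" and B :: "'v set" and d :: "'v \<Rightarrow> real" and e and h
  proof -
    have "(\<Sum>v\<in>A. d v * (\<Sum>x\<in>B. e v x * (\<Sum>s\<in>S. f s * h s v x))) = (\<Sum>v\<in>A. \<Sum>x\<in>B. \<Sum>s\<in>S. f s * (d v * (e v x * h s v x)))"
      by (simp add: sum_distrib_left algebra_simps)
    also have "\<dots> = (\<Sum>v\<in>A. \<Sum>s\<in>S. \<Sum>x\<in>B. f s * (d v * (e v x * h s v x)))"
      by (intro sum.cong refl sum.swap)
    also have "\<dots> = (\<Sum>s\<in>S. \<Sum>v\<in>A. \<Sum>x\<in>B. f s * (d v * (e v x * h s v x)))" by (rule sum.swap)
    finally show ?thesis by (simp add: sum_distrib_left)
  qed
  show ?thesis using True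
    by (simp add: cone_error_def sw distrib_left sum.distrib) (simp add: sum_distrib_left mult.left_commute)
qed (auto simp: cone_error_def)

section \<open>Betti numbers through independent families of cycles\<close>

definition homology_independent :: "nat \<Rightarrow> 'v::linorder set set \<Rightarrow> nat set \<Rightarrow> (nat \<Rightarrow> 'v set \<Rightarrow> real) \<Rightarrow> bool" where
  "homology_independent k X I z \<longleftrightarrow> finite I \<and> (\<forall>i\<in>I. z i \<in> cycles k X) \<and>
     (\<forall>a. (\<lambda>\<sigma>. \<Sum>i\<in>I. a i * z i \<sigma>) \<in> boundaries k X \<longrightarrow> (\<forall>i\<in>I. a i = 0))"

text \<open>
  Restricting the index set to \<open>nat\<close> loses nothing, as homology has finite dimension; if arbitrarily
  large families existed, the supremum would be the junk value \<open>0\<close>.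
\<close>

definition betti :: "nat \<Rightarrow> 'v::linorder set set \<Rightarrow> nat" where
  "betti k X = Sup {card I | I z. homology_independent k X I z}"

lemma homology_independent_empty: "homology_independent k X {} z"
  by (simp add: homology_independent_def)

lemma betti_leI:
  assumes "\<And>I z. homology_independent k X I z \<Longrightarrow> real (card I) \<le> b"
  shows "real (betti k X) \<le> b"
proof -
  have "card I \<le> nat \<lfloor>b\<rfloor>" if "homology_independent k X I z" for I z
    using assms[OF that] by (simp add: le_nat_floor)
  then have "betti k X \<le> nat \<lfloor>b\<rfloor>"
    unfolding betti_def using homology_independent_empty by (intro cSup_least) blast+
  moreover have "0 \<le> b" using assms[OF homology_independent_empty] by simp
  ultimately show ?thesis by (meson le_nat_floor le_floor_iff of_nat_le_iff of_nat_floor order_trans)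
qed

lemma homology_independent_card_le:
  fixes V :: "'v::linorder set"
  assumes V: "finite V" "X \<subseteq> Pow V" and X: "face_closed X" and J: "finite J"
    and ind: "homology_independent k X I z"
    and L: "\<And>j f. j \<in> J \<Longrightarrow> f \<in> cycles k X \<Longrightarrow> L j f = (\<Sum>s\<in>{s\<in>X. card s = k + 1}. f s * l j s)"
    and T: "\<And>f x. f \<in> cycles k X \<Longrightarrow> T f x = (\<Sum>s\<in>{s\<in>X. card s = k + 1}. f s * t s x)"
    and eps: "\<epsilon>\<^sup>2 = (1::real)"
    and id: "\<And>f. f \<in> cycles k X \<Longrightarrow> \<forall>j\<in>J. L j f = 0 \<Longrightarrow> (\<lambda>x. f x - \<epsilon> * T f x) \<in> boundaries k X"
  shows "real (card I) \<le> real (card J) + (\<Sum>s\<in>{s\<in>X. card s = k + 1}. \<Sum>x\<in>{s\<in>X. card s = k + 1}. (t s x)\<^sup>2)"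
proof (rule card_independent_le_constraints_plus_hilbert_schmidt[where L = L and T = T and z = z and
      B = "boundaries k X" and Z = "cycles k X" and \<epsilon> = \<epsilon> and l = l])
  show "finite {s \<in> X. card s = k + 1}" using V by (auto intro: finite_subset)
  show "finite I" using ind by (simp add: homology_independent_def)
  show "supported_on {s \<in> X. card s = k + 1} f" if "f \<in> cycles k X" for f
    using that by (auto simp: supported_on_def cycles_def chains_def)
  show "z i \<in> cycles k X" if "i \<in> I" for i using ind that by (simp add: homology_independent_def)
  show "\<forall>i\<in>I. a i = 0" if "(\<lambda>x. \<Sum>i\<in>I. a i * z i x) \<in> boundaries k X" for a
    using ind that by (simp add: homology_independent_def)
qed (use J subspace_boundaries subspace_cycles boundaries_subset_cycles[OF V X] L T eps id in auto)

text \<open>The trivial instance of the Hilbert-Schmidt bound: one constraint per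
  \<open>k\<close>-simplex forces its coefficient to vanish, only the zero cycle survives, and
  \<open>T = 0\<close> will do.\<close>

lemma betti_le_card:
  fixes V :: "'v::linorder set"
  assumes V: "finite V" "X \<subseteq> Pow V" and X: "face_closed X" and ind: "homology_independent k X I z"
  shows "card I \<le> card {s\<in>X. card s = k + 1}"
proof -
  define S where "S = {s\<in>X. card s = k + 1}"
  have fS: "finite S" using V by (auto intro: finite_subset simp: S_def)
  have "real (card I) \<le> real (card S) + (\<Sum>s\<in>S. \<Sum>x\<in>S. (0::real)\<^sup>2)"
    unfolding S_def
  proof (rule homology_independent_card_le[OF V X _ ind, where L = "\<lambda>j f. f j" and T = "\<lambda>f x. 0" and \<epsilon> = 1 and
        l = "\<lambda>j s. if s = j then 1 else 0" and t = "\<lambda>s x. 0"])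
    show "(\<lambda>x. f x - 1 * 0) \<in> boundaries k X"
      if "f \<in> cycles k X" "\<forall>j\<in>{s \<in> X. card s = k + 1}. f j = 0" for f
    proof -
      have "f x = 0" for x
      proof (rule ccontr)
        assume "f x \<noteq> 0"
        then have "x \<in> {s \<in> X. card s = k + 1}" using that(1) by (simp add: cycles_def chains_def)
        with that(2) \<open>f x \<noteq> 0\<close> show False by simp
      qed
      then have "f = (\<lambda>_. 0)" by (rule ext)
      then show ?thesis using fs.subspace_0[OF subspace_boundaries] by (simp add: zero_fun_def)
    qed
  qed (use fS in \<open>auto simp: S_def if_distrib cong: if_cong\<close>)
  then show ?thesis by (simp add: S_def)
qed

lemma card_le_betti:
  fixes V :: "'v::linorder set"
  assumes "finite V" "X \<subseteq> Pow V" "face_closed X" "homology_independent k X I z"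
  shows "card I \<le> betti k X"
  unfolding betti_def
  by (intro cSup_upper bdd_aboveI[of _ "card {s\<in>X. card s = k + 1}"])
     (use assms betti_le_card[OF assms(1,2,3)] in auto)

lemma betti_le_card_simplices:
  fixes V :: "'v::linorder set"
  assumes "finite V" "X \<subseteq> Pow V" "face_closed X"
  shows "real (betti k X) \<le> card {s\<in>X. card s = k + 1}"
  by (rule betti_leI) (use betti_le_card[OF assms] in auto)

text \<open>Coning from the single vertex \<open>v0\<close> with both weights equal to 1 is exact
  here: the diagonal and the off-diagonal coefficients of the cone error cancel, so every cycle
  bounds.\<close>

lemma betti_eq_0:
  fixes V :: "'v::linorder set"
  assumes V: "finite V" "X \<subseteq> Pow V" and X: "face_closed X" and v0: "v0 \<in> V"
    and full: "\<And>\<sigma>. \<sigma> \<subseteq> V \<Longrightarrow> card \<sigma> = k + 2 \<Longrightarrow> \<sigma> \<in> X"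
  shows "betti k X = 0"
proof -
  have cyc: "z \<in> boundaries k X" if z: "z \<in> cycles k X" for z
  proof -
    have "cone_error k V 1 1 {v0} X z \<pi> = 0" for \<pi>
    proof (cases "\<pi> \<in> X \<and> card \<pi> = k + 1")
      case True
      then have pV: "\<pi> \<subseteq> V" "finite \<pi>" using V finite_subset[of \<pi> V] by auto
      have i: "insert x \<pi> \<in> X" if "x \<in> V - \<pi>" for x by (rule full) (use that pV True in auto)
      show ?thesis
      proof (cases "v0 \<in> \<pi>")
        case True
        then have e: "\<pi> \<inter> {v0} = {v0}" "{v0} - \<pi> = {}" by auto
        show ?thesis unfolding cone_error_def e using i by simp
      next
        case False
        then have e: "\<pi> \<inter> {v0} = {}" "{v0} - \<pi> = {v0}" by auto
        show ?thesis unfolding cone_error_def e using i v0 False by simp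
      qed
    qed (auto simp: cone_error_def)
    with cone_homotopy[OF V X _ z, of "{v0}" 1 1] v0 show ?thesis by simp
  qed
  have "real (betti k X) \<le> 0"
  proof (rule betti_leI)
    fix I z assume ind: "homology_independent k X I z"
    have "(\<lambda>\<sigma>. \<Sum>i\<in>I. 1 * z i \<sigma>) \<in> cycles k X"
      by (rule fs_subspace_sum[OF subspace_cycles]) (use ind in \<open>auto simp: homology_independent_def\<close>)
    then have b: "(\<lambda>\<sigma>. \<Sum>i\<in>I. 1 * z i \<sigma>) \<in> boundaries k X" by (rule cyc)
    have H: "\<And>a. (\<lambda>\<sigma>. \<Sum>i\<in>I. a i * z i \<sigma>) \<in> boundaries k X \<Longrightarrow> \<forall>i\<in>I. a i = 0"
      using ind unfolding homology_independent_def by simp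
    have "\<forall>i\<in>I. (1::real) = 0" using H[of "\<lambda>_. 1", OF b] .
    then have "I = {}" by auto
    then show "real (card I) \<le> 0" by simp
  qed
  then show ?thesis by simp
qed

context random_complex_model
begin

text \<open>
  A batch may contain vertices of the simplex from which the iteration started, and for these the
  cone error is not centred. It is then bounded by Cauchy-Schwarz, which needs a bound on the
  number of cofaces; the simplices that violate it are removed at the price of one linear
  constraint each.
\<close>

definition good_simplex :: "nat \<Rightarrow> real \<Rightarrow> 'v set \<Rightarrow> 'v set set \<Rightarrow> 'v set \<Rightarrow> bool" where
  "good_simplex k B A X \<pi> \<longleftrightarrow>
     (\<forall>\<rho>. \<rho> \<subseteq> \<pi> \<and> card \<rho> \<in> {k, k + 1} \<longrightarrow> card {x\<in>A - \<rho>. insert x \<rho> \<in> X} \<le> B * coface_prob (card \<rho>))"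

text \<open>The truncation supplies the coface counts on which the next step relies. By then the
  vertices of \<open>W j\<close> belong to the explored set, so the counts have to include them;
  hence the union up to \<open>Suc j\<close>.\<close>

primrec cone_iterate ::
    "nat \<Rightarrow> real \<Rightarrow> nat \<Rightarrow> (nat \<Rightarrow> 'v set) \<Rightarrow> nat \<Rightarrow> 'v set set \<Rightarrow> ('v set \<Rightarrow> real) \<Rightarrow> 'v set \<Rightarrow> real" where
  "cone_iterate k B N W 0 X c = c"
| "cone_iterate k B N W (Suc j) X c = (\<lambda>\<pi>. if good_simplex k B (\<Union>i<Suc j. W i) X \<pi> then
     cone_error k V (1 / (N * coface_prob (k + 1))) (1 / (N * coface_prob k)) (W j) X (cone_iterate k B N W j X c) \<pi> else 0)"

lemma good_simplex_cong:
  assumes "X \<inter> Pow U = X' \<inter> Pow U" "A \<subseteq> U" "\<pi> \<subseteq> U"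
  shows "good_simplex k B A X \<pi> \<longleftrightarrow> good_simplex k B A X' \<pi>"
proof -
  have "{x\<in>A - \<rho>. insert x \<rho> \<in> X} = {x\<in>A - \<rho>. insert x \<rho> \<in> X'}" if "\<rho> \<subseteq> \<pi>" for \<rho>
  proof -
    have "insert x \<rho> \<in> X \<longleftrightarrow> insert x \<rho> \<in> X'" if "x \<in> A" for x
    proof -
      have "insert x \<rho> \<in> Pow U" using that \<open>\<rho> \<subseteq> \<pi>\<close> assms by auto
      then show ?thesis using assms(1) by blast
    qed
    then show ?thesis by auto
  qed
  then show ?thesis unfolding good_simplex_def by (metis (no_types, lifting))
qed

text \<open>The iteration from \<open>\<sigma>\<close> explores only \<open>\<sigma>\<close> and the
  batches used so far. This makes its \<open>j\<close>-th iterate constant when the expectation is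
  conditioned on the faces within that set.\<close>

lemma cone_iterate_local:
  assumes X: "X \<inter> Pow U = X' \<inter> Pow U" and U: "\<sigma> \<union> (\<Union>i<j. W i) \<subseteq> U"
  shows "cone_iterate k B N W j X (\<lambda>\<pi>. of_bool (\<pi> = \<sigma>)) = cone_iterate k B N W j X' (\<lambda>\<pi>. of_bool (\<pi> = \<sigma>))
    \<and> (\<forall>\<pi>. cone_iterate k B N W j X (\<lambda>\<pi>. of_bool (\<pi> = \<sigma>)) \<pi> \<noteq> 0 \<longrightarrow> \<pi> \<subseteq> \<sigma> \<union> (\<Union>i<j. W i))"
  using U
proof (induction j)
  case (Suc j)
  define c where "c = cone_iterate k B N W j X (\<lambda>\<pi>. of_bool (\<pi> = \<sigma>))"
  define E where "E = cone_error k V (1 / (N * coface_prob (k + 1))) (1 / (N * coface_prob k)) (W j)"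
  have WU: "W j \<subseteq> U" "(\<Union>i<j. W i) \<subseteq> U" "\<sigma> \<subseteq> U" using Suc.prems by (auto simp: lessThan_Suc)
  then have IH: "c = cone_iterate k B N W j X' (\<lambda>\<pi>. of_bool (\<pi> = \<sigma>))" "\<And>\<pi>. c \<pi> \<noteq> 0 \<Longrightarrow> \<pi> \<subseteq> \<sigma> \<union> (\<Union>i<j. W i)"
    using Suc.IH by (auto simp: c_def)
  have cU: "\<pi> \<subseteq> U" if "c \<pi> \<noteq> 0" for \<pi> using IH(2)[OF that] WU by blast
  have Eeq: "E X c = E X' c" unfolding E_def by (rule cone_error_cong[OF X WU(1) cU])
  have Esupp: "\<pi> \<subseteq> \<sigma> \<union> (\<Union>i<Suc j. W i)" if "E X c \<pi> \<noteq> 0" for \<pi>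
    using cone_error_support(3)[OF that[unfolded E_def]]
  proof
    assume "c \<pi> \<noteq> 0"
    from IH(2)[OF this] show ?thesis by (auto simp: lessThan_Suc)
  next
    assume "\<exists>v\<in>\<pi> \<inter> W j. \<exists>x. c (insert x (\<pi> - {v})) \<noteq> 0"
    then obtain v x where v: "v \<in> \<pi>" "v \<in> W j" "c (insert x (\<pi> - {v})) \<noteq> 0" by auto
    from IH(2)[OF v(3)] v(1,2) show ?thesis by (auto simp: lessThan_Suc)
  qed
  have "(if good_simplex k B (\<Union>i<Suc j. W i) X \<pi> then E X c \<pi> else 0)
    = (if good_simplex k B (\<Union>i<Suc j. W i) X' \<pi> then E X' c \<pi> else 0)" for \<pi>
  proof (cases "\<pi> \<subseteq> U")
    case True
    have "good_simplex k B (\<Union>i<Suc j. W i) X \<pi> = good_simplex k B (\<Union>i<Suc j. W i) X' \<pi>"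
      by (rule good_simplex_cong[OF X _ True]) (use Suc.prems in auto)
    then show ?thesis using Eeq by simp
  next
    case False
    then have "E X c \<pi> = 0" using Esupp[of \<pi>] Suc.prems by blast
    then show ?thesis using Eeq by simp
  qed
  moreover have "cone_iterate k B N W (Suc j) X (\<lambda>\<pi>. of_bool (\<pi> = \<sigma>)) =
      (\<lambda>\<pi>. if good_simplex k B (\<Union>i<Suc j. W i) X \<pi> then E X c \<pi> else 0)"
    unfolding cone_iterate.simps c_def E_def ..
  moreover have "cone_iterate k B N W (Suc j) X' (\<lambda>\<pi>. of_bool (\<pi> = \<sigma>)) =
      (\<lambda>\<pi>. if good_simplex k B (\<Union>i<Suc j. W i) X' \<pi> then E X' c \<pi> else 0)"
    unfolding cone_iterate.simps IH(1) E_def ..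
  ultimately show ?case using Esupp[unfolded Eeq] by (simp del: cone_iterate.simps)
qed auto

lemma cone_iterate_support:
  assumes "\<sigma> \<in> X" "card \<sigma> = k + 1" "B \<ge> 0" "cone_iterate k B N W j X (\<lambda>\<pi>. of_bool (\<pi> = \<sigma>)) \<pi> \<noteq> 0"
  shows "\<pi> \<in> X \<and> card \<pi> = k + 1 \<and> good_simplex k B (\<Union>i<j. W i) X \<pi>"
proof (cases j)
  case 0
  then show ?thesis using assms coface_prob_nonneg by (auto simp: good_simplex_def split: if_splits)
next
  case (Suc j')
  then have *: "good_simplex k B (\<Union>i<Suc j'. W i) X \<pi>"
    "cone_error k V (1 / (N * coface_prob (k + 1))) (1 / (N * coface_prob k)) (W j') X
       (cone_iterate k B N W j' X (\<lambda>\<pi>. of_bool (\<pi> = \<sigma>))) \<pi> \<noteq> 0"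
    using assms(4) by (simp_all split: if_splits)
  show ?thesis using cone_error_support[OF *(2)] *(1) Suc by simp
qed

lemma cone_iterate_sum:
  "cone_iterate k B N W j X (\<lambda>\<pi>. \<Sum>s\<in>S. f s * g s \<pi>) = (\<lambda>\<pi>. \<Sum>s\<in>S. f s * cone_iterate k B N W j X (g s) \<pi>)"
proof (induction j)
  case (Suc j)
  show ?case unfolding cone_iterate.simps Suc.IH by (auto simp: cone_error_sum intro!: ext)
qed simp

lemma cone_iterate_chain:
  assumes V: "X \<subseteq> Pow V" and c: "c \<in> chains k X"
  shows "cone_iterate k B N W j X c = (\<lambda>\<pi>. \<Sum>s\<in>{s\<in>X. card s = k + 1}. c s * cone_iterate k B N W j X (\<lambda>\<pi>. of_bool (\<pi> = s)) \<pi>)"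
proof -
  have fin: "finite {s\<in>X. card s = k + 1}" using V finite_V by (auto intro: finite_subset)
  have "c = (\<lambda>\<pi>. \<Sum>s\<in>{s\<in>X. card s = k + 1}. c s * of_bool (\<pi> = s))"
  proof
    fix \<pi>
    have "(\<Sum>s\<in>{s\<in>X. card s = k + 1}. c s * of_bool (\<pi> = s)) = (\<Sum>s\<in>{s\<in>X. card s = k + 1}. if s = \<pi> then c s else 0)"
      by (intro sum.cong) auto
    also have "\<dots> = c \<pi>" using fin c by (simp only: sum.delta) (auto simp: chains_def)
    finally show "c \<pi> = (\<Sum>s\<in>{s\<in>X. card s = k + 1}. c s * of_bool (\<pi> = s))" by simp
  qed
  then have "cone_iterate k B N W j X c = cone_iterate k B N W j X (\<lambda>\<pi>. \<Sum>s\<in>{s\<in>X. card s = k + 1}. c s * of_bool (\<pi> = s))"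
    by (rule arg_cong)
  then show ?thesis unfolding cone_iterate_sum .
qed

text \<open>The constraints require the untruncated error of each step to vanish at the bad
  simplices. Under them truncation changes nothing, so the iteration is repeated coning and
  \<open>f\<close> is homologous to \<open>(-1) ^ m\<close> times its \<open>m\<close>-th
  iterate.\<close>

lemma betti_le_bad_plus_hilbert_schmidt:
  assumes V: "X \<subseteq> Pow V" and X: "face_closed X" and W: "\<And>j. j < m \<Longrightarrow> W j \<subseteq> V"
  shows "real (betti k X) \<le> (\<Sum>j<m. real (card {\<pi>\<in>X. card \<pi> = k + 1 \<and> \<not> good_simplex k B (\<Union>i<Suc j. W i) X \<pi>}))
    + (\<Sum>s\<in>{s\<in>X. card s = k + 1}. \<Sum>\<pi>\<in>{s\<in>X. card s = k + 1}. (cone_iterate k B N W m X (\<lambda>\<pi>. of_bool (\<pi> = s)) \<pi>)\<^sup>2)"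
proof (rule betti_leI)
  fix I z assume ind: "homology_independent k X I z"
  define bad where "bad = (\<lambda>j. {\<pi>\<in>X. card \<pi> = k + 1 \<and> \<not> good_simplex k B (\<Union>i<Suc j. W i) X \<pi>})"
  define E where "E = (\<lambda>j. cone_error k V (1 / (N * coface_prob (k + 1))) (1 / (N * coface_prob k)) (W j) X)"
  define T where "T = (\<lambda>j. cone_iterate k B N W j X)"
  define S where "S = {s\<in>X. card s = k + 1}"
  define \<delta> :: "'v set \<Rightarrow> 'v set \<Rightarrow> real" where "\<delta> = (\<lambda>s \<pi>. of_bool (\<pi> = s))"
  have fX: "finite X" using V finite_V by (auto intro: finite_subset)
  have fJ: "finite (Sigma {..<m} bad)" using fX by (intro finite_SigmaI) (auto simp: bad_def)
  have Tsum: "T j f \<pi> = (\<Sum>s\<in>S. f s * T j (\<delta> s) \<pi>)" if "f \<in> cycles k X" for j f \<pi>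
    using cone_iterate_chain[OF V, of f k B N W j] that unfolding T_def S_def \<delta>_def by (simp add: cycles_def)
  have "real (card I) \<le> real (card (Sigma {..<m} bad)) + (\<Sum>s\<in>S. \<Sum>\<pi>\<in>S. (T m (\<delta> s) \<pi>)\<^sup>2)"
    unfolding S_def
  proof (rule homology_independent_card_le[OF finite_V V X fJ ind, where L = "\<lambda>(j, \<pi>) f. E j (T j f) \<pi>"
        and T = "T m" and \<epsilon> = "(-1) ^ m" and l = "\<lambda>(j, \<pi>) s. E j (T j (\<delta> s)) \<pi>"])
    show "(case j of (j, \<pi>) \<Rightarrow> \<lambda>f. E j (T j f) \<pi>) f
       = (\<Sum>s\<in>{s \<in> X. card s = k + 1}. f s * (case j of (j, \<pi>) \<Rightarrow> \<lambda>s. E j (T j (\<delta> s)) \<pi>) s)"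
      if "f \<in> cycles k X" for j f
    proof (cases j)
      case (Pair i \<pi>)
      have "T i f = (\<lambda>\<pi>. \<Sum>s\<in>S. f s * T i (\<delta> s) \<pi>)" using Tsum[OF that] by auto
      then show ?thesis by (simp add: Pair E_def cone_error_sum S_def)
    qed
    show "T m f \<pi> = (\<Sum>s\<in>{s \<in> X. card s = k + 1}. f s * T m (\<delta> s) \<pi>)" if "f \<in> cycles k X" for f \<pi>
      using Tsum[OF that] by (simp add: S_def)
    show "((- 1) ^ m)\<^sup>2 = (1::real)" by (simp add: power_mult[symmetric] mult.commute[of m])
    fix f assume f: "f \<in> cycles k X" and c: "\<forall>j\<in>Sigma {..<m} bad. (case j of (j, \<pi>) \<Rightarrow> \<lambda>f. E j (T j f) \<pi>) f = 0"
    have "j \<le> m \<Longrightarrow> T j f \<in> cycles k X \<and> (\<lambda>x. f x - (-1) ^ j * T j f x) \<in> boundaries k X" for j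
    proof (induction j)
      case 0
      show ?case using f fs.subspace_0[OF subspace_boundaries] by (simp add: T_def zero_fun_def)
    next
      case (Suc j)
      then have IH: "T j f \<in> cycles k X" "(\<lambda>x. f x - (-1) ^ j * T j f x) \<in> boundaries k X" and jm: "j < m" by auto
      have TE: "T (Suc j) f = E j (T j f)"
      proof
        fix \<pi>
        have "E j (T j f) \<pi> = 0" if "\<not> good_simplex k B (\<Union>i<Suc j. W i) X \<pi>"
        proof (cases "\<pi> \<in> X \<and> card \<pi> = k + 1")
          case True
          then have "(j, \<pi>) \<in> Sigma {..<m} bad" using that jm by (simp add: bad_def)
          from bspec[OF c this] show ?thesis by simp
        qed (auto simp: E_def cone_error_def)
        then show "T (Suc j) f \<pi> = E j (T j f) \<pi>" by (auto simp: T_def E_def)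
      qed
      have b: "(\<lambda>\<pi>. T j f \<pi> + T (Suc j) f \<pi>) \<in> boundaries k X"
        unfolding TE unfolding E_def by (rule cone_homotopy[OF finite_V V X W[OF jm] IH(1)])
      then have bz: "(\<lambda>\<pi>. T j f \<pi> + T (Suc j) f \<pi>) \<in> cycles k X"
        using boundaries_subset_cycles[OF finite_V V X] by auto
      have "T (Suc j) f \<in> cycles k X"
        using fs_subspace_lincomb[OF subspace_cycles bz IH(1), of 1 "-1"] by simp
      moreover have "(\<lambda>x. f x - (-1) ^ Suc j * T (Suc j) f x) \<in> boundaries k X"
        using fs_subspace_lincomb[OF subspace_boundaries IH(2) b, of 1 "(-1) ^ j"] by (simp add: algebra_simps)
      ultimately show ?case by simp
    qed
    from this[of m] show "(\<lambda>x. f x - (- 1) ^ m * T m f x) \<in> boundaries k X" by simp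
  qed
  moreover have "card (Sigma {..<m} bad) = (\<Sum>j<m. card (bad j))"
    using fX by (intro card_SigmaI) (auto simp: bad_def)
  ultimately show "real (card I) \<le> (\<Sum>j<m. real (card {\<pi>\<in>X. card \<pi> = k + 1 \<and> \<not> good_simplex k B (\<Union>i<Suc j. W i) X \<pi>}))
    + (\<Sum>s\<in>{s\<in>X. card s = k + 1}. \<Sum>\<pi>\<in>{s\<in>X. card s = k + 1}. (cone_iterate k B N W m X (\<lambda>\<pi>. of_bool (\<pi> = s)) \<pi>)\<^sup>2)"
    by (simp add: bad_def T_def \<delta>_def S_def)
qed

section \<open>Moments of the iterated cone errors\<close>

definition simplex_prob :: "nat \<Rightarrow> real" where
  "simplex_prob k = (\<Prod>i\<le>k. pr i ^ ((k + 1) choose (i + 1)))"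

lemma prod_weight_faces:
  assumes "card \<sigma> = k + 1"
  shows "(\<Prod>\<tau>\<in>Pow \<sigma> - {{}}. weight \<tau>) = simplex_prob k"
proof -
  have f: "finite \<sigma>" using assms by (simp add: card_ge_0_finite)
  \<comment> \<open>An index shift: the empty face receives the factor 1, so that the product may
    run over all subsets.\<close>
  define g where "g = (\<lambda>i. if i = 0 then 1 else pr (i - 1))"
  have "(\<Prod>\<tau>\<in>Pow \<sigma> - {{}}. weight \<tau>) = (\<Prod>\<tau>\<in>Pow \<sigma>. g (card \<tau>))"
    using f by (intro prod.mono_neutral_cong_left) (auto simp: g_def weight_def card_eq_0_iff dest: finite_subset)
  also have "\<dots> = (\<Prod>i\<le>Suc k. g i ^ ((k + 1) choose i))"
    using prod_Pow_card[OF f, of g] assms by simp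
  also have "\<dots> = simplex_prob k"
    by (simp add: prod.atMost_Suc_shift simplex_prob_def g_def del: prod.atMost_Suc binomial_Suc_Suc)
  finally show ?thesis .
qed

lemma simplex_prob_nonneg: "0 \<le> simplex_prob k"
  unfolding simplex_prob_def by (intro prod_nonneg zero_le_power pr_nonneg ballI)

lemma in_down_complex_iff: "\<sigma> \<noteq> {} \<Longrightarrow> \<sigma> \<in> down_complex Y \<longleftrightarrow> Pow \<sigma> - {{}} \<subseteq> Y"
  by (auto simp: down_complex_def)

lemma expectation_simplex:
  assumes "\<sigma> \<subseteq> V" "card \<sigma> = k + 1"
  shows "subset_expectation (Pow V - {{}}) weight (\<lambda>Y. of_bool (\<sigma> \<in> down_complex Y)) = simplex_prob k"
proof -
  have "\<sigma> \<noteq> {}" using assms by auto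
  then have "subset_expectation (Pow V - {{}}) weight (\<lambda>Y. of_bool (\<sigma> \<in> down_complex Y)) = (\<Prod>\<tau>\<in>Pow \<sigma> - {{}}. weight \<tau>)"
    unfolding in_down_complex_iff[OF \<open>\<sigma> \<noteq> {}\<close>]
    by (intro subset_expectation_superset) (use finite_V assms in auto)
  then show ?thesis using prod_weight_faces[OF assms(2)] by simp
qed

text \<open>Induction on \<open>j\<close>, conditioning on the faces inside \<open>U\<close>, the
  union of \<open>\<sigma>\<close> and the earlier batches. These fix the \<open>j\<close>-th
  iterate and the event \<open>\<sigma> \<in> down_complex Y\<close>, and one cone step multiplies
  the second moment by a single factor of the power. By disjointness the new batch meets
  \<open>U\<close> only in \<open>\<sigma>\<close>.\<close>

lemma cone_iterate_second_moment:
  fixes m N :: nat and B :: real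
  assumes \<sigma>: "\<sigma> \<subseteq> V" "card \<sigma> = k + 1"
    and W: "\<And>j. j < m \<Longrightarrow> W j \<subseteq> V" "\<And>j. j < m \<Longrightarrow> card (W j) = N"
      "\<And>i j. i < m \<Longrightarrow> j < m \<Longrightarrow> i \<noteq> j \<Longrightarrow> W i \<inter> W j = {}"
    and N: "N * coface_prob (k + 1) \<ge> 1" and B: "B = 4 * real m * real N" and jm: "j \<le> m"
  shows "subset_expectation (Pow V - {{}}) weight (\<lambda>Y. of_bool (\<sigma> \<in> down_complex Y) *
      (\<Sum>\<pi>\<in>{\<pi>\<in>Pow V. card \<pi> = k + 1}. (cone_iterate k B N W j (down_complex Y) (\<lambda>\<pi>. of_bool (\<pi> = \<sigma>)) \<pi>)\<^sup>2))
    \<le> (cone_step_constant k (4 * m + k + 1) / (N * coface_prob (k + 1))) ^ j * simplex_prob k"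
  using jm
proof (induction j)
  case 0
  have "(\<Sum>\<pi>\<in>{\<pi>\<in>Pow V. card \<pi> = k + 1}. (of_bool (\<pi> = \<sigma>) :: real)\<^sup>2) = (\<Sum>\<pi>\<in>{\<sigma>}. (of_bool (\<pi> = \<sigma>))\<^sup>2)"
    using finite_V \<sigma> by (intro sum.mono_neutral_right) auto
  then show ?case using expectation_simplex[OF \<sigma>] by simp
next
  case (Suc j)
  then have jm: "j < m" by simp
  define U where "U = \<sigma> \<union> (\<Union>i<j. W i)"
  define S where "S = {\<pi>\<in>Pow V. card \<pi> = k + 1}"
  define C where "C = cone_step_constant k (4 * m + k + 1)"
  define T where "T = (\<lambda>j X. cone_iterate k B N W j X (\<lambda>\<pi>. of_bool (\<pi> = \<sigma>)))"
  define F where "F = (\<lambda>j Y. of_bool (\<sigma> \<in> down_complex Y) * (\<Sum>\<pi>\<in>S. (T j (down_complex Y) \<pi>)\<^sup>2))"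
  have WV: "W i \<subseteq> V" if "i \<le> j" for i using W(1)[of i] that jm by simp
  have WUV: "(\<Union>i<j. W i) \<subseteq> V" by (rule UN_least) (simp add: WV)
  then have UV: "U \<subseteq> V" using \<sigma> by (simp add: U_def)
  have fs: "finite \<sigma>" "\<sigma> \<noteq> {}" using \<sigma> finite_subset[OF _ finite_V, of \<sigma>] by auto
  have R: "coface_prob (k + 1) > 0" "real N > 0"
    using N coface_prob_nonneg[of "k + 1"] by (cases "N = 0"; cases "coface_prob (k + 1) = 0"; simp)+
  have B0: "B \<ge> 0" by (simp add: B)
  have C0: "C \<ge> 0" by (simp add: C_def cone_step_constant_def)
  have fU: "finite U" using UV finite_subset[OF _ finite_V] by simp
  have NR: "1 \<le> N * coface_prob i" if "i \<in> {k, k + 1}" for i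
  proof -
    have "coface_prob (k + 1) \<le> coface_prob i" using that coface_prob_Suc_le[of k] by auto
    then have "N * coface_prob (k + 1) \<le> N * coface_prob i" by (intro mult_left_mono) auto
    then show ?thesis using N by linarith
  qed
  \<comment> \<open>Origin of \<open>K = 4 * m + k + 1\<close>: goodness bounds the cofaces with
    apex in the batches by \<open>4 * m * N * coface_prob (card \<rho>)\<close>, and the
    \<open>k + 1\<close> vertices of \<open>\<sigma>\<close> are absorbed because
    \<open>N * coface_prob (card \<rho>)\<close> is at least 1.\<close>
  have count: "card {x \<in> U - \<rho>. insert x \<rho> \<in> X} \<le> real (4 * m + k + 1) * N * coface_prob (card \<rho>)"
    if "good_simplex k B A X' \<pi>" "\<rho> \<subseteq> \<pi>" "card \<rho> \<in> {k, k + 1}" "X \<subseteq> X'" "(\<Union>i<j. W i) \<subseteq> A" "A \<subseteq> V" for X X' \<rho> A \<pi>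
  proof -
    have fA: "finite A" using that finite_subset[OF _ finite_V] by simp
    have "card {x \<in> U - \<rho>. insert x \<rho> \<in> X} \<le> card ({x \<in> A - \<rho>. insert x \<rho> \<in> X'} \<union> \<sigma>)"
      using that fA fs by (intro card_mono) (auto simp: U_def)
    also have "\<dots> \<le> card {x \<in> A - \<rho>. insert x \<rho> \<in> X'} + (k + 1)"
      using card_Un_le[of "{x \<in> A - \<rho>. insert x \<rho> \<in> X'}" \<sigma>] \<sigma> by simp
    finally have "real (card {x \<in> U - \<rho>. insert x \<rho> \<in> X}) \<le> card {x \<in> A - \<rho>. insert x \<rho> \<in> X'} + (real k + 1)" by simp
    also have "\<dots> \<le> B * coface_prob (card \<rho>) + (real k + 1) * (N * coface_prob (card \<rho>))"
      using that NR[OF that(3)] by (intro add_mono) (auto simp: good_simplex_def)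
    finally show ?thesis by (simp add: B algebra_simps)
  qed
  have split: "Pow V - {{}} = (Pow U - {{}}) \<union> (Pow V - Pow U)" using UV by auto
  have EXU: "subset_expectation (Pow V - {{}}) weight G = subset_expectation (Pow U - {{}}) weight
      (\<lambda>Y. subset_expectation (Pow V - Pow U) weight (\<lambda>Y'. G (Y \<union> Y')))" for G
    unfolding split by (rule subset_expectation_Un) (use finite_V fU in auto)
  have local: "down_complex (Y \<union> Y') \<inter> Pow U = down_complex Y \<inter> Pow U" if "Y' \<subseteq> Pow V - Pow U" for Y Y'
  proof -
    have "Y' \<inter> Pow U = {}" using that by auto
    then show ?thesis using down_complex_restrict by blast
  qed
  have Tloc: "T j (down_complex (Y \<union> Y')) = T j (down_complex Y)" if "Y' \<subseteq> Pow V - Pow U" for Y Y'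
    unfolding T_def using cone_iterate_local[OF local[OF that], of \<sigma> W j] by (simp add: U_def)
  have \<sigma>loc: "\<sigma> \<in> down_complex (Y \<union> Y') \<longleftrightarrow> \<sigma> \<in> down_complex Y" if "Y' \<subseteq> Pow V - Pow U" for Y Y'
    using local[OF that, of Y] by (auto simp: U_def)
  have step: "subset_expectation (Pow V - Pow U) weight (\<lambda>Y'. F (Suc j) (Y \<union> Y'))
      \<le> C / (N * coface_prob (k + 1)) * F j Y" if Y: "Y \<subseteq> Pow U - {{}}" for Y
  proof (cases "\<sigma> \<in> down_complex Y")
    case False
    then have "subset_expectation (Pow V - Pow U) weight (\<lambda>Y'. F (Suc j) (Y \<union> Y')) = subset_expectation (Pow V - Pow U) weight (\<lambda>Y'. 0)"
      by (intro subset_expectation_cong) (simp add: F_def \<sigma>loc)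
    then show ?thesis using False finite_V by (simp add: subset_expectation_const F_def)
  next
    case True
    define c where "c = T j (down_complex Y)"
    have cs: "\<pi> \<in> down_complex Y \<and> card \<pi> = k + 1 \<and> good_simplex k B (\<Union>i<j. W i) (down_complex Y) \<pi>" if "c \<pi> \<noteq> 0" for \<pi>
      using cone_iterate_support[OF True \<sigma>(2) B0] that by (simp add: c_def T_def)
    have "subset_expectation (Pow V - Pow U) weight (\<lambda>Y'. F (Suc j) (Y \<union> Y'))
      = subset_expectation (Pow V - Pow U) weight (\<lambda>Y'. \<Sum>\<pi>\<in>S.
        (if good_simplex k B (\<Union>i<Suc j. W i) (down_complex (Y \<union> Y')) \<pi>
         then cone_error k V (1 / (N * coface_prob (k + 1))) (1 / (N * coface_prob k)) (W j) (down_complex (Y \<union> Y')) c \<pi> else 0)\<^sup>2)"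
    proof (rule subset_expectation_cong)
      fix Y' assume Y': "Y' \<subseteq> Pow V - Pow U"
      have "T (Suc j) (down_complex (Y \<union> Y')) = (\<lambda>\<pi>. if good_simplex k B (\<Union>i<Suc j. W i) (down_complex (Y \<union> Y')) \<pi>
         then cone_error k V (1 / (N * coface_prob (k + 1))) (1 / (N * coface_prob k)) (W j) (down_complex (Y \<union> Y')) c \<pi> else 0)"
        unfolding T_def c_def cone_iterate.simps Tloc[OF Y', of Y, unfolded T_def] ..
      then show "F (Suc j) (Y \<union> Y') = (\<Sum>\<pi>\<in>S.
        (if good_simplex k B (\<Union>i<Suc j. W i) (down_complex (Y \<union> Y')) \<pi>
         then cone_error k V (1 / (N * coface_prob (k + 1))) (1 / (N * coface_prob k)) (W j) (down_complex (Y \<union> Y')) c \<pi> else 0)\<^sup>2)"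
        using True \<sigma>loc[OF Y'] by (simp add: F_def)
    qed
    also have "\<dots> \<le> C / (N * coface_prob (k + 1)) * (\<Sum>\<pi>\<in>S. (c \<pi>)\<^sup>2)"
      unfolding S_def C_def
    proof (rule expectation_cone_step[where G = "\<lambda>Y. good_simplex k B (\<Union>i<Suc j. W i) (down_complex Y)"])
      show "U \<subseteq> V" by fact
      show "W j \<subseteq> V" "card (W j) = N" using W jm by auto
      have "W j \<inter> U \<subseteq> \<sigma>"
      proof -
        have "W j \<inter> W i = {}" if "i < j" for i using W(3)[of j i] jm that by auto
        then show ?thesis by (auto simp: U_def)
      qed
      then show "card (W j \<inter> U) \<le> k + 1" using card_mono[OF fs(1)] \<sigma> by metis
      show "1 \<le> real N * coface_prob (k + 1)" by fact
      show "Y \<subseteq> Pow U" using Y by auto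
      show "\<pi> \<in> down_complex Y" if "c \<pi> \<noteq> 0" for \<pi> using cs[OF that] by simp
      have AV: "(\<Union>i<j. W i) \<subseteq> V" "(\<Union>i<Suc j. W i) \<subseteq> V" using WUV WV[of j] by (simp_all add: lessThan_Suc)
      show "card {x \<in> U - \<rho>. insert x \<rho> \<in> down_complex Y} \<le> real (4 * m + k + 1) * N * coface_prob k"
        if "c \<pi> \<noteq> 0" "\<rho> \<subseteq> \<pi>" "card \<rho> = k" for \<pi> \<rho>
        using count[of "\<Union>i<j. W i" "down_complex Y" \<pi> \<rho> "down_complex Y"] cs[OF that(1)] that AV by simp
      show "card {x \<in> U - \<pi>. insert x \<pi> \<in> down_complex Y} \<le> real (4 * m + k + 1) * N * coface_prob (k + 1)"
        if "Y' \<subseteq> Pow V - Pow U" "good_simplex k B (\<Union>i<Suc j. W i) (down_complex (Y \<union> Y')) \<pi>" "\<pi> \<subseteq> U" "card \<pi> = k + 1" for Y' \<pi>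
      proof -
        have sub: "(\<Union>i<j. W i) \<subseteq> (\<Union>i<Suc j. W i)" by (auto simp: lessThan_Suc)
        have mono: "down_complex Y \<subseteq> down_complex (Y \<union> Y')" by (auto simp: down_complex_def)
        show ?thesis using count[OF that(2) subset_refl _ mono sub AV(2)] that(4) by simp
      qed
    qed simp
    finally show ?thesis using True by (simp add: F_def c_def)
  qed
  have "subset_expectation (Pow V - {{}}) weight (F (Suc j))
     \<le> subset_expectation (Pow U - {{}}) weight (\<lambda>Y. C / (N * coface_prob (k + 1)) * F j Y)"
    unfolding EXU by (rule subset_expectation_mono[OF weight_bounds step])
  also have "\<dots> = C / (N * coface_prob (k + 1)) * subset_expectation (Pow V - {{}}) weight (F j)"
  proof -
    have "subset_expectation (Pow V - {{}}) weight (F j) = subset_expectation (Pow U - {{}}) weight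
        (\<lambda>Y. subset_expectation (Pow V - Pow U) weight (\<lambda>Y'. F j Y))"
      unfolding EXU by (intro subset_expectation_cong) (simp add: F_def \<sigma>loc Tloc)
    also have "\<dots> = subset_expectation (Pow U - {{}}) weight (F j)"
      using finite_V by (simp add: subset_expectation_const)
    finally show ?thesis unfolding subset_expectation_cmult by simp
  qed
  also have "\<dots> \<le> C / (N * coface_prob (k + 1)) * ((C / (N * coface_prob (k + 1))) ^ j * simplex_prob k)"
    using Suc.IH jm R C0 by (intro mult_left_mono) (auto simp: F_def T_def S_def C_def)
  finally show ?case by (simp add: F_def T_def S_def C_def mult.assoc)
qed

text \<open>A Chernoff bound. At each \<open>\<rho>\<close> the threshold is four times the bound
  \<open>y \<rho>\<close> on the expected number of cofaces, so the probability is at most a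
  constant times \<open>2 powr (- 4 * y \<rho>) * exp (y \<rho>)\<close>, hence times
  \<open>exp (- y \<rho>)\<close>. As \<open>y \<rho>\<close> contains the factor \<open>m\<close>,
  this reaches the same \<open>m\<close>-th power as the Hilbert-Schmidt term.\<close>

lemma expectation_bad_simplex:
  fixes m N :: nat and B :: real
  assumes \<pi>: "\<pi> \<subseteq> V" "card \<pi> = k + 1" and A: "A \<subseteq> V" "card A \<le> m * N"
    and N: "N * coface_prob (k + 1) \<ge> 1" and B: "B = 4 * real m * real N"
  shows "subset_expectation (Pow V - {{}}) weight
      (\<lambda>Y. of_bool (\<pi> \<in> down_complex Y \<and> \<not> good_simplex k B A (down_complex Y) \<pi>))
    \<le> 2 ^ (k + 2) * simplex_prob k * (1 / (N * coface_prob (k + 1))) ^ m"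
proof -
  define P where "P = {\<rho>\<in>Pow \<pi>. card \<rho> \<in> {k, k + 1}}"
  have fp: "finite \<pi>" "\<pi> \<noteq> {}" using \<pi> finite_subset[OF _ finite_V, of \<pi>] by auto
  have fP: "finite P" using fp by (simp add: P_def)
  have fA: "finite A" using A finite_subset[OF _ finite_V] by simp
  define y where "y = (\<lambda>\<rho> :: 'v set. m * N * coface_prob (card \<rho>))"
  define F where "F = (\<lambda>(\<rho> :: 'v set) x. insert x ` Pow \<rho>)"
  let ?EX = "subset_expectation (Pow V - {{}}) weight"
  have R: "coface_prob (k + 1) > 0" "real N > 0"
    using N coface_prob_nonneg[of "k + 1"] by (cases "N = 0"; cases "coface_prob (k + 1) = 0"; simp)+
  have one: "?EX (\<lambda>Y. of_bool (\<pi> \<in> down_complex Y \<and> real (card {x\<in>A - \<rho>. insert x \<rho> \<in> down_complex Y}) > B * coface_prob (card \<rho>)))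
      \<le> 2 * simplex_prob k * (1 / (N * coface_prob (k + 1))) ^ m" if \<rho>: "\<rho> \<in> P" for \<rho>
  proof -
    have rp: "\<rho> \<subseteq> \<pi>" "finite \<rho>" "card \<rho> \<in> {k, k + 1}" using \<rho> finite_subset[OF _ fp(1), of \<rho>] by (simp_all add: P_def)
    have "?EX (\<lambda>Y. of_bool (\<pi> \<in> down_complex Y \<and> real (card {x\<in>A - \<rho>. insert x \<rho> \<in> down_complex Y}) > B * coface_prob (card \<rho>)))
      \<le> ?EX (\<lambda>Y. 2 / (2 powr (4 * y \<rho>)) * (of_bool (Pow \<pi> - {{}} \<subseteq> Y) * 2 ^ card {x\<in>A - \<pi>. F \<rho> x \<subseteq> Y}))"
    proof (rule subset_expectation_mono[OF weight_bounds])
      fix Y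
      show "of_bool (\<pi> \<in> down_complex Y \<and> real (card {x\<in>A - \<rho>. insert x \<rho> \<in> down_complex Y}) > B * coface_prob (card \<rho>))
        \<le> 2 / (2 powr (4 * y \<rho>)) * (of_bool (Pow \<pi> - {{}} \<subseteq> Y) * 2 ^ card {x\<in>A - \<pi>. F \<rho> x \<subseteq> Y})"
      proof (cases "\<pi> \<in> down_complex Y \<and> real (card {x\<in>A - \<rho>. insert x \<rho> \<in> down_complex Y}) > B * coface_prob (card \<rho>)")
        case True
        have "F \<rho> x \<subseteq> Y" if x: "insert x \<rho> \<in> down_complex Y" for x
        proof
          fix \<tau> assume "\<tau> \<in> F \<rho> x"
          then have "\<tau> \<noteq> {}" "\<tau> \<subseteq> insert x \<rho>" by (auto simp: F_def)
          then show "\<tau> \<in> Y" using x by (simp add: down_complex_def)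
        qed
        \<comment> \<open>The vertex of \<open>\<pi>\<close> missing from \<open>\<rho>\<close>, if
          there is one, is set aside so that the faces counted are disjoint from those of
          \<open>\<pi>\<close>. It accounts for the extra factor 2.\<close>
        then have "card {x\<in>A - \<rho>. insert x \<rho> \<in> down_complex Y} \<le> card ({x\<in>A - \<pi>. F \<rho> x \<subseteq> Y} \<union> (\<pi> - \<rho>))"
          using fA fp by (intro card_mono) auto
        also have "\<dots> \<le> card {x\<in>A - \<pi>. F \<rho> x \<subseteq> Y} + card (\<pi> - \<rho>)" by (rule card_Un_le)
        also have "card (\<pi> - \<rho>) \<le> 1" using rp \<pi> by (auto simp: card_Diff_subset)
        finally have "card {x\<in>A - \<rho>. insert x \<rho> \<in> down_complex Y} \<le> card {x\<in>A - \<pi>. F \<rho> x \<subseteq> Y} + 1" by simp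
        then have "4 * y \<rho> \<le> real (card {x\<in>A - \<pi>. F \<rho> x \<subseteq> Y} + 1)" using True by (simp add: B y_def)
        then have "2 powr (4 * y \<rho>) \<le> 2 powr real (card {x\<in>A - \<pi>. F \<rho> x \<subseteq> Y} + 1)" by simp
        also have "\<dots> = 2 * 2 ^ card {x\<in>A - \<pi>. F \<rho> x \<subseteq> Y}" by (subst powr_realpow) auto
        finally have "1 \<le> 2 / (2 powr (4 * y \<rho>)) * 2 ^ card {x\<in>A - \<pi>. F \<rho> x \<subseteq> Y}" by simp
        moreover have "Pow \<pi> - {{}} \<subseteq> Y" using True in_down_complex_iff[OF fp(2)] by auto
        ultimately show ?thesis using True by simp
      next
        case False
        have "of_bool (\<pi> \<in> down_complex Y \<and> real (card {x\<in>A - \<rho>. insert x \<rho> \<in> down_complex Y}) > B * coface_prob (card \<rho>)) = (0::real)"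
          using False by (simp only: of_bool_eq(1))
        also have "0 \<le> 2 / (2 powr (4 * y \<rho>)) * (of_bool (Pow \<pi> - {{}} \<subseteq> Y) * 2 ^ card {x\<in>A - \<pi>. F \<rho> x \<subseteq> Y})"
          by simp
        finally show ?thesis .
      qed
    qed
    also have "\<dots> = 2 / (2 powr (4 * y \<rho>)) * (simplex_prob k * (1 + coface_prob (card \<rho>)) ^ card (A - \<pi>))"
      unfolding subset_expectation_cmult
    proof (subst subset_expectation_exponential_count)
      show "F \<rho> x \<subseteq> Pow V - {{}}" if "x \<in> A - \<pi>" for x using that A rp \<pi> by (auto simp: F_def)
      show "(Pow \<pi> - {{}}) \<inter> F \<rho> x = {}" if "x \<in> A - \<pi>" for x using that by (auto simp: F_def)
      show "F \<rho> i \<inter> F \<rho> j = {}" if "i \<in> A - \<pi>" "j \<in> A - \<pi>" "i \<noteq> j" for i j using that rp by (auto simp: F_def)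
      show "prod weight (F \<rho> i) = coface_prob (card \<rho>)" if "i \<in> A - \<pi>" for i
        unfolding F_def using prod_weight_insert_Pow[OF rp(2), of i] that rp by auto
      show "Pow \<pi> - {{}} \<subseteq> Pow V - {{}}" using \<pi> by auto
    qed (use finite_V fA prod_weight_faces[OF \<pi>(2)] in auto)
    also have "\<dots> \<le> 2 * exp (- 2 * y \<rho>) * (simplex_prob k * exp (y \<rho>))"
    proof (intro mult_mono mult_left_mono)
      have "exp (2 * y \<rho>) \<le> exp (4 * y \<rho> * ln 2)"
      proof -
        \<comment> \<open>All that is used is \<open>ln 2 \<ge> 1 / 2\<close>, whence
          \<open>2 powr (4 * y \<rho>) \<ge> exp (2 * y \<rho>)\<close>.\<close>
        have "ln (1 / 2 :: real) \<le> 1 / 2 - 1" by (rule ln_le_minus_one) simp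
        then have "1 / 2 \<le> ln (2::real)" by (simp add: ln_div)
        moreover have "y \<rho> \<ge> 0" by (simp add: y_def coface_prob_nonneg)
        ultimately have "4 * y \<rho> * (1/2) \<le> 4 * y \<rho> * ln 2" by (intro mult_left_mono) auto
        then show ?thesis by simp
      qed
      then have "exp (2 * y \<rho>) \<le> 2 powr (4 * y \<rho>)" by (simp add: powr_def mult.commute)
      then have "2 / 2 powr (4 * y \<rho>) \<le> 2 / exp (2 * y \<rho>)" by (intro divide_left_mono) auto
      then show "2 / 2 powr (4 * y \<rho>) \<le> 2 * exp (- 2 * y \<rho>)" by (simp add: exp_minus field_simps)
      have "(1 + coface_prob (card \<rho>)) ^ card (A - \<pi>) \<le> (exp (coface_prob (card \<rho>))) ^ card (A - \<pi>)"
        using coface_prob_nonneg[of "card \<rho>"] by (intro power_mono exp_ge_add_one_self) auto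
      also have "\<dots> = exp (card (A - \<pi>) * coface_prob (card \<rho>))" by (simp add: exp_of_nat_mult)
      also have "\<dots> \<le> exp (y \<rho>)"
      proof -
        have "card (A - \<pi>) \<le> m * N" using A card_mono[OF fA, of "A - \<pi>"] by auto
        then have "real (card (A - \<pi>)) \<le> real (m * N)" by (simp only: of_nat_le_iff)
        then have "card (A - \<pi>) * coface_prob (card \<rho>) \<le> real (m * N) * coface_prob (card \<rho>)"
          by (intro mult_right_mono coface_prob_nonneg)
        then show ?thesis by (simp add: y_def)
      qed
      finally show "(1 + coface_prob (card \<rho>)) ^ card (A - \<pi>) \<le> exp (y \<rho>)" .
    qed (use simplex_prob_nonneg coface_prob_nonneg[of "card \<rho>"] in auto)
    also have "\<dots> = 2 * simplex_prob k * exp (- y \<rho>)" by (simp flip: exp_add)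
    also have "\<dots> \<le> 2 * simplex_prob k * (1 / (N * coface_prob (k + 1))) ^ m"
    proof (intro mult_left_mono)
      have le: "coface_prob (k + 1) \<le> coface_prob (card \<rho>)" using rp(3) coface_prob_Suc_le[of k] by auto
      have "exp (- y \<rho>) = exp (- (N * coface_prob (card \<rho>))) ^ m"
      proof -
        have "- y \<rho> = of_nat m * (- (N * coface_prob (card \<rho>)))" by (simp add: y_def)
        then show ?thesis by (simp only: exp_of_nat_mult)
      qed
      also have "\<dots> \<le> (1 / (N * coface_prob (k + 1))) ^ m"
      proof (intro power_mono)
        have "N * coface_prob (k + 1) \<le> N * coface_prob (card \<rho>)" using le by (intro mult_left_mono) auto
        also have "\<dots> \<le> exp (N * coface_prob (card \<rho>))" using exp_ge_add_one_self[of "N * coface_prob (card \<rho>)"] by linarith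
        finally show "exp (- (N * coface_prob (card \<rho>))) \<le> 1 / (N * coface_prob (k + 1))"
          using R by (simp add: exp_minus field_simps)
      qed simp
      finally show "exp (- y \<rho>) \<le> (1 / (N * coface_prob (k + 1))) ^ m" .
    qed (use simplex_prob_nonneg in simp)
    finally show ?thesis .
  qed
  have "?EX (\<lambda>Y. of_bool (\<pi> \<in> down_complex Y \<and> \<not> good_simplex k B A (down_complex Y) \<pi>))
    \<le> ?EX (\<lambda>Y. \<Sum>\<rho>\<in>P. of_bool (\<pi> \<in> down_complex Y \<and> real (card {x\<in>A - \<rho>. insert x \<rho> \<in> down_complex Y}) > B * coface_prob (card \<rho>)))"
  proof (rule subset_expectation_mono[OF weight_bounds])
    fix Y
    show "of_bool (\<pi> \<in> down_complex Y \<and> \<not> good_simplex k B A (down_complex Y) \<pi>)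
      \<le> (\<Sum>\<rho>\<in>P. of_bool (\<pi> \<in> down_complex Y \<and> real (card {x\<in>A - \<rho>. insert x \<rho> \<in> down_complex Y}) > B * coface_prob (card \<rho>)) :: real)"
    proof (cases "\<pi> \<in> down_complex Y \<and> \<not> good_simplex k B A (down_complex Y) \<pi>")
      case True
      then obtain \<rho> where r: "\<rho> \<in> P" "real (card {x\<in>A - \<rho>. insert x \<rho> \<in> down_complex Y}) > B * coface_prob (card \<rho>)"
        by (auto simp: good_simplex_def P_def not_le)
      then have "1 \<le> (of_bool (\<pi> \<in> down_complex Y \<and> real (card {x\<in>A - \<rho>. insert x \<rho> \<in> down_complex Y}) > B * coface_prob (card \<rho>)) :: real)"
        using True by simp
      also have "\<dots> \<le> (\<Sum>\<rho>\<in>P. of_bool (\<pi> \<in> down_complex Y \<and> real (card {x\<in>A - \<rho>. insert x \<rho> \<in> down_complex Y}) > B * coface_prob (card \<rho>)))"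
        by (rule member_le_sum[OF r(1) _ fP]) simp
      finally show ?thesis using True by simp
    next
      case False
      have "of_bool (\<pi> \<in> down_complex Y \<and> \<not> good_simplex k B A (down_complex Y) \<pi>) = (0::real)"
        using False by (simp only: of_bool_eq(1))
      also have "0 \<le> (\<Sum>\<rho>\<in>P. of_bool (\<pi> \<in> down_complex Y \<and> real (card {x\<in>A - \<rho>. insert x \<rho> \<in> down_complex Y}) > B * coface_prob (card \<rho>)) :: real)"
        by (simp add: sum_nonneg)
      finally show ?thesis .
    qed
  qed
  also have "\<dots> = (\<Sum>\<rho>\<in>P. ?EX (\<lambda>Y. of_bool (\<pi> \<in> down_complex Y \<and> real (card {x\<in>A - \<rho>. insert x \<rho> \<in> down_complex Y}) > B * coface_prob (card \<rho>))))"
    by (rule subset_expectation_sum)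
  also have "\<dots> \<le> (\<Sum>\<rho>\<in>P. 2 * simplex_prob k * (1 / (N * coface_prob (k + 1))) ^ m)" by (intro sum_mono one)
  also have "\<dots> = card P * (2 * simplex_prob k * (1 / (N * coface_prob (k + 1))) ^ m)" by simp
  also have "\<dots> \<le> 2 ^ (k + 1) * (2 * simplex_prob k * (1 / (N * coface_prob (k + 1))) ^ m)"
  proof (intro mult_right_mono)
    have "card P \<le> card (Pow \<pi>)" using fp by (intro card_mono) (auto simp: P_def)
    also have "\<dots> = 2 ^ (k + 1)" using fp \<pi> by (simp add: card_Pow)
    finally show "real (card P) \<le> 2 ^ (k + 1)" by (metis numeral_power_le_of_nat_cancel_iff of_nat_le_iff of_nat_numeral of_nat_power)
  qed (use simplex_prob_nonneg R in auto)
  finally show ?thesis by simp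
qed

text \<open>The deterministic bound in expectation: each of the \<open>m\<close> truncations costs
  the Chernoff probability of a bad simplex, and the iterates cost their second moment. Both sums
  run over all possible \<open>k\<close>-simplices and have the same rate, hence the common
  factor.\<close>

lemma expectation_betti_batches_le:
  fixes m N :: nat
  assumes W: "\<And>j. j < m \<Longrightarrow> W j \<subseteq> V" "\<And>j. j < m \<Longrightarrow> card (W j) = N"
      "\<And>i j. i < m \<Longrightarrow> j < m \<Longrightarrow> i \<noteq> j \<Longrightarrow> W i \<inter> W j = {}"
    and N: "N * coface_prob (k + 1) \<ge> 1"
  shows "subset_expectation (Pow V - {{}}) weight (\<lambda>Y. betti k (down_complex Y))
    \<le> (m * 2 ^ (k + 2) + cone_step_constant k (4 * m + k + 1) ^ m) *
      (card {\<pi>\<in>Pow V. card \<pi> = k + 1} * simplex_prob k * (1 / (N * coface_prob (k + 1))) ^ m)"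
proof -
  define S where "S = {\<pi>\<in>Pow V. card \<pi> = k + 1}"
  define B where "B = 4 * real m * real N"
  define C where "C = cone_step_constant k (4 * m + k + 1)"
  define \<alpha> where "\<alpha> = 1 / (N * coface_prob (k + 1))"
  define A where "A = (\<lambda>j. \<Union>i<Suc j. W i)"
  define T where "T = (\<lambda>Y s \<pi>. cone_iterate k B N W m (down_complex Y) (\<lambda>\<pi>. of_bool (\<pi> = s)) \<pi>)"
  let ?EX = "subset_expectation (Pow V - {{}}) weight"
  have fS: "finite S" using finite_V by (simp add: S_def)
  have "?EX (\<lambda>Y. betti k (down_complex Y))
    \<le> ?EX (\<lambda>Y. (\<Sum>j<m. \<Sum>\<pi>\<in>S. of_bool (\<pi> \<in> down_complex Y \<and> \<not> good_simplex k B (A j) (down_complex Y) \<pi>))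
        + (\<Sum>s\<in>S. of_bool (s \<in> down_complex Y) * (\<Sum>\<pi>\<in>S. (T Y s \<pi>)\<^sup>2)))"
  proof (rule subset_expectation_mono[OF weight_bounds])
    fix Y assume Y: "Y \<subseteq> Pow V - {{}}"
    define X where "X = down_complex Y"
    have XV: "X \<subseteq> Pow V" using Y down_complex_subset[of Y] by (auto simp: X_def)
    have SX: "{s\<in>X. card s = k + 1} = {s\<in>S. s \<in> X}" using XV by (auto simp: S_def)
    have 1: "real (card {\<pi>\<in>X. card \<pi> = k + 1 \<and> \<not> good_simplex k B (\<Union>i<Suc j. W i) X \<pi>})
        = (\<Sum>\<pi>\<in>S. of_bool (\<pi> \<in> X \<and> \<not> good_simplex k B (A j) X \<pi>))" for j
    proof -
      have "{\<pi>\<in>X. card \<pi> = k + 1 \<and> \<not> good_simplex k B (\<Union>i<Suc j. W i) X \<pi>} = {\<pi>\<in>S. \<pi> \<in> X \<and> \<not> good_simplex k B (A j) X \<pi>}"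
        using XV by (auto simp: S_def A_def)
      then show ?thesis using fS by (simp add: of_bool_def sum.If_cases Int_def)
    qed
    have "real (betti k X) \<le> (\<Sum>j<m. real (card {\<pi>\<in>X. card \<pi> = k + 1 \<and> \<not> good_simplex k B (\<Union>i<Suc j. W i) X \<pi>}))
      + (\<Sum>s\<in>{s\<in>X. card s = k + 1}. \<Sum>\<pi>\<in>{s\<in>X. card s = k + 1}. (T Y s \<pi>)\<^sup>2)"
      unfolding T_def X_def[symmetric]
      by (rule betti_le_bad_plus_hilbert_schmidt[OF XV _ W(1)]) (simp_all add: X_def face_closed_down_complex)
    also have "(\<Sum>s\<in>{s\<in>X. card s = k + 1}. \<Sum>\<pi>\<in>{s\<in>X. card s = k + 1}. (T Y s \<pi>)\<^sup>2)
      \<le> (\<Sum>s\<in>{s\<in>S. s \<in> X}. \<Sum>\<pi>\<in>S. (T Y s \<pi>)\<^sup>2)"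
      unfolding SX using fS by (intro sum_mono sum_mono2) auto
    also have "\<dots> = (\<Sum>s\<in>S. of_bool (s \<in> X) * (\<Sum>\<pi>\<in>S. (T Y s \<pi>)\<^sup>2))"
      using fS by (intro sum.mono_neutral_cong_left) auto
    finally have "real (betti k X) \<le> (\<Sum>j<m. \<Sum>\<pi>\<in>S. of_bool (\<pi> \<in> X \<and> \<not> good_simplex k B (A j) X \<pi>))
        + (\<Sum>s\<in>S. of_bool (s \<in> X) * (\<Sum>\<pi>\<in>S. (T Y s \<pi>)\<^sup>2))"
      unfolding 1 by simp
    then show "real (betti k (down_complex Y)) \<le> (\<Sum>j<m. \<Sum>\<pi>\<in>S. of_bool (\<pi> \<in> down_complex Y \<and> \<not> good_simplex k B (A j) (down_complex Y) \<pi>))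
        + (\<Sum>s\<in>S. of_bool (s \<in> down_complex Y) * (\<Sum>\<pi>\<in>S. (T Y s \<pi>)\<^sup>2))"
      by (simp only: X_def)
  qed
  also have "\<dots> = (\<Sum>j<m. \<Sum>\<pi>\<in>S. ?EX (\<lambda>Y. of_bool (\<pi> \<in> down_complex Y \<and> \<not> good_simplex k B (A j) (down_complex Y) \<pi>)))
      + (\<Sum>s\<in>S. ?EX (\<lambda>Y. of_bool (s \<in> down_complex Y) * (\<Sum>\<pi>\<in>S. (T Y s \<pi>)\<^sup>2)))"
    by (simp only: subset_expectation_add subset_expectation_sum)
  also have "\<dots> \<le> (\<Sum>j<m. \<Sum>\<pi>\<in>S. 2 ^ (k + 2) * simplex_prob k * \<alpha> ^ m) + (\<Sum>s\<in>S. (C * \<alpha>) ^ m * simplex_prob k)"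
  proof (intro add_mono sum_mono)
    fix j \<pi> assume j: "j \<in> {..<m}" and \<pi>: "\<pi> \<in> S"
    have AV: "A j \<subseteq> V" unfolding A_def using W(1) j by (intro UN_least) auto
    have "card (A j) \<le> (\<Sum>i<Suc j. card (W i))" unfolding A_def by (rule card_UN_le) simp
    also have "\<dots> = (\<Sum>i<Suc j. N)" using W(2) j by (intro sum.cong) auto
    also have "\<dots> \<le> m * N" using j by (simp add: Suc_le_eq mult_le_mono1 flip: mult_Suc)
    finally have cA: "card (A j) \<le> m * N" .
    show "?EX (\<lambda>Y. of_bool (\<pi> \<in> down_complex Y \<and> \<not> good_simplex k B (A j) (down_complex Y) \<pi>)) \<le> 2 ^ (k + 2) * simplex_prob k * \<alpha> ^ m"
      unfolding \<alpha>_def by (rule expectation_bad_simplex[OF _ _ AV cA N B_def]) (use \<pi> in \<open>auto simp: S_def\<close>)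
  next
    fix s assume s: "s \<in> S"
    have "?EX (\<lambda>Y. of_bool (s \<in> down_complex Y) * (\<Sum>\<pi>\<in>S. (T Y s \<pi>)\<^sup>2)) \<le> (C / (N * coface_prob (k + 1))) ^ m * simplex_prob k"
      unfolding S_def T_def C_def
      by (rule cone_iterate_second_moment[OF _ _ W N B_def order_refl]) (use s in \<open>auto simp: S_def\<close>)
    then show "?EX (\<lambda>Y. of_bool (s \<in> down_complex Y) * (\<Sum>\<pi>\<in>S. (T Y s \<pi>)\<^sup>2)) \<le> (C * \<alpha>) ^ m * simplex_prob k"
      by (simp add: \<alpha>_def)
  qed
  also have "\<dots> = (m * 2 ^ (k + 2) + C ^ m) * (card S * simplex_prob k * \<alpha> ^ m)"
    by (simp add: power_mult_distrib algebra_simps)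
  finally show ?thesis by (simp add: S_def C_def \<alpha>_def)
qed

lemma expectation_betti_le_simplices:
  "subset_expectation (Pow V - {{}}) weight (\<lambda>Y. betti k (down_complex Y))
    \<le> card {\<pi>\<in>Pow V. card \<pi> = k + 1} * simplex_prob k"
proof -
  define S where "S = {\<pi>\<in>Pow V. card \<pi> = k + 1}"
  have fS: "finite S" using finite_V by (simp add: S_def)
  have "subset_expectation (Pow V - {{}}) weight (\<lambda>Y. betti k (down_complex Y))
    \<le> subset_expectation (Pow V - {{}}) weight (\<lambda>Y. \<Sum>\<pi>\<in>S. of_bool (\<pi> \<in> down_complex Y))"
  proof (rule subset_expectation_mono[OF weight_bounds])
    fix Y assume Y: "Y \<subseteq> Pow V - {{}}"
    have XV: "down_complex Y \<subseteq> Pow V" using Y down_complex_subset[of Y] by auto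
    have "real (betti k (down_complex Y)) \<le> card {s\<in>down_complex Y. card s = k + 1}"
      by (rule betti_le_card_simplices[OF finite_V XV face_closed_down_complex])
    also have "{s\<in>down_complex Y. card s = k + 1} = {s\<in>S. s \<in> down_complex Y}" using XV by (auto simp: S_def)
    also have "real (card \<dots>) = (\<Sum>\<pi>\<in>S. of_bool (\<pi> \<in> down_complex Y))"
      using fS by (simp add: of_bool_def sum.If_cases Int_def)
    finally show "real (betti k (down_complex Y)) \<le> (\<Sum>\<pi>\<in>S. of_bool (\<pi> \<in> down_complex Y))" .
  qed
  also have "\<dots> = (\<Sum>\<pi>\<in>S. simplex_prob k)"
    unfolding subset_expectation_sum by (intro sum.cong refl expectation_simplex) (auto simp: S_def)
  finally show ?thesis by (simp add: S_def)
qed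

text \<open>A union bound over missing simplices, meant for large times. The polynomial loss in
  \<open>card V\<close> does no harm, because the time from which it is applied can be a high power
  of \<open>card V\<close>.\<close>

lemma expectation_betti_le_missing:
  assumes "card V \<ge> 1"
  shows "subset_expectation (Pow V - {{}}) weight (\<lambda>Y. betti k (down_complex Y))
    \<le> card {\<pi>\<in>Pow V. card \<pi> = k + 1} * card {\<pi>\<in>Pow V. card \<pi> = k + 2} * (1 - simplex_prob (k + 1))"
proof -
  define S where "S = {\<pi>\<in>Pow V. card \<pi> = k + 1}"
  define S' where "S' = {\<pi>\<in>Pow V. card \<pi> = k + 2}"
  have fS: "finite S" "finite S'" using finite_V by (simp_all add: S_def S'_def)
  obtain v0 where v0: "v0 \<in> V" using assms by fastforce
  have "subset_expectation (Pow V - {{}}) weight (\<lambda>Y. betti k (down_complex Y))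
    \<le> subset_expectation (Pow V - {{}}) weight (\<lambda>Y. card S * (\<Sum>\<pi>\<in>S'. (1::real) + (- 1) * of_bool (\<pi> \<in> down_complex Y)))"
  proof (rule subset_expectation_mono[OF weight_bounds])
    fix Y assume Y: "Y \<subseteq> Pow V - {{}}"
    have XV: "down_complex Y \<subseteq> Pow V" using Y down_complex_subset[of Y] by auto
    show "real (betti k (down_complex Y)) \<le> card S * (\<Sum>\<pi>\<in>S'. (1::real) + (- 1) * of_bool (\<pi> \<in> down_complex Y))"
    proof (cases "\<exists>\<pi>\<in>S'. \<pi> \<notin> down_complex Y")
      case True
      then obtain \<pi> where p: "\<pi> \<in> S'" "\<pi> \<notin> down_complex Y" by auto
      have "1 = 1 + (- 1) * (of_bool (\<pi> \<in> down_complex Y) :: real)" using p by simp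
      also have "\<dots> \<le> (\<Sum>\<pi>\<in>S'. (1::real) + (- 1) * of_bool (\<pi> \<in> down_complex Y))"
        by (rule member_le_sum[OF p(1) _ fS(2)]) simp
      finally have 1: "1 \<le> (\<Sum>\<pi>\<in>S'. 1 + (- 1) * (of_bool (\<pi> \<in> down_complex Y) :: real))" .
      have "real (betti k (down_complex Y)) \<le> card {s\<in>down_complex Y. card s = k + 1}"
        by (rule betti_le_card_simplices[OF finite_V XV face_closed_down_complex])
      also have "\<dots> \<le> card S" using XV fS by (auto intro!: card_mono simp: S_def)
      also have "\<dots> \<le> card S * (\<Sum>\<pi>\<in>S'. 1 + (- 1) * (of_bool (\<pi> \<in> down_complex Y) :: real))"
        using mult_left_mono[OF 1, of "real (card S)"] by simp
      finally show ?thesis .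
    next
      case False
      have "betti k (down_complex Y) = 0"
        by (rule betti_eq_0[OF finite_V XV face_closed_down_complex v0]) (use False in \<open>auto simp: S'_def\<close>)
      then show ?thesis by (simp add: sum_nonneg)
    qed
  qed
  also have "\<dots> = card S * (\<Sum>\<pi>\<in>S'. 1 + (- 1) * simplex_prob (k + 1))"
  proof -
    have "subset_expectation (Pow V - {{}}) weight (\<lambda>Y. of_bool (\<pi> \<in> down_complex Y)) = simplex_prob (k + 1)" if "\<pi> \<in> S'" for \<pi>
      by (rule expectation_simplex) (use that in \<open>auto simp: S'_def\<close>)
    then show ?thesis using finite_V
      by (simp only: subset_expectation_cmult subset_expectation_sum subset_expectation_add subset_expectation_const finite_Diff finite_Pow_iff) (simp cong: sum.cong)
  qed
  finally show ?thesis by (simp add: S_def S'_def)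
qed

lemma exists_batches:
  "\<exists>W. (\<forall>j<m. W j \<subseteq> V \<and> card (W j) = card V div m) \<and> (\<forall>i<m. \<forall>j<m. i \<noteq> j \<longrightarrow> W i \<inter> W j = {})"
proof -
  define N where "N = card V div m"
  obtain f where f: "bij_betw f {..<card V} V"
    using ex_bij_betw_nat_finite[OF finite_V] by (auto simp: lessThan_atLeast0)
  define I where "I = (\<lambda>j. {j * N..<Suc j * N})"
  have I: "I j \<subseteq> {..<card V}" if "j < m" for j
  proof -
    have "Suc j * N \<le> m * N" using that by (intro mult_le_mono1) simp
    also have "\<dots> \<le> card V" by (simp add: N_def)
    finally show ?thesis by (auto simp: I_def)
  qed
  have disj: "I i \<inter> I j = {}" if "i < j" for i j
  proof -
    have "Suc i * N \<le> j * N" using that by (intro mult_le_mono1) simp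
    then show ?thesis by (auto simp: I_def)
  qed
  have inj: "inj_on f {..<card V}" and im: "f ` {..<card V} = V" using f by (auto simp: bij_betw_def)
  have "f ` I j \<subseteq> V \<and> card (f ` I j) = N" if "j < m" for j
    using I[OF that] im card_image[OF inj_on_subset[OF inj I[OF that]]] by (auto simp: I_def)
  moreover have "f ` I i \<inter> f ` I j = {}" if "i < m" "j < m" "i \<noteq> j" for i j
  proof -
    have "I i \<inter> I j = {}" using disj[of i j] disj[of j i] that by (cases "i < j") auto
    then show ?thesis using inj_on_image_Int[OF inj I[OF that(1)] I[OF that(2)]] by simp
  qed
  ultimately show ?thesis unfolding N_def by (intro exI[of _ "\<lambda>j. f ` I j"]) auto
qed

end

text \<open>The factor \<open>(2 * real m) ^ m\<close> converts batches of size at least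
  \<open>card V / (2 * m)\<close> back to \<open>card V\<close>; the summand 1 covers the range in
  which the batches are too small and simplices are merely counted.\<close>

definition betti_decay_constant :: "nat \<Rightarrow> nat \<Rightarrow> real" where
  "betti_decay_constant k m = (1 + real (m * 2 ^ (k + 2)) + cone_step_constant k (real (4 * m + k + 1)) ^ m) * (2 * real m) ^ m"

lemma card_subsets_le_power: "finite V \<Longrightarrow> real (card {\<pi>\<in>Pow V. card \<pi> = j}) \<le> real (card V) ^ j"
proof -
  assume "finite V"
  then have "card {\<pi>\<in>Pow V. card \<pi> = j} = card V choose j" using n_subsets[of V j] by (simp add: Pow_def)
  also have "\<dots> \<le> card V ^ j" by (cases "j \<le> card V") (auto intro: binomial_le_pow simp: binomial_eq_0)
  finally show ?thesis by (metis of_nat_le_iff of_nat_power)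
qed

context random_complex_model
begin

text \<open>The product form remains meaningful for \<open>coface_prob (k + 1) = 0\<close>. If
  \<open>card V * coface_prob (k + 1) < 2 * m\<close>, the power on the left is bounded and counting
  simplices is enough; otherwise the batches satisfy
  \<open>N * coface_prob (k + 1) \<ge> 1\<close>.\<close>

theorem expectation_betti_decay:
  assumes n: "card V \<ge> m"
  shows "(card V * coface_prob (k + 1)) ^ m * subset_expectation (Pow V - {{}}) weight (\<lambda>Y. betti k (down_complex Y))
    \<le> betti_decay_constant k m * (card V ^ (k + 1) * simplex_prob k)"
proof (cases "m = 0")
  case True
  have "subset_expectation (Pow V - {{}}) weight (\<lambda>Y. betti k (down_complex Y)) \<le> card V ^ (k + 1) * simplex_prob k"
    using expectation_betti_le_simplices[of k] mult_right_mono[OF card_subsets_le_power[OF finite_V, of "k + 1"] simplex_prob_nonneg[of k]]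
    by simp
  moreover have "0 \<le> card V ^ (k + 1) * simplex_prob k" using simplex_prob_nonneg by simp
  ultimately show ?thesis using True by (simp add: betti_decay_constant_def)
next
  case False
  then have m: "m > 0" by simp
  define n where "n = card V"
  define g where "g = subset_expectation (Pow V - {{}}) weight (\<lambda>Y. betti k (down_complex Y))"
  define s where "s = real (card {\<pi>\<in>Pow V. card \<pi> = k + 1}) * simplex_prob k"
  define R where "R = coface_prob (k + 1)"
  define D where "D = m * 2 ^ (k + 2) + cone_step_constant k (4 * m + k + 1) ^ m"
  have R0: "0 \<le> R" by (simp add: R_def coface_prob_nonneg)
  have s0: "0 \<le> s" using simplex_prob_nonneg by (simp add: s_def)
  have sn: "s \<le> n ^ (k + 1) * simplex_prob k"
    unfolding s_def n_def using mult_right_mono[OF card_subsets_le_power[OF finite_V, of "k + 1"] simplex_prob_nonneg[of k]] by simp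
  have D0: "0 \<le> D" by (simp add: D_def cone_step_constant_def)
  have gs: "g \<le> s" using expectation_betti_le_simplices[of k] by (simp add: g_def s_def)
  have "(n * R) ^ m * g \<le> (1 + D) * (2 * real m) ^ m * s"
  proof (cases "n * R \<ge> 2 * real m")
    case False
    have "(n * R) ^ m * g \<le> (n * R) ^ m * s" using gs R0 by (intro mult_left_mono) auto
    also have "\<dots> \<le> (2 * real m) ^ m * s" using False R0 by (intro mult_right_mono s0 power_mono) auto
    also have "\<dots> \<le> (1 + D) * ((2 * real m) ^ m * s)"
      using D0 s0 mult_right_mono[of 1 "1 + D" "(2 * real m) ^ m * s"] by simp
    finally show ?thesis by (simp add: mult.assoc)
  next
    case True
    \<comment> \<open>Since \<open>n \<ge> m\<close>, rounding down costs at most a factor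
      2.\<close>
    define N where "N = n div m"
    have "n < m * (N + 1)" unfolding N_def using m
      by (metis Suc_eq_plus1 dividend_less_times_div mult_Suc_right)
    moreover have "N \<ge> 1" unfolding N_def using n m div_le_mono[OF n, of m] by (simp add: n_def)
    then have "m * (N + 1) \<le> m * (2 * N)" by (intro mult_le_mono2) simp
    ultimately have "n \<le> m * (2 * N)" by linarith
    then have "real n \<le> real (m * (2 * N))" by (simp only: of_nat_le_iff)
    then have nN: "real n \<le> 2 * real m * N" by simp
    then have nNR: "n * R \<le> 2 * real m * (N * R)" using R0 mult_right_mono[of "real n" "2 * real m * N" R] by (simp add: mult.assoc)
    have NR: "N * R \<ge> 1"
    proof -
      have "2 * real m * 1 \<le> 2 * real m * (N * R)" using True nNR by linarith
      then show ?thesis using m by simp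
    qed
    obtain W where W: "\<And>j. j < m \<Longrightarrow> W j \<subseteq> V" "\<And>j. j < m \<Longrightarrow> card (W j) = N"
      "\<And>i j. i < m \<Longrightarrow> j < m \<Longrightarrow> i \<noteq> j \<Longrightarrow> W i \<inter> W j = {}"
      using exists_batches[of m] unfolding N_def n_def by metis
    have g: "g \<le> D * (s * (1 / (N * R)) ^ m)"
      using expectation_betti_batches_le[OF W NR[unfolded R_def]] by (simp add: g_def D_def s_def R_def)
    have "(n * R) ^ m * g \<le> (2 * real m * (N * R)) ^ m * (D * (s * (1 / (N * R)) ^ m))"
    proof -
      have "(n * R) ^ m * g \<le> (n * R) ^ m * (D * (s * (1 / (N * R)) ^ m))"
        using g R0 by (intro mult_left_mono) auto
      also have "\<dots> \<le> (2 * real m * (N * R)) ^ m * (D * (s * (1 / (N * R)) ^ m))"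
        using nNR R0 D0 s0 by (intro mult_right_mono power_mono) auto
      finally show ?thesis .
    qed
    also have "\<dots> = D * (2 * real m) ^ m * s"
    proof -
      have "N * R \<noteq> 0" using NR by linarith
      then show ?thesis by (simp add: power_mult_distrib power_divide)
    qed
    also have "\<dots> \<le> (1 + D) * (2 * real m) ^ m * s" using D0 s0 by (intro mult_right_mono) auto
    finally show ?thesis .
  qed
  also have "\<dots> \<le> (1 + D) * (2 * real m) ^ m * (n ^ (k + 1) * simplex_prob k)"
    using sn D0 by (intro mult_left_mono) auto
  finally show ?thesis unfolding n_def R_def g_def D_def betti_decay_constant_def by (simp only: add.assoc)
qed

end

section \<open>Existence of barcodes\<close>

lemma representation_outside:
  assumes ind: "fs.independent E" and B: "B \<subseteq> E" and v: "v \<in> fs.span B" and e: "e \<notin> B"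
  shows "fs.representation E v e = 0"
  using fs.representation_extend[OF ind v B] fs.representation_ne_zero[of B v e] e by auto

lemma boundary_supported_on:
  fixes V :: "'v::linorder set"
  assumes V: "finite V" "X \<subseteq> Pow V"
  shows "supported_on (Pow V) (boundary X c)"
proof (unfold supported_on_def, intro allI impI)
  fix \<tau> assume "boundary X c \<tau> \<noteq> 0"
  then obtain x where "csgn x \<tau> * (if insert x \<tau> \<in> X then c (insert x \<tau>) else 0) \<noteq> 0"
    unfolding boundary_eq[OF V] by (meson sum.not_neutral_contains_not_neutral)
  then have "insert x \<tau> \<in> X" by (auto split: if_splits)
  then show "\<tau> \<in> Pow V" using V by auto
qed

lemma homology_class_eq_iff:
  "homology_class k X z = homology_class k X w \<longleftrightarrow> (\<lambda>\<sigma>. z \<sigma> - w \<sigma>) \<in> boundaries k X"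
proof
  assume "homology_class k X z = homology_class k X w"
  moreover have "z \<in> homology_class k X z"
    using fs.subspace_0[OF subspace_boundaries[of k X]] by (simp add: homology_class_def zero_fun_def)
  ultimately show "(\<lambda>\<sigma>. z \<sigma> - w \<sigma>) \<in> boundaries k X" by (auto simp: homology_class_def)
next
  assume zw: "(\<lambda>\<sigma>. z \<sigma> - w \<sigma>) \<in> boundaries k X"
  have "(\<lambda>\<sigma>. z' \<sigma> - z \<sigma>) \<in> boundaries k X \<longleftrightarrow> (\<lambda>\<sigma>. z' \<sigma> - w \<sigma>) \<in> boundaries k X" for z'
    using fs_subspace_lincomb[OF subspace_boundaries _ zw, of "\<lambda>\<sigma>. z' \<sigma> - z \<sigma>" 1 1]
      fs_subspace_lincomb[OF subspace_boundaries _ zw, of "\<lambda>\<sigma>. z' \<sigma> - w \<sigma>" 1 "-1"] by auto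
  then show "homology_class k X z = homology_class k X w" by (simp add: homology_class_def)
qed

text \<open>Take a basis \<open>E\<close> adapted to the cycles and the boundaries at all times of
  \<open>F\<close>. Each basis vector that ever becomes a cycle yields an interval from its first
  time as a cycle to its first time as a boundary, and \<open>\<phi>\<close> sends a class to the
  coordinates of a representative at the vectors alive.\<close>

theorem barcode_exists:
  fixes V :: "'v::linorder set" and X :: "real \<Rightarrow> 'v set set"
  assumes V: "finite V" and XV: "\<And>t. X t \<subseteq> Pow V" and mono: "\<And>s t. s \<le> t \<Longrightarrow> X s \<subseteq> X t"
    and F: "finite F" "0 \<in> F" "\<And>s. s \<in> F \<Longrightarrow> 0 \<le> s"
    and step: "\<And>t. 0 \<le> t \<Longrightarrow> X t = X (Max {s\<in>F. s \<le> t})"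
  shows "\<exists>bs. is_barcode k X bs"
proof -
  define Z where "Z = (\<lambda>t. cycles k (X t))"
  define B where "B = (\<lambda>t. boundaries k (X t))"
  define C :: "('v set \<Rightarrow> real) set" where "C = {f. supported_on (Pow V) f}"
  define S :: "('v set \<Rightarrow> real) set" where "S = (\<lambda>\<sigma> \<pi>. of_bool (\<pi> = \<sigma>)) ` Pow V"
  have subZ: "fs.subspace (Z t)" and subB: "fs.subspace (B t)" for t
    by (simp_all add: Z_def B_def subspace_cycles subspace_boundaries)
  have monoZ: "Z s \<subseteq> Z t" and monoB: "B s \<subseteq> B t" if "s \<le> t" for s t
    using cycles_mono[OF V XV mono[OF that]] boundaries_mono[OF V XV mono[OF that]] by (simp_all add: Z_def B_def)
  have C: "fs.subspace C"
  proof (rule fs_subspaceI)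
    fix f g a b assume fg: "f \<in> C" "g \<in> C"
    have "a * f x + b * g x = 0" if "x \<notin> Pow V" for x
    proof -
      have "f x = 0" "g x = 0" using fg that by (auto simp: C_def supported_on_def)
      then show ?thesis by simp
    qed
    then show "(\<lambda>x. a * f x + b * g x) \<in> C" by (auto simp: C_def supported_on_def)
  qed (simp add: C_def supported_on_def)
  have CS: "C \<subseteq> fs.span S"
  proof
    fix f assume f: "f \<in> C"
    have "f = (\<Sum>\<sigma>\<in>Pow V. (\<lambda>\<pi>. f \<sigma> * of_bool (\<pi> = \<sigma>)))"
    proof
      fix \<pi>
      have "(\<Sum>\<sigma>\<in>Pow V. (\<lambda>\<pi>. f \<sigma> * of_bool (\<pi> = \<sigma>))) \<pi> = (\<Sum>\<sigma>\<in>Pow V. if \<sigma> = \<pi> then f \<sigma> else 0)"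
        unfolding sum_fun_apply by (intro sum.cong) auto
      also have "\<dots> = (if \<pi> \<in> Pow V then f \<pi> else 0)" using V by (intro sum.delta) simp
      also have "\<dots> = f \<pi>" using f by (auto simp: C_def supported_on_def)
      finally show "f \<pi> = (\<Sum>\<sigma>\<in>Pow V. (\<lambda>\<pi>. f \<sigma> * of_bool (\<pi> = \<sigma>))) \<pi>" by simp
    qed
    also have "\<dots> \<in> fs.span S"
      by (intro fs.span_sum fs.span_scale fs.span_base) (simp add: S_def)
    finally show "f \<in> fs.span S" .
  qed
  have ZC: "Z t \<subseteq> C" for t using XV[of t] by (auto simp: Z_def C_def cycles_def chains_def supported_on_def)
  have BC: "B t \<subseteq> C" for t using boundary_supported_on[OF V XV[of t]] by (auto simp: B_def C_def boundaries_def)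
  have fS: "finite S" using V by (simp add: S_def)
  obtain E where fE: "finite E" and ind: "fs.independent E" and spE: "fs.span E = C"
    and ad: "\<forall>s\<in>F. Z s = fs.span (E \<inter> Z s) \<and> B s = fs.span (E \<inter> B s)"
    using flag_adapted_basis[where A = Z and B = B and F = F and C = C and S = S, OF F(1) subZ subB monoZ monoB C fS CS ZC BC]
    by auto
  \<comment> \<open>The complex is constant between consecutive times of \<open>F\<close>, so every
    time may be rounded down to a time at which the basis is adapted.\<close>
  define rd where "rd = (\<lambda>t. Max {s\<in>F. s \<le> t})"
  have rd: "rd t \<in> F" "rd t \<le> t" "X t = X (rd t)" if "0 \<le> t" for t
  proof -
    have "finite {s\<in>F. s \<le> t}" "{s\<in>F. s \<le> t} \<noteq> {}" using F that by auto
    from Max_in[OF this] show "rd t \<in> F" "rd t \<le> t" by (auto simp: rd_def)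
    show "X t = X (rd t)" using step[OF that] by (simp add: rd_def)
  qed
  have Zrd: "Z t = Z (rd t)" "B t = B (rd t)" if "0 \<le> t" for t using rd(3)[OF that] by (simp_all add: Z_def B_def)
  have spanZ: "Z t = fs.span (E \<inter> Z t)" and spanB: "B t = fs.span (E \<inter> B t)" if "0 \<le> t" for t
    using ad rd(1)[OF that] unfolding Zrd[OF that] by blast+
  define b where "b = (\<lambda>e. Min {s\<in>F. e \<in> Z s})"
  define d where "d = (\<lambda>e. if \<exists>s\<in>F. e \<in> B s then ereal (Min {s\<in>F. e \<in> B s}) else \<infinity>)"
  have b_in: "b e \<in> F" "e \<in> Z (b e)" if "s \<in> F" "e \<in> Z s" for e s
  proof -
    have "finite {s\<in>F. e \<in> Z s}" "{s\<in>F. e \<in> Z s} \<noteq> {}" using F that by auto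
    from Min_in[OF this] show "b e \<in> F" "e \<in> Z (b e)" by (auto simp: b_def)
  qed
  have b_iff: "b e \<le> t \<longleftrightarrow> e \<in> Z t" if "s \<in> F" "e \<in> Z s" "0 \<le> t" for e s t
  proof
    assume "b e \<le> t"
    then show "e \<in> Z t" using monoZ[of "b e" t] b_in(2)[OF that(1,2)] by auto
  next
    assume "e \<in> Z t"
    then have "e \<in> Z (rd t)" using Zrd[OF that(3)] by simp
    then have "b e \<le> rd t" unfolding b_def using F rd(1)[OF that(3)] by (intro Min_le) auto
    then show "b e \<le> t" using rd(2)[OF that(3)] by simp
  qed
  have d_iff: "d e \<le> ereal t \<longleftrightarrow> e \<in> B t" if "0 \<le> t" for e t
  proof
    assume a: "d e \<le> ereal t"
    then have ex: "\<exists>s\<in>F. e \<in> B s" by (auto simp: d_def split: if_splits)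
    then have "finite {s\<in>F. e \<in> B s}" "{s\<in>F. e \<in> B s} \<noteq> {}" using F by auto
    from Min_in[OF this] have "e \<in> B (Min {s\<in>F. e \<in> B s})" by auto
    moreover have "Min {s\<in>F. e \<in> B s} \<le> t" using a ex by (simp add: d_def)
    ultimately show "e \<in> B t" using monoB by auto
  next
    assume "e \<in> B t"
    then have e: "e \<in> B (rd t)" using Zrd[OF that] by simp
    then have "Min {s\<in>F. e \<in> B s} \<le> rd t" using F rd(1)[OF that] by (intro Min_le) auto
    then show "d e \<le> ereal t" using rd[OF that] e by (auto simp: d_def)
  qed
  \<comment> \<open>A vector that becomes a cycle and a boundary at the same time gives an empty
    interval and no bar; one that never becomes a boundary has
    \<open>d e = \<infinity>\<close>.\<close>
  define L where "L = {e\<in>E. (\<exists>s\<in>F. e \<in> Z s) \<and> ereal (b e) < d e}"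
  have "finite L" using fE by (simp add: L_def)
  then obtain es where es: "set es = L" "distinct es" using finite_distinct_list by blast
  define bs where "bs = map (\<lambda>e. (b e, d e)) es"
  have esE: "es ! i \<in> E" if "i < length es" for i
    using es(1) nth_mem[OF that] by (auto simp: L_def)
  have alive_iff: "i \<in> alive bs t \<longleftrightarrow> i < length es \<and> es ! i \<in> Z t \<and> es ! i \<notin> B t" if "0 \<le> t" for i t
  proof (cases "i < length es")
    case True
    then obtain s where "s \<in> F" "es ! i \<in> Z s" using es(1) nth_mem[OF True] by (auto simp: L_def)
    from b_iff[OF this that] d_iff[OF that, of "es ! i"] True show ?thesis
      by (auto simp: alive_def bs_def not_le)
  qed (simp add: alive_def bs_def)
  have cover: "\<exists>i. i \<in> alive bs t \<and> es ! i = e" if "0 \<le> t" "e \<in> E" "e \<in> Z t" "e \<notin> B t" for e t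
  proof -
    have s: "rd t \<in> F" "e \<in> Z (rd t)" using rd(1)[OF that(1)] Zrd[OF that(1)] that(3) by auto
    have "b e \<le> t" using b_iff[OF s that(1)] that by simp
    moreover have "ereal t < d e" using d_iff[OF that(1), of e] that by auto
    ultimately have "ereal (b e) < d e" by (meson ereal_less_eq(3) le_less_trans)
    then have "e \<in> set es" using es s that by (auto simp: L_def)
    then obtain i where i: "i < length es" "es ! i = e" by (auto simp: in_set_conv_nth)
    then have "i \<in> alive bs t" using alive_iff[OF that(1), of i] that by simp
    with i show ?thesis by blast
  qed
  define rep where "rep = fs.representation E"
  \<comment> \<open>The choice of representative is immaterial: two of them differ by a boundary,
    which has no coordinates at basis vectors outside \<open>B t\<close>, in particular none at
    those alive.\<close>
  define \<phi> where "\<phi> = (\<lambda>t c i. if i \<in> alive bs t then rep (SOME z. z \<in> c) (es ! i) else 0)"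
  have ZspE: "z \<in> fs.span E" if "z \<in> Z t" for z t using ZC spE that by auto
  have \<phi>_class: "\<phi> t (homology_class k (X t) z) = (\<lambda>i. if i \<in> alive bs t then rep z (es ! i) else 0)"
    if t: "0 \<le> t" and z: "z \<in> Z t" for t z
  proof
    fix i
    define z' where "z' = (SOME z'. z' \<in> homology_class k (X t) z)"
    have "z \<in> homology_class k (X t) z"
      using fs.subspace_0[OF subspace_boundaries[of k "X t"]] by (simp add: homology_class_def zero_fun_def)
    then have "z' \<in> homology_class k (X t) z" unfolding z'_def by (rule someI[of "\<lambda>z'. z' \<in> homology_class k (X t) z" z])
    then have dB: "(\<lambda>\<sigma>. z' \<sigma> - z \<sigma>) \<in> B t" by (simp add: homology_class_def B_def)
    then have dE: "(\<lambda>\<sigma>. z' \<sigma> - z \<sigma>) \<in> fs.span E" using BC spE by auto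
    have zd: "z' = z + (\<lambda>\<sigma>. z' \<sigma> - z \<sigma>)" by (simp add: fun_eq_iff)
    have "rep z' = (\<lambda>e. rep z e + rep (\<lambda>\<sigma>. z' \<sigma> - z \<sigma>) e)"
      unfolding arg_cong[OF zd, of rep] unfolding rep_def by (rule fs.representation_add[OF ind dE ZspE[OF z]])
    then have r: "rep z' e = rep z e + rep (\<lambda>\<sigma>. z' \<sigma> - z \<sigma>) e" for e by (rule fun_cong)
    have "rep (\<lambda>\<sigma>. z' \<sigma> - z \<sigma>) e = 0" if "e \<notin> B t" for e
      unfolding rep_def by (rule representation_outside[OF ind, of "E \<inter> B t"]) (use dB spanB[OF t] that in auto)
    then show "\<phi> t (homology_class k (X t) z) i = (if i \<in> alive bs t then rep z (es ! i) else 0)"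
      using alive_iff[OF t, of i] r by (simp add: \<phi>_def z'_def)
  qed
  \<comment> \<open>The coordinates of \<open>v = z - w\<close> vanish outside \<open>Z t\<close>,
    as \<open>v\<close> is a cycle, and at the vectors alive, by assumption. Those that remain
    belong to basis vectors in \<open>B t\<close>.\<close>
  have inj: "homology_class k (X t) z = homology_class k (X t) w"
    if t: "0 \<le> t" and zw: "z \<in> Z t" "w \<in> Z t" and eq: "\<phi> t (homology_class k (X t) z) = \<phi> t (homology_class k (X t) w)" for t z w
  proof -
    define v where "v = (\<lambda>\<sigma>. z \<sigma> - w \<sigma>)"
    have vd: "v = z - w" by (simp add: v_def fun_eq_iff)
    have vZ: "v \<in> Z t" unfolding vd by (rule fs.subspace_diff[OF subZ zw])
    have rv: "rep v e = rep z e - rep w e" for e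
      unfolding vd rep_def by (simp add: fs.representation_diff[OF ind ZspE[OF zw(2)] ZspE[OF zw(1)]])
    have rB: "e \<in> E \<inter> B t" if "rep v e \<noteq> 0" for e
    proof -
      have eE: "e \<in> E" using that fs.representation_ne_zero[of E v e] unfolding rep_def by simp
      have eZ: "e \<in> Z t"
      proof (rule ccontr)
        assume "e \<notin> Z t"
        then have "rep v e = 0" unfolding rep_def
          by (intro representation_outside[OF ind, of "E \<inter> Z t"]) (use vZ spanZ[OF t] in auto)
        with that show False by simp
      qed
      show ?thesis
      proof (rule ccontr)
        assume "e \<notin> E \<inter> B t"
        then obtain i where i: "i \<in> alive bs t" "es ! i = e" using cover[OF t eE eZ] eE by auto
        have "rep z (es ! i) = rep w (es ! i)"
          using fun_cong[OF eq, of i] i by (simp add: \<phi>_class[OF t] zw)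
        then show False using rv[of e] that i by simp
      qed
    qed
    have "v = (\<Sum>e\<in>E. (\<lambda>\<sigma>. rep v e * e \<sigma>))"
      using fs.sum_representation_eq[OF ind ZspE[OF vZ] fE subset_refl] by (simp add: rep_def)
    also have "\<dots> \<in> B t"
    proof (intro fs.subspace_sum[OF subB])
      fix e assume "e \<in> E"
      show "(\<lambda>\<sigma>. rep v e * e \<sigma>) \<in> B t"
      proof (cases "rep v e = 0")
        case True
        then show ?thesis using fs.subspace_0[OF subB[of t]] by (simp add: zero_fun_def)
      next
        case False
        then show ?thesis using rB by (intro fs.subspace_scale[OF subB]) auto
      qed
    qed
    finally show ?thesis unfolding homology_class_eq_iff by (simp add: v_def B_def)
  qed
  have bij: "bij_betw (\<phi> t) (homology k (X t)) (interval_module bs t)" if t: "0 \<le> t" for t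
  proof (unfold bij_betw_def, intro conjI)
    show "inj_on (\<phi> t) (homology k (X t))"
    proof (rule inj_onI)
      fix x y assume "x \<in> homology k (X t)" "y \<in> homology k (X t)" "\<phi> t x = \<phi> t y"
      then show "x = y" using inj[OF t] by (auto simp: homology_def Z_def)
    qed
    show "\<phi> t ` homology k (X t) = interval_module bs t"
    proof
      show "\<phi> t ` homology k (X t) \<subseteq> interval_module bs t"
        by (auto simp: \<phi>_def interval_module_def split: if_splits)
      show "interval_module bs t \<subseteq> \<phi> t ` homology k (X t)"
      proof
        fix f assume f: "f \<in> interval_module bs t"
        define z where "z = (\<Sum>i<length es. (\<lambda>\<sigma>. f i * (es ! i) \<sigma>))"
        have f0: "f i = 0" if "i \<notin> alive bs t" for i using f that by (auto simp: interval_module_def)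
        have zZ: "z \<in> Z t" unfolding z_def
        proof (intro fs.subspace_sum[OF subZ])
          fix i
          show "(\<lambda>\<sigma>. f i * (es ! i) \<sigma>) \<in> Z t"
          proof (cases "i \<in> alive bs t")
            case True
            then show ?thesis using alive_iff[OF t, of i] by (intro fs.subspace_scale[OF subZ]) auto
          next
            case False
            then show ?thesis using f0 fs.subspace_0[OF subZ[of t]] by (simp add: zero_fun_def)
          qed
        qed
        have rz: "rep z (es ! j) = f j" if "j < length es" for j
        proof -
          have "rep z = (\<lambda>e. \<Sum>i<length es. rep (\<lambda>\<sigma>. f i * (es ! i) \<sigma>) e)"
            unfolding z_def rep_def
            by (rule fs.representation_sum[OF ind]) (intro fs.span_scale fs.span_base, auto intro: esE)
          then have "rep z (es ! j) = (\<Sum>i<length es. rep (\<lambda>\<sigma>. f i * (es ! i) \<sigma>) (es ! j))" by simp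
          also have "\<dots> = (\<Sum>i<length es. if i = j then f i else 0)"
          proof (intro sum.cong refl)
            fix i assume i: "i \<in> {..<length es}"
            have "rep (\<lambda>\<sigma>. f i * (es ! i) \<sigma>) (es ! j) = f i * rep (es ! i) (es ! j)"
              unfolding rep_def using i by (subst fs.representation_scale[OF ind]) (auto intro: fs.span_base esE)
            also have "rep (es ! i) (es ! j) = (if es ! j = es ! i then 1 else 0)"
              unfolding rep_def using i by (subst fs.representation_basis[OF ind]) (auto intro: esE)
            also have "es ! j = es ! i \<longleftrightarrow> i = j" using es(2) i that by (auto simp: nth_eq_iff_index_eq)
            finally show "rep (\<lambda>\<sigma>. f i * (es ! i) \<sigma>) (es ! j) = (if i = j then f i else 0)" by simp
          qed
          also have "\<dots> = f j" using that by simp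
          finally show ?thesis .
        qed
        have "f = \<phi> t (homology_class k (X t) z)"
        proof
          fix i
          show "f i = \<phi> t (homology_class k (X t) z) i"
            unfolding \<phi>_class[OF t zZ] using f0 rz alive_iff[OF t, of i] by auto
        qed
        moreover have "homology_class k (X t) z \<in> homology k (X t)" using zZ by (simp add: homology_def Z_def)
        ultimately show "f \<in> \<phi> t ` homology k (X t)" by blast
      qed
    qed
  qed
  have lin: "\<phi> t (homology_class k (X t) (\<lambda>\<sigma>. x * z \<sigma> + y * w \<sigma>)) =
     (\<lambda>i. x * \<phi> t (homology_class k (X t) z) i + y * \<phi> t (homology_class k (X t) w) i)"
    if t: "0 \<le> t" and z: "z \<in> Z t" and w: "w \<in> Z t" for t z w x y
  proof -
    have zw: "(\<lambda>\<sigma>. x * z \<sigma> + y * w \<sigma>) \<in> Z t" by (rule fs_subspace_lincomb[OF subZ z w])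
    have "(\<lambda>\<sigma>. x * z \<sigma> + y * w \<sigma>) = (\<lambda>\<sigma>. x * z \<sigma>) + (\<lambda>\<sigma>. y * w \<sigma>)" by (simp add: fun_eq_iff)
    then have "rep (\<lambda>\<sigma>. x * z \<sigma> + y * w \<sigma>) e = x * rep z e + y * rep w e" for e
      unfolding rep_def
      by (simp add: fs.representation_add[OF ind] fs.representation_scale[OF ind] fs.span_scale ZspE[OF z] ZspE[OF w])
    then show ?thesis unfolding \<phi>_class[OF t zw] \<phi>_class[OF t z] \<phi>_class[OF t w] by auto
  qed
  \<comment> \<open>A bar alive at \<open>t\<close> but not at \<open>s\<close> was not yet born at
    \<open>s\<close>, because boundaries stay boundaries; a cycle at time \<open>s\<close> therefore
    has no coordinate there.\<close>
  have nat: "\<phi> t (homology_class k (X t) z) = interval_map bs t (\<phi> s (homology_class k (X s) z))"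
    if s: "0 \<le> s" and st: "s \<le> t" and z: "z \<in> Z s" for s t z
  proof
    fix i
    have t: "0 \<le> t" and zt: "z \<in> Z t" using s st z monoZ[OF st] by auto
    show "\<phi> t (homology_class k (X t) z) i = interval_map bs t (\<phi> s (homology_class k (X s) z)) i"
    proof (cases "i \<in> alive bs t \<and> i \<notin> alive bs s")
      case True
      then have "es ! i \<notin> Z s" using alive_iff[OF t, of i] alive_iff[OF s, of i] monoB[OF st] by auto
      then have "rep z (es ! i) = 0" unfolding rep_def
        by (intro representation_outside[OF ind, of "E \<inter> Z s"]) (use z spanZ[OF s] in auto)
      then show ?thesis unfolding \<phi>_class[OF t zt] \<phi>_class[OF s z] interval_map_def using True by simp
    next
      case False
      then show ?thesis unfolding \<phi>_class[OF t zt] \<phi>_class[OF s z] interval_map_def by auto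
    qed
  qed
  have bars: "\<forall>(b, d)\<in>set bs. 0 \<le> b \<and> ereal b < d"
  proof -
    have "0 \<le> b e \<and> ereal (b e) < d e" if eL: "e \<in> L" for e
    proof -
      obtain s where "s \<in> F" "e \<in> Z s" using eL by (auto simp: L_def)
      from b_in(1)[OF this] F(3) eL show ?thesis by (auto simp: L_def)
    qed
    then show ?thesis using es(1) by (auto simp: bs_def)
  qed
  have "is_barcode k X bs"
    unfolding is_barcode_def
  proof (intro conjI exI[of _ \<phi>])
    show "\<forall>(b, d)\<in>set bs. 0 \<le> b \<and> ereal b < d" by (rule bars)
    show "\<forall>t\<ge>0. bij_betw (\<phi> t) (homology k (X t)) (interval_module bs t)"
      by (intro allI impI bij)
    show "\<forall>t\<ge>0. \<forall>z\<in>cycles k (X t). \<forall>w\<in>cycles k (X t). \<forall>a b.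
        \<phi> t (homology_class k (X t) (\<lambda>\<sigma>. a * z \<sigma> + b * w \<sigma>)) =
        (\<lambda>i. a * \<phi> t (homology_class k (X t) z) i + b * \<phi> t (homology_class k (X t) w) i)"
      by (intro allI impI ballI lin) (simp_all add: Z_def)
    show "\<forall>s\<ge>0. \<forall>t\<ge>s. \<forall>z\<in>cycles k (X s).
        \<phi> t (homology_class k (X t) z) = interval_map bs t (\<phi> s (homology_class k (X s) z))"
      by (intro allI impI ballI nat) (simp_all add: Z_def)
  qed
  then show ?thesis by blast
qed

section \<open>Lifetime sums\<close>

text \<open>Cycles whose classes \<open>\<phi> t\<close> maps to the unit vectors of the bars alive
  are independent modulo boundaries.\<close>

lemma card_alive_le_betti:
  fixes V :: "'v::linorder set"
  assumes V: "finite V" and XV: "X t \<subseteq> Pow V" and X: "face_closed (X t)"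
    and bc: "is_barcode k X bs" and t: "0 \<le> t"
  shows "card (alive bs t) \<le> betti k (X t)"
proof -
  from bc have "\<exists>\<phi>. (\<forall>t\<ge>0. bij_betw (\<phi> t) (homology k (X t)) (interval_module bs t)) \<and>
      (\<forall>t\<ge>0. \<forall>z\<in>cycles k (X t). \<forall>w\<in>cycles k (X t). \<forall>a b.
        \<phi> t (homology_class k (X t) (\<lambda>\<sigma>. a * z \<sigma> + b * w \<sigma>)) =
        (\<lambda>i. a * \<phi> t (homology_class k (X t) z) i + b * \<phi> t (homology_class k (X t) w) i))"
    unfolding is_barcode_def by (elim conjE exE) (intro exI conjI, assumption+)
  then obtain \<phi> where \<phi>: "\<forall>t\<ge>0. bij_betw (\<phi> t) (homology k (X t)) (interval_module bs t)"
      "\<forall>t\<ge>0. \<forall>z\<in>cycles k (X t). \<forall>w\<in>cycles k (X t). \<forall>a b.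
        \<phi> t (homology_class k (X t) (\<lambda>\<sigma>. a * z \<sigma> + b * w \<sigma>)) =
        (\<lambda>i. a * \<phi> t (homology_class k (X t) z) i + b * \<phi> t (homology_class k (X t) w) i)"
    by (elim conjE exE)
  note bij = \<phi>(1)[rule_format, OF t] and lin = \<phi>(2)[rule_format, OF t]
  define h where "h = (\<lambda>z. \<phi> t (homology_class k (X t) z))"
  have "\<exists>z. z \<in> cycles k (X t) \<and> h z = (\<lambda>j. of_bool (j = i))" if "i \<in> alive bs t" for i
  proof -
    have "(\<lambda>j. of_bool (j = i)) \<in> interval_module bs t" using that by (simp add: interval_module_def)
    then have "(\<lambda>j. of_bool (j = i)) \<in> \<phi> t ` homology k (X t)" using bij by (simp add: bij_betw_def)
    then show ?thesis by (auto simp: homology_def h_def)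
  qed
  then obtain z where z: "\<And>i. i \<in> alive bs t \<Longrightarrow> z i \<in> cycles k (X t)"
    "\<And>i. i \<in> alive bs t \<Longrightarrow> h (z i) = (\<lambda>j. of_bool (j = i))" by metis
  have fin: "finite (alive bs t)" by (simp add: alive_def)
  have zero_in: "(\<lambda>\<sigma>. 0) \<in> cycles k (X t)"
    using fs.subspace_0[OF subspace_cycles[of k "X t"]] by (simp add: zero_fun_def)
  have h0: "h (\<lambda>\<sigma>. 0) = (\<lambda>i. 0)"
    using lin[OF zero_in zero_in, of 0 0] by (simp add: h_def)
  have hsum: "(\<lambda>\<sigma>. \<Sum>i\<in>I. a i * z i \<sigma>) \<in> cycles k (X t) \<and>
      h (\<lambda>\<sigma>. \<Sum>i\<in>I. a i * z i \<sigma>) = (\<lambda>j. \<Sum>i\<in>I. a i * of_bool (j = i))" if "I \<subseteq> alive bs t" for I a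
    using finite_subset[OF that fin] that
  proof (induction I rule: finite_induct)
    case empty
    then show ?case using zero_in h0 by simp
  next
    case (insert i I)
    then have IH: "(\<lambda>\<sigma>. \<Sum>i\<in>I. a i * z i \<sigma>) \<in> cycles k (X t)"
      "h (\<lambda>\<sigma>. \<Sum>i\<in>I. a i * z i \<sigma>) = (\<lambda>j. \<Sum>i\<in>I. a i * of_bool (j = i))" and i: "i \<in> alive bs t" by auto
    have e: "(\<lambda>\<sigma>. \<Sum>i\<in>insert i I. a i * z i \<sigma>) = (\<lambda>\<sigma>. a i * z i \<sigma> + 1 * (\<Sum>i\<in>I. a i * z i \<sigma>))"
      using insert.hyps by simp
    have "(\<lambda>\<sigma>. \<Sum>i\<in>insert i I. a i * z i \<sigma>) \<in> cycles k (X t)"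
      unfolding e by (rule fs_subspace_lincomb[OF subspace_cycles z(1)[OF i] IH(1)])
    moreover have "h (\<lambda>\<sigma>. \<Sum>i\<in>insert i I. a i * z i \<sigma>) = (\<lambda>j. \<Sum>i\<in>insert i I. a i * of_bool (j = i))"
    proof -
      have "h (\<lambda>\<sigma>. \<Sum>i\<in>insert i I. a i * z i \<sigma>) = (\<lambda>j. a i * h (z i) j + 1 * h (\<lambda>\<sigma>. \<Sum>i\<in>I. a i * z i \<sigma>) j)"
        unfolding e unfolding h_def by (rule lin[OF z(1)[OF i] IH(1)])
      also have "\<dots> = (\<lambda>j. \<Sum>i\<in>insert i I. a i * of_bool (j = i))"
        unfolding IH(2) z(2)[OF i] using insert.hyps by (intro ext) (simp only: sum.insert mult_1 not_False_eq_True)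
      finally show ?thesis .
    qed
    ultimately show ?case ..
  qed
  have "homology_independent k (X t) (alive bs t) z"
    unfolding homology_independent_def
  proof (intro conjI allI impI ballI fin z(1))
    fix a i assume b: "(\<lambda>\<sigma>. \<Sum>i\<in>alive bs t. a i * z i \<sigma>) \<in> boundaries k (X t)" and i: "i \<in> alive bs t"
    have "homology_class k (X t) (\<lambda>\<sigma>. \<Sum>i\<in>alive bs t. a i * z i \<sigma>) = homology_class k (X t) (\<lambda>\<sigma>. 0)"
      unfolding homology_class_eq_iff using b by simp
    then have "h (\<lambda>\<sigma>. \<Sum>i\<in>alive bs t. a i * z i \<sigma>) = h (\<lambda>\<sigma>. 0)" by (simp add: h_def)
    then have "(\<Sum>j\<in>alive bs t. a j * of_bool (i = j)) = 0"
      using hsum[of "alive bs t" a] unfolding h0 by (auto dest: fun_cong[where x = i])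
    moreover have "(\<Sum>j\<in>alive bs t. a j * of_bool (i = j)) = (\<Sum>j\<in>alive bs t. if j = i then a j else 0)"
      by (intro sum.cong) auto
    ultimately show "a i = 0" using fin i by simp
  qed
  then show ?thesis by (rule card_le_betti[OF V XV X])
qed

lemma bar_truncated_length_le:
  assumes b: "0 \<le> b" "ereal b < d" and T: "0 < T"
  shows "ennreal (real_of_ereal (min d (ereal T)) - min b T) \<le> emeasure lborel ({t. b \<le> t \<and> ereal t < d} \<inter> {0..T})"
proof (cases "b < T")
  case False
  then have "min d (ereal T) = ereal T" "min b T = T" using b by (auto simp: min_def) (meson ereal_less_eq(3) le_less_trans not_le order.asym)
  then show ?thesis by simp
next
  case True
  define m where "m = real_of_ereal (min d (ereal T))"
  have m: "ereal m = min d (ereal T)" unfolding m_def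
    using b by (cases d) (auto simp: min_def)
  have bm: "b \<le> m"
  proof -
    have "ereal b \<le> ereal m" unfolding m using b True by (simp add: min_def less_imp_le)
    then show ?thesis by simp
  qed
  have "{b..<m} \<subseteq> {t. b \<le> t \<and> ereal t < d} \<inter> {0..T}"
  proof
    fix t assume t: "t \<in> {b..<m}"
    then have "ereal t < min d (ereal T)" unfolding m[symmetric] by simp
    then show "t \<in> {t. b \<le> t \<and> ereal t < d} \<inter> {0..T}" using t b by auto
  qed
  moreover have "{t. b \<le> t \<and> ereal t < d} \<inter> {0..T} \<in> sets lborel" by measurable
  ultimately have "emeasure lborel {b..<m} \<le> emeasure lborel ({t. b \<le> t \<and> ereal t < d} \<inter> {0..T})" by (rule emeasure_mono)
  moreover have "emeasure lborel {b..<m} = ennreal (m - b)" using bm by simp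
  moreover have "min b T = b" using True by simp
  ultimately show ?thesis by (simp add: m_def)
qed

lemma bar_length_le:
  assumes b: "0 \<le> b" "ereal b < d"
  shows "e2ennreal (d - ereal b) \<le> emeasure lborel ({t. b \<le> t \<and> ereal t < d} \<inter> {0..})"
proof (cases d)
  case (real r)
  have e: "{t. b \<le> t \<and> ereal t < d} \<inter> {0..} = {b..<r}" using b real by auto
  have "e2ennreal (d - ereal b) = ennreal (r - b)" using real by (simp add: ennreal.rep_eq e2ennreal_ereal)
  then show ?thesis unfolding e using b real by simp
next
  case PInf
  have e: "{t. b \<le> t \<and> ereal t < d} \<inter> {0..} = {b..}" using b PInf by auto
  have "emeasure lborel {b..} = \<infinity>"
  proof (rule ccontr)
    assume "emeasure lborel {b..} \<noteq> \<infinity>"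
    then obtain r where r: "0 \<le> r" "emeasure lborel {b..} = ennreal r" by (cases "emeasure lborel {b..}") auto
    obtain n :: nat where n: "r < n" using reals_Archimedean2 by blast
    have "ennreal n = emeasure lborel {b..b + n}" by simp
    also have "\<dots> \<le> emeasure lborel {b..}" by (intro emeasure_mono) auto
    finally show False using r n by simp
  qed
  then show ?thesis unfolding e by simp
qed (use b in auto)

lemma card_alive_eq_sum:
  "of_nat (card (alive bs t)) = (\<Sum>i<length bs. indicator {t. fst (bs ! i) \<le> t \<and> ereal t < snd (bs ! i)} t :: ennreal)"
proof -
  have "alive bs t = {i\<in>{..<length bs}. fst (bs ! i) \<le> t \<and> ereal t < snd (bs ! i)}" by (auto simp: alive_def)
  moreover have "(\<Sum>i<length bs. indicator {t. fst (bs ! i) \<le> t \<and> ereal t < snd (bs ! i)} t)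
     = (\<Sum>i<length bs. if fst (bs ! i) \<le> t \<and> ereal t < snd (bs ! i) then 1 else (0::ennreal))"
    by (intro sum.cong) (auto simp: indicator_def)
  ultimately show ?thesis by (simp add: sum.If_cases Int_def)
qed

lemma nn_integral_card_alive:
  assumes A: "A \<in> sets borel"
  shows "(\<integral>\<^sup>+t\<in>A. of_nat (card (alive bs t)) \<partial>lborel)
    = (\<Sum>i<length bs. emeasure lborel ({t. fst (bs ! i) \<le> t \<and> ereal t < snd (bs ! i)} \<inter> A))"
proof -
  have m: "{t. fst (bs ! i) \<le> t \<and> ereal t < snd (bs ! i)} \<in> sets borel" for i by measurable
  have "(\<integral>\<^sup>+t\<in>A. of_nat (card (alive bs t)) \<partial>lborel)
    = (\<integral>\<^sup>+t. (\<Sum>i<length bs. indicator ({t. fst (bs ! i) \<le> t \<and> ereal t < snd (bs ! i)} \<inter> A) t) \<partial>lborel)"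
    unfolding card_alive_eq_sum sum_distrib_right by (simp add: indicator_inter_arith)
  also have "\<dots> = (\<Sum>i<length bs. \<integral>\<^sup>+t. indicator ({t. fst (bs ! i) \<le> t \<and> ereal t < snd (bs ! i)} \<inter> A) t \<partial>lborel)"
    using m A by (intro nn_integral_sum) auto
  also have "\<dots> = (\<Sum>i<length bs. emeasure lborel ({t. fst (bs ! i) \<le> t \<and> ereal t < snd (bs ! i)} \<inter> A))"
    using m A by (intro sum.cong refl nn_integral_indicator) auto
  finally show ?thesis .
qed

text \<open>\<open>ennreal\<close> sends negative numbers to 0, so replacing the summands by their
  positive parts can only increase the left side.\<close>

lemma ennreal_sum_le: "ennreal (\<Sum>i\<in>I. f i) \<le> (\<Sum>i\<in>I. ennreal (f i))"
proof -
  have "ennreal (\<Sum>i\<in>I. f i) \<le> ennreal (\<Sum>i\<in>I. max 0 (f i))" by (intro ennreal_leI sum_mono) auto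
  also have "\<dots> = (\<Sum>i\<in>I. ennreal (max 0 (f i)))" by (subst sum_ennreal) auto
  also have "\<dots> = (\<Sum>i\<in>I. ennreal (f i))" by (intro sum.cong) (auto simp: max_def ennreal_neg)
  finally show ?thesis .
qed

lemma lifetime_sum_upto_le_integral:
  assumes bc: "\<exists>bs. is_barcode k X bs" and T: "0 < T"
  shows "ennreal (lifetime_sum_upto k X T) \<le> (\<integral>\<^sup>+t\<in>{0..T}. of_nat (card (alive (barcode k X) t)) \<partial>lborel)"
proof -
  define bs where "bs = barcode k X"
  have "is_barcode k X bs" unfolding bs_def barcode_def using bc by (rule someI_ex)
  then have "\<forall>(b, d)\<in>set bs. 0 \<le> b \<and> ereal b < d" unfolding is_barcode_def by (rule conjunct1)
  then have bars: "0 \<le> fst (bs ! i) \<and> ereal (fst (bs ! i)) < snd (bs ! i)" if "i < length bs" for i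
    using nth_mem[OF that] by (auto simp: case_prod_beta)
  have "lifetime_sum_upto k X T = (\<Sum>i<length bs. real_of_ereal (min (snd (bs ! i)) (ereal T)) - min (fst (bs ! i)) T)"
    unfolding lifetime_sum_upto_def bs_def[symmetric]
    by (simp add: sum_list_sum_nth lessThan_atLeast0 case_prod_beta)
  then have "ennreal (lifetime_sum_upto k X T) \<le> (\<Sum>i<length bs. ennreal (real_of_ereal (min (snd (bs ! i)) (ereal T)) - min (fst (bs ! i)) T))"
    by (simp only: ennreal_sum_le)
  also have "\<dots> \<le> (\<Sum>i<length bs. emeasure lborel ({t. fst (bs ! i) \<le> t \<and> ereal t < snd (bs ! i)} \<inter> {0..T}))"
    by (intro sum_mono bar_truncated_length_le T) (use bars in auto)
  also have "\<dots> = (\<integral>\<^sup>+t\<in>{0..T}. of_nat (card (alive bs t)) \<partial>lborel)"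
    by (rule nn_integral_card_alive[symmetric]) simp
  finally show ?thesis by (simp add: bs_def)
qed

lemma lifetime_sum_le_integral:
  assumes bc: "\<exists>bs. is_barcode k X bs"
  shows "lifetime_sum k X \<le> (\<integral>\<^sup>+t\<in>{0..}. of_nat (card (alive (barcode k X) t)) \<partial>lborel)"
proof -
  define bs where "bs = barcode k X"
  have "is_barcode k X bs" unfolding bs_def barcode_def using bc by (rule someI_ex)
  then have "\<forall>(b, d)\<in>set bs. 0 \<le> b \<and> ereal b < d" unfolding is_barcode_def by (rule conjunct1)
  then have bars: "0 \<le> fst (bs ! i) \<and> ereal (fst (bs ! i)) < snd (bs ! i)" if "i < length bs" for i
    using nth_mem[OF that] by (auto simp: case_prod_beta)
  have "lifetime_sum k X = (\<Sum>i<length bs. e2ennreal (snd (bs ! i) - ereal (fst (bs ! i))))"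
    unfolding lifetime_sum_def bs_def[symmetric]
    by (simp add: sum_list_sum_nth lessThan_atLeast0 case_prod_beta)
  also have "\<dots> \<le> (\<Sum>i<length bs. emeasure lborel ({t. fst (bs ! i) \<le> t \<and> ereal t < snd (bs ! i)} \<inter> {0..}))"
    by (intro sum_mono bar_length_le) (use bars in auto)
  also have "\<dots> = (\<integral>\<^sup>+t\<in>{0..}. of_nat (card (alive bs t)) \<partial>lborel)"
    by (rule nn_integral_card_alive[symmetric]) simp
  finally show ?thesis by (simp add: bs_def)
qed

section \<open>From the random process to random sets of faces\<close>

lemma complex_process_eq_down_complex:
  "complex_process V u \<omega> t = down_complex {\<tau> \<in> Pow V - {{}}. u \<tau> \<omega> \<le> t}"
  unfolding complex_process_def down_complex_def by auto

text \<open>The complex changes only at values of the weights. Time 0 is added to them so that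
  rounding down is possible for every \<open>t \<ge> 0\<close>.\<close>

lemma complex_process_barcode_exists:
  fixes V :: "'v::linorder set"
  assumes V: "finite V" and u: "\<And>\<sigma>. \<sigma> \<in> Pow V - {{}} \<Longrightarrow> 0 \<le> u \<sigma> \<omega>"
  shows "\<exists>bs. is_barcode k (complex_process V u \<omega>) bs"
proof (rule barcode_exists[OF V, where F = "insert 0 ((\<lambda>\<tau>. u \<tau> \<omega>) ` (Pow V - {{}}))"])
  let ?F = "insert 0 ((\<lambda>\<tau>. u \<tau> \<omega>) ` (Pow V - {{}}))"
  show "complex_process V u \<omega> t \<subseteq> Pow V" for t by (auto simp: complex_process_def)
  show "complex_process V u \<omega> s \<subseteq> complex_process V u \<omega> t" if "s \<le> t" for s t
    using that by (auto simp: complex_process_def intro: order_trans)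
  show fF: "finite ?F" using V by simp
  show "complex_process V u \<omega> t = complex_process V u \<omega> (Max {s\<in>?F. s \<le> t})" if t: "0 \<le> t" for t
  proof -
    have F: "finite {s\<in>?F. s \<le> t}" "{s\<in>?F. s \<le> t} \<noteq> {}" using fF t by auto
    have le: "Max {s\<in>?F. s \<le> t} \<le> t" using Max_in[OF F] by auto
    have "u \<tau> \<omega> \<le> t \<longleftrightarrow> u \<tau> \<omega> \<le> Max {s\<in>?F. s \<le> t}" if "\<tau> \<in> Pow V - {{}}" for \<tau>
    proof
      assume "u \<tau> \<omega> \<le> t"
      then show "u \<tau> \<omega> \<le> Max {s\<in>?F. s \<le> t}" using that by (intro Max_ge F) auto
    qed (use le in linarith)
    then show ?thesis unfolding complex_process_eq_down_complex by (metis (no_types, lifting) Collect_cong)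
  qed
qed (use u in auto)

text \<open>The bridge to the finite model: the events that exactly the faces in \<open>Y\<close>
  have weight at most \<open>t\<close> partition the probability space, and by independence their
  probabilities are the products in \<open>subset_expectation\<close>.\<close>

lemma nn_integral_open_faces:
  fixes u :: "'v set \<Rightarrow> 'w \<Rightarrow> real"
  assumes M: "prob_space M" and ind: "prob_space.indep_vars M (\<lambda>\<sigma>. borel) u N"
    and N: "finite N" "N \<noteq> {}" and P: "\<And>\<sigma>. \<sigma> \<in> N \<Longrightarrow> cdf (distr M borel (u \<sigma>)) t = P \<sigma>"
    and G: "\<And>Y. 0 \<le> G Y"
  shows "(\<integral>\<^sup>+\<omega>. ennreal (G {\<tau>\<in>N. u \<tau> \<omega> \<le> t}) \<partial>M) = ennreal (subset_expectation N P G)"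
proof -
  interpret prob_space M by fact
  have rv [measurable]: "u \<tau> \<in> borel_measurable M" if "\<tau> \<in> N" for \<tau>
    using ind that unfolding indep_vars_def by auto
  define A where "A = (\<lambda>(Y :: 'v set set) \<tau>. if \<tau> \<in> Y then {..t} else {t<..})"
  define E where "E = (\<lambda>Y. {\<omega> \<in> space M. {\<tau>\<in>N. u \<tau> \<omega> \<le> t} = Y})"
  have E: "E Y = (\<Inter>\<tau>\<in>N. u \<tau> -` A Y \<tau> \<inter> space M)" if "Y \<subseteq> N" for Y
    using that N by (auto simp: E_def A_def not_le split: if_splits)
  have le: "prob (u \<tau> -` {..t} \<inter> space M) = P \<tau>" if "\<tau> \<in> N" for \<tau>
    using P[OF that] rv[OF that] by (simp add: cdf_def measure_distr)
  have gt: "prob (u \<tau> -` {t<..} \<inter> space M) = 1 - P \<tau>" if "\<tau> \<in> N" for \<tau>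
  proof -
    have "u \<tau> -` {t<..} \<inter> space M = space M - (u \<tau> -` {..t} \<inter> space M)" by auto
    then show ?thesis using prob_compl[of "u \<tau> -` {..t} \<inter> space M"] le[OF that] rv[OF that]
      by (simp add: measurable_sets)
  qed
  have PE: "prob (E Y) = (\<Prod>a\<in>Y. P a) * (\<Prod>a\<in>N - Y. 1 - P a)" if Y: "Y \<subseteq> N" for Y
  proof -
    have "prob (E Y) = (\<Prod>\<tau>\<in>N. prob (u \<tau> -` A Y \<tau> \<inter> space M))"
      unfolding E[OF Y] by (rule indep_varsD[OF ind]) (use N in \<open>auto simp: A_def\<close>)
    also have "\<dots> = (\<Prod>\<tau>\<in>Y \<union> (N - Y). if \<tau> \<in> Y then P \<tau> else 1 - P \<tau>)"
      using Y by (intro prod.cong) (auto simp: A_def le gt)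
    also have "\<dots> = (\<Prod>\<tau>\<in>Y. if \<tau> \<in> Y then P \<tau> else 1 - P \<tau>) * (\<Prod>\<tau>\<in>N - Y. if \<tau> \<in> Y then P \<tau> else 1 - P \<tau>)"
      using N finite_subset[OF Y] by (intro prod.union_disjoint) auto
    finally show ?thesis by simp
  qed
  have mE: "E Y \<in> sets M" if "Y \<subseteq> N" for Y
    unfolding E[OF that] using N rv by (intro sets.finite_INT measurable_sets[OF rv]) (auto simp: A_def)
  have "(\<integral>\<^sup>+\<omega>. ennreal (G {\<tau>\<in>N. u \<tau> \<omega> \<le> t}) \<partial>M) = (\<integral>\<^sup>+\<omega>. (\<Sum>Y\<in>Pow N. ennreal (G Y) * indicator (E Y) \<omega>) \<partial>M)"
  proof (intro nn_integral_cong)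
    fix \<omega> assume w: "\<omega> \<in> space M"
    have "(\<Sum>Y\<in>Pow N. ennreal (G Y) * indicator (E Y) \<omega>) = (\<Sum>Y\<in>{{\<tau>\<in>N. u \<tau> \<omega> \<le> t}}. ennreal (G Y) * indicator (E Y) \<omega>)"
      using N by (intro sum.mono_neutral_right) (auto simp: E_def indicator_def split: if_splits)
    also have "\<dots> = ennreal (G {\<tau>\<in>N. u \<tau> \<omega> \<le> t})" using w by (simp add: E_def)
    finally show "ennreal (G {\<tau>\<in>N. u \<tau> \<omega> \<le> t}) = (\<Sum>Y\<in>Pow N. ennreal (G Y) * indicator (E Y) \<omega>)" by simp
  qed
  also have "\<dots> = (\<Sum>Y\<in>Pow N. \<integral>\<^sup>+\<omega>. ennreal (G Y) * indicator (E Y) \<omega> \<partial>M)"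
    using mE by (intro nn_integral_sum) auto
  also have "\<dots> = (\<Sum>Y\<in>Pow N. ennreal (G Y * prob (E Y)))"
    using mE G by (intro sum.cong refl) (simp add: nn_integral_cmult_indicator emeasure_eq_measure ennreal_mult)
  also have "\<dots> = ennreal (\<Sum>Y\<in>Pow N. G Y * prob (E Y))"
    using G by (intro sum_ennreal) auto
  also have "(\<Sum>Y\<in>Pow N. G Y * prob (E Y)) = subset_expectation N P G"
    unfolding subset_expectation_def by (intro sum.cong refl) (simp add: PE mult.commute)
  finally show ?thesis .
qed

definition expected_betti :: "(nat \<Rightarrow> real \<Rightarrow> real) \<Rightarrow> nat \<Rightarrow> 'v::linorder set \<Rightarrow> real \<Rightarrow> real" where
  "expected_betti p k V t =
     subset_expectation (Pow V - {{}}) (\<lambda>\<sigma>. p (card \<sigma> - 1) t) (\<lambda>Y. betti k (down_complex Y))"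

text \<open>The barcode results from a choice, with no evident measurability in
  \<open>\<omega>\<close>. Bounding by Betti numbers first leads to a function of the set of open
  faces, which takes finitely many values and is jointly measurable in \<open>(\<omega>, t)\<close>,
  so Fubini's theorem applies.\<close>

lemma nn_integral_alive_le:
  fixes V :: "'v::linorder set"
  assumes w: "simplex_weights M p V u" and V: "finite V" "V \<noteq> {}"
    and A: "A \<in> sets borel" "A \<subseteq> {0..}"
  shows "(\<integral>\<^sup>+\<omega>. (\<integral>\<^sup>+t\<in>A. of_nat (card (alive (barcode k (complex_process V u \<omega>)) t)) \<partial>lborel) \<partial>M)
    \<le> (\<integral>\<^sup>+t\<in>A. ennreal (expected_betti p k V t) \<partial>lborel)"
proof -
  define N where "N = Pow V - {{}}"
  have N: "finite N" "N \<noteq> {}" using V by (auto simp: N_def)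
  have M: "prob_space M" and ind: "prob_space.indep_vars M (\<lambda>\<sigma>. borel) u N"
    and u0: "\<And>\<sigma> \<omega>. \<sigma> \<in> N \<Longrightarrow> \<omega> \<in> space M \<Longrightarrow> 0 \<le> u \<sigma> \<omega>"
    and cdf: "\<And>\<sigma>. \<sigma> \<in> N \<Longrightarrow> cdf (distr M borel (u \<sigma>)) = p (card \<sigma> - 1)"
    using w by (auto simp: simplex_weights_def N_def)
  interpret prob_space M by (rule M)
  interpret pair_sigma_finite M lborel ..
  have rv: "u \<tau> \<in> borel_measurable M" if "\<tau> \<in> N" for \<tau>
    using ind that unfolding indep_vars_def by auto
  define faces where "faces = (\<lambda>\<omega> t. {\<tau>\<in>N. u \<tau> \<omega> \<le> t})"
  define f where "f = (\<lambda>(\<omega>, t). ennreal (betti k (down_complex (faces \<omega> t))) * indicator A t)"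
  have mf: "f \<in> borel_measurable (M \<Otimes>\<^sub>M lborel)"
  proof -
    define E where "E = (\<lambda>Y. {x \<in> space (M \<Otimes>\<^sub>M lborel). \<forall>\<tau>\<in>N. (u \<tau> (fst x) \<le> snd x) = (\<tau> \<in> Y)})"
    have mE: "E Y \<in> sets (M \<Otimes>\<^sub>M lborel)" for Y
      unfolding E_def
    proof (intro sets.sets_Collect_finite_All N)
      fix \<tau> assume t: "\<tau> \<in> N"
      show "{x \<in> space (M \<Otimes>\<^sub>M lborel). (u \<tau> (fst x) \<le> snd x) = (\<tau> \<in> Y)} \<in> sets (M \<Otimes>\<^sub>M lborel)"
      proof -
        have m: "(\<lambda>x. u \<tau> (fst x)) \<in> borel_measurable (M \<Otimes>\<^sub>M lborel)" "snd \<in> borel_measurable (M \<Otimes>\<^sub>M lborel)"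
          using measurable_compose[OF measurable_fst rv[OF t]] measurable_snd[of M lborel] by simp_all
        show ?thesis
          using borel_measurable_le[OF m] borel_measurable_less[OF m(2,1)] by (cases "\<tau> \<in> Y") (simp_all only: not_le simp_thms)
      qed
    qed
    have "f x = (\<Sum>Y\<in>Pow N. ennreal (betti k (down_complex Y)) * indicator (E Y) x) * indicator A (snd x)"
      if x: "x \<in> space (M \<Otimes>\<^sub>M lborel)" for x
    proof -
      have "(\<Sum>Y\<in>Pow N. ennreal (betti k (down_complex Y)) * indicator (E Y) x)
        = (\<Sum>Y\<in>{faces (fst x) (snd x)}. ennreal (betti k (down_complex Y)) * indicator (E Y) x)"
        using N by (intro sum.mono_neutral_right) (auto simp: E_def faces_def indicator_def)
      also have "\<dots> = ennreal (betti k (down_complex (faces (fst x) (snd x))))" using x by (simp add: E_def faces_def)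
      finally show ?thesis by (simp add: f_def case_prod_beta)
    qed
    moreover have "(\<lambda>x. (\<Sum>Y\<in>Pow N. ennreal (betti k (down_complex Y)) * indicator (E Y) x) * indicator A (snd x)) \<in> borel_measurable (M \<Otimes>\<^sub>M lborel)"
      using mE A by measurable
    ultimately show ?thesis by (simp cong: measurable_cong)
  qed
  have "(\<integral>\<^sup>+\<omega>. (\<integral>\<^sup>+t\<in>A. of_nat (card (alive (barcode k (complex_process V u \<omega>)) t)) \<partial>lborel) \<partial>M)
    \<le> (\<integral>\<^sup>+\<omega>. (\<integral>\<^sup>+t. f (\<omega>, t) \<partial>lborel) \<partial>M)"
  proof (intro nn_integral_mono)
    fix \<omega> t assume w: "\<omega> \<in> space M"
    have "\<exists>bs. is_barcode k (complex_process V u \<omega>) bs"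
      by (rule complex_process_barcode_exists[OF V(1)]) (use u0 w in \<open>auto simp: N_def\<close>)
    then have bc: "is_barcode k (complex_process V u \<omega>) (barcode k (complex_process V u \<omega>))"
      unfolding barcode_def by (rule someI_ex)
    show "of_nat (card (alive (barcode k (complex_process V u \<omega>)) t)) * indicator A t \<le> f (\<omega>, t)"
    proof (cases "t \<in> A")
      case True
      have X: "complex_process V u \<omega> t = down_complex (faces \<omega> t)"
        by (simp add: complex_process_eq_down_complex faces_def N_def)
      have "card (alive (barcode k (complex_process V u \<omega>)) t) \<le> betti k (complex_process V u \<omega> t)"
      proof (rule card_alive_le_betti[OF V(1) _ _ bc])
        show "complex_process V u \<omega> t \<subseteq> Pow V" by (auto simp: complex_process_def)
        show "face_closed (complex_process V u \<omega> t)" unfolding X by (rule face_closed_down_complex)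
        show "0 \<le> t" using A True by auto
      qed
      then show ?thesis using True by (simp add: f_def X ennreal_of_nat_eq_real_of_nat)
    qed simp
  qed
  also have "\<dots> = (\<integral>\<^sup>+t. (\<integral>\<^sup>+\<omega>. f (\<omega>, t) \<partial>M) \<partial>lborel)" by (rule Fubini[OF mf, symmetric])
  also have "\<dots> = (\<integral>\<^sup>+t\<in>A. ennreal (expected_betti p k V t) \<partial>lborel)"
  proof (intro nn_integral_cong)
    fix t
    show "(\<integral>\<^sup>+\<omega>. f (\<omega>, t) \<partial>M) = ennreal (expected_betti p k V t) * indicator A t"
    proof (cases "t \<in> A")
      case True
      have "(\<integral>\<^sup>+\<omega>. f (\<omega>, t) \<partial>M) = (\<integral>\<^sup>+\<omega>. ennreal ((\<lambda>Y. real (betti k (down_complex Y))) {\<tau>\<in>N. u \<tau> \<omega> \<le> t}) \<partial>M)"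
        using True by (simp add: f_def faces_def)
      also have "\<dots> = ennreal (subset_expectation N (\<lambda>\<sigma>. p (card \<sigma> - 1) t) (\<lambda>Y. real (betti k (down_complex Y))))"
        by (rule nn_integral_open_faces[OF M ind N]) (simp_all add: cdf)
      finally show ?thesis using True by (simp add: expected_betti_def N_def)
    qed (simp add: f_def)
  qed
  finally show ?thesis .
qed

lemma expected_lifetime_sum_upto_le:
  fixes V :: "'v::linorder set"
  assumes w: "simplex_weights M p V u" and V: "finite V" "V \<noteq> {}" and T: "0 < T"
  shows "(\<integral>\<^sup>+\<omega>. ennreal (lifetime_sum_upto k (complex_process V u \<omega>) T) \<partial>M)
    \<le> (\<integral>\<^sup>+t\<in>{0..T}. ennreal (expected_betti p k V t) \<partial>lborel)"
proof -
  have "(\<integral>\<^sup>+\<omega>. ennreal (lifetime_sum_upto k (complex_process V u \<omega>) T) \<partial>M)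
    \<le> (\<integral>\<^sup>+\<omega>. (\<integral>\<^sup>+t\<in>{0..T}. of_nat (card (alive (barcode k (complex_process V u \<omega>)) t)) \<partial>lborel) \<partial>M)"
    by (intro nn_integral_mono lifetime_sum_upto_le_integral T complex_process_barcode_exists V(1))
       (use w in \<open>auto simp: simplex_weights_def\<close>)
  also have "\<dots> \<le> (\<integral>\<^sup>+t\<in>{0..T}. ennreal (expected_betti p k V t) \<partial>lborel)"
    by (rule nn_integral_alive_le[OF w V]) auto
  finally show ?thesis .
qed

lemma expected_lifetime_sum_le:
  fixes V :: "'v::linorder set"
  assumes w: "simplex_weights M p V u" and V: "finite V" "V \<noteq> {}"
  shows "(\<integral>\<^sup>+\<omega>. lifetime_sum k (complex_process V u \<omega>) \<partial>M)
    \<le> (\<integral>\<^sup>+t\<in>{0..}. ennreal (expected_betti p k V t) \<partial>lborel)"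
proof -
  have "(\<integral>\<^sup>+\<omega>. lifetime_sum k (complex_process V u \<omega>) \<partial>M)
    \<le> (\<integral>\<^sup>+\<omega>. (\<integral>\<^sup>+t\<in>{0..}. of_nat (card (alive (barcode k (complex_process V u \<omega>)) t)) \<partial>lborel) \<partial>M)"
    by (intro nn_integral_mono lifetime_sum_le_integral complex_process_barcode_exists V(1))
       (use w in \<open>auto simp: simplex_weights_def\<close>)
  also have "\<dots> \<le> (\<integral>\<^sup>+t\<in>{0..}. ennreal (expected_betti p k V t) \<partial>lborel)"
    by (rule nn_integral_alive_le[OF w V]) auto
  finally show ?thesis .
qed

section \<open>Asymptotics\<close>

text \<open>For the smallest \<open>j \<ge> 1\<close> with \<open>x \<le> 2 ^ j\<close>, decay at
  \<open>x > 2 ^ (j - 1)\<close> gives \<open>H * 2 ^ M / 2 ^ (M * j)\<close>, whence the factor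
  \<open>2 ^ M\<close>; the last term covers \<open>x > 2 ^ J\<close>. Larger \<open>j\<close> are
  kept in the sum so that only sublevel sets of \<open>x\<close> occur.\<close>

lemma dyadic_decay_bound:
  fixes G H x :: real
  assumes G: "G \<le> H" "x ^ M * G \<le> H" and H: "0 \<le> H"
  shows "G \<le> H * 2 ^ M * (\<Sum>j\<le>J. of_bool (x \<le> 2 ^ j) / 2 ^ (M * j)) + H / 2 ^ (M * J)"
proof (induction J)
  case 0
  then show ?case using G H by (auto intro: add_increasing)
next
  case (Suc J)
  show ?case
  proof (cases "x \<le> 2 ^ Suc J")
    case True
    \<comment> \<open>The new summand is exactly the old remainder, which it replaces.\<close>
    have "H * 2 ^ M * (1 / 2 ^ (M * Suc J)) = H / 2 ^ (M * J)" by (simp add: power_add)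
    moreover have "0 \<le> H / 2 ^ (M * Suc J)" using H by simp
    ultimately show ?thesis using Suc True by (simp add: distrib_left)
  next
    case False
    have "G \<le> H / 2 ^ (M * Suc J)"
    proof (cases "G \<le> 0")
      case True
      then show ?thesis using H by (meson divide_nonneg_nonneg order_trans zero_le_numeral zero_le_power)
    next
      case G0: False
      have "(2 ^ Suc J) ^ M * G \<le> x ^ M * G" using False G0 by (intro mult_right_mono power_mono) auto
      moreover have "(2 ^ Suc J) ^ M = (2::real) ^ (M * Suc J)" by (simp only: power_mult[symmetric] mult.commute)
      ultimately have "2 ^ (M * Suc J) * G \<le> H" using G(2) by simp
      then show ?thesis by (simp add: pos_le_divide_eq mult.commute)
    qed
    moreover have "0 \<le> H * 2 ^ M * (\<Sum>j\<le>Suc J. of_bool (x \<le> 2 ^ j) / 2 ^ (M * j))"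
      using H by (intro mult_nonneg_nonneg sum_nonneg) auto
    ultimately show ?thesis by linarith
  qed
qed

lemma exists_dyadic_exponent:
  fixes x :: real
  assumes "1 \<le> x"
  shows "\<exists>J. 2 ^ J \<le> x \<and> x < 2 ^ Suc J"
proof -
  obtain n where "x < 2 ^ n" using real_arch_pow[of 2 x] by auto
  then have ex: "\<exists>n. x < 2 ^ n" by blast
  define n where "n = (LEAST n. x < 2 ^ n)"
  have n: "x < 2 ^ n" unfolding n_def using ex by (rule LeastI_ex)
  then obtain J where J: "n = Suc J" using assms by (cases n) auto
  have "\<not> x < 2 ^ J" using not_less_Least[of J "\<lambda>n. x < 2 ^ n"] J n_def by simp
  then show ?thesis using n J by (intro exI[of _ J]) auto
qed

section \<open>Monotonicity and limits of \<open>q\<close>, \<open>r\<close>, \<open>rcheck\<close>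
  and \<open>Phi\<close>\<close>

locale distribution_family =
  fixes p :: "nat \<Rightarrow> real \<Rightarrow> real" and k :: nat
  assumes dist: "\<And>i. nonneg_distribution_function (p i)"
begin

lemma p_mono: "s \<le> t \<Longrightarrow> p i s \<le> p i t"
  and p_nonneg: "0 \<le> p i t" and p_le_1: "p i t \<le> 1"
  and p_right_cont: "continuous (at_right a) (p i)"
  and p_lim: "(p i \<longlongrightarrow> 1) at_top"
proof -
  obtain \<mu> where m: "real_distribution \<mu>" "p i = cdf \<mu>"
    using dist[of i] by (auto simp: nonneg_distribution_function_def)
  interpret real_distribution \<mu> by (rule m(1))
  show "s \<le> t \<Longrightarrow> p i s \<le> p i t" "0 \<le> p i t" "p i t \<le> 1" "continuous (at_right a) (p i)" "(p i \<longlongrightarrow> 1) at_top"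
    unfolding m(2) by (rule cdf_nondecreasing cdf_nonneg cdf_bounded_prob cdf_is_right_cont cdf_lim_at_top_prob; assumption?)+
qed

abbreviation "q \<equiv> qfun p"
abbreviation "r \<equiv> rfun p k"

lemma q_nonneg: "0 \<le> q j t" and q_le_1: "q j t \<le> 1" and q_mono: "s \<le> t \<Longrightarrow> q j s \<le> q j t"
  unfolding qfun_def
  by (auto intro!: prod_nonneg prod_le_1 zero_le_power power_le_one prod_mono power_mono p_nonneg p_le_1 p_mono)

lemma r_mono: "s \<le> t \<Longrightarrow> r s \<le> r t"
  unfolding rfun_def
  by (auto intro!: prod_nonneg prod_le_1 zero_le_power power_le_one prod_mono power_mono p_nonneg p_le_1 p_mono simp del: prod.cl_ivl_Suc)

lemma q_right_cont: "continuous (at_right a) (q j)"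
  unfolding qfun_def by (intro continuous_intros p_right_cont)

lemma q_lim: "(q j \<longlongrightarrow> 1) at_top"
proof -
  have "((\<lambda>t. \<Prod>i=0..j. p i t ^ ((j + 1) choose (i + 1))) \<longlongrightarrow> (\<Prod>i=0..j. 1 ^ ((j + 1) choose (i + 1)))) at_top"
    by (intro tendsto_intros p_lim)
  then show ?thesis by (simp add: qfun_def[abs_def])
qed

lemma r_lim: "(r \<longlongrightarrow> 1) at_top"
proof -
  have "((\<lambda>t. \<Prod>i=0..k+1. p i t ^ ((k + 1) choose i)) \<longlongrightarrow> (\<Prod>i=0..k+1. 1 ^ ((k + 1) choose i))) at_top"
    by (intro tendsto_intros p_lim)
  then show ?thesis by (simp add: rfun_def[abs_def])
qed

lemma q_measurable [measurable]: "q j \<in> borel_measurable borel"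
  by (rule borel_measurable_mono) (auto simp: mono_def q_mono)

lemma rcheck_set_nonempty:
  assumes "v < 1"
  shows "{t. 0 \<le> t \<and> r t > v} \<noteq> {}"
proof -
  have "\<forall>\<^sub>F t in at_top. r t > v" using order_tendstoD(1)[OF r_lim assms] .
  then have "\<forall>\<^sub>F t in at_top. r t > v \<and> 0 \<le> t" using eventually_ge_at_top[of 0] by eventually_elim simp
  then obtain t where "r t > v \<and> 0 \<le> t" using eventually_happens'[OF trivial_limit_at_top_linorder] by blast
  then show ?thesis by auto
qed

lemma rcheck_bdd: "bdd_below {t. 0 \<le> t \<and> r t > v}"
  by (rule bdd_belowI[of _ 0]) auto

text \<open>By monotonicity of \<open>r\<close>; the condition \<open>v < 1\<close> makes the set in
  the infimum nonempty. Sublevel sets of \<open>r\<close> thus lie to the left of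
  \<open>rcheck\<close>, which is how integrals of \<open>q\<close> over them lead to
  \<open>Phi\<close>.\<close>

lemma le_rcheck:
  assumes "v < 1" "r t \<le> v"
  shows "t \<le> rcheck p k v"
  unfolding rcheck_def
proof (rule cInf_greatest[OF rcheck_set_nonempty[OF assms(1)]])
  fix s assume "s \<in> {t. 0 \<le> t \<and> r t > v}"
  then have "r t < r s" using assms by auto
  then show "t \<le> s" using r_mono[of s t] by force
qed

lemma rcheck_nonneg: "v < 1 \<Longrightarrow> 0 \<le> rcheck p k v"
  unfolding rcheck_def by (rule cInf_greatest[OF rcheck_set_nonempty]) auto

lemma rcheck_mono: "v \<le> w \<Longrightarrow> w < 1 \<Longrightarrow> rcheck p k v \<le> rcheck p k w"
  unfolding rcheck_def by (rule cInf_superset_mono[OF rcheck_set_nonempty rcheck_bdd]) auto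

lemma nn_integral_q: "0 \<le> T \<Longrightarrow> (\<integral>\<^sup>+t\<in>{0..T}. ennreal (q k t) \<partial>lborel) = ennreal (Qfun p k T)"
proof -
  assume "0 \<le> T"
  have fin: "emeasure lborel {0..T} < \<infinity>" using \<open>0 \<le> T\<close> by simp
  have int: "set_integrable lborel {0..T} (q k)"
    unfolding set_integrable_def
    by (rule integrableI_bounded_set_indicator[where B = 1]) (use fin q_nonneg q_le_1 in auto)
  have "(\<integral>\<^sup>+t\<in>{0..T}. ennreal (q k t) \<partial>lborel) = (\<integral>\<^sup>+t. ennreal (indicator {0..T} t *\<^sub>R q k t) \<partial>lborel)"
    by (intro nn_integral_cong) (simp add: indicator_def)
  also have "\<dots> = ennreal (\<integral>t. indicator {0..T} t *\<^sub>R q k t \<partial>lborel)"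
    by (rule nn_integral_eq_integral) (use int q_nonneg in \<open>auto simp: set_integrable_def\<close>)
  finally show ?thesis by (simp add: Qfun_def set_lebesgue_integral_def)
qed

lemma Qfun_nonneg: "0 \<le> Qfun p k T"
  unfolding Qfun_def set_lebesgue_integral_def by (intro integral_nonneg_AE) (simp add: q_nonneg)

lemma Phi_nonneg: "0 \<le> Phi p k v"
  by (simp add: Phi_def Qfun_nonneg)

lemma Phi_mono: "v \<le> w \<Longrightarrow> w < 1 \<Longrightarrow> Phi p k v \<le> Phi p k w"
proof -
  assume vw: "v \<le> w" "w < 1"
  have 0: "0 \<le> rcheck p k v" "rcheck p k v \<le> rcheck p k w"
    using vw rcheck_nonneg rcheck_mono by auto
  have "ennreal (Phi p k v) \<le> ennreal (Phi p k w)"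
    unfolding Phi_def using 0 by (subst (1 2) nn_integral_q[symmetric]) (auto intro!: nn_integral_mono simp: indicator_def)
  then show ?thesis using Phi_nonneg by (simp add: ennreal_le_iff)
qed

lemma nn_integral_q_sublevel:
  assumes "v < 1"
  shows "(\<integral>\<^sup>+t\<in>{0..T}. ennreal (q k t * of_bool (r t \<le> v)) \<partial>lborel) \<le> ennreal (Phi p k v)"
proof -
  have "(\<integral>\<^sup>+t\<in>{0..T}. ennreal (q k t * of_bool (r t \<le> v)) \<partial>lborel)
    \<le> (\<integral>\<^sup>+t\<in>{0..rcheck p k v}. ennreal (q k t) \<partial>lborel)"
    using le_rcheck[OF assms] by (intro nn_integral_mono) (auto simp: indicator_def)
  then show ?thesis using nn_integral_q[OF rcheck_nonneg[OF assms]] by (simp add: Phi_def)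
qed

lemma model: "finite V \<Longrightarrow> random_complex_model V (\<lambda>i. p i t)"
  by unfold_locales (auto simp: p_nonneg p_le_1)

lemma expected_betti_nonneg: "finite V \<Longrightarrow> 0 \<le> expected_betti p k V t"
  unfolding expected_betti_def subset_expectation_def
  by (intro sum_nonneg mult_nonneg_nonneg prod_nonneg) (auto simp: p_nonneg p_le_1)

text \<open>The dictionary at time \<open>t\<close>: \<open>coface_prob (k + 1)\<close> is
  \<open>r t\<close> and \<open>simplex_prob k\<close> is \<open>q k t\<close>.\<close>

lemma expected_betti_decay:
  assumes V: "finite V" "m \<le> card V"
  shows "(card V * r t) ^ m * expected_betti p k V t \<le> betti_decay_constant k m * (real (card V) ^ (k + 1) * q k t)"
proof -
  interpret m: random_complex_model V "\<lambda>i. p i t" by (rule model[OF V(1)])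
  have "m.coface_prob (k + 1) = r t" by (simp add: m.coface_prob_def rfun_def atLeast0AtMost)
  moreover have "m.simplex_prob k = q k t" by (simp add: m.simplex_prob_def qfun_def atLeast0AtMost)
  moreover have "m.weight = (\<lambda>\<sigma>. p (card \<sigma> - 1) t)" by (simp add: m.weight_def fun_eq_iff)
  ultimately show ?thesis using m.expectation_betti_decay[OF V(2), of k] by (simp add: expected_betti_def)
qed

lemma expected_betti_le_missing:
  assumes V: "finite V" "1 \<le> card V"
  shows "expected_betti p k V t \<le> real (card V) ^ (2 * k + 3) * (1 - q (k + 1) t)"
proof -
  interpret m: random_complex_model V "\<lambda>i. p i t" by (rule model[OF V(1)])
  have s: "m.simplex_prob (k + 1) = q (k + 1) t" by (simp only: m.simplex_prob_def qfun_def atLeast0AtMost)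
  have "m.weight = (\<lambda>\<sigma>. p (card \<sigma> - 1) t)" by (simp add: m.weight_def fun_eq_iff)
  then have "expected_betti p k V t \<le> real (card {\<pi>\<in>Pow V. card \<pi> = k + 1} * card {\<pi>\<in>Pow V. card \<pi> = k + 2}) * (1 - q (k + 1) t)"
    using m.expectation_betti_le_missing[OF V(2), of k] s by (simp add: expected_betti_def)
  also have "\<dots> \<le> real (card V) ^ (k + 1) * real (card V) ^ (k + 2) * (1 - q (k + 1) t)"
    unfolding of_nat_mult using q_le_1[of "k + 1" t]
    by (intro mult_right_mono mult_mono card_subsets_le_power V(1)) auto
  also have "real (card V) ^ (k + 1) * real (card V) ^ (k + 2) = real (card V) ^ (2 * k + 3)"
    by (simp add: power_add[symmetric] mult_2 numeral_eq_Suc)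
  finally show ?thesis .
qed

text \<open>The maximum lets one constant serve for the trivial bound and for decay of order
  \<open>M\<close>.\<close>

definition decay_constant :: "nat \<Rightarrow> real" where
  "decay_constant M = max (betti_decay_constant k 0) (betti_decay_constant k M)"

lemma decay_constant_nonneg: "0 \<le> decay_constant M"
  by (simp add: decay_constant_def betti_decay_constant_def cone_step_constant_def le_max_iff_disj)

lemma expected_betti_bounds:
  assumes V: "finite V" "M \<le> card V"
  shows "expected_betti p k V t \<le> decay_constant M * (real (card V) ^ (k + 1) * q k t)"
    and "(card V * r t) ^ M * expected_betti p k V t \<le> decay_constant M * (real (card V) ^ (k + 1) * q k t)"
proof -
  have nn: "0 \<le> real (card V) ^ (k + 1) * q k t" using q_nonneg by simp
  have "expected_betti p k V t \<le> betti_decay_constant k 0 * (real (card V) ^ (k + 1) * q k t)"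
    using expected_betti_decay[OF V(1), of 0 t] by simp
  also have "\<dots> \<le> decay_constant M * (real (card V) ^ (k + 1) * q k t)"
    using nn by (intro mult_right_mono) (auto simp: decay_constant_def)
  finally show "expected_betti p k V t \<le> decay_constant M * (real (card V) ^ (k + 1) * q k t)" .
  have "(card V * r t) ^ M * expected_betti p k V t \<le> betti_decay_constant k M * (real (card V) ^ (k + 1) * q k t)"
    by (rule expected_betti_decay[OF V])
  also have "\<dots> \<le> decay_constant M * (real (card V) ^ (k + 1) * q k t)"
    using nn by (intro mult_right_mono) (auto simp: decay_constant_def)
  finally show "(card V * r t) ^ M * expected_betti p k V t \<le> decay_constant M * (real (card V) ^ (k + 1) * q k t)" .
qed

text \<open>The dyadic bound with \<open>x = n * r t\<close> turns each indicator into a sublevel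
  set of \<open>r\<close>, over which \<open>q\<close> integrates to at most \<open>Phi\<close> at
  \<open>2 ^ j / n\<close>; \<open>2 ^ J < n\<close> keeps these arguments below 1. In the remainder
  \<open>q\<close> is only bounded by 1, which produces the term in \<open>T\<close>.\<close>

lemma integral_expected_betti_dyadic:
  assumes V: "finite V" "card V = n" "M \<le> n" "0 < n" and J: "2 ^ J < real n" and T: "0 < T"
  shows "(\<integral>\<^sup>+t\<in>{0..T}. ennreal (expected_betti p k V t) \<partial>lborel)
    \<le> ennreal (decay_constant M * real n ^ (k + 1) * (2 ^ M * (\<Sum>j\<le>J. Phi p k (2 ^ j / n) / 2 ^ (M * j)) + T / 2 ^ (M * J)))"
proof -
  define H where "H = decay_constant M * real n ^ (k + 1)"
  have H: "0 \<le> H" using decay_constant_nonneg by (simp add: H_def)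
  have v1: "2 ^ j / real n < 1" if "j \<le> J" for j
  proof -
    have "(2::real) ^ j \<le> 2 ^ J" using that by (intro power_increasing) auto
    then have "2 ^ j < real n" using J by linarith
    then show ?thesis by simp
  qed
  have pt: "ennreal (expected_betti p k V t)
      \<le> (\<Sum>j\<le>J. ennreal (H * 2 ^ M / 2 ^ (M * j)) * ennreal (q k t * of_bool (r t \<le> 2 ^ j / n))) + ennreal (H / 2 ^ (M * J))" for t
  proof -
    have "expected_betti p k V t \<le> (H * q k t) * 2 ^ M * (\<Sum>j\<le>J. of_bool (n * r t \<le> 2 ^ j) / 2 ^ (M * j)) + (H * q k t) / 2 ^ (M * J)"
    proof (rule dyadic_decay_bound)
      show "expected_betti p k V t \<le> H * q k t"
        using expected_betti_bounds(1)[OF V(1), of M t] V by (simp add: H_def mult.assoc)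
      show "(n * r t) ^ M * expected_betti p k V t \<le> H * q k t"
        using expected_betti_bounds(2)[OF V(1), of M t] V by (simp add: H_def mult.assoc)
      show "0 \<le> H * q k t" using H q_nonneg by simp
    qed
    also have "(H * q k t) / 2 ^ (M * J) \<le> H / 2 ^ (M * J)"
      using H q_le_1[of k t] q_nonneg[of k t] by (intro divide_right_mono) (auto simp: mult_left_le)
    also have "(H * q k t) * 2 ^ M * (\<Sum>j\<le>J. of_bool (n * r t \<le> 2 ^ j) / 2 ^ (M * j))
      = (\<Sum>j\<le>J. (H * 2 ^ M / 2 ^ (M * j)) * (q k t * of_bool (r t \<le> 2 ^ j / n)))"
      unfolding sum_distrib_left
    proof (intro sum.cong refl)
      fix j
      have "n * r t \<le> 2 ^ j \<longleftrightarrow> r t \<le> 2 ^ j / n" using V(4) by (simp add: pos_le_divide_eq mult.commute)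
      then show "H * q k t * 2 ^ M * (of_bool (n * r t \<le> 2 ^ j) / 2 ^ (M * j)) = H * 2 ^ M / 2 ^ (M * j) * (q k t * of_bool (r t \<le> 2 ^ j / n))"
        by simp
    qed
    finally have "ennreal (expected_betti p k V t)
      \<le> ennreal ((\<Sum>j\<le>J. (H * 2 ^ M / 2 ^ (M * j)) * (q k t * of_bool (r t \<le> 2 ^ j / n))) + H / 2 ^ (M * J))"
      by (intro ennreal_leI) simp
    also have "\<dots> = ennreal (\<Sum>j\<le>J. (H * 2 ^ M / 2 ^ (M * j)) * (q k t * of_bool (r t \<le> 2 ^ j / n))) + ennreal (H / 2 ^ (M * J))"
      using H q_nonneg[of k t] by (intro ennreal_plus sum_nonneg) auto
    also have "ennreal (\<Sum>j\<le>J. (H * 2 ^ M / 2 ^ (M * j)) * (q k t * of_bool (r t \<le> 2 ^ j / n)))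
      = (\<Sum>j\<le>J. ennreal (H * 2 ^ M / 2 ^ (M * j)) * ennreal (q k t * of_bool (r t \<le> 2 ^ j / n)))"
    proof -
      have nn: "0 \<le> H * 2 ^ M / 2 ^ (M * j)" "0 \<le> q k t * of_bool (r t \<le> 2 ^ j / n)" for j
        using H q_nonneg[of k t] by auto
      show ?thesis
        unfolding ennreal_mult[OF nn, symmetric] by (rule sum_ennreal[symmetric]) (intro mult_nonneg_nonneg nn)
    qed
    finally show ?thesis .
  qed
  have mr: "r \<in> borel_measurable borel" by (rule borel_measurable_mono) (auto simp: mono_def r_mono)
  note [measurable] = mr
  have "(\<integral>\<^sup>+t\<in>{0..T}. ennreal (expected_betti p k V t) \<partial>lborel)
    \<le> (\<integral>\<^sup>+t. (\<Sum>j\<le>J. ennreal (H * 2 ^ M / 2 ^ (M * j)) * (ennreal (q k t * of_bool (r t \<le> 2 ^ j / n)) * indicator {0..T} t))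
        + ennreal (H / 2 ^ (M * J)) * indicator {0..T} t \<partial>lborel)"
  proof (intro nn_integral_mono)
    fix t
    have "ennreal (expected_betti p k V t) * indicator {0..T} t \<le> ((\<Sum>j\<le>J. ennreal (H * 2 ^ M / 2 ^ (M * j)) * ennreal (q k t * of_bool (r t \<le> 2 ^ j / n))) + ennreal (H / 2 ^ (M * J))) * indicator {0..T} t"
      by (intro mult_right_mono pt) simp
    then show "ennreal (expected_betti p k V t) * indicator {0..T} t \<le> (\<Sum>j\<le>J. ennreal (H * 2 ^ M / 2 ^ (M * j)) * (ennreal (q k t * of_bool (r t \<le> 2 ^ j / n)) * indicator {0..T} t))
        + ennreal (H / 2 ^ (M * J)) * indicator {0..T} t"
      by (simp only: distrib_right sum_distrib_right mult.assoc)
  qed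
  also have "\<dots> = (\<Sum>j\<le>J. ennreal (H * 2 ^ M / 2 ^ (M * j)) * (\<integral>\<^sup>+t\<in>{0..T}. ennreal (q k t * of_bool (r t \<le> 2 ^ j / n)) \<partial>lborel))
      + ennreal (H / 2 ^ (M * J)) * emeasure lborel {0..T}"
    by (subst nn_integral_add) (simp_all add: nn_integral_sum nn_integral_cmult nn_integral_cmult_indicator)
  also have "\<dots> \<le> (\<Sum>j\<le>J. ennreal (H * 2 ^ M / 2 ^ (M * j)) * ennreal (Phi p k (2 ^ j / n))) + ennreal (H / 2 ^ (M * J)) * ennreal T"
    using T by (intro add_mono sum_mono mult_left_mono nn_integral_q_sublevel v1) auto
  also have "\<dots> = ennreal (\<Sum>j\<le>J. H * 2 ^ M / 2 ^ (M * j) * Phi p k (2 ^ j / n)) + ennreal (H / 2 ^ (M * J) * T)"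
  proof -
    have nn: "0 \<le> H * 2 ^ M / 2 ^ (M * j)" "0 \<le> Phi p k (2 ^ j / n)" "0 \<le> H / 2 ^ (M * J)" "0 \<le> T" for j
      using H T Phi_nonneg by auto
    show ?thesis
      unfolding ennreal_mult[OF nn(1,2), symmetric] ennreal_mult[OF nn(3,4), symmetric]
      by (subst sum_ennreal) (rule refl mult_nonneg_nonneg nn)+
  qed
  also have "\<dots> = ennreal ((\<Sum>j\<le>J. H * 2 ^ M / 2 ^ (M * j) * Phi p k (2 ^ j / n)) + H / 2 ^ (M * J) * T)"
    using H T Phi_nonneg by (intro ennreal_plus[symmetric] sum_nonneg) auto
  also have "(\<Sum>j\<le>J. H * 2 ^ M / 2 ^ (M * j) * Phi p k (2 ^ j / n)) + H / 2 ^ (M * J) * T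
    = H * (2 ^ M * (\<Sum>j\<le>J. Phi p k (2 ^ j / n) / 2 ^ (M * j)) + T / 2 ^ (M * J))"
    by (simp add: sum_distrib_left algebra_simps)
  finally show ?thesis by (simp add: H_def)
qed

text \<open>A single threshold \<open>r t = y / n\<close> instead of the dyadic ones. It serves
  rapidly decaying \<open>Phi\<close>, where the ratio of \<open>Phi\<close> at consecutive scales
  is not controlled.\<close>

lemma integral_expected_betti_cut:
  assumes V: "finite V" "card V = n" "M \<le> n" "0 < n" and y: "0 < y" "y < n" and T: "0 < T"
  shows "(\<integral>\<^sup>+t\<in>{0..T}. ennreal (expected_betti p k V t) \<partial>lborel)
    \<le> ennreal (decay_constant M * real n ^ (k + 1) * (Phi p k (y / n) + T / y ^ M))"
proof -
  define H where "H = decay_constant M * real n ^ (k + 1)"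
  have H: "0 \<le> H" using decay_constant_nonneg by (simp add: H_def)
  have pt: "expected_betti p k V t \<le> H * (q k t * of_bool (r t \<le> y / n)) + H / y ^ M" for t
  proof (cases "r t \<le> y / n")
    case True
    have "expected_betti p k V t \<le> H * q k t" using expected_betti_bounds(1)[OF V(1), of M t] V by (simp add: H_def mult.assoc)
    moreover have "0 \<le> H / y ^ M" using H y by simp
    ultimately show ?thesis using True by simp
  next
    case False
    have "y \<le> n * r t" using False V(4) by (simp add: pos_le_divide_eq mult.commute not_le pos_divide_less_eq)
    then have "y ^ M * expected_betti p k V t \<le> (n * r t) ^ M * expected_betti p k V t"
      using y expected_betti_nonneg[OF V(1)] by (intro mult_right_mono power_mono) auto
    also have "\<dots> \<le> H * q k t" using expected_betti_bounds(2)[OF V(1), of M t] V by (simp add: H_def mult.assoc)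
    also have "\<dots> \<le> H" using H q_le_1[of k t] by (simp add: mult_left_le)
    finally show ?thesis using False y by (simp add: pos_le_divide_eq mult.commute)
  qed
  have mr: "r \<in> borel_measurable borel" by (rule borel_measurable_mono) (auto simp: mono_def r_mono)
  note [measurable] = mr
  have "(\<integral>\<^sup>+t\<in>{0..T}. ennreal (expected_betti p k V t) \<partial>lborel)
    \<le> (\<integral>\<^sup>+t. ennreal H * (ennreal (q k t * of_bool (r t \<le> y / n)) * indicator {0..T} t)
        + ennreal (H / y ^ M) * indicator {0..T} t \<partial>lborel)"
  proof (intro nn_integral_mono)
    fix t
    have "ennreal (expected_betti p k V t) \<le> ennreal (H * (q k t * of_bool (r t \<le> y / n)) + H / y ^ M)"
      by (intro ennreal_leI pt)
    also have "\<dots> = ennreal H * ennreal (q k t * of_bool (r t \<le> y / n)) + ennreal (H / y ^ M)"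
      using H y q_nonneg[of k t] by (subst ennreal_plus) (auto simp: ennreal_mult)
    finally have "ennreal (expected_betti p k V t) * indicator {0..T} t \<le> (ennreal H * ennreal (q k t * of_bool (r t \<le> y / n)) + ennreal (H / y ^ M)) * indicator {0..T} t"
      by (intro mult_right_mono) auto
    then show "ennreal (expected_betti p k V t) * indicator {0..T} t \<le> ennreal H * (ennreal (q k t * of_bool (r t \<le> y / n)) * indicator {0..T} t)
        + ennreal (H / y ^ M) * indicator {0..T} t"
      by (simp only: distrib_right mult.assoc)
  qed
  also have "\<dots> = ennreal H * (\<integral>\<^sup>+t\<in>{0..T}. ennreal (q k t * of_bool (r t \<le> y / n)) \<partial>lborel)
      + ennreal (H / y ^ M) * emeasure lborel {0..T}"
    by (subst nn_integral_add) (simp_all add: nn_integral_cmult nn_integral_cmult_indicator)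
  also have "\<dots> \<le> ennreal H * ennreal (Phi p k (y / n)) + ennreal (H / y ^ M) * ennreal T"
    using T V(4) y by (intro add_mono mult_left_mono nn_integral_q_sublevel) auto
  also have "\<dots> = ennreal (H * Phi p k (y / n) + H / y ^ M * T)"
  proof -
    have nn: "0 \<le> H / y ^ M" "0 \<le> Phi p k (y / n)" "0 \<le> T" using H T y Phi_nonneg by auto
    show ?thesis
      unfolding ennreal_mult[OF H nn(2), symmetric] ennreal_mult[OF nn(1,3), symmetric]
      by (rule ennreal_plus[symmetric]) (intro mult_nonneg_nonneg H nn)+
  qed
  also have "H * Phi p k (y / n) + H / y ^ M * T = H * (Phi p k (y / n) + T / y ^ M)" by (simp add: distrib_left)
  finally show ?thesis by (simp add: H_def)
qed

text \<open>Markov's inequality, applied to bounded intervals \<open>{t<..y}\<close>, whose measure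
  is a difference of values of \<open>q\<close>. The passage to
  \<open>y \<rightarrow> \<infinity>\<close> uses that \<open>q\<close> tends to 1.\<close>

lemma moment_tail:
  assumes \<delta>: "0 < \<delta>" and fin: "(\<integral>\<^sup>+t\<in>{0..}. ennreal (t powr (1 + \<delta>)) \<partial>interval_measure (q (k + 1))) < \<infinity>"
  shows "\<exists>K\<ge>0. \<forall>t>0. 1 - q (k + 1) t \<le> K * t powr (- (1 + \<delta>))"
proof -
  define \<mu> where "\<mu> = interval_measure (q (k + 1))"
  obtain K where K: "0 \<le> K" "(\<integral>\<^sup>+t\<in>{0..}. ennreal (t powr (1 + \<delta>)) \<partial>\<mu>) = ennreal K"
    using fin unfolding \<mu>_def by (cases "\<integral>\<^sup>+t\<in>{0..}. ennreal (t powr (1 + \<delta>)) \<partial>interval_measure (q (k + 1))") auto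
  have "1 - q (k + 1) t \<le> K * t powr (- (1 + \<delta>))" if t: "0 < t" for t
  proof -
    have le: "t powr (1 + \<delta>) * (q (k + 1) y - q (k + 1) t) \<le> K" if y: "t \<le> y" for y
    proof -
      have "ennreal (t powr (1 + \<delta>) * (q (k + 1) y - q (k + 1) t)) = ennreal (t powr (1 + \<delta>)) * emeasure \<mu> {t<..y}"
        unfolding \<mu>_def using q_mono[OF y, of "k + 1"]
        by (subst emeasure_interval_measure_Ioc[OF y q_mono q_right_cont]) (auto simp: ennreal_mult)
      also have "\<dots> = (\<integral>\<^sup>+s. ennreal (t powr (1 + \<delta>)) * indicator {t<..y} s \<partial>\<mu>)"
        by (rule nn_integral_cmult_indicator[symmetric]) (simp add: \<mu>_def)
      also have "\<dots> \<le> (\<integral>\<^sup>+s\<in>{0..}. ennreal (s powr (1 + \<delta>)) \<partial>\<mu>)"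
        using t \<delta> by (intro nn_integral_mono) (auto simp: indicator_def intro!: ennreal_leI powr_mono2)
      finally show ?thesis using K by (simp add: ennreal_le_iff)
    qed
    have "((\<lambda>y. t powr (1 + \<delta>) * (q (k + 1) y - q (k + 1) t)) \<longlongrightarrow> t powr (1 + \<delta>) * (1 - q (k + 1) t)) at_top"
      by (intro tendsto_intros q_lim)
    moreover have "\<forall>\<^sub>F y in at_top. t powr (1 + \<delta>) * (q (k + 1) y - q (k + 1) t) \<le> K"
      using eventually_ge_at_top[of t] by (rule eventually_mono) (rule le)
    ultimately have "t powr (1 + \<delta>) * (1 - q (k + 1) t) \<le> K"
      by (rule tendsto_upperbound) (rule trivial_limit_at_top_linorder)
    then have "1 - q (k + 1) t \<le> K / t powr (1 + \<delta>)" using t by (simp add: pos_le_divide_eq mult.commute)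
    then show ?thesis by (simp only: powr_minus_divide times_divide_eq_right mult_1_right)
  qed
  with K show ?thesis by blast
qed

lemma integral_expected_betti_tail:
  assumes \<delta>: "0 < \<delta>" and fin: "(\<integral>\<^sup>+t\<in>{0..}. ennreal (t powr (1 + \<delta>)) \<partial>interval_measure (q (k + 1))) < \<infinity>"
  shows "\<exists>K\<ge>0. \<forall>(V :: 'v::linorder set) n T. finite V \<longrightarrow> card V = n \<longrightarrow> 1 \<le> n \<longrightarrow> 0 < T \<longrightarrow>
    (\<integral>\<^sup>+t\<in>{T..}. ennreal (expected_betti p k V t) \<partial>lborel) \<le> ennreal (K * real n ^ (2 * k + 3) * T powr (- \<delta>))"
proof -
  obtain K where K: "0 \<le> K" "\<And>t. t > 0 \<Longrightarrow> 1 - q (k + 1) t \<le> K * t powr (- (1 + \<delta>))"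
    using moment_tail[OF assms] by blast
  have "(\<integral>\<^sup>+t\<in>{T..}. ennreal (expected_betti p k V t) \<partial>lborel) \<le> ennreal (K / \<delta> * real n ^ (2 * k + 3) * T powr (- \<delta>))"
    if V: "finite V" "card V = n" "1 \<le> n" and T: "0 < T" for V :: "'v set" and n T
  proof -
    define B where "B = K * real n ^ (2 * k + 3)"
    have B: "0 \<le> B" using K by (simp add: B_def)
    have pt: "expected_betti p k V t \<le> B * t powr (- (1 + \<delta>))" if "T \<le> t" for t
    proof -
      have "expected_betti p k V t \<le> real n ^ (2 * k + 3) * (1 - q (k + 1) t)"
        using expected_betti_le_missing[OF V(1)] V by simp
      also have "\<dots> \<le> real n ^ (2 * k + 3) * (K * t powr (- (1 + \<delta>)))"
        using K(2)[of t] T that by (intro mult_left_mono) auto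
      finally show ?thesis by (simp add: B_def mult_ac)
    qed
    have "(\<integral>\<^sup>+t\<in>{T..}. ennreal (expected_betti p k V t) \<partial>lborel)
      \<le> (\<integral>\<^sup>+t. ennreal (B * t powr (- (1 + \<delta>))) * indicator {T..} t \<partial>lborel)"
    proof (intro nn_integral_mono)
      fix t
      show "ennreal (expected_betti p k V t) * indicator {T..} t \<le> ennreal (B * t powr (- (1 + \<delta>))) * indicator {T..} t"
      proof (cases "T \<le> t")
        case True
        then show ?thesis by (intro mult_right_mono ennreal_leI pt) simp_all
      qed simp
    qed
    \<comment> \<open>Integrating the power \<open>- (1 + \<delta>)\<close> is the origin of the
      factor \<open>1 / \<delta>\<close> in the constant.\<close>
    also have "\<dots> = ennreal (0 - (- B / \<delta> * T powr (- \<delta>)))"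
    proof (rule nn_integral_FTC_atLeast)
      show "DERIV (\<lambda>t. - B / \<delta> * t powr (- \<delta>)) t :> B * t powr (- (1 + \<delta>))" if "T \<le> t" for t
      proof -
        have "DERIV (\<lambda>t. - B / \<delta> * t powr (- \<delta>)) t :> - B / \<delta> * (- \<delta> * t powr (- \<delta> - 1))"
          using T that by (intro DERIV_cmult has_real_derivative_powr) auto
        moreover have "- \<delta> - 1 = - (1 + \<delta>)" by simp
        ultimately show ?thesis using \<delta> by simp
      qed
      have "((\<lambda>t. t powr (- \<delta>)) \<longlongrightarrow> 0) at_top"
        using \<delta> by (intro tendsto_neg_powr filterlim_ident) auto
      then have "((\<lambda>t. - B / \<delta> * t powr (- \<delta>)) \<longlongrightarrow> - B / \<delta> * 0) at_top" by (intro tendsto_intros)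
      then show "((\<lambda>t. - B / \<delta> * t powr (- \<delta>)) \<longlongrightarrow> 0) at_top" by simp
    qed (use B in auto)
    finally show ?thesis by (simp add: B_def)
  qed
  moreover have "0 \<le> K / \<delta>" using K \<delta> by simp
  ultimately show ?thesis by blast
qed

lemma expected_betti_measurable [measurable]:
  assumes "finite V"
  shows "expected_betti p k V \<in> borel_measurable borel"
proof -
  have [measurable]: "p i \<in> borel_measurable borel" for i
    by (rule borel_measurable_mono) (auto simp: mono_def p_mono)
  show ?thesis unfolding expected_betti_def[abs_def] subset_expectation_def by measurable
qed

lemma integral_expected_betti_split:
  assumes "finite V" "0 < T"
  shows "(\<integral>\<^sup>+t\<in>{0..}. ennreal (expected_betti p k V t) \<partial>lborel)
    \<le> (\<integral>\<^sup>+t\<in>{0..T}. ennreal (expected_betti p k V t) \<partial>lborel) + (\<integral>\<^sup>+t\<in>{T..}. ennreal (expected_betti p k V t) \<partial>lborel)"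
proof -
  note [measurable] = expected_betti_measurable[OF assms(1)]
  have "(\<integral>\<^sup>+t\<in>{0..}. ennreal (expected_betti p k V t) \<partial>lborel)
    \<le> (\<integral>\<^sup>+t. ennreal (expected_betti p k V t) * indicator {0..T} t + ennreal (expected_betti p k V t) * indicator {T..} t \<partial>lborel)"
    by (intro nn_integral_mono) (auto simp: indicator_def)
  also have "\<dots> = (\<integral>\<^sup>+t\<in>{0..T}. ennreal (expected_betti p k V t) \<partial>lborel) + (\<integral>\<^sup>+t\<in>{T..}. ennreal (expected_betti p k V t) \<partial>lborel)"
    by (rule nn_integral_add) measurable
  finally show ?thesis .
qed

section \<open>Polynomial control of \<open>Phi\<close> by the doubling condition\<close>

context
  fixes A u0 :: real and a :: nat
  assumes u0: "0 < u0" "u0 < 1" "0 < Phi p k u0"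
    and doubling: "\<And>v. 0 \<le> v \<Longrightarrow> v \<le> u0 \<Longrightarrow> A * Phi p k v \<le> Phi p k (v / 2)"
    and A: "(1 / 2) ^ a \<le> A"
begin

lemma Phi_halving: "0 \<le> v \<Longrightarrow> v \<le> u0 \<Longrightarrow> Phi p k v \<le> 2 ^ a * Phi p k (v / 2)"
proof -
  assume v: "0 \<le> v" "v \<le> u0"
  have "(1 / 2) ^ a * Phi p k v \<le> A * Phi p k v" using A Phi_nonneg by (intro mult_right_mono)
  also have "\<dots> \<le> Phi p k (v / 2)" by (rule doubling[OF v])
  finally show ?thesis by (simp add: power_divide field_simps)
qed

lemma Phi_dyadic_upper:
  assumes n: "0 < n"
  shows "2 ^ j \<le> n * u0 \<Longrightarrow> Phi p k (2 ^ j / n) \<le> 2 ^ (a * j) * Phi p k (1 / n)"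
proof (induction j)
  case (Suc j)
  have "(2::real) ^ j \<le> 2 ^ Suc j" by simp
  then have IH: "Phi p k (2 ^ j / n) \<le> 2 ^ (a * j) * Phi p k (1 / n)" using Suc by linarith
  have "Phi p k (2 ^ Suc j / n) \<le> 2 ^ a * Phi p k (2 ^ Suc j / n / 2)"
    using Suc.prems n by (intro Phi_halving) (auto simp: pos_divide_le_eq mult.commute)
  also have "2 ^ Suc j / n / 2 = 2 ^ j / n" by simp
  also have "2 ^ a * Phi p k (2 ^ j / n) \<le> 2 ^ a * (2 ^ (a * j) * Phi p k (1 / n))"
    using IH by (intro mult_left_mono) auto
  finally show ?case by (simp add: power_add)
qed simp

text \<open>Doubling is iterated from \<open>u0\<close> down to \<open>1 / n\<close>:
  \<open>2 ^ J / n\<close> is the last dyadic point not exceeding \<open>u0\<close>, and one further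
  halving bridges the gap between the two, hence \<open>Suc J\<close>.\<close>

lemma Phi_lower:
  assumes n: "0 < n" and J: "2 ^ J \<le> n * u0" "n * u0 < 2 ^ Suc J"
  shows "Phi p k u0 \<le> 2 ^ (a * Suc J) * Phi p k (1 / n)"
proof -
  have "Phi p k u0 \<le> 2 ^ a * Phi p k (u0 / 2)" using u0 by (intro Phi_halving) auto
  also have "\<dots> \<le> 2 ^ a * Phi p k (2 ^ J / n)"
  proof (intro mult_left_mono Phi_mono)
    show "u0 / 2 \<le> 2 ^ J / n" using J n by (simp add: field_simps)
    have "2 ^ J / n \<le> u0" using J n by (simp add: pos_divide_le_eq mult.commute)
    then show "2 ^ J / n < 1" using u0 by linarith
  qed simp
  also have "\<dots> \<le> 2 ^ a * (2 ^ (a * J) * Phi p k (1 / n))"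
    using Phi_dyadic_upper[OF n J(1)] by (intro mult_left_mono) auto
  finally show ?thesis by (simp add: power_add)
qed

text \<open>Under doubling, \<open>Phi\<close> at \<open>1 / n\<close> decreases no faster than a
  power of \<open>n\<close>, so error terms of high order in \<open>1 / n\<close> can be absorbed
  into it.\<close>

lemma Phi_polynomial_lower:
  assumes n: "1 \<le> n * u0" "0 < n"
  shows "1 / n ^ a \<le> 2 ^ a / Phi p k u0 * Phi p k (1 / n)"
proof -
  obtain J where J: "2 ^ J \<le> n * u0" "n * u0 < 2 ^ Suc J" using exists_dyadic_exponent[OF n(1)] by auto
  have "2 ^ J \<le> n" using J n u0 by (meson mult_left_le less_imp_le order_trans)
  then have "(2 ^ J) ^ a \<le> n ^ a" by (intro power_mono) auto
  have "Phi p k u0 \<le> 2 ^ (a * Suc J) * Phi p k (1 / n)" by (rule Phi_lower[OF n(2) J])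
  also have "2 ^ (a * Suc J) = 2 ^ a * ((2::real) ^ J) ^ a" by (simp add: power_add power_mult[symmetric] mult.commute)
  also have "2 ^ a * (2 ^ J) ^ a * Phi p k (1 / n) \<le> 2 ^ a * n ^ a * Phi p k (1 / n)"
    using \<open>(2 ^ J) ^ a \<le> n ^ a\<close> Phi_nonneg by (intro mult_right_mono mult_left_mono) auto
  finally show ?thesis using u0(3) n by (simp add: field_simps)
qed

text \<open>In \<open>M = a + m + 1\<close> the share \<open>a\<close> offsets the growth of
  \<open>Phi\<close> along the dyadic scales, the share \<open>m\<close> yields the factor
  \<open>1 / n ^ m\<close> at \<open>T\<close>, and the 1 leaves a convergent geometric sum over
  \<open>j\<close>.\<close>

lemma integral_expected_betti_doubling:
  fixes n m :: nat
  defines "M \<equiv> a + m + 1"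
  assumes V: "finite V" "card V = n" and n: "M \<le> n" "1 \<le> n * u0" and T: "0 < T"
  shows "(\<integral>\<^sup>+t\<in>{0..T}. ennreal (expected_betti p k V t) \<partial>lborel)
    \<le> ennreal (decay_constant M * (2 * 2 ^ M + 2 ^ a * (2 / u0) ^ m / Phi p k u0) * real n ^ (k + 1) * Phi p k (1 / n) * (1 + T / real n ^ m))"
proof -
  define F where "F = Phi p k (1 / n)"
  define K where "K = 2 ^ a * (2 / u0) ^ m / Phi p k u0"
  have F0: "0 \<le> F" by (simp add: F_def Phi_nonneg)
  have K0: "0 \<le> K" using u0 by (simp add: K_def)
  have n0: "0 < n" using n u0 by (cases "n = 0") auto
  obtain J where J: "2 ^ J \<le> n * u0" "n * u0 < 2 ^ Suc J" using exists_dyadic_exponent[OF n(2)] by auto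
  have "n * u0 < n" using u0 n0 by simp
  then have Jn: "2 ^ J < real n" using J by linarith
  have sum: "(\<Sum>j\<le>J. Phi p k (2 ^ j / n) / 2 ^ (M * j)) \<le> 2 * F"
  proof -
    have g2: "(\<Sum>j\<le>J. (1 / 2 :: real) ^ j) \<le> 2"
    proof -
      have "(\<Sum>j\<le>J. (1 / 2 :: real) ^ j) = (\<Sum>j<Suc J. (1 / 2) ^ j)" by (simp add: lessThan_Suc_atMost)
      also have "\<dots> = 2 * (1 - (1 / 2) ^ Suc J)" by (subst sum_gp_strict) simp
      finally show ?thesis by simp
    qed
    have "(\<Sum>j\<le>J. Phi p k (2 ^ j / n) / 2 ^ (M * j)) \<le> (\<Sum>j\<le>J. F * (1 / 2) ^ j)"
    proof (rule sum_mono)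
      fix j assume "j \<in> {..J}"
      then have "(2::real) ^ j \<le> 2 ^ J" by (intro power_increasing) auto
      then have "2 ^ j \<le> n * u0" using J(1) by linarith
      then have "Phi p k (2 ^ j / n) \<le> 2 ^ (a * j) * F"
        unfolding F_def using n0 by (intro Phi_dyadic_upper) auto
      then have "Phi p k (2 ^ j / n) / 2 ^ (M * j) \<le> 2 ^ (a * j) * F / 2 ^ (M * j)" by (intro divide_right_mono) auto
      also have "\<dots> = F * (1 / 2 ^ ((m + 1) * j))" by (simp add: M_def power_add add_mult_distrib)
      also have "\<dots> \<le> F * (1 / 2 ^ j)"
        using F0 by (intro mult_left_mono divide_left_mono power_increasing) auto
      finally show "Phi p k (2 ^ j / n) / 2 ^ (M * j) \<le> F * (1 / 2) ^ j" by (simp add: power_divide)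
    qed
    also have "\<dots> = F * (\<Sum>j\<le>J. (1 / 2) ^ j)" by (simp add: sum_distrib_left)
    also have "\<dots> \<le> F * 2" using g2 F0 by (rule mult_left_mono)
    finally show ?thesis by (simp add: mult.commute)
  qed
  \<comment> \<open>The remainder carries no \<open>Phi\<close> of its own. One is recovered by
    splitting \<open>M\<close>: the part \<open>2 ^ (a * J)\<close> is traded for \<open>Phi\<close>
    by \<open>Phi_lower\<close>, and the part \<open>2 ^ (m * J)\<close> for \<open>n ^ m\<close>,
    since \<open>2 ^ J\<close> exceeds \<open>n * u0 / 2\<close>.\<close>
  have tail: "1 / 2 ^ (M * J) \<le> K * F / real n ^ m"
  proof -
    have "Phi p k u0 \<le> 2 ^ (a * Suc J) * F" unfolding F_def by (rule Phi_lower[OF _ J]) (use n0 in simp)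
    then have 1: "1 / 2 ^ (a * J) \<le> 2 ^ a * F / Phi p k u0" using u0 by (simp add: power_add field_simps)
    have "1 / 2 ^ J \<le> 2 / (n * u0)" using J n0 u0 by (simp add: field_simps)
    then have "(1 / 2 ^ J) ^ m \<le> (2 / (n * u0)) ^ m" by (intro power_mono) auto
    then have 2: "1 / 2 ^ (m * J) \<le> (2 / u0) ^ m / real n ^ m"
      by (simp add: power_divide power_mult_distrib power_mult[symmetric] mult.commute)
    have "(1::real) / 2 ^ (M * J) = 1 / 2 ^ (a * J) * (1 / 2 ^ (m * J)) * (1 / 2 ^ J)"
      by (simp add: M_def power_add add_mult_distrib)
    also have "\<dots> \<le> 1 / 2 ^ (a * J) * (1 / 2 ^ (m * J)) * 1"
      by (intro mult_left_mono) auto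
    also have "\<dots> \<le> (2 ^ a * F / Phi p k u0) * ((2 / u0) ^ m / real n ^ m) * 1"
      using F0 u0 by (intro mult_mono 1 2) auto
    finally show ?thesis by (simp add: K_def field_simps)
  qed
  have "(\<integral>\<^sup>+t\<in>{0..T}. ennreal (expected_betti p k V t) \<partial>lborel)
    \<le> ennreal (decay_constant M * real n ^ (k + 1) * (2 ^ M * (\<Sum>j\<le>J. Phi p k (2 ^ j / n) / 2 ^ (M * j)) + T / 2 ^ (M * J)))"
    by (rule integral_expected_betti_dyadic[OF V n(1) n0 Jn T])
  also have "\<dots> \<le> ennreal (decay_constant M * (2 * 2 ^ M + K) * real n ^ (k + 1) * F * (1 + T / real n ^ m))"
  proof (intro ennreal_leI)
    have s: "2 ^ M * (\<Sum>j\<le>J. Phi p k (2 ^ j / n) / 2 ^ (M * j)) + T / 2 ^ (M * J) \<le> (2 * 2 ^ M + K) * (F * (1 + T / real n ^ m))"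
    proof -
      have "2 ^ M * (\<Sum>j\<le>J. Phi p k (2 ^ j / n) / 2 ^ (M * j)) \<le> 2 ^ M * (2 * F)"
        using sum by (intro mult_left_mono) auto
      also have "\<dots> \<le> 2 * 2 ^ M * (F * (1 + T / real n ^ m))"
        using F0 T by (simp add: mult_le_cancel_left1 distrib_left)
      finally have 1: "2 ^ M * (\<Sum>j\<le>J. Phi p k (2 ^ j / n) / 2 ^ (M * j)) \<le> 2 * 2 ^ M * (F * (1 + T / real n ^ m))" .
      have "T / 2 ^ (M * J) = T * (1 / 2 ^ (M * J))" by simp
      also have "\<dots> \<le> T * (K * F / real n ^ m)" using tail T by (intro mult_left_mono) auto
      also have "\<dots> = K * (F * (T / real n ^ m))" by simp
      also have "\<dots> \<le> K * (F * (1 + T / real n ^ m))" using K0 F0 by (intro mult_left_mono) auto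
      finally have 2: "T / 2 ^ (M * J) \<le> K * (F * (1 + T / real n ^ m))" .
      show ?thesis unfolding distrib_right by (rule add_mono[OF 1 2])
    qed
    have "decay_constant M * real n ^ (k + 1) * (2 ^ M * (\<Sum>j\<le>J. Phi p k (2 ^ j / n) / 2 ^ (M * j)) + T / 2 ^ (M * J))
      \<le> decay_constant M * real n ^ (k + 1) * ((2 * 2 ^ M + K) * (F * (1 + T / real n ^ m)))"
      using s decay_constant_nonneg by (intro mult_left_mono) auto
    also have "\<dots> = decay_constant M * (2 * 2 ^ M + K) * real n ^ (k + 1) * F * (1 + T / real n ^ m)" by simp
    finally show "decay_constant M * real n ^ (k + 1) * (2 ^ M * (\<Sum>j\<le>J. Phi p k (2 ^ j / n) / 2 ^ (M * j)) + T / 2 ^ (M * J))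
      \<le> decay_constant M * (2 * 2 ^ M + K) * real n ^ (k + 1) * F * (1 + T / real n ^ m)" .
  qed
  finally show ?thesis by (simp add: F_def K_def)
qed

end

section \<open>Bounds for the integrated Betti number as \<open>n\<close> tends to infinity\<close>

lemma doubling_integral_bound:
  fixes V :: "nat \<Rightarrow> 'v::linorder set"
  assumes V: "\<And>n. finite (V n) \<and> card (V n) = n"
    and A: "0 < A" and u0: "0 < u0" "u0 < 1" "0 < Phi p k u0"
    and doubling: "\<And>v. 0 \<le> v \<Longrightarrow> v \<le> u0 \<Longrightarrow> A * Phi p k v \<le> Phi p k (v / 2)"
  shows "\<exists>C\<ge>0. \<forall>\<^sub>F n in sequentially. \<forall>T>0. (\<integral>\<^sup>+t\<in>{0..T}. ennreal (expected_betti p k (V n) t) \<partial>lborel)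
    \<le> ennreal (C * real n ^ (k + 1) * Phi p k (1 / real n) * (1 + T / real n ^ m))"
proof -
  obtain a where a: "(1 / 2) ^ a < A" using real_arch_pow_inv[OF A, of "1 / 2"] by auto
  then have a': "(1 / 2) ^ a \<le> A" by simp
  define M where "M = a + m + 1"
  define C where "C = decay_constant M * (2 * 2 ^ M + 2 ^ a * (2 / u0) ^ m / Phi p k u0)"
  have "0 \<le> C" using decay_constant_nonneg[of M] u0 by (simp add: C_def)
  moreover have "\<forall>\<^sub>F n in sequentially. \<forall>T>0. (\<integral>\<^sup>+t\<in>{0..T}. ennreal (expected_betti p k (V n) t) \<partial>lborel)
    \<le> ennreal (C * real n ^ (k + 1) * Phi p k (1 / real n) * (1 + T / real n ^ m))"
    using eventually_ge_at_top[of "max M (nat \<lceil>1 / u0\<rceil>)"]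
  proof eventually_elim
    case (elim n)
    then have "1 / u0 \<le> n" by linarith
    then have n: "1 \<le> n * u0" using u0 by (simp add: pos_divide_le_eq)
    show ?case
      unfolding C_def M_def
      by (intro allI impI integral_expected_betti_doubling[OF u0 doubling a'])
         (use V n elim in \<open>auto simp: M_def\<close>)
  qed
  ultimately show ?thesis by blast
qed

text \<open>The time axis is cut at \<open>T = n ^ s\<close>, and the truncated bound with exponent
  \<open>s\<close> makes the correction factor equal to 2. The tail is at most
  \<open>K * n ^ (2 * k + 3) * n powr (- s * \<delta>)\<close>; as
  \<open>s * \<delta> \<ge> k + 2 + a\<close>, it is at most \<open>K * n ^ (k + 1) / n ^ a\<close>,
  which the polynomial lower bound for \<open>Phi\<close> absorbs.\<close>

lemma doubling_integral_bound_moment: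
  fixes V :: "nat \<Rightarrow> 'v::linorder set"
  assumes V: "\<And>n. finite (V n) \<and> card (V n) = n"
    and A: "0 < A" and u0: "0 < u0" "u0 < 1" "0 < Phi p k u0"
    and doubling: "\<And>v. 0 \<le> v \<Longrightarrow> v \<le> u0 \<Longrightarrow> A * Phi p k v \<le> Phi p k (v / 2)"
    and \<delta>: "0 < \<delta>" and fin: "(\<integral>\<^sup>+t\<in>{0..}. ennreal (t powr (1 + \<delta>)) \<partial>interval_measure (qfun p (k + 1))) < \<infinity>"
  shows "\<exists>C\<ge>0. \<forall>\<^sub>F n in sequentially. (\<integral>\<^sup>+t\<in>{0..}. ennreal (expected_betti p k (V n) t) \<partial>lborel)
    \<le> ennreal (C * (real n ^ (k + 1) * Phi p k (1 / real n)))"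
proof -
  obtain a where a: "(1 / 2) ^ a < A" using real_arch_pow_inv[OF A, of "1 / 2"] by auto
  then have a': "(1 / 2) ^ a \<le> A" by simp
  obtain K where K: "0 \<le> K" "\<And>(V :: 'v set) n T. finite V \<Longrightarrow> card V = n \<Longrightarrow> 1 \<le> n \<Longrightarrow> 0 < T \<Longrightarrow>
    (\<integral>\<^sup>+t\<in>{T..}. ennreal (expected_betti p k V t) \<partial>lborel) \<le> ennreal (K * real n ^ (2 * k + 3) * T powr (- \<delta>))"
    using integral_expected_betti_tail[OF \<delta> fin, where 'v = 'v] by blast
  define s where "s = nat \<lceil>real (k + 2 + a) / \<delta>\<rceil>"
  have s: "real (k + 2 + a) \<le> s * \<delta>"
  proof -
    have "real (k + 2 + a) / \<delta> \<le> s" unfolding s_def by linarith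
    then show ?thesis using \<delta> by (simp add: pos_divide_le_eq)
  qed
  obtain C where C: "0 \<le> C" "\<forall>\<^sub>F n in sequentially. \<forall>T>0. (\<integral>\<^sup>+t\<in>{0..T}. ennreal (expected_betti p k (V n) t) \<partial>lborel)
    \<le> ennreal (C * real n ^ (k + 1) * Phi p k (1 / real n) * (1 + T / real n ^ s))"
    using doubling_integral_bound[OF V A u0 doubling, of s] by blast
  define D where "D = 2 * C + K * (2 ^ a / Phi p k u0)"
  have "0 \<le> D" using C(1) K(1) u0 by (simp add: D_def)
  moreover have "\<forall>\<^sub>F n in sequentially. (\<integral>\<^sup>+t\<in>{0..}. ennreal (expected_betti p k (V n) t) \<partial>lborel)
    \<le> ennreal (D * (real n ^ (k + 1) * Phi p k (1 / real n)))"
    using C(2) eventually_ge_at_top[of "max 1 (nat \<lceil>1 / u0\<rceil>)"]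
  proof eventually_elim
    case (elim n)
    then have "1 / u0 \<le> n" and n1: "1 \<le> n" by linarith+
    then have n: "1 \<le> n * u0" using u0 by (simp add: pos_divide_le_eq)
    define T where "T = real n ^ s"
    have T: "0 < T" using n1 by (simp add: T_def)
    have "(\<integral>\<^sup>+t\<in>{0..}. ennreal (expected_betti p k (V n) t) \<partial>lborel)
      \<le> (\<integral>\<^sup>+t\<in>{0..T}. ennreal (expected_betti p k (V n) t) \<partial>lborel) + (\<integral>\<^sup>+t\<in>{T..}. ennreal (expected_betti p k (V n) t) \<partial>lborel)"
      by (rule integral_expected_betti_split[OF _ T]) (use V in simp)
    also have "\<dots> \<le> ennreal (C * real n ^ (k + 1) * Phi p k (1 / real n) * (1 + T / real n ^ s)) + ennreal (K * real n ^ (2 * k + 3) * T powr (- \<delta>))"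
      by (intro add_mono elim(1)[rule_format, OF T] K(2) T n1) (use V in simp_all)
    also have "\<dots> = ennreal (C * real n ^ (k + 1) * Phi p k (1 / real n) * (1 + T / real n ^ s) + K * real n ^ (2 * k + 3) * T powr (- \<delta>))"
      using C(1) K(1) T Phi_nonneg by (intro ennreal_plus[symmetric] mult_nonneg_nonneg) auto
    also have "\<dots> \<le> ennreal (D * (real n ^ (k + 1) * Phi p k (1 / real n)))"
    proof (intro ennreal_leI)
      have "T powr (- \<delta>) = real n powr (- (s * \<delta>))" using n1 by (simp add: T_def powr_realpow[symmetric] powr_powr)
      also have "\<dots> \<le> real n powr (- real (k + 2 + a))" using s n1 by (intro powr_mono) auto
      also have "\<dots> = 1 / (real n ^ (k + 2) * real n ^ a)"
        using n1 by (subst powr_minus_divide, subst powr_realpow) (simp_all add: power_add)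
      also have "\<dots> = 1 / real n ^ (k + 2) * (1 / real n ^ a)" by simp
      also have "\<dots> \<le> 1 / real n ^ (k + 2) * (2 ^ a / Phi p k u0 * Phi p k (1 / n))"
        using n n1 by (intro mult_left_mono Phi_polynomial_lower[OF u0 doubling a']) auto
      finally have "K * real n ^ (2 * k + 3) * T powr (- \<delta>) \<le> K * real n ^ (2 * k + 3) * (1 / real n ^ (k + 2) * (2 ^ a / Phi p k u0 * Phi p k (1 / n)))"
        using K(1) by (intro mult_left_mono) auto
      also have "\<dots> = K * (2 ^ a / Phi p k u0) * (real n ^ (k + 1) * Phi p k (1 / n))"
      proof -
        have "2 * k + 3 = (k + 1) + (k + 2)" by simp
        then have "real n ^ (2 * k + 3) = real n ^ (k + 1) * real n ^ (k + 2)" by (simp only: power_add)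
        then show ?thesis using n1 by simp
      qed
      finally have 2: "K * real n ^ (2 * k + 3) * T powr (- \<delta>) \<le> K * (2 ^ a / Phi p k u0) * (real n ^ (k + 1) * Phi p k (1 / n))" .
      have Tn: "1 + T / real n ^ s = 2" using n1 by (simp add: T_def)
      show "C * real n ^ (k + 1) * Phi p k (1 / real n) * (1 + T / real n ^ s) + K * real n ^ (2 * k + 3) * T powr (- \<delta>)
        \<le> D * (real n ^ (k + 1) * Phi p k (1 / real n))"
        unfolding Tn D_def distrib_right using 2 by simp
    qed
    finally show ?case .
  qed
  ultimately show ?thesis by blast
qed

text \<open>The threshold \<open>y = sqrt n\<close> tends to infinity while \<open>y / n\<close>
  tends to 0, so decay of the Betti number and decay of \<open>Phi\<close> both take effect. With
  order \<open>2 * l\<close> each term is of order \<open>1 / n ^ l\<close>, and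
  \<open>l = m + k + 1\<close> pays for the factor \<open>n ^ (k + 1)\<close>.\<close>

lemma rapid_decay_integral_bound:
  fixes V :: "nat \<Rightarrow> 'v::linorder set"
  assumes V: "\<And>n. finite (V n) \<and> card (V n) = n"
    and decay: "\<And>m::nat. Phi p k \<in> O[at_right 0](\<lambda>v. v ^ m)"
  shows "\<exists>C\<ge>0. \<forall>\<^sub>F n in sequentially. \<forall>T>0. (\<integral>\<^sup>+t\<in>{0..T}. ennreal (expected_betti p k (V n) t) \<partial>lborel)
    \<le> ennreal (C * (1 + T) / real n ^ m)"
proof -
  define l where "l = m + k + 1"
  define D where "D = decay_constant (2 * l)"
  have D0: "0 \<le> D" by (simp add: D_def decay_constant_nonneg)
  obtain c where c: "0 < c" "\<forall>\<^sub>F v in at_right 0. norm (Phi p k v) \<le> c * norm (v ^ (2 * l))"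
    using landau_o.bigE[OF decay[of "2 * l"]] by blast
  have lim: "filterlim (\<lambda>n. sqrt (real n) / real n) (at_right 0) sequentially" by real_asymp
  have ev: "\<forall>\<^sub>F n in sequentially. norm (Phi p k (sqrt (real n) / real n)) \<le> c * norm ((sqrt (real n) / real n) ^ (2 * l))"
    using filterlim_iff[THEN iffD1, OF lim] c(2) by blast
  define C where "C = D * (c + 1)"
  have "0 \<le> C" using D0 c by (simp add: C_def)
  moreover have "\<forall>\<^sub>F n in sequentially. \<forall>T>0. (\<integral>\<^sup>+t\<in>{0..T}. ennreal (expected_betti p k (V n) t) \<partial>lborel)
    \<le> ennreal (C * (1 + T) / real n ^ m)"
    using ev eventually_ge_at_top[of "max 2 (2 * l)"]
  proof eventually_elim
    case (elim n)
    then have n: "2 \<le> n" "2 * l \<le> n" by auto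
    have sq: "sqrt (real n) ^ (2 * l) = real n ^ l" by (simp add: power_mult)
    have "real n < (real n)\<^sup>2" using n by (simp add: power2_eq_square)
    then have sn: "0 < sqrt (real n)" "sqrt (real n) < real n" using n by (auto intro: real_less_lsqrt)
    have Ph: "Phi p k (sqrt (real n) / real n) \<le> c / real n ^ l"
    proof -
      have "Phi p k (sqrt (real n) / real n) \<le> c * norm ((sqrt (real n) / real n) ^ (2 * l))" using elim(1) by simp
      also have "(sqrt (real n) / real n) ^ (2 * l) = 1 / real n ^ l"
      proof -
        have "real n ^ (2 * l) = real n ^ l * real n ^ l" by (simp only: mult_2 power_add)
        then show ?thesis unfolding power_divide sq using n by simp
      qed
      finally show ?thesis by simp
    qed
    show ?case
    proof (intro allI impI)
      fix T :: real assume T: "0 < T"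
      have "(\<integral>\<^sup>+t\<in>{0..T}. ennreal (expected_betti p k (V n) t) \<partial>lborel)
        \<le> ennreal (D * real n ^ (k + 1) * (Phi p k (sqrt (real n) / n) + T / sqrt (real n) ^ (2 * l)))"
        unfolding D_def by (rule integral_expected_betti_cut) (use V n sn T in auto)
      also have "\<dots> \<le> ennreal (C * (1 + T) / real n ^ m)"
      proof (intro ennreal_leI)
        have "Phi p k (sqrt (real n) / n) + T / sqrt (real n) ^ (2 * l) \<le> c / real n ^ l + T / real n ^ l"
          using Ph by (simp add: sq)
        also have "\<dots> = (c + T) / real n ^ l" by (simp add: add_divide_distrib)
        also have "\<dots> \<le> ((c + 1) * (1 + T)) / real n ^ l"
          using c(1) T by (intro divide_right_mono) (auto simp: algebra_simps)
        finally have "D * real n ^ (k + 1) * (Phi p k (sqrt (real n) / n) + T / sqrt (real n) ^ (2 * l))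
          \<le> D * real n ^ (k + 1) * (((c + 1) * (1 + T)) / real n ^ l)"
          using D0 by (intro mult_left_mono) auto
        also have "\<dots> = C * (1 + T) / real n ^ m"
        proof -
          have "real n ^ l = real n ^ m * real n ^ (k + 1)" by (simp add: l_def power_add)
          then show ?thesis using n by (simp add: C_def)
        qed
        finally show "D * real n ^ (k + 1) * (Phi p k (sqrt (real n) / n) + T / sqrt (real n) ^ (2 * l)) \<le> C * (1 + T) / real n ^ m" .
      qed
      finally show "(\<integral>\<^sup>+t\<in>{0..T}. ennreal (expected_betti p k (V n) t) \<partial>lborel) \<le> ennreal (C * (1 + T) / real n ^ m)" .
    qed
  qed
  ultimately show ?thesis by blast
qed

text \<open>The cut is again at \<open>T = n ^ s\<close>. The truncated bound is used with
  \<open>m + s\<close> so that the factor \<open>1 + T\<close> is compensated, and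
  \<open>s * \<delta> \<ge> 2 * k + 3 + m\<close> lets the tail outweigh its polynomial
  loss.\<close>

lemma rapid_decay_integral_bound_moment:
  fixes V :: "nat \<Rightarrow> 'v::linorder set"
  assumes V: "\<And>n. finite (V n) \<and> card (V n) = n"
    and decay: "\<And>m::nat. Phi p k \<in> O[at_right 0](\<lambda>v. v ^ m)"
    and \<delta>: "0 < \<delta>" and fin: "(\<integral>\<^sup>+t\<in>{0..}. ennreal (t powr (1 + \<delta>)) \<partial>interval_measure (qfun p (k + 1))) < \<infinity>"
  shows "\<exists>C\<ge>0. \<forall>\<^sub>F n in sequentially. (\<integral>\<^sup>+t\<in>{0..}. ennreal (expected_betti p k (V n) t) \<partial>lborel)
    \<le> ennreal (C / real n ^ m)"
proof -
  obtain K where K: "0 \<le> K" "\<And>(V :: 'v set) n T. finite V \<Longrightarrow> card V = n \<Longrightarrow> 1 \<le> n \<Longrightarrow> 0 < T \<Longrightarrow>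
    (\<integral>\<^sup>+t\<in>{T..}. ennreal (expected_betti p k V t) \<partial>lborel) \<le> ennreal (K * real n ^ (2 * k + 3) * T powr (- \<delta>))"
    using integral_expected_betti_tail[OF \<delta> fin, where 'v = 'v] by blast
  define s where "s = nat \<lceil>real (2 * k + 3 + m) / \<delta>\<rceil>"
  have s: "real (2 * k + 3 + m) \<le> s * \<delta>"
  proof -
    have "real (2 * k + 3 + m) / \<delta> \<le> s" unfolding s_def by linarith
    then show ?thesis using \<delta> by (simp add: pos_divide_le_eq)
  qed
  obtain C where C: "0 \<le> C" "\<forall>\<^sub>F n in sequentially. \<forall>T>0. (\<integral>\<^sup>+t\<in>{0..T}. ennreal (expected_betti p k (V n) t) \<partial>lborel)
    \<le> ennreal (C * (1 + T) / real n ^ (m + s))"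
    using rapid_decay_integral_bound[OF V decay, of "m + s"] by blast
  have "\<forall>\<^sub>F n in sequentially. (\<integral>\<^sup>+t\<in>{0..}. ennreal (expected_betti p k (V n) t) \<partial>lborel) \<le> ennreal ((2 * C + K) / real n ^ m)"
    using C(2) eventually_ge_at_top[of 1]
  proof eventually_elim
    case (elim n)
    then have n1: "1 \<le> n" by simp
    define T where "T = real n ^ s"
    have T: "1 \<le> T" using n1 by (simp add: T_def)
    have "(\<integral>\<^sup>+t\<in>{0..}. ennreal (expected_betti p k (V n) t) \<partial>lborel)
      \<le> (\<integral>\<^sup>+t\<in>{0..T}. ennreal (expected_betti p k (V n) t) \<partial>lborel) + (\<integral>\<^sup>+t\<in>{T..}. ennreal (expected_betti p k (V n) t) \<partial>lborel)"
      by (rule integral_expected_betti_split) (use V T in auto)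
    also have "\<dots> \<le> ennreal (C * (1 + T) / real n ^ (m + s)) + ennreal (K * real n ^ (2 * k + 3) * T powr (- \<delta>))"
      using T by (intro add_mono elim(1)[rule_format] K(2) n1) (use V in simp_all)
    also have "\<dots> = ennreal (C * (1 + T) / real n ^ (m + s) + K * real n ^ (2 * k + 3) * T powr (- \<delta>))"
      using C(1) K(1) T by (intro ennreal_plus[symmetric]) auto
    also have "\<dots> \<le> ennreal ((2 * C + K) / real n ^ m)"
    proof (intro ennreal_leI)
      have "C * (1 + T) / real n ^ (m + s) \<le> C * (2 * T) / real n ^ (m + s)"
        using C(1) T by (intro divide_right_mono mult_left_mono) auto
      also have "\<dots> = 2 * C / real n ^ m" using n1 by (simp add: T_def power_add)
      finally have 1: "C * (1 + T) / real n ^ (m + s) \<le> 2 * C / real n ^ m" .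
      have "T powr (- \<delta>) = real n powr (- (s * \<delta>))" using n1 by (simp add: T_def powr_realpow[symmetric] powr_powr)
      also have "\<dots> \<le> real n powr (- real (2 * k + 3 + m))" using s n1 by (intro powr_mono) auto
      also have "\<dots> = 1 / real n ^ (2 * k + 3 + m)"
        using n1 by (subst powr_minus_divide, subst powr_realpow) simp_all
      finally have "K * real n ^ (2 * k + 3) * T powr (- \<delta>) \<le> K * real n ^ (2 * k + 3) * (1 / real n ^ (2 * k + 3 + m))"
        using K(1) by (intro mult_left_mono) auto
      also have "\<dots> = K / real n ^ m" using n1 by (simp add: power_add)
      finally show "C * (1 + T) / real n ^ (m + s) + K * real n ^ (2 * k + 3) * T powr (- \<delta>) \<le> (2 * C + K) / real n ^ m"
        using 1 by (simp add: add_divide_distrib)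
    qed
    finally show ?case .
  qed
  moreover have "0 \<le> 2 * C + K" using C K by simp
  ultimately show ?thesis by blast
qed

end

theorem theorem4p3:
  fixes k :: nat
    and p :: "nat \<Rightarrow> real \<Rightarrow> real"
    and V :: "nat \<Rightarrow> 'v::linorder set"
    and M :: "nat \<Rightarrow> 'w measure"
    and u :: "nat \<Rightarrow> 'v set \<Rightarrow> 'w \<Rightarrow> real"
  defines "X \<equiv> \<lambda>n. complex_process (V n) (u n)"
  assumes "\<And>i. nonneg_distribution_function (p i)"
    and "\<And>n. finite (V n) \<and> card (V n) = n"
    and "\<And>n. simplex_weights (M n) p (V n) (u n)"
  shows
    "((\<exists>A u\<^sub>0. 0 < A \<and> A \<le> 1 \<and> 0 < u\<^sub>0 \<and> u\<^sub>0 < 1 \<and> Phi p k u\<^sub>0 > 0 \<and>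
          (\<forall>v. 0 \<le> v \<and> v \<le> u\<^sub>0 \<longrightarrow> Phi p k (v / 2) \<ge> A * Phi p k v)) \<longrightarrow>
        (\<forall>m::nat. \<exists>C\<ge>0. \<forall>\<^sub>F n in sequentially. \<forall>T>0.
           (\<integral>\<^sup>+\<omega>. ennreal (lifetime_sum_upto k (X n \<omega>) T) \<partial>M n)
             \<le> ennreal (C * real n ^ (k + 1) * Phi p k (1 / real n) * (1 + T / real n ^ m))) \<and>
        ((\<exists>\<delta>>0. (\<integral>\<^sup>+t\<in>{0..}. ennreal (t powr (1 + \<delta>)) \<partial>interval_measure (qfun p (k + 1))) < \<infinity>) \<longrightarrow>
           (\<exists>C\<ge>0. \<forall>\<^sub>F n in sequentially.
              (\<integral>\<^sup>+\<omega>. lifetime_sum k (X n \<omega>) \<partial>M n)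
                \<le> ennreal (C * (real n ^ (k + 1) * Phi p k (1 / real n))))))
     \<and>
     ((\<forall>m::nat. Phi p k \<in> O[at_right 0](\<lambda>v. v ^ m)) \<longrightarrow>
        (\<forall>m::nat. \<exists>C\<ge>0. \<forall>\<^sub>F n in sequentially. \<forall>T>0.
           (\<integral>\<^sup>+\<omega>. ennreal (lifetime_sum_upto k (X n \<omega>) T) \<partial>M n)
             \<le> ennreal (C * (1 + T) / real n ^ m)) \<and>
        ((\<exists>\<delta>>0. (\<integral>\<^sup>+t\<in>{0..}. ennreal (t powr (1 + \<delta>)) \<partial>interval_measure (qfun p (k + 1))) < \<infinity>) \<longrightarrow>
           (\<forall>m::nat. \<exists>C\<ge>0. \<forall>\<^sub>F n in sequentially.
              (\<integral>\<^sup>+\<omega>. lifetime_sum k (X n \<omega>) \<partial>M n) \<le> ennreal (C / real n ^ m))))"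
proof -
  note dist = assms(2) and V = assms(3) and weights = assms(4)
  interpret distribution_family p k by unfold_locales (rule dist)
  \<comment> \<open>The comparison with expected Betti numbers asks for a vertex, so it starts at
    \<open>n = 1\<close>; the claims hold only eventually in \<open>n\<close> anyway.\<close>
  have Vn: "finite (V n)" "V n \<noteq> {}" if "1 \<le> n" for n
    using V[of n] that by auto
  have upto: "(\<integral>\<^sup>+\<omega>. ennreal (lifetime_sum_upto k (X n \<omega>) T) \<partial>M n)
      \<le> (\<integral>\<^sup>+t\<in>{0..T}. ennreal (expected_betti p k (V n) t) \<partial>lborel)" if "1 \<le> n" "0 < T" for n T
    unfolding X_def by (rule expected_lifetime_sum_upto_le[OF weights Vn[OF that(1)] that(2)])
  have total: "(\<integral>\<^sup>+\<omega>. lifetime_sum k (X n \<omega>) \<partial>M n)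
      \<le> (\<integral>\<^sup>+t\<in>{0..}. ennreal (expected_betti p k (V n) t) \<partial>lborel)" if "1 \<le> n" for n
    unfolding X_def by (rule expected_lifetime_sum_le[OF weights Vn[OF that]])
  \<comment> \<open>The claims differ only in the bound, so the passage from Betti numbers to
    lifetime sums is made once for an arbitrary \<open>b\<close>, here with truncation and then
    without.\<close>
  have transfer_upto: "\<exists>C\<ge>0. \<forall>\<^sub>F n in sequentially. \<forall>T>0.
      (\<integral>\<^sup>+\<omega>. ennreal (lifetime_sum_upto k (X n \<omega>) T) \<partial>M n) \<le> ennreal (b C n T)"
    if h: "\<exists>C\<ge>0. \<forall>\<^sub>F n in sequentially. \<forall>T>0.
      (\<integral>\<^sup>+t\<in>{0..T}. ennreal (expected_betti p k (V n) t) \<partial>lborel) \<le> ennreal (b C n T)" for b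
  proof -
    obtain C where C: "0 \<le> C" "\<forall>\<^sub>F n in sequentially. \<forall>T>0.
      (\<integral>\<^sup>+t\<in>{0..T}. ennreal (expected_betti p k (V n) t) \<partial>lborel) \<le> ennreal (b C n T)" using h by (elim exE conjE)
    have "\<forall>\<^sub>F n in sequentially. \<forall>T>0. (\<integral>\<^sup>+\<omega>. ennreal (lifetime_sum_upto k (X n \<omega>) T) \<partial>M n) \<le> ennreal (b C n T)"
      using C(2) eventually_ge_at_top[of 1]
    proof eventually_elim
      case (elim n)
      show ?case
      proof (intro allI impI)
        fix T :: real assume T: "0 < T"
        show "(\<integral>\<^sup>+\<omega>. ennreal (lifetime_sum_upto k (X n \<omega>) T) \<partial>M n) \<le> ennreal (b C n T)"
          by (rule order_trans[OF upto[OF elim(2) T] elim(1)[rule_format, OF T]])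
      qed
    qed
    with C(1) show ?thesis by (intro exI[of _ C] conjI)
  qed
  have transfer_total: "\<exists>C\<ge>0. \<forall>\<^sub>F n in sequentially. (\<integral>\<^sup>+\<omega>. lifetime_sum k (X n \<omega>) \<partial>M n) \<le> ennreal (b C n)"
    if h: "\<exists>C\<ge>0. \<forall>\<^sub>F n in sequentially. (\<integral>\<^sup>+t\<in>{0..}. ennreal (expected_betti p k (V n) t) \<partial>lborel) \<le> ennreal (b C n)" for b
  proof -
    obtain C where C: "0 \<le> C" "\<forall>\<^sub>F n in sequentially.
      (\<integral>\<^sup>+t\<in>{0..}. ennreal (expected_betti p k (V n) t) \<partial>lborel) \<le> ennreal (b C n)" using h by (elim exE conjE)
    have "\<forall>\<^sub>F n in sequentially. (\<integral>\<^sup>+\<omega>. lifetime_sum k (X n \<omega>) \<partial>M n) \<le> ennreal (b C n)"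
      using C(2) eventually_ge_at_top[of 1]
    proof eventually_elim
      case (elim n)
      show ?case by (rule order_trans[OF total[OF elim(2)] elim(1)])
    qed
    with C(1) show ?thesis by (intro exI[of _ C] conjI)
  qed
  show ?thesis
  proof (intro conjI impI allI)
    fix m :: nat
    assume "\<exists>A u\<^sub>0. 0 < A \<and> A \<le> 1 \<and> 0 < u\<^sub>0 \<and> u\<^sub>0 < 1 \<and> Phi p k u\<^sub>0 > 0 \<and>
          (\<forall>v. 0 \<le> v \<and> v \<le> u\<^sub>0 \<longrightarrow> Phi p k (v / 2) \<ge> A * Phi p k v)"
    then obtain A u0 where "0 < A" "0 < u0" "u0 < 1" "Phi p k u0 > 0"
      "\<And>v. 0 \<le> v \<Longrightarrow> v \<le> u0 \<Longrightarrow> A * Phi p k v \<le> Phi p k (v / 2)" by auto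
    then show "\<exists>C\<ge>0. \<forall>\<^sub>F n in sequentially. \<forall>T>0.
           (\<integral>\<^sup>+\<omega>. ennreal (lifetime_sum_upto k (X n \<omega>) T) \<partial>M n)
             \<le> ennreal (C * real n ^ (k + 1) * Phi p k (1 / real n) * (1 + T / real n ^ m))"
      by (intro transfer_upto) (rule doubling_integral_bound[OF V])
  next
    assume "\<exists>A u\<^sub>0. 0 < A \<and> A \<le> 1 \<and> 0 < u\<^sub>0 \<and> u\<^sub>0 < 1 \<and> Phi p k u\<^sub>0 > 0 \<and>
          (\<forall>v. 0 \<le> v \<and> v \<le> u\<^sub>0 \<longrightarrow> Phi p k (v / 2) \<ge> A * Phi p k v)"
    then obtain A u0 where *: "0 < A" "0 < u0" "u0 < 1" "Phi p k u0 > 0"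
      "\<And>v. 0 \<le> v \<Longrightarrow> v \<le> u0 \<Longrightarrow> A * Phi p k v \<le> Phi p k (v / 2)" by auto
    assume "\<exists>\<delta>>0. (\<integral>\<^sup>+t\<in>{0..}. ennreal (t powr (1 + \<delta>)) \<partial>interval_measure (qfun p (k + 1))) < \<infinity>"
    then obtain \<delta> where "0 < \<delta>" "(\<integral>\<^sup>+t\<in>{0..}. ennreal (t powr (1 + \<delta>)) \<partial>interval_measure (qfun p (k + 1))) < \<infinity>" by (elim exE conjE)
    from doubling_integral_bound_moment[OF V * this]
    show "\<exists>C\<ge>0. \<forall>\<^sub>F n in sequentially. (\<integral>\<^sup>+\<omega>. lifetime_sum k (X n \<omega>) \<partial>M n)
        \<le> ennreal (C * (real n ^ (k + 1) * Phi p k (1 / real n)))"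
      by (rule transfer_total)
  next
    fix m :: nat
    assume "\<forall>m::nat. Phi p k \<in> O[at_right 0](\<lambda>v. v ^ m)"
    then have "\<And>m::nat. Phi p k \<in> O[at_right 0](\<lambda>v. v ^ m)" by (rule spec)
    from rapid_decay_integral_bound[OF V this]
    show "\<exists>C\<ge>0. \<forall>\<^sub>F n in sequentially. \<forall>T>0.
           (\<integral>\<^sup>+\<omega>. ennreal (lifetime_sum_upto k (X n \<omega>) T) \<partial>M n) \<le> ennreal (C * (1 + T) / real n ^ m)"
      by (rule transfer_upto)
  next
    fix m :: nat
    assume "\<forall>m::nat. Phi p k \<in> O[at_right 0](\<lambda>v. v ^ m)"
    then have *: "\<And>m::nat. Phi p k \<in> O[at_right 0](\<lambda>v. v ^ m)" by (rule spec)
    assume "\<exists>\<delta>>0. (\<integral>\<^sup>+t\<in>{0..}. ennreal (t powr (1 + \<delta>)) \<partial>interval_measure (qfun p (k + 1))) < \<infinity>"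
    then obtain \<delta> where "0 < \<delta>" "(\<integral>\<^sup>+t\<in>{0..}. ennreal (t powr (1 + \<delta>)) \<partial>interval_measure (qfun p (k + 1))) < \<infinity>" by (elim exE conjE)
    from rapid_decay_integral_bound_moment[OF V * this]
    show "\<exists>C\<ge>0. \<forall>\<^sub>F n in sequentially. (\<integral>\<^sup>+\<omega>. lifetime_sum k (X n \<omega>) \<partial>M n) \<le> ennreal (C / real n ^ m)"
      by (rule transfer_total)
  qed
qed

end
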